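(* Let $M$ be a von Neumann algebra, let $E(M)$ be its central extension and $E(M)_h$ the set of self-adjoint elements of $E(M)$. Let $t_{ch}(M)$ be the topology on $E(M)_h$ induced by the topology $t_c(M)$ on $E(M)$ generated by the center-valued norm, and let $t_o(M)$ be the order topology on $E(M)_h$. Then: (i) $t_{ch}(M)\le t_o(M)$ if and only if $M$ is of type I$_{fin}$; (ii) $t_{ch}(M)=t_o(M)$ if and only if $M$ is a $\sigma$-finite type I$_{fin}$ algebra.
   Context: $M$ is a von Neumann algebra on a complex Hilbert space $H$, with center $Z(M)$, projection lattice $P(M)$ and identity $\mathbf 1$; $p^\perp=\mathbf 1-p$. A closed linear operator $x$ affiliated with $M$ is measurable if there are $p_n\in P(M)$ with $p_n\uparrow\mathbf 1$, $p_n(H)\subset\mathcal D(x)$ and $p_n^\perp$ finite in $M$ for all $n$; $S(M)$ is the set of measurable operators. A closed affiliated operator $x$ is locally measurable if there are central projections $z_n\uparrow\mathbf 1$ with $z_nx\in S(M)$ for all $n$; these form a $*$-algebra $LS(M)$ (with strong sum, strong product and adjoint). Central extension: $E(M)$ is the $*$-subalgebra of all $x\in LS(M)$ for which there is a family $\{z_i\}_{i\in I}$ of mutually orthogonal central projections with $\bigvee_i z_i=\mathbf 1$ and $z_ix\in M$ for all $i$. Identify $Z(M)$ with $L^\infty(\Omega,\Sigma,\mu)$, where $\mu$ has the direct sum property (there is a family $\{\Omega_i\}_{i\in J}\subset\Sigma$, $0<\mu(\Omega_i)<\infty$, such that each $A\in\Sigma$ with $\mu(A)<\infty$ equals $\bigcup_{i\in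 J_0}(A\cap\Omega_i)\cup B$ for some countable $J_0\subset J$ and null set $B$), and the center $S(Z(M))$ of $E(M)$ with $L^0(\Omega,\Sigma,\mu)$. For $\varepsilon,\delta>0$, $A\in\Sigma$, $\mu(A)<\infty$ let $W(A,\varepsilon,\delta)$ be the set of $f\in L^0(\Omega,\Sigma,\mu)$ for which there is $B\in\Sigma$, $B\subseteq A$, with $\mu(A\setminus B)\le\delta$, $f\chi_B\in L^\infty$ and $\|f\chi_B\|_{L^\infty}\le\varepsilon$. Center-valued norm: for $x\in E(M)$, $\|x\|=\inf\{f\in S(Z(M)): |x|\le f\}\in S(Z(M))$. Put $O(A,\varepsilon,\delta)=\{x\in E(M):\|x\|\in W(A,\varepsilon,\delta)\}$. The vector topology $t_c(M)$ on $E(M)$ is the one in which the sets $x+O(A,\varepsilon,\delta)$ ($\varepsilon,\delta>0$, $A\in\Sigma$, $\mu(A)<\infty$) form a base of neighborhoods of $x$. Order topology: $E(M)_h$ carries the usual partial order of self-adjoint operators. A net $\{x_\alpha\}_{\alpha\in I}\subset E(M)_h$ is $(o)$-convergent to $x\in E(M)_h$ if there are nets $\{a_\alpha\}_{\alpha\in I},\{b_\alpha\}_{\alpha\in I}$ in $E(M)_h$ with $a_\alpha\le x_\alpha\le b_\alpha$ for each $\alpha$, $a_\alpha\uparrow x$ and $b_\alpha\downarrow x$ (supremum, resp. infimum, taken in $E(M)_h$). The order topology $t_o(M)$ is the strongest topology on $E(M)_h$ for which $(o)$-convergence of nets implies their topological convergence. Type I$_{fin}$ means finite and of type I. $\sigma$-finite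 means that every family of mutually orthogonal nonzero projections in $M$ is at most countable. For topologies, $t\le s$ means that $s$ is finer than or equal to $t$.
   Formalization: The measure μ is also assumed semifinite; the stated direct sum property does not imply this, and without it (ii) fails (M = C, Ω one point of infinite mass: t_c is indiscrete). Every Z(M) admits an identification with such a measure. *)

theory Defs
  imports "HOL-Analysis.Analysis" "HOL-Probability.Essential_Supremum"
begin

section \<open>Complex Hilbert spaces\<close>

text \<open>The inner product is linear in its first argument. Positive definiteness is contained in
  the last axiom, since the norm is nonnegative and vanishes only at 0.\<close>

class complex_hilbert = banach +
  fixes scaleC :: "complex \<Rightarrow> 'a \<Rightarrow> 'a" (infixr "*\<^sub>C" 75)
    and cinner :: "'a \<Rightarrow> 'a \<Rightarrow> complex"
  assumes scaleC_add_right: "c *\<^sub>C (x + y) = c *\<^sub>C x + c *\<^sub>C y"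
    and scaleC_add_left: "(c + d) *\<^sub>C x = c *\<^sub>C x + d *\<^sub>C x"
    and scaleC_scaleC: "c *\<^sub>C d *\<^sub>C x = (c * d) *\<^sub>C x"
    and scaleC_of_real: "complex_of_real r *\<^sub>C x = r *\<^sub>R x"
    and cinner_commute: "cinner x y = cnj (cinner y x)"
    and cinner_add_left: "cinner (x + y) z = cinner x z + cinner y z"
    and cinner_scaleC_left: "cinner (c *\<^sub>C x) y = c * cinner x y"
    and cinner_self: "cinner x x = complex_of_real ((norm x)\<^sup>2)"

instantiation complex :: complex_hilbert
begin

definition scaleC_complex :: "complex \<Rightarrow> complex \<Rightarrow> complex" where
  "scaleC_complex c x = c * x"

definition cinner_complex :: "complex \<Rightarrow> complex \<Rightarrow> complex" where
  "cinner_complex x y = x * cnj y"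

instance
proof
  fix x :: complex
  show "cinner x x = complex_of_real ((norm x)\<^sup>2)"
    unfolding cinner_complex_def by (simp only: complex_norm_square)
qed (simp_all add: scaleC_complex_def cinner_complex_def distrib_left distrib_right
      scaleR_conv_of_real)

end


section \<open>Von Neumann algebras\<close>

text \<open>Bounded operators are elements of \<^typ>\<open>'a \<Rightarrow>\<^sub>L 'a\<close>, whose members are a priori only
  real-linear; von Neumann algebras consist of complex-linear ones.\<close>

definition clinear_ops :: "('a::complex_hilbert \<Rightarrow>\<^sub>L 'a) set" where
  "clinear_ops = {T :: 'a \<Rightarrow>\<^sub>L 'a. \<forall>c \<xi>. T (c *\<^sub>C \<xi>) = c *\<^sub>C T \<xi>}"

definition is_adjoint :: "('a::complex_hilbert \<Rightarrow>\<^sub>L 'a) \<Rightarrow> ('a \<Rightarrow>\<^sub>L 'a) \<Rightarrow> bool" where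
  "is_adjoint T S \<longleftrightarrow> (\<forall>\<xi> \<eta>. cinner (T \<xi>) \<eta> = cinner \<xi> (S \<eta>))"

definition commutant :: "('a::complex_hilbert \<Rightarrow>\<^sub>L 'a) set \<Rightarrow> ('a \<Rightarrow>\<^sub>L 'a) set" where
  "commutant M = {T \<in> clinear_ops. \<forall>S\<in>M. T o\<^sub>L S = S o\<^sub>L T}"

definition von_neumann_algebra :: "('a::complex_hilbert \<Rightarrow>\<^sub>L 'a) set \<Rightarrow> bool" where
  "von_neumann_algebra M \<longleftrightarrow>
     M \<subseteq> clinear_ops \<and> (\<forall>T\<in>M. \<exists>S\<in>M. is_adjoint T S) \<and> commutant (commutant M) = M"

definition center :: "('a::complex_hilbert \<Rightarrow>\<^sub>L 'a) set \<Rightarrow> ('a \<Rightarrow>\<^sub>L 'a) set" where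
  "center M = M \<inter> commutant M"

definition projections :: "('a::complex_hilbert \<Rightarrow>\<^sub>L 'a) set \<Rightarrow> ('a \<Rightarrow>\<^sub>L 'a) set" where
  "projections M = {p \<in> M. p o\<^sub>L p = p \<and> is_adjoint p p}"

definition proj_le :: "('a::complex_hilbert \<Rightarrow>\<^sub>L 'a) \<Rightarrow> ('a \<Rightarrow>\<^sub>L 'a) \<Rightarrow> bool" where
  "proj_le p q \<longleftrightarrow> q o\<^sub>L p = p"

definition is_proj_sup ::
    "('a::complex_hilbert \<Rightarrow>\<^sub>L 'a) set \<Rightarrow> ('a \<Rightarrow>\<^sub>L 'a) set \<Rightarrow> ('a \<Rightarrow>\<^sub>L 'a) \<Rightarrow> bool" where
  "is_proj_sup M F p \<longleftrightarrow> p \<in> projections M \<and> (\<forall>q\<in>F. proj_le q p) \<and>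
     (\<forall>r\<in>projections M. (\<forall>q\<in>F. proj_le q r) \<longrightarrow> proj_le p r)"

definition increases_to_one ::
    "('a::complex_hilbert \<Rightarrow>\<^sub>L 'a) set \<Rightarrow> (nat \<Rightarrow> 'a \<Rightarrow>\<^sub>L 'a) \<Rightarrow> bool" where
  "increases_to_one M p \<longleftrightarrow>
     (\<forall>n. proj_le (p n) (p (Suc n))) \<and> is_proj_sup M (range p) id_blinfun"

definition orthogonal_family :: "('a::complex_hilbert \<Rightarrow>\<^sub>L 'a) set \<Rightarrow> bool" where
  "orthogonal_family F \<longleftrightarrow> (\<forall>p\<in>F. \<forall>q\<in>F. p \<noteq> q \<longrightarrow> p o\<^sub>L q = 0)"

text \<open>Murray--von Neumann equivalence: \<open>v\<^sup>*v = p\<close> and \<open>vv\<^sup>* = q\<close> for some \<open>v\<close> in \<open>M\<close>.\<close>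

definition proj_equiv ::
    "('a::complex_hilbert \<Rightarrow>\<^sub>L 'a) set \<Rightarrow> ('a \<Rightarrow>\<^sub>L 'a) \<Rightarrow> ('a \<Rightarrow>\<^sub>L 'a) \<Rightarrow> bool" where
  "proj_equiv M p q \<longleftrightarrow> (\<exists>v\<in>M. \<exists>w\<in>M. is_adjoint v w \<and> w o\<^sub>L v = p \<and> v o\<^sub>L w = q)"

definition finite_projection ::
    "('a::complex_hilbert \<Rightarrow>\<^sub>L 'a) set \<Rightarrow> ('a \<Rightarrow>\<^sub>L 'a) \<Rightarrow> bool" where
  "finite_projection M p \<longleftrightarrow> p \<in> projections M \<and>
     (\<forall>q\<in>projections M. proj_le q p \<and> proj_equiv M p q \<longrightarrow> q = p)"

definition abelian_projection ::
    "('a::complex_hilbert \<Rightarrow>\<^sub>L 'a) set \<Rightarrow> ('a \<Rightarrow>\<^sub>L 'a) \<Rightarrow> bool" where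
  "abelian_projection M p \<longleftrightarrow> p \<in> projections M \<and>
     (\<forall>S\<in>M. \<forall>T\<in>M. (p o\<^sub>L S o\<^sub>L p) o\<^sub>L (p o\<^sub>L T o\<^sub>L p) = (p o\<^sub>L T o\<^sub>L p) o\<^sub>L (p o\<^sub>L S o\<^sub>L p))"

definition type_I :: "('a::complex_hilbert \<Rightarrow>\<^sub>L 'a) set \<Rightarrow> bool" where
  "type_I M \<longleftrightarrow> (\<forall>z\<in>projections (center M). z \<noteq> 0 \<longrightarrow>
     (\<exists>p. abelian_projection M p \<and> p \<noteq> 0 \<and> proj_le p z))"

definition type_I_fin :: "('a::complex_hilbert \<Rightarrow>\<^sub>L 'a) set \<Rightarrow> bool" where
  "type_I_fin M \<longleftrightarrow> finite_projection M id_blinfun \<and> type_I M"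

definition sigma_finite_algebra :: "('a::complex_hilbert \<Rightarrow>\<^sub>L 'a) set \<Rightarrow> bool" where
  "sigma_finite_algebra M \<longleftrightarrow>
     (\<forall>F. F \<subseteq> projections M - {0} \<and> orthogonal_family F \<longrightarrow> countable F)"


section \<open>Unbounded operators\<close>

text \<open>A linear operator in \<open>H\<close> is identified with its graph, so that equality of operators includes
  equality of domains. The product \<open>xy\<close> with its natural domain is then the relational
  composition \<^term>\<open>y O x\<close>.\<close>

type_synonym 'a opr = "('a \<times> 'a) set"

definition linear_operator :: "'a::complex_hilbert opr \<Rightarrow> bool" where
  "linear_operator x \<longleftrightarrow> (0, 0) \<in> x \<and>
     (\<forall>\<xi> \<eta> \<xi>' \<eta>'. (\<xi>, \<eta>) \<in> x \<and> (\<xi>', \<eta>') \<in> x \<longrightarrow> (\<xi> + \<xi>', \<eta> + \<eta>') \<in> x) \<and>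
     (\<forall>c \<xi> \<eta>. (\<xi>, \<eta>) \<in> x \<longrightarrow> (c *\<^sub>C \<xi>, c *\<^sub>C \<eta>) \<in> x) \<and>
     (\<forall>\<eta>. (0, \<eta>) \<in> x \<longrightarrow> \<eta> = 0)"

definition bounded_opr :: "('a::complex_hilbert \<Rightarrow>\<^sub>L 'a) \<Rightarrow> 'a opr" where
  "bounded_opr T = range (\<lambda>\<xi>. (\<xi>, T \<xi>))"

definition adj :: "'a::complex_hilbert opr \<Rightarrow> 'a opr" where
  "adj x = {(\<eta>, \<zeta>). \<forall>(\<xi>, \<omega>)\<in>x. cinner \<omega> \<eta> = cinner \<xi> \<zeta>}"

definition strong_sum :: "'a::complex_hilbert opr \<Rightarrow> 'a opr \<Rightarrow> 'a opr" where
  "strong_sum x y = closure {(\<xi>, \<eta> + \<zeta>) | \<xi> \<eta> \<zeta>. (\<xi>, \<eta>) \<in> x \<and> (\<xi>, \<zeta>) \<in> y}"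

definition strong_scale :: "complex \<Rightarrow> 'a::complex_hilbert opr \<Rightarrow> 'a opr" where
  "strong_scale c x = closure {(\<xi>, c *\<^sub>C \<eta>) | \<xi> \<eta>. (\<xi>, \<eta>) \<in> x}"

definition strong_diff :: "'a::complex_hilbert opr \<Rightarrow> 'a opr \<Rightarrow> 'a opr" where
  "strong_diff x y = strong_sum x (strong_scale (-1) y)"

definition strong_prod :: "'a::complex_hilbert opr \<Rightarrow> 'a opr \<Rightarrow> 'a opr" where
  "strong_prod x y = closure (y O x)"

definition positive_opr :: "'a::complex_hilbert opr \<Rightarrow> bool" where
  "positive_opr x \<longleftrightarrow> (\<forall>(\<xi>, \<eta>)\<in>x. Im (cinner \<eta> \<xi>) = 0 \<and> 0 \<le> Re (cinner \<eta> \<xi>))"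

definition opr_le :: "'a::complex_hilbert opr \<Rightarrow> 'a opr \<Rightarrow> bool" where
  "opr_le x y \<longleftrightarrow> positive_opr (strong_diff y x)"

text \<open>\<open>|x|\<close> is the positive self-adjoint square root of \<open>x\<^sup>*x\<close>.\<close>

definition modulus :: "'a::complex_hilbert opr \<Rightarrow> 'a opr" where
  "modulus x = (THE y. linear_operator y \<and> adj y = y \<and> positive_opr y \<and> y O y = x O adj x)"

definition unitaries :: "('a::complex_hilbert \<Rightarrow>\<^sub>L 'a) set \<Rightarrow> ('a \<Rightarrow>\<^sub>L 'a) set" where
  "unitaries N =
     {u \<in> N. \<exists>v\<in>N. is_adjoint u v \<and> u o\<^sub>L v = id_blinfun \<and> v o\<^sub>L u = id_blinfun}"

definition affiliated :: "('a::complex_hilbert \<Rightarrow>\<^sub>L 'a) set \<Rightarrow> 'a opr \<Rightarrow> bool" where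
  "affiliated M x \<longleftrightarrow> (\<forall>u\<in>unitaries (commutant M). \<forall>(\<xi>, \<eta>)\<in>x. (u \<xi>, u \<eta>) \<in> x)"

definition measurable_oprs :: "('a::complex_hilbert \<Rightarrow>\<^sub>L 'a) set \<Rightarrow> 'a opr set" where
  "measurable_oprs M = {x. linear_operator x \<and> closed x \<and> affiliated M x \<and>
     (\<exists>p. increases_to_one M p \<and> (\<forall>n. p n \<in> projections M \<and> range (blinfun_apply (p n)) \<subseteq> Domain x \<and>
            finite_projection M (id_blinfun - p n)))}"

text \<open>For a central projection \<open>z\<close>, the product \<open>zx\<close> is the strong product: with the natural domain
  of \<open>x\<close> it need not be closed.\<close>

definition locally_measurable_oprs :: "('a::complex_hilbert \<Rightarrow>\<^sub>L 'a) set \<Rightarrow> 'a opr set" where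
  "locally_measurable_oprs M = {x. linear_operator x \<and> closed x \<and> affiliated M x \<and>
     (\<exists>z. increases_to_one M z \<and> (\<forall>n. z n \<in> projections (center M) \<and>
            strong_prod (bounded_opr (z n)) x \<in> measurable_oprs M))}"

definition central_extension :: "('a::complex_hilbert \<Rightarrow>\<^sub>L 'a) set \<Rightarrow> 'a opr set" where
  "central_extension M = {x \<in> locally_measurable_oprs M.
     \<exists>F. F \<subseteq> projections (center M) \<and> orthogonal_family F \<and> is_proj_sup M F id_blinfun \<and>
       (\<forall>z\<in>F. strong_prod (bounded_opr z) x \<in> bounded_opr ` M)}"

definition self_adjoint_part :: "'a::complex_hilbert opr set \<Rightarrow> 'a opr set" where
  "self_adjoint_part A = {x \<in> A. adj x = x}"


section \<open>Suprema, nets and the order topology\<close>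

definition is_sup_in :: "'c set \<Rightarrow> ('c \<Rightarrow> 'c \<Rightarrow> bool) \<Rightarrow> 'c set \<Rightarrow> 'c \<Rightarrow> bool" where
  "is_sup_in E le A s \<longleftrightarrow>
     s \<in> E \<and> (\<forall>a\<in>A. le a s) \<and> (\<forall>y\<in>E. (\<forall>a\<in>A. le a y) \<longrightarrow> le s y)"

definition is_inf_in :: "'c set \<Rightarrow> ('c \<Rightarrow> 'c \<Rightarrow> bool) \<Rightarrow> 'c set \<Rightarrow> 'c \<Rightarrow> bool" where
  "is_inf_in E le A s \<longleftrightarrow>
     s \<in> E \<and> (\<forall>a\<in>A. le s a) \<and> (\<forall>y\<in>E. (\<forall>a\<in>A. le y a) \<longrightarrow> le y s)"

text \<open>A net is indexed by a nonempty set \<open>I\<close> with an upward directed preorder \<open>r\<close>.\<close>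

definition directed_index :: "'i set \<Rightarrow> ('i \<Rightarrow> 'i \<Rightarrow> bool) \<Rightarrow> bool" where
  "directed_index I r \<longleftrightarrow> I \<noteq> {} \<and> (\<forall>i\<in>I. r i i) \<and>
     (\<forall>i\<in>I. \<forall>j\<in>I. \<forall>k\<in>I. r i j \<and> r j k \<longrightarrow> r i k) \<and>
     (\<forall>i\<in>I. \<forall>j\<in>I. \<exists>k\<in>I. r i k \<and> r j k)"

definition net_filter :: "'i set \<Rightarrow> ('i \<Rightarrow> 'i \<Rightarrow> bool) \<Rightarrow> 'i filter" where
  "net_filter I r = (INF i\<in>I. principal {j \<in> I. r i j})"

definition o_converges ::
    "'c set \<Rightarrow> ('c \<Rightarrow> 'c \<Rightarrow> bool) \<Rightarrow> 'i set \<Rightarrow> ('i \<Rightarrow> 'i \<Rightarrow> bool) \<Rightarrow> ('i \<Rightarrow> 'c) \<Rightarrow> 'c \<Rightarrow> bool" where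
  "o_converges E le I r X x \<longleftrightarrow> x \<in> E \<and> (\<forall>i\<in>I. X i \<in> E) \<and>
     (\<exists>a b. (\<forall>i\<in>I. a i \<in> E \<and> b i \<in> E \<and> le (a i) (X i) \<and> le (X i) (b i)) \<and>
        (\<forall>i\<in>I. \<forall>j\<in>I. r i j \<longrightarrow> le (a i) (a j) \<and> le (b j) (b i)) \<and>
        is_sup_in E le (a ` I) x \<and> is_inf_in E le (b ` I) x)"

text \<open>The strongest topology on \<open>E\<close> for which \<open>(o)\<close>-convergence implies topological convergence.
  A formula cannot quantify over all index types, so the nets in the definition are indexed by the
  fixed type \<^typ>\<open>('c \<times> 'c \<times> 'c) set\<close>. The lemmas \<open>o_converges_order_topology\<close> (for nets over
  an arbitrary index type) and \<open>order_topology_strongest\<close> show that this is no restriction.\<close>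

definition order_topology :: "'c set \<Rightarrow> ('c \<Rightarrow> 'c \<Rightarrow> bool) \<Rightarrow> 'c topology" where
  "order_topology E le = topology (\<lambda>U. U \<subseteq> E \<and>
     (\<forall>(I :: ('c \<times> 'c \<times> 'c) set set) r X x.
        directed_index I r \<and> o_converges E le I r X x \<and> x \<in> U \<longrightarrow>
        (\<forall>\<^sub>F i in net_filter I r. X i \<in> U)))"

lemma openin_order_topology:
  "openin (order_topology E le) U \<longleftrightarrow> U \<subseteq> E \<and>
     (\<forall>(I :: ('c \<times> 'c \<times> 'c) set set) r X (x :: 'c).
        directed_index I r \<and> o_converges E le I r X x \<and> x \<in> U \<longrightarrow>
        (\<forall>\<^sub>F i in net_filter I r. X i \<in> U))"
proof -
  define P where "P = (\<lambda>U. U \<subseteq> E \<and>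
     (\<forall>(I :: ('c \<times> 'c \<times> 'c) set set) r X (x :: 'c).
        directed_index I r \<and> o_converges E le I r X x \<and> x \<in> U \<longrightarrow>
        (\<forall>\<^sub>F i in net_filter I r. X i \<in> U)))"
  have "istopology P"
    unfolding istopology_def
  proof (intro conjI allI impI)
    fix S T assume "P S" "P T"
    show "P (S \<inter> T)" unfolding P_def
    proof (intro conjI allI impI)
      show "S \<inter> T \<subseteq> E" using \<open>P S\<close> unfolding P_def by blast
    next
      fix I :: "('c \<times> 'c \<times> 'c) set set" and r X x
      assume *: "directed_index I r \<and> o_converges E le I r X x \<and> x \<in> S \<inter> T"
      have "\<forall>\<^sub>F i in net_filter I r. X i \<in> S" "\<forall>\<^sub>F i in net_filter I r. X i \<in> T"
        using \<open>P S\<close> \<open>P T\<close> * unfolding P_def by blast+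
      then show "\<forall>\<^sub>F i in net_filter I r. X i \<in> S \<inter> T"
        by eventually_elim blast
    qed
  next
    fix \<K> assume K: "\<forall>K\<in>\<K>. P K"
    show "P (\<Union>\<K>)" unfolding P_def
    proof (intro conjI allI impI)
      show "\<Union>\<K> \<subseteq> E" using K unfolding P_def by blast
    next
      fix I :: "('c \<times> 'c \<times> 'c) set set" and r X x
      assume *: "directed_index I r \<and> o_converges E le I r X x \<and> x \<in> \<Union>\<K>"
      then obtain K' where "K' \<in> \<K>" "x \<in> K'" by blast
      with K * have "\<forall>\<^sub>F i in net_filter I r. X i \<in> K'" unfolding P_def by blast
      then show "\<forall>\<^sub>F i in net_filter I r. X i \<in> \<Union>\<K>"
        by (rule eventually_mono) (use \<open>K' \<in> \<K>\<close> in blast)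
    qed
  qed
  then show ?thesis
    unfolding order_topology_def P_def[symmetric] by (simp add: P_def)
qed

lemma directed_indexD:
  assumes "directed_index I r"
  shows "I \<noteq> {}" and "i \<in> I \<Longrightarrow> r i i"
    and "r i j \<Longrightarrow> r j k \<Longrightarrow> i \<in> I \<Longrightarrow> j \<in> I \<Longrightarrow> k \<in> I \<Longrightarrow> r i k"
    and "i \<in> I \<Longrightarrow> j \<in> I \<Longrightarrow> \<exists>k\<in>I. r i k \<and> r j k"
  using assms unfolding directed_index_def by blast+

lemma eventually_net_filter:
  assumes "directed_index I r"
  shows "eventually P (net_filter I r) \<longleftrightarrow> (\<exists>i\<in>I. \<forall>j\<in>I. r i j \<longrightarrow> P j)"
proof -
  have "\<exists>k\<in>I. principal {l \<in> I. r k l} \<le> inf (principal {l \<in> I. r i l}) (principal {l \<in> I. r j l})"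
    if ij: "i \<in> I" "j \<in> I" for i j
  proof -
    obtain k where k: "k \<in> I" "r i k" "r j k"
      using directed_indexD(4)[OF assms ij] by blast
    have "{l \<in> I. r k l} \<subseteq> {l \<in> I. r i l} \<inter> {l \<in> I. r j l}"
      using directed_indexD(3)[OF assms k(2)] directed_indexD(3)[OF assms k(3)] ij k(1) by blast
    then show ?thesis using k(1) by (intro bexI[of _ k]) simp_all
  qed
  then have "eventually P (net_filter I r) \<longleftrightarrow>
      (\<exists>i\<in>I. eventually P (principal {l \<in> I. r i l}))"
    unfolding net_filter_def by (rule eventually_INF_base[OF directed_indexD(1)[OF assms]])
  also have "\<dots> \<longleftrightarrow> (\<exists>i\<in>I. \<forall>j\<in>I. r i j \<longrightarrow> P j)"
    unfolding eventually_principal by blast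
  finally show ?thesis .
qed

lemma topspace_order_topology [simp]: "topspace (order_topology E le) = E"
proof -
  have "\<forall>\<^sub>F i in net_filter I r. X i \<in> E"
    if dir: "directed_index I r" and conv: "o_converges E le I r X x"
    for I :: "('a \<times> 'a \<times> 'a) set set" and r X x
  proof -
    obtain i where "i \<in> I" using directed_indexD(1)[OF dir] by blast
    then show ?thesis
      using conv unfolding eventually_net_filter[OF dir] o_converges_def by blast
  qed
  then have "openin (order_topology E le) E"
    unfolding openin_order_topology by blast
  then show ?thesis
    using openin_subset openin_topspace[of "order_topology E le"]
    by (metis openin_order_topology subset_antisym)
qed

lemma directed_finite_bound:
  assumes "directed_index I r" "finite S" "S \<subseteq> I"
  shows "\<exists>k\<in>I. \<forall>s\<in>S. r s k"
  using assms(2,3)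
proof (induction S rule: finite_induct)
  case empty
  then show ?case using directed_indexD(1)[OF assms(1)] by blast
next
  case (insert s S)
  then obtain k where k: "k \<in> I" "\<forall>s\<in>S. r s k" by blast
  obtain l where l: "l \<in> I" "r s l" "r k l"
    using directed_indexD(4)[OF assms(1), of s k] k(1) insert.prems by blast
  have "r t l" if "t \<in> S" for t
    using directed_indexD(3)[OF assms(1), of t k l] k l that insert.prems by blast
  then show ?case using l by blast
qed

lemma o_converges_order_topology:
  fixes I :: "'i set" and E :: "'c set"
  assumes dir: "directed_index I r" and conv: "o_converges E le I r X x"
  shows "limitin (order_topology E le) X x (net_filter I r)"
  unfolding limitin_def
proof (intro conjI allI impI)
  show "x \<in> topspace (order_topology E le)" using conv by (simp add: o_converges_def)
next
  fix U assume U: "openin (order_topology E le) U \<and> x \<in> U"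
  show "\<forall>\<^sub>F i in net_filter I r. X i \<in> U"
  proof (rule ccontr)
    assume "\<not> ?thesis"
    then have freq: "\<exists>j\<in>I. r i j \<and> X j \<notin> U" if "i \<in> I" for i
      using that eventually_net_filter[OF dir] by blast
    obtain a b where ab: "\<And>i. i \<in> I \<Longrightarrow> a i \<in> E \<and> b i \<in> E \<and> le (a i) (X i) \<and> le (X i) (b i)"
        "\<And>i j. i \<in> I \<Longrightarrow> j \<in> I \<Longrightarrow> r i j \<Longrightarrow> le (a i) (a j) \<and> le (b j) (b i)"
        "is_sup_in E le (a ` I) x" "is_inf_in E le (b ` I) x"
      and XE: "\<And>i. i \<in> I \<Longrightarrow> X i \<in> E" and xE: "x \<in> E"
      using conv unfolding o_converges_def by metis
    define f where "f = (\<lambda>i. (a i, b i, X i))"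
    define K where "K = f ` I"
    define \<phi> where "\<phi> = inv_into I f"
    have \<phi>: "\<phi> k \<in> I" "f (\<phi> k) = k" if "k \<in> K" for k
      using that unfolding K_def \<phi>_def by (auto intro: inv_into_into f_inv_into_f)
    define FF where "FF = {F. finite F \<and> F \<noteq> {} \<and> F \<subseteq> K}"
    define Q where "Q = (\<lambda>g F i. F \<in> FF \<longrightarrow> i \<in> I \<and> (\<forall>G\<in>FF. G \<subset> F \<longrightarrow> g G \<in> I \<longrightarrow> r (g G) i) \<and>
        (if is_singleton F then i = \<phi> (the_elem F) else X i \<notin> U))"
    have "\<exists>g. \<forall>F. Q g F (g F)"
    proof (rule dependent_wf_choice[OF wf_finite_psubset])
      fix g h :: "('c \<times> 'c \<times> 'c) set \<Rightarrow> 'i" and F i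
      assume *: "\<And>G. (G, F) \<in> finite_psubset \<Longrightarrow> g G = h G"
      have "g G = h G" if "F \<in> FF" "G \<subset> F" for G
        using * that by (auto simp: finite_psubset_def FF_def)
      then show "Q g F i = Q h F i" unfolding Q_def by auto
    next
      fix F :: "('c \<times> 'c \<times> 'c) set" and g :: "('c \<times> 'c \<times> 'c) set \<Rightarrow> 'i"
      show "\<exists>i. Q g F i"
      proof (cases "F \<in> FF")
        case False
        then show ?thesis by (simp add: Q_def)
      next
        case True
        show ?thesis
        proof (cases "is_singleton F")
          case True
          then obtain k where k: "F = {k}" by (auto simp: is_singleton_def)
          with \<open>F \<in> FF\<close> have "k \<in> K" by (auto simp: FF_def)
          then have "Q g F (\<phi> k)"
            using k \<phi> unfolding Q_def FF_def by auto
          then show ?thesis by blast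
        next
          case False
          let ?S = "{g G | G. G \<in> FF \<and> G \<subset> F \<and> g G \<in> I}"
          have "?S \<subseteq> g ` Pow F" by blast
          moreover have "finite (g ` Pow F)" using \<open>F \<in> FF\<close> by (simp add: FF_def)
          ultimately have "finite ?S" by (rule finite_subset)
          moreover have "?S \<subseteq> I" by blast
          ultimately have "\<exists>k\<in>I. \<forall>s\<in>?S. r s k" by (rule directed_finite_bound[OF dir])
          then obtain k where k: "k \<in> I" "\<forall>s\<in>?S. r s k" by (rule bexE)
          obtain l where l: "l \<in> I" "r k l" "X l \<notin> U" using freq[OF k(1)] by blast
          have "r s l" if "s \<in> ?S" for s
            using directed_indexD(3)[OF dir _ l(2) _ k(1) l(1), of s] k(2) that \<open>?S \<subseteq> I\<close> by blast
          then have "\<forall>G\<in>FF. G \<subset> F \<longrightarrow> g G \<in> I \<longrightarrow> r (g G) l" by blast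
          then have "Q g F l" using l False by (simp add: Q_def)
          then show ?thesis by blast
        qed
      qed
    qed
    then obtain g where g: "\<And>F. Q g F (g F)" by blast
    have gI: "g F \<in> I" if "F \<in> FF" for F using g[of F] that by (simp add: Q_def)
    have gmono: "r (g G) (g F)" if "G \<in> FF" "F \<in> FF" "G \<subseteq> F" for F G
    proof (cases "G = F")
      case True
      then show ?thesis using directed_indexD(2)[OF dir] gI that by blast
    next
      case False
      then show ?thesis using g[of F] that gI[of G] unfolding Q_def by blast
    qed
    have gsing: "{k} \<in> FF" "f (g {k}) = k" if "k \<in> K" for k
    proof -
      show "{k} \<in> FF" using that by (simp add: FF_def)
      then have "g {k} = \<phi> k" using g[of "{k}"] by (simp add: Q_def)
      then show "f (g {k}) = k" using \<phi>(2)[OF that] by simp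
    qed
    have I_ne: "I \<noteq> {}" by (rule directed_indexD(1)[OF dir])
    have dirF: "directed_index FF (\<subseteq>)"
      unfolding directed_index_def
    proof (intro conjI ballI)
      show "FF \<noteq> {}" using I_ne gsing K_def by blast
      fix F G assume "F \<in> FF" "G \<in> FF"
      then show "\<exists>H\<in>FF. F \<subseteq> H \<and> G \<subseteq> H"
        by (intro bexI[of _ "F \<union> G"]) (auto simp: FF_def)
    qed auto
    have img: "(f \<circ> g) ` FF = K"
    proof
      show "(f \<circ> g) ` FF \<subseteq> K" using gI unfolding K_def by auto
      show "K \<subseteq> (f \<circ> g) ` FF"
      proof
        fix k assume "k \<in> K"
        then show "k \<in> (f \<circ> g) ` FF" using gsing[of k] by (intro image_eqI[of _ _ "{k}"]) auto
      qed
    qed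
    have "(a \<circ> g) ` FF = fst ` ((f \<circ> g) ` FF)" by (auto simp: f_def image_image)
    also have "\<dots> = a ` I" unfolding img K_def by (auto simp: f_def image_image)
    finally have ima: "(a \<circ> g) ` FF = a ` I" .
    have "(b \<circ> g) ` FF = (fst \<circ> snd) ` ((f \<circ> g) ` FF)" by (auto simp: f_def image_image)
    also have "\<dots> = b ` I" unfolding img K_def by (auto simp: f_def image_image)
    finally have imb: "(b \<circ> g) ` FF = b ` I" .
    have "\<forall>F\<in>FF. (a \<circ> g) F \<in> E \<and> (b \<circ> g) F \<in> E \<and>
        le ((a \<circ> g) F) ((X \<circ> g) F) \<and> le ((X \<circ> g) F) ((b \<circ> g) F)"
      using ab(1) gI by simp
    moreover have "\<forall>F\<in>FF. \<forall>G\<in>FF. F \<subseteq> G \<longrightarrow>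
        le ((a \<circ> g) F) ((a \<circ> g) G) \<and> le ((b \<circ> g) G) ((b \<circ> g) F)"
      using ab(2) gI gmono by simp
    moreover have "\<forall>F\<in>FF. (X \<circ> g) F \<in> E" using XE gI by simp
    moreover have "is_sup_in E le ((a \<circ> g) ` FF) x" "is_inf_in E le ((b \<circ> g) ` FF) x"
      unfolding ima imb by (rule ab)+
    ultimately have "o_converges E le FF (\<subseteq>) (X \<circ> g) x"
      unfolding o_converges_def using xE by blast
    then have "\<forall>\<^sub>F F in net_filter FF (\<subseteq>). (X \<circ> g) F \<in> U"
      using U dirF unfolding openin_order_topology by blast
    then obtain F0 where F0: "F0 \<in> FF" "\<And>F. F \<in> FF \<Longrightarrow> F0 \<subseteq> F \<Longrightarrow> X (g F) \<in> U"
      using eventually_net_filter[OF dirF] by auto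
    obtain i0 where "i0 \<in> I" "X i0 \<notin> U" using freq I_ne by blast
    define k0 where "k0 = f i0"
    have k0: "k0 \<in> K" using \<open>i0 \<in> I\<close> by (simp add: k0_def K_def)
    let ?F = "insert k0 F0"
    have "?F \<in> FF" using F0(1) k0 by (auto simp: FF_def)
    have "X (g ?F) \<notin> U"
    proof (cases "is_singleton ?F")
      case True
      then have eq: "?F = {k0}" by (auto simp: is_singleton_def)
      have "f (g ?F) = f i0" unfolding eq using gsing(2)[OF k0] by (simp only: k0_def)
      then show ?thesis using \<open>X i0 \<notin> U\<close> by (simp add: f_def)
    next
      case False
      then show ?thesis using g[of ?F] \<open>?F \<in> FF\<close> by (simp add: Q_def)
    qed
    then show False using F0(2)[OF \<open>?F \<in> FF\<close>] by blast
  qed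
qed

lemma order_topology_strongest:
  fixes E :: "'c set" and T :: "'c topology"
  assumes "topspace T = E"
    and "\<And>(I :: ('c \<times> 'c \<times> 'c) set set) r X x.
      directed_index I r \<Longrightarrow> o_converges E le I r X x \<Longrightarrow> limitin T X x (net_filter I r)"
    and "openin T U"
  shows "openin (order_topology E le) U"
  unfolding openin_order_topology
proof (intro conjI allI impI)
  show "U \<subseteq> E" using assms(1,3) openin_subset by blast
  fix I :: "('c \<times> 'c \<times> 'c) set set" and r X x
  assume "directed_index I r \<and> o_converges E le I r X x \<and> x \<in> U"
  then show "\<forall>\<^sub>F i in net_filter I r. X i \<in> U"
    using assms(2)[of I r X x] assms(3) by (simp add: limitin_def)
qed


section \<open>The center as a function algebra\<close>

definition direct_sum_property :: "'w measure \<Rightarrow> bool" where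
  "direct_sum_property \<mu> \<longleftrightarrow> (\<exists>D. D \<subseteq> sets \<mu> \<and> (\<forall>W\<in>D. 0 < emeasure \<mu> W \<and> emeasure \<mu> W < \<infinity>) \<and>
     (\<forall>A\<in>sets \<mu>. emeasure \<mu> A < \<infinity> \<longrightarrow>
        (\<exists>D0 B. D0 \<subseteq> D \<and> countable D0 \<and> B \<in> null_sets \<mu> \<and> A = (\<Union>W\<in>D0. A \<inter> W) \<union> B)))"

text \<open>Semifiniteness in the usual sense. It is not implied by the direct sum property as stated above
  (a single atom of infinite mass satisfies it with an empty family), but it is needed for the
  neighborhoods \<open>W(A, \<epsilon>, \<delta>)\<close> below to separate the points of \<open>L\<^sup>0\<close>. The locale \<^locale>\<open>semifinite_measure\<close> does not require the
  subset to have positive measure and is therefore satisfied by every measure.\<close>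

definition semifinite :: "'w measure \<Rightarrow> bool" where
  "semifinite \<mu> \<longleftrightarrow> (\<forall>A\<in>sets \<mu>. emeasure \<mu> A = \<infinity> \<longrightarrow>
     (\<exists>B\<in>sets \<mu>. B \<subseteq> A \<and> 0 < emeasure \<mu> B \<and> emeasure \<mu> B < \<infinity>))"

definition Linf_norm :: "'w measure \<Rightarrow> ('w \<Rightarrow> complex) \<Rightarrow> ereal" where
  "Linf_norm \<mu> f = esssup \<mu> (\<lambda>\<omega>. ereal (cmod (f \<omega>)))"

definition Linf :: "'w measure \<Rightarrow> ('w \<Rightarrow> complex) set" where
  "Linf \<mu> = {f \<in> borel_measurable \<mu>. Linf_norm \<mu> f < \<infinity>}"

text \<open>\<open>\<Phi>\<close> is a \<open>*\<close>-isomorphism of the algebra \<open>S(Z(M))\<close> onto the algebra \<open>L\<^sup>0\<close> of classes of almost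
  everywhere equal measurable functions, carrying \<open>Z(M)\<close> onto \<open>L\<^sup>\<infinity>\<close>. The values of \<open>\<Phi>\<close> are
  representatives of the classes.\<close>

definition center_identification ::
    "('a::complex_hilbert \<Rightarrow>\<^sub>L 'a) set \<Rightarrow> 'w measure \<Rightarrow> ('a opr \<Rightarrow> 'w \<Rightarrow> complex) \<Rightarrow> bool" where
  "center_identification M \<mu> \<Phi> \<longleftrightarrow> (let S = measurable_oprs (center M) in
     (\<forall>x\<in>S. \<Phi> x \<in> borel_measurable \<mu>) \<and>
     (\<forall>f\<in>borel_measurable \<mu>. \<exists>x\<in>S. AE \<omega> in \<mu>. \<Phi> x \<omega> = f \<omega>) \<and>
     (\<forall>x\<in>S. \<forall>y\<in>S. (AE \<omega> in \<mu>. \<Phi> x \<omega> = \<Phi> y \<omega>) \<longrightarrow> x = y) \<and>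
     (\<forall>x\<in>S. \<forall>y\<in>S. AE \<omega> in \<mu>. \<Phi> (strong_sum x y) \<omega> = \<Phi> x \<omega> + \<Phi> y \<omega>) \<and>
     (\<forall>x\<in>S. \<forall>y\<in>S. AE \<omega> in \<mu>. \<Phi> (strong_prod x y) \<omega> = \<Phi> x \<omega> * \<Phi> y \<omega>) \<and>
     (\<forall>c. \<forall>x\<in>S. AE \<omega> in \<mu>. \<Phi> (strong_scale c x) \<omega> = c * \<Phi> x \<omega>) \<and>
     (\<forall>x\<in>S. AE \<omega> in \<mu>. \<Phi> (adj x) \<omega> = cnj (\<Phi> x \<omega>)) \<and>
     (\<forall>x\<in>S. x \<in> bounded_opr ` center M \<longleftrightarrow> \<Phi> x \<in> Linf \<mu>))"

definition W_nbhd :: "'w measure \<Rightarrow> 'w set \<Rightarrow> real \<Rightarrow> real \<Rightarrow> ('w \<Rightarrow> complex) set" where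
  "W_nbhd \<mu> A \<epsilon> \<delta> = {f \<in> borel_measurable \<mu>. \<exists>B\<in>sets \<mu>. B \<subseteq> A \<and>
     emeasure \<mu> (A - B) \<le> ennreal \<delta> \<and> (\<lambda>\<omega>. f \<omega> * indicator B \<omega>) \<in> Linf \<mu> \<and>
     Linf_norm \<mu> (\<lambda>\<omega>. f \<omega> * indicator B \<omega>) \<le> ereal \<epsilon>}"


section \<open>The topology of the center-valued norm\<close>

definition center_norm :: "('a::complex_hilbert \<Rightarrow>\<^sub>L 'a) set \<Rightarrow> 'a opr \<Rightarrow> 'a opr" where
  "center_norm M x = (THE g. is_inf_in (self_adjoint_part (measurable_oprs (center M))) opr_le
     {f \<in> self_adjoint_part (measurable_oprs (center M)). opr_le (modulus x) f} g)"

definition O_nbhd :: "('a::complex_hilbert \<Rightarrow>\<^sub>L 'a) set \<Rightarrow> 'w measure \<Rightarrow> ('a opr \<Rightarrow> 'w \<Rightarrow> complex) \<Rightarrow>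
    'w set \<Rightarrow> real \<Rightarrow> real \<Rightarrow> 'a opr set" where
  "O_nbhd M \<mu> \<Phi> A \<epsilon> \<delta> = {x \<in> central_extension M. \<Phi> (center_norm M x) \<in> W_nbhd \<mu> A \<epsilon> \<delta>}"

definition center_norm_topology ::
    "('a::complex_hilbert \<Rightarrow>\<^sub>L 'a) set \<Rightarrow> 'w measure \<Rightarrow> ('a opr \<Rightarrow> 'w \<Rightarrow> complex) \<Rightarrow> 'a opr topology" where
  "center_norm_topology M \<mu> \<Phi> = topology (\<lambda>U. U \<subseteq> central_extension M \<and>
     (\<forall>x\<in>U. \<exists>A \<epsilon> \<delta>. A \<in> sets \<mu> \<and> emeasure \<mu> A < \<infinity> \<and> 0 < \<epsilon> \<and> 0 < \<delta> \<and>
        strong_sum x ` O_nbhd M \<mu> \<Phi> A \<epsilon> \<delta> \<subseteq> U))"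

lemma W_nbhd_mono:
  assumes "A \<subseteq> A'" "\<epsilon>' \<le> \<epsilon>" "\<delta>' \<le> \<delta>" "A \<in> sets \<mu>" "A' \<in> sets \<mu>"
  shows "W_nbhd \<mu> A' \<epsilon>' \<delta>' \<subseteq> W_nbhd \<mu> A \<epsilon> \<delta>"
proof
  fix f assume "f \<in> W_nbhd \<mu> A' \<epsilon>' \<delta>'"
  then obtain B where f [measurable]: "f \<in> borel_measurable \<mu>" and B [measurable]: "B \<in> sets \<mu>"
    and B': "B \<subseteq> A'" "emeasure \<mu> (A' - B) \<le> ennreal \<delta>'"
      "Linf_norm \<mu> (\<lambda>\<omega>. f \<omega> * indicator B \<omega>) < \<infinity>"
      "Linf_norm \<mu> (\<lambda>\<omega>. f \<omega> * indicator B \<omega>) \<le> ereal \<epsilon>'"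
    by (auto simp: W_nbhd_def Linf_def)
  note [measurable] = assms(4,5)
  have "emeasure \<mu> (A - B \<inter> A) \<le> emeasure \<mu> (A' - B)"
    using assms(1) by (intro emeasure_mono) auto
  also have "\<dots> \<le> ennreal \<delta>" using B'(2) assms(3) by (meson ennreal_leI order_trans)
  finally have 1: "emeasure \<mu> (A - B \<inter> A) \<le> ennreal \<delta>" .
  have 2: "Linf_norm \<mu> (\<lambda>\<omega>. f \<omega> * indicator (B \<inter> A) \<omega>) \<le> Linf_norm \<mu> (\<lambda>\<omega>. f \<omega> * indicator B \<omega>)"
    unfolding Linf_norm_def
    by (rule esssup_mono) (measurable, auto simp: indicator_def)
  have 3: "(\<lambda>\<omega>. f \<omega> * indicator (B \<inter> A) \<omega>) \<in> borel_measurable \<mu>" by measurable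
  show "f \<in> W_nbhd \<mu> A \<epsilon> \<delta>"
    unfolding W_nbhd_def Linf_def
  proof (intro CollectI conjI bexI[of _ "B \<inter> A"])
    show "Linf_norm \<mu> (\<lambda>\<omega>. f \<omega> * indicator (B \<inter> A) \<omega>) < \<infinity>"
      using 2 B'(3) by (rule le_less_trans)
    have "Linf_norm \<mu> (\<lambda>\<omega>. f \<omega> * indicator (B \<inter> A) \<omega>) \<le> ereal \<epsilon>'"
      using 2 B'(4) by (rule order_trans)
    also have "\<dots> \<le> ereal \<epsilon>" using assms(2) by simp
    finally show "Linf_norm \<mu> (\<lambda>\<omega>. f \<omega> * indicator (B \<inter> A) \<omega>) \<le> ereal \<epsilon>" .
  qed (use f 1 3 in auto)
qed

lemma openin_center_norm_topology:
  "openin (center_norm_topology M \<mu> \<Phi>) U \<longleftrightarrow> U \<subseteq> central_extension M \<and>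
     (\<forall>x\<in>U. \<exists>A \<epsilon> \<delta>. A \<in> sets \<mu> \<and> emeasure \<mu> A < \<infinity> \<and> 0 < \<epsilon> \<and> 0 < \<delta> \<and>
        strong_sum x ` O_nbhd M \<mu> \<Phi> A \<epsilon> \<delta> \<subseteq> U)"
proof -
  define P where "P = (\<lambda>U. U \<subseteq> central_extension M \<and>
     (\<forall>x\<in>U. \<exists>A \<epsilon> \<delta>. A \<in> sets \<mu> \<and> emeasure \<mu> A < \<infinity> \<and> 0 < \<epsilon> \<and> 0 < \<delta> \<and>
        strong_sum x ` O_nbhd M \<mu> \<Phi> A \<epsilon> \<delta> \<subseteq> U))"
  have O_mono: "O_nbhd M \<mu> \<Phi> A' \<epsilon>' \<delta>' \<subseteq> O_nbhd M \<mu> \<Phi> A \<epsilon> \<delta>"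
    if "A \<subseteq> A'" "\<epsilon>' \<le> \<epsilon>" "\<delta>' \<le> \<delta>" "A \<in> sets \<mu>" "A' \<in> sets \<mu>" for A A' \<epsilon> \<epsilon>' \<delta> \<delta>'
    using W_nbhd_mono[OF that] unfolding O_nbhd_def by blast
  have "istopology P"
    unfolding istopology_def
  proof (intro conjI allI impI)
    fix S T assume S: "P S" and T: "P T"
    show "P (S \<inter> T)" unfolding P_def
    proof (intro conjI ballI)
      show "S \<inter> T \<subseteq> central_extension M" using S by (auto simp: P_def)
      fix x assume x: "x \<in> S \<inter> T"
      obtain A1 e1 d1 where 1: "A1 \<in> sets \<mu>" "emeasure \<mu> A1 < \<infinity>" "0 < e1" "0 < d1"
          "strong_sum x ` O_nbhd M \<mu> \<Phi> A1 e1 d1 \<subseteq> S"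
        using S x unfolding P_def by blast
      obtain A2 e2 d2 where 2: "A2 \<in> sets \<mu>" "emeasure \<mu> A2 < \<infinity>" "0 < e2" "0 < d2"
          "strong_sum x ` O_nbhd M \<mu> \<Phi> A2 e2 d2 \<subseteq> T"
        using T x unfolding P_def by blast
      have fin: "emeasure \<mu> (A1 \<union> A2) < \<infinity>"
        using 1 2 emeasure_subadditive[of A1 \<mu> A2] by (auto intro: le_less_trans)
      let ?O = "O_nbhd M \<mu> \<Phi> (A1 \<union> A2) (min e1 e2) (min d1 d2)"
      have "?O \<subseteq> O_nbhd M \<mu> \<Phi> A1 e1 d1" "?O \<subseteq> O_nbhd M \<mu> \<Phi> A2 e2 d2"
        by (rule O_mono; use 1(1) 2(1) in auto)+
      then have "strong_sum x ` ?O \<subseteq> S \<inter> T" using 1(5) 2(5) by blast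
      then show "\<exists>A \<epsilon> \<delta>. A \<in> sets \<mu> \<and> emeasure \<mu> A < \<infinity> \<and> 0 < \<epsilon> \<and> 0 < \<delta> \<and>
          strong_sum x ` O_nbhd M \<mu> \<Phi> A \<epsilon> \<delta> \<subseteq> S \<inter> T"
        using 1 2 fin by (intro exI[of _ "A1 \<union> A2"] exI[of _ "min e1 e2"] exI[of _ "min d1 d2"]) auto
    qed
  next
    fix \<K> assume K: "\<forall>K\<in>\<K>. P K"
    show "P (\<Union>\<K>)" unfolding P_def
    proof (intro conjI ballI)
      show "\<Union>\<K> \<subseteq> central_extension M" using K unfolding P_def by blast
      fix x assume "x \<in> \<Union>\<K>"
      then obtain K' where "K' \<in> \<K>" "x \<in> K'" by blast
      then have "P K'" using K by blast
      from conjunct2[OF this[unfolded P_def], THEN bspec, OF \<open>x \<in> K'\<close>]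
      obtain A e d where "A \<in> sets \<mu>" "emeasure \<mu> A < \<infinity>" "0 < e" "0 < d"
          and sub: "strong_sum x ` O_nbhd M \<mu> \<Phi> A e d \<subseteq> K'"
        by (elim exE conjE)
      moreover have "strong_sum x ` O_nbhd M \<mu> \<Phi> A e d \<subseteq> \<Union>\<K>"
        by (rule order_trans[OF sub Union_upper[OF \<open>K' \<in> \<K>\<close>]])
      ultimately show "\<exists>A \<epsilon> \<delta>. A \<in> sets \<mu> \<and> emeasure \<mu> A < \<infinity> \<and> 0 < \<epsilon> \<and> 0 < \<delta> \<and>
          strong_sum x ` O_nbhd M \<mu> \<Phi> A \<epsilon> \<delta> \<subseteq> \<Union>\<K>"
        by (intro exI conjI)
    qed
  qed
  then show ?thesis
    unfolding center_norm_topology_def P_def[symmetric] by (simp add: P_def)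
qed

definition coarser :: "'c topology \<Rightarrow> 'c topology \<Rightarrow> bool" where
  "coarser t s \<longleftrightarrow> (\<forall>U. openin t U \<longrightarrow> openin s U)"

abbreviation E_h :: "('a::complex_hilbert \<Rightarrow>\<^sub>L 'a) set \<Rightarrow> 'a opr set" where
  "E_h M \<equiv> self_adjoint_part (central_extension M)"

definition t_ch ::
    "('a::complex_hilbert \<Rightarrow>\<^sub>L 'a) set \<Rightarrow> 'w measure \<Rightarrow> ('a opr \<Rightarrow> 'w \<Rightarrow> complex) \<Rightarrow> 'a opr topology" where
  "t_ch M \<mu> \<Phi> = subtopology (center_norm_topology M \<mu> \<Phi>) (E_h M)"

definition t_o :: "('a::complex_hilbert \<Rightarrow>\<^sub>L 'a) set \<Rightarrow> 'a opr topology" where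
  "t_o M = order_topology (E_h M) opr_le"

end

theory Submission
  imports Defs
begin

text \<open>The algebra \<open>E(M)\<close> is described by bounded operators. An element \<open>x\<close> has bounded pieces \<open>z x\<close> for
central projections \<open>z\<close>; there is a sequence of central projections \<open>z\<^sub>n \<up> 1\<close> along which all pieces are
bounded (\<open>EM_E\<close>), and every compatible sequence of bounded pieces is glued to an element of \<open>E(M)\<close>
(\<open>EM_I\<close>, \<open>glue_EM\<close>). Sums, adjoints, the order and the modulus can be computed piece by piece. The
isomorphism \<open>\<Phi>\<close> turns central projections into measurable sets, and the center-valued norm of \<open>x\<close> is the
least central operator above \<open>|x|\<close>. Hence \<open>x \<in> O(A, \<epsilon>, \<delta>)\<close> means that the piece of \<open>x\<close> over some \<open>B \<subseteq> A\<close>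
with \<open>\<mu>(A - B) \<le> \<delta>\<close> is bounded by \<open>\<epsilon>\<close> in the operator norm (\<open>O_nbhd_iff\<close>): the topology is convergence in
measure of norms over the center.

Let \<open>M\<close> be of type I\<open>\<^sub>f\<^sub>i\<^sub>n\<close>. Below every nonzero central projection lies another one that is a finite sum
of abelian projections \<open>e\<^sub>1, \<dots>, e\<^sub>n\<close> (\<open>type_I_fin_local\<close>), and \<open>e\<^sub>k T e\<^sub>k = c\<^sub>k e\<^sub>k\<close> with central
\<open>c\<^sub>k\<close>. For positive \<open>T\<close> this gives \<open>T \<le> n (c\<^sub>1 + \<dots> + c\<^sub>n)\<close>. If \<open>T\<close> runs through a net decreasing to \<open>0\<close>,
then so does the central bound, and a net of functions that decreases to \<open>0\<close> is uniformly small on some set of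
positive measure. Exhaustion makes it small on most of \<open>A\<close> (\<open>decreasing_net_small\<close>). Applied to
\<open>b\<^sub>i - a\<^sub>i\<close> for \<open>a\<^sub>i \<le> x\<^sub>i \<le> b\<^sub>i\<close> this shows that order convergent nets converge in the topology of the
center-valued norm. If \<open>M\<close> is not of type I\<open>\<^sub>f\<^sub>i\<^sub>n\<close>, then a nonunitary isometry or repeated halving of a
projection without abelian subprojections yields projections \<open>q\<^sub>n\<close> that decrease strictly everywhere below
some central projection (\<open>not_type_I_fin_sequence\<close>). They converge in order, but not in the norm over the center.

Now let \<open>M\<close> be \<open>\<sigma>\<close>-finite. Then \<open>1\<close> is the supremum of a sequence of sets \<open>A\<^sub>n\<close> of finite measure. If
an order open \<open>V\<close> contained no neighborhood of \<open>v \<in> V\<close>, there would be \<open>y\<^sub>n \<in> O(A\<^sub>n, 2\<^sup>-\<^sup>n, 2\<^sup>-\<^sup>n)\<close> with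
\<open>v + y\<^sub>n \<notin> V\<close>. By the Borel--Cantelli argument \<open>\<plusminus> y\<^sub>n \<le> b\<^sub>n\<close> for some \<open>b\<^sub>n\<close> decreasing to \<open>0\<close>, so that
\<open>v + y\<^sub>n\<close> converges to \<open>v\<close> in order, a contradiction (\<open>order_open_contains_nbhd\<close>). Conversely, an uncountable
orthogonal family of central projections gives an order closed set that is not closed in the topology of the
norm (\<open>countable_of_topologies_eq\<close>), and in type I\<open>\<^sub>f\<^sub>i\<^sub>n\<close> countability over the center implies
\<open>\<sigma>\<close>-finiteness of \<open>M\<close> (\<open>sigma_finite_of_center\<close>).\<close>

section \<open>The real inner product and orthogonal projections\<close>

definition rin :: "'a::complex_hilbert => 'a => real" where
 "rin x y = Re (cinner x y)"

lemma rin_commute: "rin x y = rin y x"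
 unfolding rin_def by (subst cinner_commute) simp

lemma rin_self: "rin x x = (norm x)\<^sup>2"
 by (simp add: rin_def cinner_self)

lemma rin_add_left: "rin (x + y) z = rin x z + rin y z"
 by (simp add: rin_def cinner_add_left)

lemma rin_add_right: "rin z (x + y) = rin z x + rin z y"
 by (metis rin_add_left rin_commute)

lemma rin_scaleR_left: "rin (r *\<^sub>R x) y = r * rin x y"
 unfolding rin_def by (simp add: scaleC_of_real[symmetric] cinner_scaleC_left)

lemma rin_scaleR_right: "rin x (r *\<^sub>R y) = r * rin x y"
 by (metis rin_scaleR_left rin_commute)

lemma rin_zero_left [simp]: "rin 0 y = 0"
 using rin_scaleR_left[of 0 0 y] by simp

lemma rin_zero_right [simp]: "rin x 0 = 0"
 by (simp add: rin_commute[of x])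

lemma rin_minus_left: "rin (- x) y = - rin x y"
 using rin_scaleR_left[of "-1" x y] by simp

lemma rin_minus_right: "rin x (- y) = - rin x y"
 using rin_scaleR_right[of x "-1" y] by simp

lemma rin_diff_left: "rin (x - y) z = rin x z - rin y z"
 using rin_add_left[of x "- y" z] by (simp add: rin_minus_left)

lemma rin_diff_right: "rin z (x - y) = rin z x - rin z y"
 by (metis rin_diff_left rin_commute)

lemmas rin_simps = rin_add_left rin_add_right rin_diff_left rin_diff_right rin_scaleR_left
 rin_scaleR_right rin_minus_left rin_minus_right

lemma norm_add_rin: "(norm (x + y))\<^sup>2 = (norm x)\<^sup>2 + 2 * rin x y + (norm y)\<^sup>2"
 by (simp add: rin_self[symmetric] rin_simps rin_commute[of y x])

lemma norm_diff_rin: "(norm (x - y))\<^sup>2 = (norm x)\<^sup>2 - 2 * rin x y + (norm y)\<^sup>2"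
 by (simp add: rin_self[symmetric] rin_simps rin_commute[of y x])

lemma parallelogram:
 fixes x y :: "'a::complex_hilbert"
 shows "(norm (x + y))\<^sup>2 + (norm (x - y))\<^sup>2 = 2 * (norm x)\<^sup>2 + 2 * (norm y)\<^sup>2"
 by (simp add: norm_add_rin norm_diff_rin)

text \<open>A nonnegative symmetric bilinear form satisfies the Cauchy--Schwarz inequality; it is used for
 the inner product and for the forms of positive operators.\<close>

lemma quadratic_discriminant:
 fixes a b c :: real
 assumes "\<And>t. 0 \<le> a + 2 * t * b + t\<^sup>2 * c" "0 \<le> c"
 shows "b\<^sup>2 \<le> a * c"
proof (cases "c = 0")
 case True
 have "b = 0"
 proof (rule ccontr)
  assume "b ~= 0"
  then show False using assms(1)[of "- (a + 1) / (2 * b)"] True by (simp add: field_simps)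
 qed
 then show ?thesis using True by simp
next
 case False
 then have "c > 0" using assms(2) by simp
 have "0 <= a + 2 * (- b / c) * b + (- b / c)\<^sup>2 * c" by (rule assms)
 also have "... = a - b\<^sup>2 / c" using `c > 0` by (simp add: field_simps power2_eq_square)
 finally show ?thesis using `c > 0` by (simp add: field_simps)
qed

lemma rin_Cauchy_Schwarz: "\<bar>rin x y\<bar> \<le> norm x * norm y"
proof -
 have "(rin x y)\<^sup>2 <= (norm x)\<^sup>2 * (norm y)\<^sup>2"
 proof (rule quadratic_discriminant)
  fix t :: real
  have "0 <= (norm (x + t *\<^sub>R y))\<^sup>2" by simp
  also have "... = (norm x)\<^sup>2 + 2 * t * rin x y + t\<^sup>2 * (norm y)\<^sup>2"
   unfolding norm_add_rin by (simp add: rin_scaleR_right power_mult_distrib)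
  finally show "0 <= (norm x)\<^sup>2 + 2 * t * rin x y + t\<^sup>2 * (norm y)\<^sup>2" .
 qed simp
 then have "\<bar>rin x y\<bar> <= \<bar>norm x * norm y\<bar>"
  unfolding abs_le_square_iff by (simp only: power_mult_distrib)
 then show ?thesis by (simp add: abs_mult)
qed

lemma bounded_bilinear_rin: "bounded_bilinear rin"
 by standard (auto simp: rin_simps intro!: exI[of _ 1] rin_Cauchy_Schwarz)

lemmas tendsto_rin [tendsto_intros] = bounded_bilinear.tendsto[OF bounded_bilinear_rin]

lemma rin_all_zero: "(\<And>y. rin x y = 0) ==> x = 0"
 using rin_self[of x] by simp

text \<open>Complex multiplication and the imaginary part of the inner product expressed through \<open>rin\<close>.\<close>

lemma cinner_scaleC_right: "cinner x (c *\<^sub>C y) = cnj c * cinner x y"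
 by (subst (1 2) cinner_commute) (simp add: cinner_scaleC_left)

lemma Im_cinner: "Im (cinner x y) = rin x (\<i> *\<^sub>C y)"
 by (simp add: rin_def cinner_scaleC_right)

lemma rin_scaleC: "rin (c *\<^sub>C x) y = rin x (cnj c *\<^sub>C y)"
 by (simp add: rin_def cinner_scaleC_left cinner_scaleC_right)

lemma norm_scaleC: "norm (c *\<^sub>C x) = cmod c * norm (x::'a::complex_hilbert)"
proof -
 have "complex_of_real ((norm (c *\<^sub>C x))\<^sup>2) = complex_of_real ((cmod c * norm x)\<^sup>2)"
  unfolding cinner_self[symmetric] cinner_scaleC_left cinner_scaleC_right
  using complex_norm_square[of c] by (simp add: cinner_self power_mult_distrib mult.commute)
 then show ?thesis by (simp only: of_real_eq_iff power2_eq_iff_nonneg norm_ge_zero mult_nonneg_nonneg)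
qed

text \<open>The nearest point of a closed subspace: by the parallelogram law, the diameters of the sets of
 almost nearest points tend to 0.\<close>

lemma nearest_point:
 fixes K :: "'a::complex_hilbert set"
 assumes K: "subspace K" "closed K"
 shows "\<exists>k\<in>K. \<forall>h\<in>K. rin (x - k) h = 0"
proof -
 define d where "d = infdist x K"
 define S where "S = (%n. {k : K. (norm (x - k))\<^sup>2 <= d\<^sup>2 + 1 / real (Suc n)})"
 have d: "d <= norm (x - h)" if "h : K" for h
  using infdist_le[OF that, of x] by (simp add: d_def dist_norm)
 have d0: "0 <= d" unfolding d_def by (rule infdist_nonneg)
 have "EX l. ALL n. l : S n"
 proof (rule decreasing_closed_nest)
  show "closed (S n)" for n
   unfolding S_def using K(2) by (intro closed_Collect_conj closed_Collect_le continuous_intros) simp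
  show "S n ~= {}" for n
  proof -
   have "infdist x K < sqrt (d\<^sup>2 + 1 / real (Suc n))"
    unfolding d_def[symmetric] by (intro real_less_rsqrt) simp
   moreover have "K ~= {}" using K(1) subspace_0 by blast
   ultimately have "EX k:K. dist x k < sqrt (d\<^sup>2 + 1 / real (Suc n))"
    unfolding infdist_def by (auto simp: cInf_less_iff)
   then obtain k where "k : K" "norm (x - k) < sqrt (d\<^sup>2 + 1 / real (Suc n))" by (auto simp: dist_norm)
   moreover from this(2) have "(norm (x - k))\<^sup>2 <= (sqrt (d\<^sup>2 + 1 / real (Suc n)))\<^sup>2"
    by (intro power_mono) auto
   ultimately show ?thesis by (auto simp: S_def)
  qed
  show "S n <= S m" if "m <= n" for m n
   using that frac_le[of 1 1 "real (Suc m)" "real (Suc n)"] by (force simp: S_def)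
  have est: "(norm (k - k'))\<^sup>2 <= 4 * (1 / real (Suc n))" if k: "k : S n" "k' : S n" for n k k'
  proof -
   have "(1/2) *\<^sub>R (k + k') : K" using K(1) k by (intro subspace_scale subspace_add) (auto simp: S_def)
   then have "d\<^sup>2 <= (norm (x - (1/2) *\<^sub>R (k + k')))\<^sup>2" using d d0 by (intro power_mono) auto
   moreover have "(x - k) + (x - k') = 2 *\<^sub>R (x - (1/2) *\<^sub>R (k + k'))"
    by (simp add: algebra_simps scaleR_2)
   then have "(norm ((x - k) + (x - k')))\<^sup>2 = 4 * (norm (x - (1/2) *\<^sub>R (k + k')))\<^sup>2"
    by (simp only: norm_scaleR) (simp add: power_mult_distrib)
   moreover have "(norm ((x - k) - (x - k')))\<^sup>2 = (norm (k - k'))\<^sup>2" by (simp add: norm_minus_commute)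
   moreover have "(norm (x - k))\<^sup>2 <= d\<^sup>2 + 1 / real (Suc n)" "(norm (x - k'))\<^sup>2 <= d\<^sup>2 + 1 / real (Suc n)"
    using k by (auto simp: S_def)
   ultimately show ?thesis using parallelogram[of "x - k" "x - k'"] by argo
  qed
  fix e :: real assume "e > 0"
  obtain n where n: "1 / real (Suc n) < e\<^sup>2 / 4" using nat_approx_posE[of "e\<^sup>2 / 4"] `e > 0` by auto
  have "dist k k' < e" if "k : S n" "k' : S n" for k k'
  proof -
   have "(norm (k - k'))\<^sup>2 < e\<^sup>2" using est[OF that] n by linarith
   then show ?thesis using `e > 0` by (simp add: dist_norm power2_less_imp_less)
  qed
  then show "EX n. ALL k:S n. ALL k':S n. dist k k' < e" by blast
 qed blast
 then obtain l where l: "!!n. l : S n" by blast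
 then have lK: "l : K" by (auto simp: S_def)
 have "(norm (x - l))\<^sup>2 <= d\<^sup>2"
 proof (rule LIMSEQ_le_const)
  show "(%n. d\<^sup>2 + 1 / real (Suc n)) \<longlonglongrightarrow> d\<^sup>2"
   using tendsto_add[OF tendsto_const LIMSEQ_Suc[OF lim_1_over_n], of "d\<^sup>2"] by simp
 qed (use l in "auto simp: S_def")
 have "rin (x - l) h = 0" if "h : K" for h
 proof -
  have "(rin (x - l) h)\<^sup>2 <= 0 * (norm h)\<^sup>2"
  proof (rule quadratic_discriminant)
   fix t :: real
   have "l - t *\<^sub>R h : K" using K(1) lK that by (intro subspace_diff subspace_scale)
   then have "d\<^sup>2 <= (norm (x - (l - t *\<^sub>R h)))\<^sup>2" using d d0 by (intro power_mono) auto
   with `(norm (x - l))\<^sup>2 <= d\<^sup>2` have "(norm (x - l))\<^sup>2 <= (norm (x - (l - t *\<^sub>R h)))\<^sup>2" by (rule order_trans)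
   also have "x - (l - t *\<^sub>R h) = (x - l) + t *\<^sub>R h" by simp
   finally show "0 <= 0 + 2 * t * rin (x - l) h + t\<^sup>2 * (norm h)\<^sup>2"
    unfolding norm_add_rin by (simp add: rin_scaleR_right power_mult_distrib)
  qed simp
  then show ?thesis by simp
 qed
 then show ?thesis using lK by blast
qed

no_notation matrix_matrix_mult (infixl "**" 70)

abbreviation opm :: "('b::real_normed_vector \<Rightarrow>\<^sub>L 'c::real_normed_vector) => ('a::real_normed_vector \<Rightarrow>\<^sub>L 'b) => ('a \<Rightarrow>\<^sub>L 'c)"
 (infixl "**" 70) where "S ** T \<equiv> S o\<^sub>L T"

abbreviation one_op :: "'a::real_normed_vector \<Rightarrow>\<^sub>L 'a" ("\<one>") where "\<one> \<equiv> id_blinfun"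

lemma opm_assoc: "(R**S)**T = R**(S**T)"
 by (rule blinfun_eqI) simp

lemma opm_one [simp]: "\<one>**T = T" "T**\<one> = T"
 by (rule blinfun_eqI, simp)+

interpretation opm: bounded_bilinear "%S T. S**T"
 by (rule bounded_bilinear_blinfun_compose)

lemmas op_simps = opm_assoc opm.add_left opm.add_right opm.diff_left opm.diff_right
 opm.minus_left opm.minus_right opm.zero_left opm.zero_right opm.scaleR_left opm.scaleR_right

lemma op_apply_assoc: "(R**S) x = R (S x)"
 by simp

definition proj_on :: "'a::complex_hilbert set => 'a \<Rightarrow>\<^sub>L 'a" where
 "proj_on K = Blinfun (%x. THE k. k \<in> K \<and> (\<forall>h\<in>K. rin (x - k) h = 0))"

lemma proj_on:
 fixes K :: "'a::complex_hilbert set"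
 assumes K: "subspace K" "closed K"
 shows proj_on_in: "proj_on K x \<in> K" and proj_on_orth: "\<And>h. h \<in> K ==> rin (x - proj_on K x) h = 0"
  and proj_on_eqI: "\<And>k. k \<in> K ==> (\<And>h. h \<in> K ==> rin (x - k) h = 0) ==> proj_on K x = k"
proof -
 define f where "f = (%x. THE k. k : K & (ALL h:K. rin (x - k) h = 0))"
 have uniq: "k = k'" if "k : K" "ALL h:K. rin (x - k) h = 0" "k' : K" "ALL h:K. rin (x - k') h = 0" for x k k'
 proof -
  have "k - k' : K" using that K(1) by (simp add: subspace_diff)
  then have "rin (x - k) (k - k') = 0" "rin (x - k') (k - k') = 0" using that by blast+
  then have "rin (k - k') (k - k') = 0" by (simp add: rin_diff_left)
  then show ?thesis by (simp add: rin_self)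
 qed
 have f: "f x : K" "!!h. h : K ==> rin (x - f x) h = 0" for x
 proof -
  have "EX!k. k : K & (ALL h:K. rin (x - k) h = 0)"
   using nearest_point[OF K, of x] uniq by blast
  from theI'[OF this] show "f x : K" "!!h. h : K ==> rin (x - f x) h = 0"
   unfolding f_def by auto
 qed
 have feq: "f x = k" if "k : K" "!!h. h : K ==> rin (x - k) h = 0" for x k
  using uniq[OF f(1) _ that(1)] f(2) that(2) by blast
 have "bounded_linear f"
 proof (rule bounded_linear_intro[where K = 1])
  fix x y :: 'a and r :: real
  show "f (x + y) = f x + f y"
  proof (rule feq)
   show "f x + f y : K" using K(1) f(1) by (intro subspace_add)
   fix h assume "h : K"
   then have "rin (x - f x) h + rin (y - f y) h = 0" using f(2) by simp
   then show "rin (x + y - (f x + f y)) h = 0" by (simp add: rin_simps)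
  qed
  show "f (r *\<^sub>R x) = r *\<^sub>R f x"
  proof (rule feq)
   show "r *\<^sub>R f x : K" using K(1) f(1) by (intro subspace_scale)
   fix h assume "h : K"
   then have "r * rin (x - f x) h = 0" using f(2) by simp
   then show "rin (r *\<^sub>R x - r *\<^sub>R f x) h = 0" by (simp add: rin_simps algebra_simps)
  qed
  have "rin (x - f x) (f x) = 0" using f by blast
  then have "(norm x)\<^sup>2 = (norm (x - f x))\<^sup>2 + (norm (f x))\<^sup>2"
   using norm_add_rin[of "x - f x" "f x"] by simp
  then have "(norm (f x))\<^sup>2 <= (norm x)\<^sup>2" by simp
  then show "norm (f x) <= norm x * 1" by (simp add: power2_le_iff_abs_le)
 qed
 then have eq: "blinfun_apply (proj_on K) = f"
  unfolding proj_on_def f_def[symmetric] by (simp add: bounded_linear_Blinfun_apply)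
 show "proj_on K x : K" and "!!h. h : K ==> rin (x - proj_on K x) h = 0"
  unfolding eq by (fact f)+
 show "!!k. k : K ==> (!!h. h : K ==> rin (x - k) h = 0) ==> proj_on K x = k"
  unfolding eq by (rule feq)
qed

lemma proj_on_fix:
 assumes "subspace K" "closed K" "k \<in> K"
 shows "proj_on K k = k"
 by (rule proj_on_eqI[OF assms(1,2)]) (use assms(3) in auto)

section \<open>Adjoints and positive operators\<close>

lemma Riesz_rin:
 fixes f :: "'a::complex_hilbert => real"
 assumes "bounded_linear f"
 shows "\<exists>y. \<forall>x. f x = rin x y"
proof (cases "ALL x. f x = 0")
 case True
 then show ?thesis by (intro exI[of _ 0]) simp
next
 case False
 interpret f: bounded_linear f by fact
 define K where "K = {x. f x = 0}"
 have sub: "subspace K" unfolding K_def by (auto simp: subspace_def f.add f.scaleR f.zero)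
 have "closed K" unfolding K_def
  by (intro closed_Collect_eq continuous_on_const f.continuous_on continuous_on_id)
 from False obtain x0 where "f x0 ~= 0" by blast
 obtain k where k: "k : K" "ALL h:K. rin (x0 - k) h = 0"
  using nearest_point[OF sub `closed K`] by blast
 define u where "u = x0 - k"
 have fu: "f u ~= 0" using `f x0 ~= 0` k(1) unfolding u_def K_def by (simp add: f.diff)
 then have un: "norm u ~= 0" using f.zero by fastforce
 show ?thesis
 proof (intro exI allI)
  fix x
  have "x - (f x / f u) *\<^sub>R u : K" unfolding K_def using fu by (simp add: f.diff f.scaleR)
  then have "rin u (x - (f x / f u) *\<^sub>R u) = 0" using k(2) u_def by blast
  then have "rin u x = f x / f u * (norm u)\<^sup>2" by (simp add: rin_simps rin_self)
  then show "f x = rin x ((f u / (norm u)\<^sup>2) *\<^sub>R u)"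
   using fu un by (simp add: rin_simps rin_commute[of x u])
 qed
qed

text \<open>The adjoint with respect to the real inner product, which exists for every bounded real-linear
 operator; on complex-linear operators it is the Hilbert space adjoint.\<close>

definition dag :: "('a::complex_hilbert \<Rightarrow>\<^sub>L 'a) => ('a \<Rightarrow>\<^sub>L 'a)" where
 "dag T = (SOME S :: 'a \<Rightarrow>\<^sub>L 'a. \<forall>\<xi> \<eta>. rin (T \<xi>) \<eta> = rin \<xi> (S \<eta>))"

lemma rin_dag:
 fixes T :: "'a::complex_hilbert \<Rightarrow>\<^sub>L 'a"
 shows "rin (T h) k = rin h (dag T k)"
proof -
 have "EX y. ALL x. rin (T x) k = rin x y" for k
  by (rule Riesz_rin)
   (intro bounded_linear_compose[OF bounded_bilinear.bounded_linear_left[OF bounded_bilinear_rin]]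
    blinfun.bounded_linear_right)
 then obtain g where g: "!!x k. rin (T x) k = rin x (g k)" by metis
 have "bounded_linear g"
 proof (rule bounded_linear_intro[where K = "norm T"])
  fix x y :: 'a and r :: real
  show "g (x + y) = g x + g y"
   using rin_all_zero[of "g (x + y) - (g x + g y)"]
   by (simp add: rin_simps rin_commute[of "g _"] g[symmetric])
  show "g (r *\<^sub>R x) = r *\<^sub>R g x"
   using rin_all_zero[of "g (r *\<^sub>R x) - r *\<^sub>R g x"]
   by (simp add: rin_simps rin_commute[of "g _"] g[symmetric])
  have "(norm (g x))\<^sup>2 = rin (T (g x)) x" by (simp add: g rin_self)
  also have "... <= norm (T (g x)) * norm x" using rin_Cauchy_Schwarz abs_le_D1 by blast
  also have "... <= norm T * norm (g x) * norm x"
   by (intro mult_right_mono norm_blinfun) auto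
  finally have "norm (g x) * norm (g x) <= norm (g x) * (norm x * norm T)"
   by (simp add: power2_eq_square mult_ac)
  then show "norm (g x) <= norm x * norm T"
   by (metis mult_left_le_imp_le mult_nonneg_nonneg norm_ge_zero order_le_less zero_less_norm_iff norm_zero)
 qed
 then have "ALL h k. rin (T h) k = rin h (Blinfun g k)"
  by (simp add: bounded_linear_Blinfun_apply g)
 then have "ALL h k. rin (T h) k = rin h (dag T k)"
  unfolding dag_def by (rule someI)
 then show ?thesis by blast
qed

lemma rin_dag':
 fixes T :: "'a::complex_hilbert \<Rightarrow>\<^sub>L 'a"
 shows "rin x (T y) = rin (dag T x) y"
 by (metis rin_dag rin_commute)

lemma dag_unique:
 fixes S T :: "'a::complex_hilbert \<Rightarrow>\<^sub>L 'a"
 assumes "\<And>x y. rin (T x) y = rin x (S y)"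
 shows "dag T = S"
proof (rule blinfun_eqI)
 fix y
 have "rin x (dag T y) = rin x (S y)" for x
  using rin_dag[of T x y] assms[of x y] by simp
 then have "rin (dag T y - S y) x = 0" for x
  by (simp add: rin_commute[of _ x] rin_diff_right)
 then show "dag T y = S y" using rin_all_zero[of "dag T y - S y"] by simp
qed

lemma dag_dag [simp]: "dag (dag T) = T"
 by (rule dag_unique) (simp add: rin_dag')

lemma dag_comp: "dag (S**T) = dag T**dag S"
 by (rule dag_unique) (simp add: rin_dag)

lemma dag_add: "dag (S + T) = dag S + dag T"
 by (rule dag_unique) (simp add: rin_dag rin_simps blinfun.add_left)

lemma dag_diff: "dag (S - T) = dag S - dag T"
 by (rule dag_unique) (simp add: rin_dag rin_simps blinfun.diff_left)

lemma dag_minus: "dag (- T) = - dag T"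
 by (rule dag_unique) (simp add: rin_dag rin_simps blinfun.minus_left)

lemma dag_scaleR: "dag (r *\<^sub>R T) = r *\<^sub>R dag T"
 by (rule dag_unique) (simp add: rin_dag rin_simps blinfun.scaleR_left)

lemma dag_one [simp]: "dag \<one> = \<one>"
 by (rule dag_unique) simp

lemma dag_zero [simp]: "dag 0 = 0"
 by (rule dag_unique) simp

lemmas dag_simps = dag_comp dag_add dag_diff dag_minus dag_scaleR

lemma op_eqI_rin:
 fixes S T :: "'a::complex_hilbert \<Rightarrow>\<^sub>L 'a"
 assumes "\<And>x y. rin (S x) y = rin (T x) y"
 shows "S = T"
proof (rule blinfun_eqI)
 fix x
 show "S x = T x" using rin_all_zero[of "S x - T x"] assms by (simp add: rin_diff_left)
qed

lemma norm_op_sq: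
 fixes T :: "'a::complex_hilbert \<Rightarrow>\<^sub>L 'a"
 shows "(norm (T x))\<^sup>2 = rin ((dag T**T) x) x"
 by (simp add: rin_self[symmetric] rin_dag)

lemma dag_mult_zero: "dag T**T = 0 ==> T = 0"
 by (rule blinfun_eqI) (use norm_op_sq[of T] in auto)

definition pos :: "('a::complex_hilbert \<Rightarrow>\<^sub>L 'a) => bool" where
 "pos T \<longleftrightarrow> dag T = T \<and> (\<forall>\<xi>. 0 \<le> rin (T \<xi>) \<xi>)"

lemma pos_dag: "pos T ==> dag T = T" and pos_ge: "pos T ==> 0 \<le> rin (T x) x"
 by (auto simp: pos_def)

lemma pos_add: "pos S ==> pos T ==> pos (S + T)"
 by (auto simp: pos_def dag_simps rin_simps blinfun.add_left)

lemma pos_scaleR: "pos T ==> 0 \<le> r ==> pos (r *\<^sub>R T)"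
 by (auto simp: pos_def dag_simps rin_simps blinfun.scaleR_left)

lemma pos_zero [simp]: "pos 0" by (simp add: pos_def)
lemma pos_one [simp]: "pos \<one>" by (simp add: pos_def rin_self)

lemma pos_conj: "pos T ==> pos (dag S**T**S)"
 by (auto simp: pos_def dag_simps opm_assoc rin_dag[of "dag S"])

lemma pos_square: "dag S = S ==> pos (S**S)"
 using pos_conj[of \<one> S] by simp

lemma pos_dag_mult: "pos (dag S**S)"
 using pos_conj[of \<one> S] by simp

lemma selfadj_zero:
 fixes T :: "'a::complex_hilbert \<Rightarrow>\<^sub>L 'a"
 assumes "dag T = T" "\<And>x. rin (T x) x = 0"
 shows "T = 0"
proof (rule op_eqI_rin)
 fix x y
 have "rin (T (x + y)) (x + y) = rin (T x) x + 2 * rin (T x) y + rin (T y) y"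
  using rin_dag[of T y x] assms(1) by (simp add: blinfun.add_right rin_simps rin_commute[of y])
 then show "rin (T x) y = rin ((0::'a \<Rightarrow>\<^sub>L 'a) x) y" using assms(2) by simp
qed

lemma pos_antisym: "pos T ==> pos (- T) ==> T = 0"
 by (rule selfadj_zero) (auto simp: pos_def blinfun.minus_left rin_simps intro: antisym)

lemma pos_sum_zero: "pos S ==> pos T ==> S + T = 0 ==> S = 0"
 by (rule pos_antisym) (auto simp: eq_neg_iff_add_eq_0[symmetric])

lemma pos_Cauchy_Schwarz:
 assumes "pos T"
 shows "(rin (T x) y)\<^sup>2 \<le> rin (T x) x * rin (T y) y"
proof (rule quadratic_discriminant)
 fix t :: real
 have "0 <= rin (T (x + t *\<^sub>R y)) (x + t *\<^sub>R y)" by (rule pos_ge[OF assms])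
 also have "... = rin (T x) x + 2 * t * rin (T x) y + t\<^sup>2 * rin (T y) y"
  using rin_dag[of T y x] pos_dag[OF assms]
  by (simp add: blinfun.add_right blinfun.scaleR_right rin_simps rin_commute[of y]
    power2_eq_square algebra_simps)
 finally show "0 <= rin (T x) x + 2 * t * rin (T x) y + t\<^sup>2 * rin (T y) y" .
qed (rule pos_ge[OF assms])

lemma rin_op_le:
 fixes T :: "'a::complex_hilbert \<Rightarrow>\<^sub>L 'a"
 shows "rin (T x) x \<le> norm T * (norm x)\<^sup>2"
proof -
 have "rin (T x) x <= norm (T x) * norm x" using rin_Cauchy_Schwarz abs_le_D1 by blast
 also have "... <= norm T * norm x * norm x" by (intro mult_right_mono norm_blinfun) auto
 finally show ?thesis by (simp add: power2_eq_square mult.assoc)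
qed

lemma pos_norm_le:
 fixes T :: "'a::complex_hilbert \<Rightarrow>\<^sub>L 'a"
 assumes "pos T" "\<And>x. rin (T x) x \<le> c * (norm x)\<^sup>2"
 shows "(norm (T x))\<^sup>2 \<le> c * rin (T x) x"
proof (cases "T x = 0")
 case True
 then show ?thesis by simp
next
 case False
 have "((norm (T x))\<^sup>2)\<^sup>2 = (rin (T x) (T x))\<^sup>2" by (simp add: rin_self)
 also have "... <= rin (T x) x * rin (T (T x)) (T x)" by (rule pos_Cauchy_Schwarz[OF assms(1)])
 also have "... <= rin (T x) x * (c * (norm (T x))\<^sup>2)"
  by (intro mult_left_mono assms pos_ge)
 finally have "(norm (T x))\<^sup>2 * (norm (T x))\<^sup>2 <= (c * rin (T x) x) * (norm (T x))\<^sup>2"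
  by (simp add: power2_eq_square mult_ac)
 moreover have "0 < (norm (T x))\<^sup>2" using False by simp
 ultimately show ?thesis by (rule mult_right_le_imp_le)
qed

lemma op_norm_le_form:
 fixes T :: "'a::complex_hilbert \<Rightarrow>\<^sub>L 'a"
 assumes "dag T = T" "\<And>x. \<bar>rin (T x) x\<bar> \<le> c * (norm x)\<^sup>2" "0 \<le> c"
 shows "norm T \<le> c"
proof -
 \<comment> \<open>The bilinear form is bounded through polarization and the parallelogram law.\<close>
 have pol: "4 * rin (T x) y <= 2 * c * ((norm x)\<^sup>2 + (norm y)\<^sup>2)" for x y
 proof -
  have "4 * rin (T x) y = rin (T (x + y)) (x + y) - rin (T (x - y)) (x - y)"
   using rin_dag[of T y x] assms(1)
   by (simp add: blinfun.add_right blinfun.diff_right rin_simps rin_commute[of y])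
  also have "... <= c * (norm (x + y))\<^sup>2 + c * (norm (x - y))\<^sup>2"
   using assms(2)[of "x + y"] assms(2)[of "x - y"] by linarith
  also have "... = c * ((norm (x + y))\<^sup>2 + (norm (x - y))\<^sup>2)" by (simp add: algebra_simps)
  also have "... = 2 * c * ((norm x)\<^sup>2 + (norm y)\<^sup>2)"
   unfolding parallelogram by (simp add: algebra_simps)
  finally show ?thesis .
 qed
 show ?thesis
 proof (rule norm_blinfun_bound[OF assms(3)])
  fix x
  show "norm (T x) <= c * norm x"
  proof (cases "T x = 0")
   case True
   then show ?thesis using assms(3) by simp
  next
   case False
   then have "x ~= 0" by auto
   define y where "y = (norm x / norm (T x)) *\<^sub>R T x"
   have "norm y = norm x" unfolding y_def using False by simp
   moreover have "rin (T x) y = norm x * norm (T x)"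
    unfolding y_def using False by (simp add: rin_simps rin_self power2_eq_square)
   ultimately have "4 * (norm x * norm (T x)) <= 4 * (c * norm x * norm x)"
    using pol[of x y] by (simp add: power2_eq_square)
   then have "norm x * norm (T x) <= norm x * (c * norm x)" by (simp add: mult_ac)
   then show ?thesis using `x ~= 0` by simp
  qed
 qed
qed

section \<open>Square roots of positive operators\<close>

abbreviation op_le :: "('a::complex_hilbert \<Rightarrow>\<^sub>L 'a) => ('a \<Rightarrow>\<^sub>L 'a) => bool" (infix "\<preceq>" 50) where
 "S \<preceq> T \<equiv> pos (T - S)"

lemma op_le_trans: "R \<preceq> S ==> S \<preceq> T ==> R \<preceq> T"
 using pos_add[of "S - R" "T - S"] by simp

lemma op_le_antisym: "S \<preceq> T ==> T \<preceq> S ==> S = T"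
 using pos_antisym[of "T - S"] by simp

lemma op_leD: "S \<preceq> T ==> rin (S x) x \<le> rin (T x) x"
 using pos_ge[of "T - S" x] by (simp add: blinfun.diff_left rin_simps)

lemma op_leI:
 "dag S = S ==> dag T = T ==> (\<And>x. rin (S x) x \<le> rin (T x) x) ==> S \<preceq> T"
 by (simp add: pos_def dag_simps blinfun.diff_left rin_simps)

lemma op_le_norm:
 assumes "dag T = T" "norm T \<le> c"
 shows "T \<preceq> c *\<^sub>R \<one>" "- (c *\<^sub>R \<one>) \<preceq> T"
proof -
 have "\<bar>rin (T x) x\<bar> <= c * rin x x" for x
 proof -
  have "norm T * (norm x)\<^sup>2 <= c * (norm x)\<^sup>2" by (intro mult_right_mono assms) simp
  then show ?thesis
   using rin_op_le[of T x] rin_op_le[of "- T" x]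
   by (simp add: rin_self blinfun.minus_left rin_simps abs_le_iff)
 qed
 note * = this
 have "rin (T x) x <= c * rin x x" "- (c * rin x x) <= rin (T x) x" for x
  using *[of x] by (auto simp: abs_le_iff)
 then show "T \<preceq> c *\<^sub>R \<one>" "- (c *\<^sub>R \<one>) \<preceq> T"
  by - (rule op_leI; simp add: dag_simps assms blinfun.scaleR_left blinfun.minus_left rin_simps)+
qed

lemma norm_op_le:
 assumes "dag T = T" "T \<preceq> c *\<^sub>R \<one>" "- (c *\<^sub>R \<one>) \<preceq> T" "0 \<le> c"
 shows "norm T \<le> c"
proof (rule op_norm_le_form[OF assms(1) _ assms(4)])
 fix x
 show "\<bar>rin (T x) x\<bar> <= c * (norm x)\<^sup>2"
  using op_leD[OF assms(2), of x] op_leD[OF assms(3), of x]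
  by (simp add: blinfun.scaleR_left blinfun.minus_left rin_simps rin_self abs_le_iff)
qed

lemma norm_comp_le: "norm (S**T) \<le> norm S * norm T"
 by (rule norm_blinfun_compose)

text \<open>The iteration \<open>Y \<mapsto> (X + Y\<^sup>2) / 2\<close> converges in norm to \<open>1 - sqrt (1 - X)\<close> if \<open>\<parallel>X\<parallel> \<le> 1\<close>:
 its increments are dominated by those of the same iteration for the number 1.\<close>

primrec sqrt_iter :: "('a::complex_hilbert \<Rightarrow>\<^sub>L 'a) => nat => ('a \<Rightarrow>\<^sub>L 'a)" where
 "sqrt_iter X 0 = 0"
| "sqrt_iter X (Suc n) = (1/2) *\<^sub>R (X + sqrt_iter X n**sqrt_iter X n)"

primrec sqrt_iter_num :: "nat => real" where
 "sqrt_iter_num 0 = 0"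
| "sqrt_iter_num (Suc n) = (1 + (sqrt_iter_num n)\<^sup>2) / 2"

lemma sqrt_iter_num: "0 \<le> sqrt_iter_num n \<and> sqrt_iter_num n \<le> 1 \<and> sqrt_iter_num n \<le> sqrt_iter_num (Suc n)"
proof (induction n)
 case (Suc n)
 then have "(sqrt_iter_num n)\<^sup>2 <= (sqrt_iter_num (Suc n))\<^sup>2" by (intro power_mono) auto
 moreover have "(sqrt_iter_num n)\<^sup>2 <= 1" using Suc power_mono[of "sqrt_iter_num n" 1 2] by simp
 ultimately show ?case by (auto simp: field_simps)
qed simp

lemma sqrt_iter_commute: "R**X = X**R ==> R**sqrt_iter X n = sqrt_iter X n**R"
proof (induction n)
 case (Suc n)
 then have "R**sqrt_iter X n = sqrt_iter X n**R" by blast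
 then have "R**(sqrt_iter X n**sqrt_iter X n) = (sqrt_iter X n**sqrt_iter X n)**R"
  by (metis opm_assoc)
 with Suc.prems show ?case by (simp add: op_simps)
qed (simp add: op_simps)

lemma sqrt_iter_dag: "dag X = X ==> dag (sqrt_iter X n) = sqrt_iter X n"
 by (induction n) (simp_all add: dag_simps)

lemma sqrt_iter_norm: "norm X \<le> 1 ==> norm (sqrt_iter X n) \<le> sqrt_iter_num n"
proof (induction n)
 case (Suc n)
 have "norm (sqrt_iter X n**sqrt_iter X n) <= norm (sqrt_iter X n) * norm (sqrt_iter X n)"
  by (rule norm_comp_le)
 also have "... <= sqrt_iter_num n * sqrt_iter_num n"
  using Suc sqrt_iter_num by (intro mult_mono) auto
 finally have "norm (X + sqrt_iter X n**sqrt_iter X n) <= 1 + (sqrt_iter_num n)\<^sup>2"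
  using norm_triangle_ineq[of X "sqrt_iter X n**sqrt_iter X n"] Suc.prems
  by (simp add: power2_eq_square)
 then show ?case by simp
qed simp

lemma sqrt_iter_diff:
 assumes "norm X \<le> 1"
 shows "norm (sqrt_iter X (Suc n) - sqrt_iter X n) \<le> sqrt_iter_num (Suc n) - sqrt_iter_num n"
proof (induction n)
 case 0
 then show ?case using assms by simp
next
 case (Suc n)
 let ?Y = "sqrt_iter X n" and ?Y' = "sqrt_iter X (Suc n)"
 let ?y = "sqrt_iter_num n" and ?y' = "sqrt_iter_num (Suc n)"
 have comm: "?Y**?Y' = ?Y'**?Y" by (rule sqrt_iter_commute, rule sqrt_iter_commute[symmetric]) simp
 have "sqrt_iter X (Suc (Suc n)) - ?Y' = (1/2) *\<^sub>R (?Y'**?Y' - ?Y**?Y)"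
  by (simp only: sqrt_iter.simps(2)[of X "Suc n"]) (simp add: algebra_simps)
 also have "?Y'**?Y' - ?Y**?Y = (?Y' - ?Y)**(?Y' + ?Y)"
  unfolding opm.diff_left opm.add_right using comm by simp
 finally have eq: "sqrt_iter X (Suc (Suc n)) - ?Y' = (1/2) *\<^sub>R ((?Y' - ?Y)**(?Y' + ?Y))" .
 have "norm ((?Y' - ?Y)**(?Y' + ?Y)) <= norm (?Y' - ?Y) * norm (?Y' + ?Y)" by (rule norm_comp_le)
 also have "... <= (?y' - ?y) * (?y' + ?y)"
 proof (rule mult_mono)
  show "norm (?Y' + ?Y) <= ?y' + ?y"
   using norm_triangle_ineq[of ?Y' ?Y] sqrt_iter_norm[OF assms, of n] sqrt_iter_norm[OF assms, of "Suc n"]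
   by linarith
  show "0 <= ?y' - ?y" using sqrt_iter_num[of n] by simp
 qed (use Suc in auto)
 also have "... = ?y'\<^sup>2 - ?y\<^sup>2" by (simp only: power2_eq_square algebra_simps)
 finally have "norm (sqrt_iter X (Suc (Suc n)) - ?Y') <= (1/2) * (?y'\<^sup>2 - ?y\<^sup>2)"
  unfolding eq by (simp only: norm_scaleR) simp
 moreover have "sqrt_iter_num (Suc (Suc n)) - ?y' = (1/2) * (?y'\<^sup>2 - ?y\<^sup>2)"
  by (simp only: sqrt_iter_num.simps(2)[of "Suc n"]) (simp add: field_simps)
 ultimately show ?case by linarith
qed

lemma sqrt_of_contraction:
 fixes X :: "'a::complex_hilbert \<Rightarrow>\<^sub>L 'a"
 assumes "dag X = X" "norm X \<le> 1"
 shows "\<exists>S. pos S \<and> S**S = \<one> - X \<and> (\<forall>R. R**X = X**R --> R**S = S**R)"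
proof -
 have diff: "norm (sqrt_iter X (n + k) - sqrt_iter X n) <= sqrt_iter_num (n + k) - sqrt_iter_num n" for n k
 proof (induction k)
  case (Suc k)
  have "norm (sqrt_iter X (n + Suc k) - sqrt_iter X n)
    <= norm (sqrt_iter X (Suc (n + k)) - sqrt_iter X (n + k)) + norm (sqrt_iter X (n + k) - sqrt_iter X n)"
   using norm_triangle_ineq[of "sqrt_iter X (Suc (n + k)) - sqrt_iter X (n + k)"
     "sqrt_iter X (n + k) - sqrt_iter X n"] by (simp del: sqrt_iter.simps)
  then show ?case using Suc sqrt_iter_diff[OF assms(2), of "n + k"] by simp
 qed simp
 have "convergent sqrt_iter_num"
 proof (rule Bseq_mono_convergent)
  show "Bseq sqrt_iter_num" by (rule BseqI'[where K = 1]) (use sqrt_iter_num in auto)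
  have "incseq sqrt_iter_num" by (rule incseq_SucI) (use sqrt_iter_num in blast)
  then show "ALL m. ALL n>=m. sqrt_iter_num m <= sqrt_iter_num n" by (auto dest: incseqD)
 qed
 then have "Cauchy sqrt_iter_num" by (rule convergent_Cauchy)
 have "Cauchy (sqrt_iter X)"
 proof (rule CauchyI')
  fix e :: real assume "e > 0"
  then obtain N where N: "!!m n. m >= N ==> n >= N ==> \<bar>sqrt_iter_num m - sqrt_iter_num n\<bar> < e"
   using CauchyD[OF `Cauchy sqrt_iter_num` `e > 0`] by auto
  have "dist (sqrt_iter X m) (sqrt_iter X n) < e" if "m >= N" "n > m" for m n
   using diff[of m "n - m"] N[of n m] that
   by (simp add: dist_norm norm_minus_commute[of "sqrt_iter X m"])
  then show "EX M. ALL m>=M. ALL n>m. dist (sqrt_iter X m) (sqrt_iter X n) < e" by blast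
 qed
 then obtain Y where Y: "sqrt_iter X \<longlonglongrightarrow> Y" using Cauchy_convergent convergent_def by blast
 have "(%n. sqrt_iter X (Suc n)) \<longlonglongrightarrow> (1/2) *\<^sub>R (X + Y**Y)"
  unfolding sqrt_iter.simps by (intro tendsto_intros opm.tendsto Y)
 then have Yeq: "Y = (1/2) *\<^sub>R (X + Y**Y)"
  using LIMSEQ_unique[OF LIMSEQ_Suc[OF Y]] by blast
 have "2 *\<^sub>R Y = 2 *\<^sub>R ((1/2) *\<^sub>R (X + Y**Y))" using Yeq by (rule arg_cong)
 then have YY: "2 *\<^sub>R Y = X + Y**Y" by simp
 have normY: "norm Y <= 1"
  by (rule LIMSEQ_le_const2[OF tendsto_norm[OF Y]])
   (use order_trans[OF sqrt_iter_norm[OF assms(2)]] sqrt_iter_num in blast)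
 have Ycomm: "R**Y = Y**R" if "R**X = X**R" for R
 proof (rule LIMSEQ_unique)
  show "(%n. R**sqrt_iter X n) \<longlonglongrightarrow> R**Y" by (intro opm.tendsto tendsto_const Y)
  show "(%n. R**sqrt_iter X n) \<longlonglongrightarrow> Y**R"
   unfolding sqrt_iter_commute[OF that] by (intro opm.tendsto tendsto_const Y)
 qed
 have dagY: "dag Y = Y"
 proof (rule dag_unique, rule LIMSEQ_unique)
  fix x y
  show "(%n. rin (sqrt_iter X n x) y) \<longlonglongrightarrow> rin (Y x) y" by (intro tendsto_intros Y)
  have "(%n. rin x (sqrt_iter X n y)) \<longlonglongrightarrow> rin x (Y y)" by (intro tendsto_intros Y)
  then show "(%n. rin (sqrt_iter X n x) y) \<longlonglongrightarrow> rin x (Y y)"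
   by (simp add: rin_dag[of "sqrt_iter X _"] sqrt_iter_dag[OF assms(1)])
 qed
 have "pos (\<one> - Y)" using op_le_norm(1)[OF dagY normY] by simp
 moreover have "(\<one> - Y)**(\<one> - Y) = \<one> - X"
  using YY by (simp add: op_simps scaleR_2 algebra_simps)
 moreover have "R**(\<one> - Y) = (\<one> - Y)**R" if "R**X = X**R" for R
  using Ycomm[OF that] by (simp add: op_simps)
 ultimately show ?thesis by blast
qed

lemma sqrt_exists:
 assumes "pos T"
 obtains S where "pos S" "S**S = T" "\<And>R. R**T = T**R ==> R**S = S**R"
proof -
 define c where "c = norm T + 1"
 have c: "c > 0" by (simp add: c_def add_nonneg_pos)
 define X where "X = \<one> - (1/c) *\<^sub>R T"
 have dagX: "dag X = X" unfolding X_def by (simp add: dag_simps pos_dag[OF assms])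
 have "T \<preceq> c *\<^sub>R \<one>" by (rule op_le_norm) (auto simp: pos_dag[OF assms] c_def)
 from pos_scaleR[OF this, of "1/c"] c have "(1/c) *\<^sub>R T \<preceq> \<one>"
  by (simp add: scaleR_diff_right)
 then have "pos (\<one> + (\<one> - (1/c) *\<^sub>R T))" "pos ((1/c) *\<^sub>R T)"
  using assms c by (auto intro!: pos_add pos_scaleR)
 then have "norm X <= 1"
  by (intro norm_op_le) (auto simp: X_def dag_simps pos_dag[OF assms] algebra_simps)
 from sqrt_of_contraction[OF dagX this] obtain S where S: "pos S" "S**S = \<one> - X"
  "!!R. R**X = X**R ==> R**S = S**R" by blast
 have "pos (sqrt c *\<^sub>R S)" using S(1) c by (intro pos_scaleR) auto
 moreover have "(sqrt c *\<^sub>R S)**(sqrt c *\<^sub>R S) = T"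
  using S(2) c by (simp add: op_simps X_def)
 moreover have "R**(sqrt c *\<^sub>R S) = (sqrt c *\<^sub>R S)**R" if "R**T = T**R" for R
  using S(3)[of R] that unfolding X_def by (simp add: op_simps)
 ultimately show ?thesis by (rule that)
qed

lemma sqrt_unique:
 assumes "pos A" "pos B" "A**A = B**B"
 shows "A = B"
proof -
 obtain S where S: "pos S" "S**S = A**A" "!!R. R**(A**A) = (A**A)**R ==> R**S = S**R"
  by (rule sqrt_exists[OF pos_square[OF pos_dag[OF assms(1)]]], rule that)
 have "C = S" if C: "pos C" "C**C = A**A" for C
 proof -
  have comm: "C**S = S**C" by (rule S(3)) (simp add: C(2)[symmetric] opm_assoc)
  define D where "D = C - S"
  have dagD: "dag D = D" unfolding D_def using C S(1) by (simp add: dag_simps pos_dag)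
  have 0: "D**C + D**S = 0" unfolding D_def using comm C(2) S(2) by (simp add: op_simps)
  have 1: "pos (D**C**D)" "pos (D**S**D)"
   using pos_conj[OF C(1), of D] pos_conj[OF S(1), of D] dagD by simp_all
  have 2: "D**C**D + D**S**D = 0"
   unfolding opm.add_left[symmetric] 0 by (simp add: op_simps)
  have 3: "D**C**D = 0" "D**S**D = 0"
   using pos_sum_zero[OF 1 2] 2 by auto
  then have "D**D**D = 0"
   unfolding D_def by (metis (no_types, lifting) diff_self opm.diff_left opm.diff_right)
  then have "(D**D)**(D**D) = 0" by (simp add: opm_assoc[symmetric] op_simps(10))
  then have "D**D = 0" using dag_mult_zero[of "D**D"] dagD by (simp add: dag_simps)
  then have "D = 0" using dag_mult_zero[of D] dagD by simp
  then show ?thesis by (simp add: D_def)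
 qed
 then show ?thesis using assms by metis
qed

definition oabs :: "('a::complex_hilbert \<Rightarrow>\<^sub>L 'a) => ('a \<Rightarrow>\<^sub>L 'a)" where
 "oabs T = (THE S. pos S \<and> S**S = dag T**T)"

lemma oabs:
 shows oabs_pos: "pos (oabs T)" and oabs_square: "oabs T**oabs T = dag T**T"
  and oabs_commute: "\<And>R. R**(dag T**T) = (dag T**T)**R ==> R**oabs T = oabs T**R"
proof -
 obtain S where S: "pos S" "S**S = dag T**T"
   "!!R. R**(dag T**T) = (dag T**T)**R ==> R**S = S**R"
  by (rule sqrt_exists[OF pos_dag_mult[of T]], rule that)
 have "oabs T = S" unfolding oabs_def
  by (rule the_equality) (simp_all add: S(1,2) sqrt_unique)
 show "pos (oabs T)" "oabs T**oabs T = dag T**T"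
  "!!R. R**(dag T**T) = (dag T**T)**R ==> R**oabs T = oabs T**R"
  unfolding `oabs T = S` by (fact S)+
qed

lemma oabs_eqI: "pos S ==> S**S = dag T**T ==> oabs T = S"
 by (rule sqrt_unique) (auto simp: oabs_pos oabs_square)

lemma norm_oabs_apply: "norm (oabs T x) = norm (T x)"
proof -
 have "(norm (oabs T x))\<^sup>2 = (norm (T x))\<^sup>2"
  unfolding norm_op_sq pos_dag[OF oabs_pos] oabs_square ..
 then show ?thesis by simp
qed

lemma norm_oabs: "norm (oabs T) = norm T"
proof (rule antisym)
 show "norm (oabs T) <= norm T"
  by (rule norm_blinfun_bound) (simp_all add: norm_oabs_apply norm_blinfun)
 show "norm T <= norm (oabs T)"
  by (rule norm_blinfun_bound) (simp, metis norm_oabs_apply norm_blinfun)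
qed

lemma pos_mult:
 assumes "pos A" "pos B" "A**B = B**A"
 shows "pos (A**B)"
proof -
 obtain S where S: "pos S" "S**S = A" "!!R. R**A = A**R ==> R**S = S**R"
  by (rule sqrt_exists[OF assms(1)], rule that)
 have "A**B = S**(S**B)" using S(2) by (simp add: opm_assoc[symmetric])
 also have "... = dag S**B**S" using S(3)[of B] assms(3) pos_dag[OF S(1)] by (simp add: opm_assoc)
 finally show ?thesis using pos_conj[OF assms(2)] by simp
qed

section \<open>Projections\<close>

definition is_proj :: "('a::complex_hilbert \<Rightarrow>\<^sub>L 'a) => bool" where
 "is_proj p \<longleftrightarrow> p**p = p \<and> dag p = p"

lemma is_projD: "is_proj p ==> p**p = p" "is_proj p ==> dag p = p"
 by (auto simp: is_proj_def)

lemma is_proj_absorb: "is_proj p ==> p**(p**T) = p**T"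
 by (simp add: opm_assoc[symmetric] is_projD)

lemma is_proj_pos: "is_proj p ==> pos p"
 using pos_dag_mult[of p] by (simp add: is_projD)

lemma is_proj_compl: "is_proj p ==> is_proj (\<one> - p)"
 by (simp add: is_proj_def dag_simps op_simps)

lemma is_proj_le_one: "is_proj p ==> p \<preceq> \<one>"
 by (rule is_proj_pos) (rule is_proj_compl)

lemma is_proj_norm_apply: "is_proj p ==> (norm (p x))\<^sup>2 = rin (p x) x"
 by (simp add: norm_op_sq is_projD)

lemma is_proj_pyth: "is_proj p ==> (norm x)\<^sup>2 = (norm (p x))\<^sup>2 + (norm (x - p x))\<^sup>2"
 using is_proj_norm_apply[of p x] by (simp add: norm_diff_rin rin_commute)

lemma is_proj_contr: "is_proj p ==> norm (p x) \<le> norm x"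
proof -
 assume "is_proj p"
 from is_proj_pyth[OF this, of x] have "(norm (p x))\<^sup>2 <= (norm x)\<^sup>2" by simp
 then show ?thesis by (simp add: power2_le_iff_abs_le)
qed

lemma is_proj_norm: "is_proj p ==> norm p \<le> 1"
 by (rule norm_blinfun_bound) (use is_proj_contr in auto)

lemma is_proj_mult:
 assumes "is_proj p" "is_proj q" "p**q = q**p"
 shows "is_proj (p**q)"
 using assms unfolding is_proj_def by (metis dag_comp opm_assoc)

lemma is_proj_proj_on:
 fixes K :: "'a::complex_hilbert set"
 assumes K: "subspace K" "closed K"
 shows "is_proj (proj_on K)"
proof -
 have "rin (proj_on K x) y = rin x (proj_on K y)" for x y
  using proj_on_orth[OF K proj_on_in[OF K, of y], of x] proj_on_orth[OF K proj_on_in[OF K, of x], of y]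
  by (simp add: rin_simps rin_commute[of y] rin_commute[of "proj_on K y"])
 then have "dag (proj_on K) = proj_on K" by (rule dag_unique)
 moreover have "proj_on K**proj_on K = proj_on K"
  by (rule blinfun_eqI) (simp add: proj_on_fix[OF K proj_on_in[OF K]])
 ultimately show ?thesis by (simp add: is_proj_def)
qed

lemma proj_on_commute:
 fixes K :: "'a::complex_hilbert set" and R :: "'a \<Rightarrow>\<^sub>L 'a"
 assumes K: "subspace K" "closed K"
  and inv: "\<And>k. k \<in> K ==> R k \<in> K" "\<And>k. k \<in> K ==> dag R k \<in> K"
 shows "R**proj_on K = proj_on K**R"
proof (rule blinfun_eqI)
 fix x
 have "proj_on K (R x) = R (proj_on K x)"
 proof (rule proj_on_eqI[OF K])
  show "R (proj_on K x) : K" by (intro inv proj_on_in K)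
  fix h assume "h : K"
  then have "rin (x - proj_on K x) (dag R h) = 0" by (intro proj_on_orth[OF K] inv)
  then show "rin (R x - R (proj_on K x)) h = 0"
   by (simp add: rin_dag[symmetric] blinfun.diff_right)
 qed
 then show "(R**proj_on K) x = (proj_on K**R) x" by simp
qed

lemma subspace_closure_of_subspace:
 fixes K :: "'b::real_normed_vector set"
 assumes "subspace K"
 shows "subspace (closure K)"
proof -
 have "0 : closure K" using assms closure_subset subspace_0 by blast
 moreover have "x + y : closure K" if xy: "x : closure K" "y : closure K" for x y
 proof -
  obtain f g where "!!n. f n : K" "f \<longlonglongrightarrow> x" "!!n. g n : K" "g \<longlonglongrightarrow> y"
   using xy unfolding closure_sequential by blast
  then show ?thesis unfolding closure_sequential
   by (intro exI[of _ "%n. f n + g n"]) (simp add: assms subspace_add tendsto_add)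
 qed
 moreover have "c *\<^sub>R x : closure K" if x: "x : closure K" for c x
 proof -
  obtain f where "!!n. f n : K" "f \<longlonglongrightarrow> x" using x unfolding closure_sequential by blast
  then show ?thesis unfolding closure_sequential
   by (intro exI[of _ "%n. c *\<^sub>R f n"]) (simp add: assms subspace_scale tendsto_scaleR)
 qed
 ultimately show ?thesis by (simp add: subspace_def)
qed

lemma blinfun_closure_invariant:
 fixes R :: "'b::real_normed_vector \<Rightarrow>\<^sub>L 'b"
 assumes "R ` A \<subseteq> A" "k \<in> closure A"
 shows "R k \<in> closure A"
proof -
 have "R ` closure A <= closure A"
  by (rule image_closure_subset) (use assms(1) closure_subset in "auto intro: continuous_intros")
 then show ?thesis using assms(2) by blast
qed

lemma closure_span_invariant:
 fixes R :: "'b::real_normed_vector \<Rightarrow>\<^sub>L 'b"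
 assumes "\<And>g. g \<in> G ==> R g \<in> G" "k \<in> closure (span G)"
 shows "R k \<in> closure (span G)"
proof (rule blinfun_closure_invariant[OF _ assms(2)])
 have "span (R ` G) = R ` span G"
  by (rule linear_span_image) (simp add: linear_iff blinfun.add_right blinfun.scaleR_right)
 moreover have "span (R ` G) <= span G" by (rule span_mono) (use assms(1) in blast)
 ultimately show "R ` span G <= span G" by simp
qed

text \<open>The spectral projection of a self-adjoint operator for the positive half-line, with the
 polar decomposition \<open>S = |S| (2 q - 1)\<close>. It is the projection onto the closed range of \<open>S + |S|\<close>.\<close>

lemma spectral_projection:
 fixes S :: "'a::complex_hilbert \<Rightarrow>\<^sub>L 'a"
 assumes S: "dag S = S"
 obtains q where "is_proj q" "\<And>R. R**S = S**R ==> R**q = q**R" "pos (q**S)" "pos (- ((\<one> - q)**S))"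
  "S = oabs S**(q - (\<one> - q))" "oabs S = S**(q - (\<one> - q))"
proof -
 define A where "A = oabs S"
 have A: "pos A" "A**A = S**S" unfolding A_def using oabs_pos oabs_square[of S] S by simp_all
 have AS: "A**S = S**A"
  unfolding A_def by (rule oabs_commute[symmetric]) (simp add: S opm_assoc)
 have Acomm: "R**A = A**R" if "R**S = S**R" for R
  unfolding A_def by (rule oabs_commute) (simp add: S, metis opm_assoc that)
 define P where "P = S + A"
 define N where "N = A - S"
 have dagPN: "dag P = P" "dag N = N" unfolding P_def N_def using S A(1) by (simp_all add: dag_simps pos_dag)
 have NP: "N**P = 0" unfolding P_def N_def using AS A(2) by (simp add: op_simps)
 define K where "K = closure (range P)"
 have K: "subspace K" "closed K"
  unfolding K_def
  by (auto intro!: subspace_closure_of_subspace linear_subspace_image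
    simp: linear_iff blinfun.add_right blinfun.scaleR_right)
 define q where "q = proj_on K"
 have q: "is_proj q" unfolding q_def by (rule is_proj_proj_on[OF K])
 have inv: "R k : K" if "R**P = P**R" "k : K" for R :: "'a \<Rightarrow>\<^sub>L 'a" and k
 proof -
  have "R (P x) : range P" for x
   using that(1) by (metis op_apply_assoc rangeI)
  then show ?thesis
   using blinfun_closure_invariant[of R "range P"] that(2) unfolding K_def by blast
 qed
 have qcomm: "R**q = q**R" if "R**S = S**R" for R
 proof -
  have 1: "R**P = P**R" unfolding P_def using that Acomm[OF that] by (simp add: op_simps)
  have "dag (P**R) = dag (R**P)" using 1 by simp
  then have "dag R**P = P**dag R" by (simp add: dag_simps dagPN)
  then show ?thesis unfolding q_def using 1 by (intro proj_on_commute[OF K] inv)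
 qed
 have qP: "q**P = P"
  by (rule blinfun_eqI)
   (use proj_on_fix[OF K] in "auto simp: q_def K_def intro: subsetD[OF closure_subset]")
 have Nker: "N k = 0" if "k : K" for k
 proof -
  have "closed {k. N k = 0}" by (intro closed_Collect_eq continuous_intros)
  moreover have "range P <= {k. N k = 0}"
  proof clarify
   fix x show "N (P x) = 0" using NP by (metis op_apply_assoc blinfun.zero_left)
  qed
  ultimately show ?thesis using that closure_minimal unfolding K_def by blast
 qed
 have Nq: "N**q = 0"
  by (rule blinfun_eqI) (simp add: q_def Nker proj_on_in[OF K])
 then have "dag (N**q) = 0" by simp
 then have qN: "q**N = 0" by (simp only: dag_comp dagPN is_projD[OF q])
 have qA: "q**A = q**S" using qN by (simp add: N_def op_simps)
 have qAS: "S + A = q**S + q**A" using qP by (simp add: P_def op_simps)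
 have 1: "A**(q - (\<one> - q)) = S"
 proof -
  have "A**q = q**A" using Acomm[OF qcomm[symmetric, of S]] qcomm[of A] AS by simp
  then show ?thesis using qA qAS by (simp add: op_simps algebra_simps)
 qed
 have 2: "S**(q - (\<one> - q)) = A"
  using qcomm[of S] qA qAS by (simp add: op_simps algebra_simps)
 have "q**S = q**A**q" using qA qcomm[of A] AS q by (metis is_projD(1) opm_assoc)
 then have 3: "pos (q**S)" using pos_conj[OF A(1), of q] q by (simp add: is_projD)
 have "- ((\<one> - q)**S) = (\<one> - q)**A"
  using qA qAS by (simp add: op_simps algebra_simps)
 also have "... = (\<one> - q)**A**(\<one> - q)"
  using qcomm[of A] AS q by (simp add: op_simps is_projD is_proj_absorb)
 finally have 4: "pos (- ((\<one> - q)**S))"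
  using pos_conj[OF A(1), of "\<one> - q"] q by (simp add: is_projD dag_simps)
 show ?thesis
  by (rule that[OF q qcomm 3 4]) (simp_all add: 1 2 A_def[symmetric])
qed

section \<open>Strong limits\<close>

lemma tendsto_of_Cauchy_filter:
 fixes f :: "'i => 'b::banach"
 assumes "F \<noteq> bot" "\<And>e. e > 0 ==> \<exists>P. eventually P F \<and> (\<forall>i j. P i \<and> P j --> dist (f i) (f j) < e)"
 shows "\<exists>l. (f \<longlongrightarrow> l) F"
proof -
 have "cauchy_filter (filtermap f F)"
  using assms(2) by (simp add: cauchy_filter_metric_filtermap)
 moreover have "complete (UNIV :: 'b set)"
  by (meson Cauchy_convergent UNIV_I complete_def convergent_def)
 ultimately obtain l where "filtermap f F <= nhds l"
  using cauchy_filter_complete_converges[of "filtermap f F" UNIV] assms(1)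
  by (auto simp: filtermap_bot_iff)
 then show ?thesis by (auto simp: filterlim_def)
qed

lemma pointwise_limit_op:
 fixes T :: "'i => 'a::real_normed_vector \<Rightarrow>\<^sub>L 'b::real_normed_vector"
 assumes "F \<noteq> bot" "\<And>h. ((%i. T i h) \<longlongrightarrow> f h) F" "eventually (%i. norm (T i) \<le> C) F"
 obtains L where "\<And>h. blinfun_apply L h = f h" "norm L \<le> C"
proof -
 have C: "0 <= C"
  using eventually_happens'[OF assms(1,3)] norm_ge_zero order_trans by blast
 have le: "norm (f h) <= C * norm h" for h
 proof (rule tendsto_upperbound[OF tendsto_norm[OF assms(2)] _ assms(1)])
  show "\<forall>\<^sub>F i in F. norm (T i h) <= C * norm h"
   using assms(3)
   by eventually_elim (meson mult_right_mono norm_blinfun norm_ge_zero order_trans)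
 qed
 have "bounded_linear f"
 proof (rule bounded_linear_intro[where K = C])
  fix x y :: 'a and r :: real
  show "f (x + y) = f x + f y"
   using tendsto_unique[OF assms(1) assms(2)[of "x + y"]] tendsto_add[OF assms(2)[of x] assms(2)[of y]]
   by (simp add: blinfun.add_right)
  show "f (r *\<^sub>R x) = r *\<^sub>R f x"
   using tendsto_unique[OF assms(1) assms(2)[of "r *\<^sub>R x"]]
    tendsto_scaleR[OF tendsto_const assms(2)[of x], of r]
   by (simp add: blinfun.scaleR_right)
 qed (use le in "simp add: mult.commute")
 then have eq: "blinfun_apply (Blinfun f) = f" by (rule bounded_linear_Blinfun_apply)
 show ?thesis
  by (rule that[of "Blinfun f"]) (auto simp: eq intro!: norm_blinfun_bound C le)
qed

lemma selfadj_limit: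
 fixes T :: "'i => 'a::complex_hilbert \<Rightarrow>\<^sub>L 'a" and L :: "'a \<Rightarrow>\<^sub>L 'a"
 assumes "F \<noteq> bot" "\<And>x. ((%i. T i x) \<longlongrightarrow> L x) F" "eventually (%i. dag (T i) = T i) F"
 shows "dag L = L"
proof (rule dag_unique)
 fix x y
 have 1: "((%i. rin (T i x) y) \<longlongrightarrow> rin (L x) y) F" by (intro tendsto_intros assms)
 have "((%i. rin x (T i y)) \<longlongrightarrow> rin x (L y)) F" by (intro tendsto_intros assms)
 moreover have "eventually (%i. rin x (T i y) = rin (T i x) y) F"
  using assms(3) by eventually_elim (metis rin_dag)
 ultimately have "((%i. rin (T i x) y) \<longlongrightarrow> rin x (L y)) F"
  by (rule Lim_transform_eventually)
 then show "rin (L x) y = rin x (L y)" using 1 tendsto_unique[OF assms(1)] by blast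
qed

lemma pos_limit:
 fixes T :: "'i => 'a::complex_hilbert \<Rightarrow>\<^sub>L 'a" and L :: "'a \<Rightarrow>\<^sub>L 'a"
 assumes "F \<noteq> bot" "\<And>x. ((%i. T i x) \<longlongrightarrow> L x) F" "eventually (%i. pos (T i)) F"
 shows "pos L"
 unfolding pos_def
proof
 show "dag L = L" using assms(3)
  by (intro selfadj_limit[OF assms(1,2)]) (auto elim: eventually_mono simp: pos_def)
 show "ALL x. 0 <= rin (L x) x"
 proof
  fix x
  have "((%i. rin (T i x) x) \<longlongrightarrow> rin (L x) x) F" by (intro tendsto_intros assms)
  then show "0 <= rin (L x) x"
  proof (rule tendsto_lowerbound[OF _ _ assms(1)])
   show "eventually (%i. 0 <= rin (T i x) x) F"
    using assms(3) by eventually_elim (rule pos_ge)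
  qed
 qed
qed

lemma net_filter_nontrivial: "directed_index I r ==> net_filter I r \<noteq> bot"
proof
 assume dir: "directed_index I r" and "net_filter I r = bot"
 then have "eventually (%_. False) (net_filter I r)" by simp
 then obtain i where "i : I" "ALL j:I. ~ r i j"
  using eventually_net_filter[OF dir, of "%_. False"] by auto
 then show False using directed_indexD(2)[OF dir, of i] by simp
qed

lemma eventually_net_ge: "directed_index I r ==> i \<in> I ==> eventually (%j. j \<in> I \<and> r i j) (net_filter I r)"
proof -
 assume dir: "directed_index I r" and i: "i : I"
 have "eventually (%j. j : I & r i j) (principal {j : I. r i j})" by (simp add: eventually_principal)
 moreover have "net_filter I r <= principal {j : I. r i j}"
  unfolding net_filter_def by (rule INF_lower[OF i])
 ultimately show ?thesis by (rule filter_leD[rotated])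
qed

lemma net_filter_nat: "net_filter (UNIV :: nat set) (\<le>) = sequentially"
 by (simp add: net_filter_def at_top_def atLeast_def)

lemma directed_nat: "directed_index (UNIV :: nat set) (\<le>)"
 unfolding directed_index_def by (auto, metis nat_le_linear order_refl)

text \<open>A decreasing net of self-adjoint operators that is bounded below converges strongly: the forms
 converge, and \<open>\<parallel>P \<xi>\<parallel>\<^sup>2 \<le> c \<langle>P \<xi>, \<xi>\<rangle>\<close> for \<open>0 \<le> P \<le> c\<close> makes the vectors Cauchy.\<close>

theorem decreasing_net_converges:
 fixes T :: "'i => 'a::complex_hilbert \<Rightarrow>\<^sub>L 'a"
 assumes dir: "directed_index I r" and sa: "\<And>i. i \<in> I ==> dag (T i) = T i"
  and decr: "\<And>i j. i \<in> I ==> j \<in> I ==> r i j ==> T j \<preceq> T i"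
  and bdd: "\<And>i. i \<in> I ==> B \<preceq> T i"
 obtains L :: "'a \<Rightarrow>\<^sub>L 'a" where "\<And>x. ((%i. T i x) \<longlongrightarrow> L x) (net_filter I r)" "dag L = L"
  "\<And>i. i \<in> I ==> L \<preceq> T i" "\<And>C. (\<And>i. i \<in> I ==> C \<preceq> T i) ==> C \<preceq> L"
proof -
 let ?F = "net_filter I r"
 have nt: "?F ~= bot" by (rule net_filter_nontrivial[OF dir])
 obtain i0 where i0: "i0 : I" using directed_indexD(1)[OF dir] by blast
 have dagB: "dag B = B"
  using pos_dag[OF bdd[OF i0]] sa[OF i0] by (simp add: dag_simps)
 define c where "c = norm (T i0 - B)"
 have tr: "r i k" if "r i j" "r j k" "i : I" "j : I" "k : I" for i j k
  using directed_indexD(3)[OF dir] that by blast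
 have diff: "T i - T j \<preceq> c *\<^sub>R \<one>" if "i : I" "j : I" "r i0 i" for i j
 proof -
  have "T i0 - B \<preceq> c *\<^sub>R \<one>"
   by (rule op_le_norm) (simp_all add: dag_simps sa[OF i0] dagB c_def)
  moreover have "T i - T j \<preceq> T i0 - B"
   using pos_add[OF decr[OF i0 that(1,3)] bdd[OF that(2)]] by (simp add: algebra_simps)
  ultimately show ?thesis by (rule op_le_trans[rotated])
 qed
 have est: "(norm (T i x - T j x))\<^sup>2 <= c * (rin (T i x) x - rin (T j x) x)"
  if "i : I" "j : I" "r i0 i" "r i j" for i j x
 proof -
  have "(norm ((T i - T j) x))\<^sup>2 <= c * rin ((T i - T j) x) x"
   using op_leD[OF diff[OF that(1-3)]]
   by (intro pos_norm_le decr that) (simp add: blinfun.scaleR_left rin_simps rin_self)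
  then show ?thesis by (simp add: blinfun.diff_left rin_simps)
 qed
 have "EX l. ((%i. T i x) \<longlongrightarrow> l) ?F" for x
 proof (rule tendsto_of_Cauchy_filter[OF nt])
  fix e :: real assume e: "e > 0"
  define m where "m = (INF i\<in>I. rin (T i x) x)"
  have bb: "bdd_below ((%i. rin (T i x) x) ` I)"
   using op_leD[OF bdd] by (intro bdd_belowI2)
  define d where "d = (e/2)\<^sup>2 / (c + 1)"
  have c0: "0 <= c" by (simp add: c_def)
  have d: "d > 0" unfolding d_def using e c0 by simp
  have cd: "c * d < (e/2)\<^sup>2"
  proof -
   have "c * d < (c + 1) * d" using d by simp
   also have "... = (e/2)\<^sup>2" unfolding d_def using c0 by simp
   finally show ?thesis .
  qed
  have "EX i:I. rin (T i x) x < m + d"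
   using d bb i0 cINF_less_iff[of I "%i. rin (T i x) x" "m + d"] unfolding m_def by auto
  then obtain i1 where i1: "i1 : I" "rin (T i1 x) x < m + d" by blast
  obtain k where k: "k : I" "r i0 k" "r i1 k" using directed_indexD(4)[OF dir i0 i1(1)] by blast
  have close: "norm (T k x - T j x) < e / 2" if j: "j : I" "r k j" for j
  proof -
   have "rin (T k x) x < m + d" using op_leD[OF decr[OF i1(1) k(1,3)], of x] i1(2) by simp
   moreover have "m <= rin (T j x) x" unfolding m_def by (rule cINF_lower[OF bb j(1)])
   ultimately have "c * (rin (T k x) x - rin (T j x) x) <= c * d"
    using c0 by (intro mult_left_mono) auto
   then have "(norm (T k x - T j x))\<^sup>2 < (e/2)\<^sup>2"
    using est[OF k(1) j(1) k(2) j(2), of x] cd by linarith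
   then show ?thesis by (rule power2_less_imp_less) (use e in simp)
  qed
  show "EX P. eventually P ?F & (ALL i j. P i & P j --> dist (T i x) (T j x) < e)"
  proof (intro exI conjI allI impI)
   show "eventually (%j. j : I & r k j) ?F" by (rule eventually_net_ge[OF dir k(1)])
   fix i j assume "(i : I & r k i) & j : I & r k j"
   then have "dist (T k x) (T i x) < e / 2" "dist (T k x) (T j x) < e / 2"
    using close by (auto simp: dist_norm)
   then show "dist (T i x) (T j x) < e"
    using dist_triangle3[of "T i x" "T j x" "T k x"] by simp
  qed
 qed
 then obtain f where f: "!!x. ((%i. T i x) \<longlongrightarrow> f x) ?F" by metis
 have ev: "eventually (%i. norm (T i) <= norm (T i0) + c) ?F"
  using eventually_net_ge[OF dir i0]
 proof eventually_elim
  case (elim i)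
  have "norm (T i0 - T i) <= c"
  proof (rule norm_op_le)
   show "T i0 - T i \<preceq> c *\<^sub>R \<one>" using elim i0 directed_indexD(2)[OF dir] by (intro diff) auto
   have "pos ((T i0 - T i) + c *\<^sub>R \<one>)"
    using elim i0 by (intro pos_add decr pos_scaleR) (auto simp: c_def)
   then show "- (c *\<^sub>R \<one>) \<preceq> T i0 - T i" by simp
  qed (use elim i0 sa in "auto simp: dag_simps c_def")
  then show ?case using norm_triangle_ineq4[of "T i0" "T i0 - T i"] by simp
 qed
 obtain L where Lf: "!!x. blinfun_apply L x = f x" and "norm L <= norm (T i0) + c"
  by (rule pointwise_limit_op[OF nt f ev], rule that)
 have L: "((%i. T i x) \<longlongrightarrow> L x) ?F" for x using f Lf by simp
 have evI: "eventually (%i. i : I) ?F" using eventually_net_ge[OF dir i0] by eventually_elim simp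
 show ?thesis
 proof (rule that[OF L])
  show "dag L = L" by (rule selfadj_limit[OF nt L]) (use evI sa in "auto elim: eventually_mono")
  show "L \<preceq> T i" if "i : I" for i
  proof (rule pos_limit[OF nt])
   show "((%j. (T i - T j) x) \<longlongrightarrow> (T i - L) x) ?F" for x
    unfolding blinfun.diff_left by (intro tendsto_intros L)
   show "eventually (%j. T j \<preceq> T i) ?F"
    using eventually_net_ge[OF dir that] by eventually_elim (use decr that in blast)
  qed
  show "C \<preceq> L" if "!!i. i : I ==> C \<preceq> T i" for C
  proof (rule pos_limit[OF nt])
   show "((%j. (T j - C) x) \<longlongrightarrow> (L - C) x) ?F" for x
    unfolding blinfun.diff_left by (intro tendsto_intros L)
   show "eventually (%j. C \<preceq> T j) ?F" using evI by eventually_elim (rule that)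
  qed
 qed
qed

lemma orthogonal_sum_norm:
 fixes x :: "'i => 'a::complex_hilbert"
 assumes "finite J" "\<And>i j. i \<in> J ==> j \<in> J ==> i \<noteq> j ==> rin (x i) (x j) = 0"
 shows "(norm (\<Sum>i\<in>J. x i))\<^sup>2 = (\<Sum>i\<in>J. (norm (x i))\<^sup>2)"
 using assms
proof (induction J rule: finite_induct)
 case (insert i J)
 have "rin (x i) (\<Sum>j\<in>J. x j) = (\<Sum>j\<in>J. rin (x i) (x j))"
  by (rule bounded_bilinear.sum_right[OF bounded_bilinear_rin])
 also have "... = 0" using insert by (intro sum.neutral) auto
 finally show ?case using insert by (simp add: norm_add_rin)
qed simp

lemma orthogonal_has_sum:
 fixes x :: "'i => 'a::complex_hilbert"
 assumes orth: "\<And>i j. i \<in> I ==> j \<in> I ==> i \<noteq> j ==> rin (x i) (x j) = 0"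
  and bdd: "\<And>J. finite J ==> J \<subseteq> I ==> (\<Sum>i\<in>J. (norm (x i))\<^sup>2) \<le> B"
 shows "\<exists>s. (x has_sum s) I"
proof -
 define S where "S = {J. finite J & J <= I}"
 define g where "g = (%J. \<Sum>i\<in>J. (norm (x i))\<^sup>2)"
 have bb: "bdd_above (g ` S)" using bdd unfolding S_def g_def by (auto intro!: bdd_aboveI2)
 have "EX l. (sum x \<longlongrightarrow> l) (finite_subsets_at_top I)"
 proof (rule tendsto_of_Cauchy_filter)
  fix e :: real assume e: "e > 0"
  define m where "m = (SUP J\<in>S. g J)"
  have "S ~= {}" unfolding S_def by blast
  have "EX J:S. m - (e/2)\<^sup>2 < g J"
   using e bb `S ~= {}` less_cSUP_iff[of S g "m - (e/2)\<^sup>2"] unfolding m_def by auto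
  then obtain J0 where J0: "J0 : S" "m - (e/2)\<^sup>2 < g J0" by blast
  have close: "norm (sum x J - sum x J0) < e / 2" if "J : S" "J0 <= J" for J
  proof -
   have "sum x J - sum x J0 = sum x (J - J0)"
    using that by (subst sum_diff) (auto simp: S_def)
   moreover have "(norm (sum x (J - J0)))\<^sup>2 = g (J - J0)"
    unfolding g_def using that orth by (intro orthogonal_sum_norm) (auto simp: S_def)
   moreover have "g (J - J0) = g J - g J0"
    unfolding g_def using that by (subst sum_diff) (auto simp: S_def)
   ultimately have "(norm (sum x J - sum x J0))\<^sup>2 = g J - g J0" by simp
   moreover have "g J <= m" unfolding m_def by (rule cSUP_upper[OF that(1) bb])
   ultimately have "(norm (sum x J - sum x J0))\<^sup>2 < (e/2)\<^sup>2" using J0(2) by linarith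
   then show ?thesis by (rule power2_less_imp_less) (use e in simp)
  qed
  show "EX P. eventually P (finite_subsets_at_top I) &
    (ALL J J'. P J & P J' --> dist (sum x J) (sum x J') < e)"
  proof (intro exI conjI allI impI)
   show "eventually (%J. J : S & J0 <= J) (finite_subsets_at_top I)"
    using J0(1) unfolding eventually_finite_subsets_at_top S_def by blast
   fix J J' assume "(J : S & J0 <= J) & J' : S & J0 <= J'"
   then have "dist (sum x J) (sum x J0) < e / 2" "dist (sum x J') (sum x J0) < e / 2"
    using close by (auto simp: dist_norm)
   then show "dist (sum x J) (sum x J') < e"
    using dist_triangle2[of "sum x J" "sum x J'" "sum x J0"] by simp
  qed
 qed simp
 then show ?thesis by (simp add: has_sum_def)
qed

lemma is_proj_sum:
 assumes "finite J" "\<And>i. i \<in> J ==> is_proj (p i)" "\<And>i j. i \<in> J ==> j \<in> J ==> i \<noteq> j ==> p i**p j = 0"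
 shows "is_proj (\<Sum>i\<in>J. p i)"
 using assms
proof (induction J rule: finite_induct)
 case (insert i J)
 have "p i**(\<Sum>j\<in>J. p j) = 0" "(\<Sum>j\<in>J. p j)**p i = 0"
  unfolding opm.sum_left opm.sum_right using insert by (auto intro!: sum.neutral)
 with insert show ?case by (simp add: is_proj_def op_simps dag_simps)
qed (simp add: is_proj_def)

lemma orthogonal_projections_Bessel:
 assumes "finite J" "\<And>i. i \<in> J ==> is_proj (p i)" "\<And>i j. i \<in> J ==> j \<in> J ==> i \<noteq> j ==> p i**p j = 0"
 shows "(\<Sum>i\<in>J. (norm (p i x))\<^sup>2) \<le> (norm x)\<^sup>2"
proof -
 have "(\<Sum>i\<in>J. (norm (p i x))\<^sup>2) = (norm (\<Sum>i\<in>J. p i x))\<^sup>2"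
 proof (rule orthogonal_sum_norm[symmetric, OF assms(1)])
  fix i j assume ij: "i : J" "j : J" "i ~= j"
  have "rin (p i x) (p j x) = rin x ((p i**p j) x)"
   using assms(2)[OF ij(1)] by (simp add: rin_dag is_projD)
  then show "rin (p i x) (p j x) = 0" using assms(3)[OF ij] by simp
 qed
 also have "(\<Sum>i\<in>J. p i x) = (\<Sum>i\<in>J. p i) x" by (simp add: blinfun.sum_left)
 also have "(norm ...)\<^sup>2 <= (norm x)\<^sup>2"
  by (intro power_mono is_proj_contr is_proj_sum assms) auto
 finally show ?thesis .
qed

text \<open>A uniformly bounded family of operators with mutually orthogonal initial and mutually orthogonal
 final projections can be summed strongly.\<close>

lemma orthogonal_sum_op:
 fixes T p q :: "'i => 'a::complex_hilbert \<Rightarrow>\<^sub>L 'a"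
 assumes proj: "\<And>i. i \<in> I ==> is_proj (p i)" "\<And>i. i \<in> I ==> is_proj (q i)"
  and orth: "\<And>i j. i \<in> I ==> j \<in> I ==> i \<noteq> j ==> p i**p j = 0"
   "\<And>i j. i \<in> I ==> j \<in> I ==> i \<noteq> j ==> q i**q j = 0"
  and T: "\<And>i. i \<in> I ==> T i**p i = T i" "\<And>i. i \<in> I ==> q i**T i = T i"
  and C: "\<And>i. i \<in> I ==> norm (T i) \<le> C" "0 \<le> C"
 shows "\<exists>L :: 'a \<Rightarrow>\<^sub>L 'a. (\<forall>x. ((%i. T i x) has_sum blinfun_apply L x) I) \<and> norm L \<le> C"
proof -
 have orthT: "rin (T i x) (T j x) = 0" if "i : I" "j : I" "i ~= j" for i j x
 proof -
  have "rin (T i x) (T j x) = rin ((q i**T i) x) ((q j**T j) x)" using T that by simp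
  also have "... = rin (T i x) ((q i**q j) (T j x))"
   using proj(2)[OF that(1)] by (simp add: rin_dag is_projD)
  finally show ?thesis using orth(2)[OF that] by simp
 qed
 have bdd: "(\<Sum>i\<in>J. (norm (T i x))\<^sup>2) <= (C * norm x)\<^sup>2" if J: "finite J" "J <= I" for J x
 proof -
  have "(\<Sum>i\<in>J. (norm (T i x))\<^sup>2) <= (\<Sum>i\<in>J. C\<^sup>2 * (norm (p i x))\<^sup>2)"
  proof (rule sum_mono)
   fix i assume i: "i : J"
   have "norm (T i x) = norm (T i (p i x))" using T(1)[of i] i J by (metis op_apply_assoc subsetD)
   also have "... <= norm (T i) * norm (p i x)" by (rule norm_blinfun)
   also have "... <= C * norm (p i x)" using C i J by (intro mult_right_mono) auto
   finally have "(norm (T i x))\<^sup>2 <= (C * norm (p i x))\<^sup>2" by (intro power_mono) auto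
   then show "(norm (T i x))\<^sup>2 <= C\<^sup>2 * (norm (p i x))\<^sup>2" by (simp add: power_mult_distrib)
  qed
  also have "... = C\<^sup>2 * (\<Sum>i\<in>J. (norm (p i x))\<^sup>2)" by (simp add: sum_distrib_left)
  also have "... <= C\<^sup>2 * (norm x)\<^sup>2"
   using J by (intro mult_left_mono orthogonal_projections_Bessel proj(1) orth(1)) auto
  finally show ?thesis by (simp add: power_mult_distrib)
 qed
 have "EX s. ((%i. T i x) has_sum s) I" for x
  using orthT bdd[of _ x] by (intro orthogonal_has_sum) auto
 then obtain f where f: "!!x. ((%i. T i x) has_sum f x) I" by metis
 have "((%J. (\<Sum>i\<in>J. T i) x) \<longlongrightarrow> f x) (finite_subsets_at_top I)" for x
  using f[of x] by (simp add: has_sum_def blinfun.sum_left)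
 moreover have "eventually (%J. norm (\<Sum>i\<in>J. T i) <= C) (finite_subsets_at_top I)"
 proof (rule eventually_finite_subsets_at_top_weakI)
  fix J assume J: "finite J" "J <= I"
  show "norm (\<Sum>i\<in>J. T i) <= C"
  proof (rule norm_blinfun_bound[OF C(2)])
   fix x
   have "(norm ((\<Sum>i\<in>J. T i) x))\<^sup>2 = (\<Sum>i\<in>J. (norm (T i x))\<^sup>2)"
    unfolding blinfun.sum_left using J by (intro orthogonal_sum_norm orthT) auto
   also have "... <= (C * norm x)\<^sup>2" by (rule bdd[OF J])
   finally show "norm ((\<Sum>i\<in>J. T i) x) <= C * norm x"
    using C(2) by (simp add: power2_le_iff_abs_le)
  qed
 qed
 ultimately obtain L where "!!x. blinfun_apply L x = f x" "norm L <= C"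
  using pointwise_limit_op[of "finite_subsets_at_top I"] by (metis finite_subsets_at_top_neq_bot)
 with f show ?thesis by (intro exI[of _ L]) auto
qed

section \<open>Commutants\<close>

text \<open>A von Neumann algebra is the commutant of a set of bounded real-linear operators that is closed
 under adjoints; complex-linearity is commutation with the complex scalars. This description
 covers the algebra, its center and its commutant at the same time.\<close>

definition comm :: "('a::complex_hilbert \<Rightarrow>\<^sub>L 'a) set => ('a \<Rightarrow>\<^sub>L 'a) set" where
 "comm X = {T. \<forall>S\<in>X. T**S = S**T}"

definition vna :: "('a::complex_hilbert \<Rightarrow>\<^sub>L 'a) set => bool" where
 "vna N \<longleftrightarrow> (\<exists>X. (\<forall>S\<in>X. dag S \<in> X) \<and> N = comm X)"

lemma commI: "(\<And>S. S \<in> X ==> T**S = S**T) ==> T \<in> comm X"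
 by (simp add: comm_def)

lemma commD: "T \<in> comm X ==> S \<in> X ==> T**S = S**T"
 by (simp add: comm_def)

lemma vnaE:
 assumes "vna N"
 obtains X where "\<And>S. S \<in> X ==> dag S \<in> X" "N = comm X"
 using assms by (auto simp: vna_def)

context
 fixes N :: "('a::complex_hilbert \<Rightarrow>\<^sub>L 'a) set"
 assumes N: "vna N"
begin

lemma vna_zero: "0 \<in> N" and vna_one: "\<one> \<in> N"
 by (rule vnaE[OF N], simp add: comm_def op_simps)+

lemma vna_add: "S \<in> N ==> T \<in> N ==> S + T \<in> N"
 and vna_diff: "S \<in> N ==> T \<in> N ==> S - T \<in> N"
 and vna_minus: "S \<in> N ==> - S \<in> N"
 and vna_scaleR: "S \<in> N ==> r *\<^sub>R S \<in> N"
 by (rule vnaE[OF N], simp add: comm_def op_simps)+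

lemma vna_comp:
 assumes "S \<in> N" "T \<in> N"
 shows "S**T \<in> N"
proof -
 obtain X where X: "N = comm X" by (rule vnaE[OF N])
 have "(S**T)**R = R**(S**T)" if "R : X" for R
  using commD[of S X R] commD[of T X R] assms that unfolding X by (metis opm_assoc)
 then show ?thesis unfolding X by (rule commI)
qed

lemma vna_dag:
 assumes "S \<in> N"
 shows "dag S \<in> N"
proof -
 obtain X where X: "!!S. S : X ==> dag S : X" "N = comm X" by (rule vnaE[OF N]) blast
 have "dag S**R = R**dag S" if "R : X" for R
 proof -
  have "dag (S**dag R) = dag (dag R**S)" using commD[of S X "dag R"] assms X that by simp
  then show ?thesis by (simp add: dag_simps)
 qed
 then show ?thesis unfolding X(2) by (rule commI)
qed

lemma vna_sum: "(\<And>i. i \<in> J ==> f i \<in> N) ==> (\<Sum>i\<in>J. f i) \<in> N"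
 by (induction J rule: infinite_finite_induct) (auto intro: vna_zero vna_add)

lemma vna_bicommutant:
 assumes "S \<in> N" "\<And>R. R**S = S**R ==> R**q = q**R"
 shows "q \<in> N"
proof -
 obtain X where X: "N = comm X" by (rule vnaE[OF N])
 show ?thesis unfolding X
 proof (rule commI)
  fix R assume "R : X"
  then have "R**S = S**R" using commD[of S X R] assms(1) X by simp
  then show "q**R = R**q" using assms(2) by simp
 qed
qed

lemma vna_oabs:
 assumes "T \<in> N"
 shows "oabs T \<in> N"
proof (rule vna_bicommutant)
 show "dag T**T : N" by (intro vna_comp vna_dag assms)
qed (rule oabs_commute)

lemma vna_sqrt:
 assumes "T \<in> N" "pos T"
 obtains S where "S \<in> N" "pos S" "S**S = T"
proof -
 obtain S where S: "pos S" "S**S = T" "!!R. R**T = T**R ==> R**S = S**R"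
  by (rule sqrt_exists[OF assms(2)], rule that)
 have "S : N" by (rule vna_bicommutant[OF assms(1) S(3)])
 with S(1,2) show ?thesis using that by blast
qed

lemma vna_spectral_projection:
 assumes "S \<in> N" "dag S = S"
 obtains q where "q \<in> N" "is_proj q" "\<And>R. R**S = S**R ==> R**q = q**R"
  "pos (q**S)" "pos (- ((\<one> - q)**S))"
  "S = oabs S**(q - (\<one> - q))" "oabs S = S**(q - (\<one> - q))"
proof -
 obtain q where q: "is_proj q" "!!R. R**S = S**R ==> R**q = q**R" "pos (q**S)" "pos (- ((\<one> - q)**S))"
  "S = oabs S**(q - (\<one> - q))" "oabs S = S**(q - (\<one> - q))"
  by (rule spectral_projection[OF assms(2)], rule that)
 have "q : N" by (rule vna_bicommutant[OF assms(1) q(2)])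
 from this q show ?thesis by (rule that)
qed

lemma vna_limit:
 assumes "F \<noteq> bot" "eventually (%i. T i \<in> N) F" "\<And>x. ((%i. blinfun_apply (T i) x) \<longlongrightarrow> blinfun_apply L x) F"
 shows "L \<in> N"
proof -
 obtain X where X: "N = comm X" by (rule vnaE[OF N])
 show ?thesis unfolding X
 proof (rule commI, rule blinfun_eqI)
  fix R x assume R: "R : X"
  have "((%i. T i (R x)) \<longlongrightarrow> L (R x)) F" by (rule assms)
  moreover have "((%i. R (T i x)) \<longlongrightarrow> R (L x)) F" by (intro tendsto_intros assms)
  moreover have "eventually (%i. R (T i x) = T i (R x)) F"
   using assms(2)
  proof eventually_elim
   case (elim i)
   then have "T i**R = R**T i" using commD[of "T i" X R] R X by simp
   then show ?case by (metis op_apply_assoc)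
  qed
  moreover have "((%i. T i (R x)) \<longlongrightarrow> R (L x)) F"
   by (rule Lim_transform_eventually) fact+
  ultimately have "L (R x) = R (L x)"
   by (intro tendsto_unique[OF assms(1)])
  then show "(L**R) x = (R**L) x" by simp
 qed
qed

lemma vna_has_sum:
 assumes "\<And>i. i \<in> I ==> T i \<in> N" "\<And>x. ((%i. blinfun_apply (T i) x) has_sum blinfun_apply L x) I"
 shows "L \<in> N"
proof (rule vna_limit[of "finite_subsets_at_top I" "%J. \<Sum>i\<in>J. T i"])
 show "eventually (%J. (\<Sum>i\<in>J. T i) : N) (finite_subsets_at_top I)"
  by (rule eventually_finite_subsets_at_top_weakI) (use assms(1) in "auto intro: vna_sum")
 show "((%J. (\<Sum>i\<in>J. T i) x) \<longlongrightarrow> L x) (finite_subsets_at_top I)" for x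
  using assms(2)[of x] by (simp add: has_sum_def blinfun.sum_left)
qed simp

lemma vna_proj_on:
 assumes "subspace K" "closed K" "\<And>R k. R \<in> comm N ==> k \<in> K ==> R k \<in> K"
 shows "proj_on K \<in> N"
proof -
 obtain X where X: "!!S. S : X ==> dag S : X" "N = comm X" by (rule vnaE[OF N]) blast
 have sub: "R : comm N" if "R : X" for R
  unfolding X(2) by (rule commI) (use that in "simp add: comm_def")
 show ?thesis unfolding X(2)
 proof (rule commI)
  fix R assume "R : X"
  then show "proj_on K**R = R**proj_on K"
   by (intro proj_on_commute[symmetric] assms sub X(1))
 qed
qed

end

section \<open>Von Neumann algebras and their centers\<close>

definition cmul :: "complex => 'a::complex_hilbert \<Rightarrow>\<^sub>L 'a" where
 "cmul c = Blinfun (%\<xi>. c *\<^sub>C \<xi>)"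

lemma scaleC_scaleR: "c *\<^sub>C r *\<^sub>R (x::'a::complex_hilbert) = r *\<^sub>R c *\<^sub>C x"
 unfolding scaleC_of_real[symmetric] scaleC_scaleC by (simp add: mult.commute)

lemma cmul_apply [simp]: "cmul c x = c *\<^sub>C x"
proof -
 have "bounded_linear (%x::'a. c *\<^sub>C x)"
  by (rule bounded_linear_intro[where K = "cmod c"])
   (simp_all add: scaleC_add_right scaleC_scaleR norm_scaleC mult.commute)
 then show ?thesis by (simp add: cmul_def bounded_linear_Blinfun_apply)
qed

lemma dag_cmul: "dag (cmul c) = cmul (cnj c)"
 by (rule dag_unique) (simp add: rin_scaleC)

lemma cmul_cmul: "cmul c**cmul d = cmul (c * d)"
 by (rule blinfun_eqI) (simp add: scaleC_scaleC)

lemma cmul_one: "cmul 1 = \<one>"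
 by (rule blinfun_eqI) (use scaleC_of_real[of 1] in simp)

lemma clinear_ops_iff: "T \<in> clinear_ops \<longleftrightarrow> (\<forall>c. T**cmul c = cmul c**T)"
proof
 assume "T : clinear_ops"
 then show "ALL c. T**cmul c = cmul c**T" by (auto simp: clinear_ops_def intro!: blinfun_eqI)
next
 assume *: "ALL c. T**cmul c = cmul c**T"
 have "T (c *\<^sub>C x) = c *\<^sub>C T x" for c x
  using arg_cong[OF spec[OF *, of c], of "%S. blinfun_apply S x"] by simp
 then show "T : clinear_ops" by (simp add: clinear_ops_def)
qed

lemma clinear_ops_dag: "T \<in> clinear_ops ==> dag T \<in> clinear_ops"
 unfolding clinear_ops_iff
proof
 fix c
 assume "ALL c. T**cmul c = cmul c**T"
 then have "dag (T**cmul (cnj c)) = dag (cmul (cnj c)**T)" by simp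
 then show "dag T**cmul c = cmul c**dag T" by (simp add: dag_comp dag_cmul)
qed

lemma is_adjoint_iff:
 assumes "T \<in> clinear_ops"
 shows "is_adjoint T S \<longleftrightarrow> S = dag T"
proof
 assume "is_adjoint T S"
 then show "S = dag T"
  by (intro dag_unique[symmetric]) (simp add: is_adjoint_def rin_def)
next
 assume S: "S = dag T"
 have "cinner (T x) y = cinner x (dag T y)" for x y
 proof (rule complex_eqI)
  show "Re (cinner (T x) y) = Re (cinner x (dag T y))" using rin_dag[of T] by (simp add: rin_def)
  have "dag T (\<i> *\<^sub>C y) = \<i> *\<^sub>C dag T y"
   using clinear_ops_dag[OF assms] by (simp add: clinear_ops_def)
  then show "Im (cinner (T x) y) = Im (cinner x (dag T y))"
   by (simp add: Im_cinner rin_dag)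
 qed
 then show "is_adjoint T S" by (simp add: is_adjoint_def S)
qed

lemma commutant_eq_comm: "commutant N = comm (N \<union> range cmul)"
 by (auto simp: commutant_def comm_def clinear_ops_iff)

locale vn_algebra =
 fixes M :: "('a::complex_hilbert \<Rightarrow>\<^sub>L 'a) set"
 assumes vN: "von_neumann_algebra M"
begin

abbreviation Z where "Z \<equiv> center M"

lemma M_clinear: "T \<in> M ==> T \<in> clinear_ops"
 using vN by (auto simp: von_neumann_algebra_def)

lemma vna_commutant: "vna (commutant M)"
proof -
 have "dag T : M" if "T : M" for T
  using vN that is_adjoint_iff[of T] M_clinear[OF that] by (auto simp: von_neumann_algebra_def)
 then have "ALL S : M \<union> range cmul. dag S : M \<union> range cmul" by (auto simp: dag_cmul)
 then show ?thesis unfolding vna_def commutant_eq_comm by blast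
qed

lemma M_eq_comm: "M = comm (commutant M \<union> range cmul)"
 using vN commutant_eq_comm[of "commutant M"] by (simp add: von_neumann_algebra_def)

lemma vna_M: "vna M"
proof -
 have "ALL S : commutant M \<union> range cmul. dag S : commutant M \<union> range cmul"
  by (auto simp: dag_cmul vna_dag[OF vna_commutant])
 then show ?thesis unfolding vna_def using M_eq_comm by blast
qed

lemma center_eq_comm: "Z = comm (M \<union> commutant M \<union> range cmul)"
 unfolding center_def using M_eq_comm commutant_eq_comm[of M] by (auto simp: comm_def)

lemma vna_Z: "vna Z"
proof -
 have "ALL S : M \<union> commutant M \<union> range cmul. dag S : M \<union> commutant M \<union> range cmul"
  by (auto simp: dag_cmul vna_dag[OF vna_commutant] vna_dag[OF vna_M])
 then show ?thesis unfolding vna_def using center_eq_comm by blast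
qed

lemmas M_simps [simp] = vna_zero[OF vna_M] vna_one[OF vna_M] vna_add[OF vna_M] vna_diff[OF vna_M]
 vna_minus[OF vna_M] vna_scaleR[OF vna_M] vna_comp[OF vna_M] vna_dag[OF vna_M] vna_sum[OF vna_M]
 vna_oabs[OF vna_M]

lemmas Z_simps [simp] = vna_zero[OF vna_Z] vna_one[OF vna_Z] vna_add[OF vna_Z] vna_diff[OF vna_Z]
 vna_minus[OF vna_Z] vna_scaleR[OF vna_Z] vna_comp[OF vna_Z] vna_dag[OF vna_Z] vna_sum[OF vna_Z]
 vna_oabs[OF vna_Z]

lemma Z_M [simp]: "T \<in> Z ==> T \<in> M"
 by (simp add: center_def)

lemma Z_comm: "z \<in> Z ==> T \<in> M ==> T**z = z**T"
 by (rule commD[of z "M \<union> commutant M \<union> range cmul", symmetric]) (simp_all flip: center_eq_comm)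

lemma cmul_M: "cmul c \<in> M"
proof -
 have "cmul c**S = S**cmul c" if "S : commutant M \<union> range cmul" for S
  using that by (auto simp: cmul_cmul mult.commute commutant_def clinear_ops_iff)
 then have "cmul c : comm (commutant M \<union> range cmul)" by (rule commI)
 then show ?thesis using M_eq_comm by blast
qed

lemma is_adjoint_M: "T \<in> M ==> is_adjoint T S \<longleftrightarrow> S = dag T"
 by (rule is_adjoint_iff) (rule M_clinear)

lemma projections_M: "p \<in> projections M \<longleftrightarrow> p \<in> M \<and> is_proj p"
 by (auto simp: projections_def is_proj_def is_adjoint_M)

definition zproj :: "('a \<Rightarrow>\<^sub>L 'a) => bool" where
 "zproj z \<longleftrightarrow> z \<in> Z \<and> is_proj z"

lemma projections_Z: "z \<in> projections Z \<longleftrightarrow> zproj z"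
 by (auto simp: projections_def zproj_def is_proj_def is_adjoint_M center_def)

lemma zprojD [simp]: "zproj z ==> z \<in> Z" "zproj z ==> is_proj z" "zproj z ==> z**z = z" "zproj z ==> dag z = z"
 by (auto simp: zproj_def is_proj_def)

lemma zprojI: "z \<in> Z ==> is_proj z ==> zproj z"
 by (simp only: zproj_def)

lemma zproj_comm: "zproj z ==> T \<in> M ==> T**z = z**T"
 by (rule Z_comm) simp_all

lemma zproj_mult: "zproj z ==> zproj w ==> zproj (z**w)"
 by (intro zprojI is_proj_mult) (simp_all add: zproj_comm[of w])

lemma zproj_compl: "zproj z ==> zproj (\<one> - z)"
 by (intro zprojI is_proj_compl) simp_all

lemma zproj_one [simp]: "zproj \<one>" and zproj_zero [simp]: "zproj 0"
 by (rule zprojI; simp add: is_proj_def)+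

lemma zproj_diff:
 assumes "zproj z" "zproj w" "w**z = w"
 shows "zproj (z - w)"
proof -
 have "z**w = w" using assms zproj_comm[of z w] by simp
 then show ?thesis using assms
  by (intro zprojI) (simp_all add: is_proj_def op_simps dag_simps)
qed

lemma is_proj_zmult: "zproj z ==> p \<in> M ==> is_proj p ==> is_proj (z**p)"
 by (rule is_proj_mult) (simp_all add: zproj_comm[symmetric])

lemma pos_zmult: "zproj z ==> T \<in> M ==> pos T ==> pos (z**T)"
 by (rule pos_mult) (simp_all add: zproj_comm[symmetric] is_proj_pos)

subsection \<open>Exhaustion and gluing over the center\<close>

text \<open>The sum of an orthogonal family of central projections is its supremum.\<close>

lemma central_family_sum:
 assumes Fz: "\<And>w. w \<in> F ==> zproj w" and Fo: "\<And>w w'. w \<in> F ==> w' \<in> F ==> w \<noteq> w' ==> w**w' = 0"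
 obtains L where "zproj L" "\<And>x. ((%w. blinfun_apply w x) has_sum blinfun_apply L x) F"
  "\<And>w. w \<in> F ==> w**L = w" "\<And>T. \<forall>w\<in>F. T**w = w ==> T**L = L"
proof -
 have "EX L :: 'a \<Rightarrow>\<^sub>L 'a. (ALL x. ((%w. blinfun_apply w x) has_sum blinfun_apply L x) F) & norm L <= 1"
  by (rule orthogonal_sum_op[of F "%w. w" "%w. w"]) (use Fz Fo in "auto intro: is_proj_norm")
 then obtain L :: "'a \<Rightarrow>\<^sub>L 'a" where L: "!!x. ((%w. blinfun_apply w x) has_sum L x) F" by blast
 have LZ: "L : Z" by (rule vna_has_sum[OF vna_Z _ L]) (use Fz in auto)
 have wL: "w**L = w" if "w : F" for w
 proof (rule blinfun_eqI)
  fix x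
  have "((%w'. w (blinfun_apply w' x)) has_sum w (L x)) F"
   by (rule has_sum_bounded_linear[OF blinfun.bounded_linear_right L])
  moreover have "((%w'. w (blinfun_apply w' x)) has_sum w x) F"
  proof (rule has_sum_finite_neutralI[of "{w}"])
   show "w (blinfun_apply w' x) = 0" if "w' : F - {w}" for w'
    using Fo[OF `w : F`, of w'] that by (metis Diff_iff blinfun.zero_left insertI1 op_apply_assoc)
   show "w x = (\<Sum>w'\<in>{w}. w (blinfun_apply w' x))"
    using Fz[OF that] by (simp add: op_apply_assoc[symmetric] del: blinfun_apply_blinfun_compose)
  qed (use that in auto)
  ultimately have "w (L x) = w x" by (rule has_sum_unique)
  then show "(w**L) x = w x" by simp
 qed
 have ext: "T**L = L" if T: "ALL w:F. T**w = w" for T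
 proof (rule blinfun_eqI)
  fix x
  have "((%w'. T (blinfun_apply w' x)) has_sum T (L x)) F"
   by (rule has_sum_bounded_linear[OF blinfun.bounded_linear_right L])
  moreover have "T (blinfun_apply w' x) = w' x" if "w' : F" for w' using T that by (metis op_apply_assoc)
  ultimately have "((%w'. blinfun_apply w' x) has_sum T (L x)) F" using has_sum_cong by force
  from has_sum_unique[OF this L[of x]] show "(T**L) x = L x" by simp
 qed
 have "dag L = L"
 proof (rule selfadj_limit[of "finite_subsets_at_top F" "%J. \<Sum>w\<in>J. w"])
  show "((%J. blinfun_apply (\<Sum>w\<in>J. w) x) \<longlongrightarrow> L x) (finite_subsets_at_top F)" for x
   using L[of x] by (simp add: has_sum_def blinfun.sum_left)
  show "eventually (%J. dag (\<Sum>w\<in>J. w) = (\<Sum>w\<in>J. w)) (finite_subsets_at_top F)"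
  proof (rule eventually_finite_subsets_at_top_weakI)
   fix J assume J: "finite J" "J <= F"
   show "dag (\<Sum>w\<in>J. w) = (\<Sum>w\<in>J. w)"
    by (rule is_projD(2), rule is_proj_sum) (use J Fz in "auto intro!: Fo")
  qed
 qed simp
 moreover have Lw: "L**w = w" if "w : F" for w using wL[OF that] Z_comm[OF LZ, of w] Fz[OF that] by simp
 ultimately have zL: "zproj L" using LZ ext[of L] by (intro zprojI) (simp_all add: is_proj_def)
 show ?thesis by (rule that[OF zL L wL ext])
qed

lemma maximal_orthogonal_family:
 obtains F where "F \<subseteq> S" "orthogonal_family F" "\<And>p. p \<in> S ==> \<forall>q\<in>F. p**q = 0 \<and> q**p = 0 ==> p \<in> F"
proof -
 define A where "A = {F. F <= S & orthogonal_family F}"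
 have "EX F:A. ALL G:A. F <= G --> G = F"
 proof (rule subset_Zorn')
  fix C assume C: "subset.chain A C"
  have "orthogonal_family (\<Union>C)"
   unfolding orthogonal_family_def
  proof (intro ballI impI)
   fix p q assume "p : \<Union>C" "q : \<Union>C" "p ~= q"
   then obtain X Y where "X : C" "Y : C" "p : X" "q : Y" by blast
   moreover have "X <= Y \<or> Y <= X" using C `X : C` `Y : C` by (auto simp: subset_chain_def)
   ultimately obtain X' where "X' : C" "p : X'" "q : X'" by blast
   moreover have "orthogonal_family X'" using C `X' : C` by (auto simp: subset_chain_def A_def)
   ultimately show "p**q = 0" using `p ~= q` by (simp add: orthogonal_family_def)
  qed
  then show "\<Union>C \<in> A" using C by (auto simp: subset_chain_def A_def)
 qed
 then obtain F where F: "F : A" "!!G. G : A ==> F <= G ==> G = F" by blast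
 have "p : F" if "p : S" "ALL q:F. p**q = 0 & q**p = 0" for p
 proof -
  have "insert p F : A" using F(1) that by (auto simp: A_def orthogonal_family_def)
  then show ?thesis using F(2)[of "insert p F"] by blast
 qed
 with F(1) show ?thesis by (intro that[of F]) (auto simp: A_def)
qed

text \<open>A property that holds locally below a central projection holds on the members of a partition
 of it.\<close>

lemma central_exhaustion:
 assumes z0: "zproj z0"
  and loc: "\<And>w. zproj w ==> w \<noteq> 0 ==> w**z0 = w ==> \<exists>w'. zproj w' \<and> w' \<noteq> 0 \<and> w'**w = w' \<and> P w'"
 obtains F where "\<And>w. w \<in> F ==> zproj w \<and> w \<noteq> 0 \<and> w**z0 = w \<and> P w"
  "\<And>w w'. w \<in> F ==> w' \<in> F ==> w \<noteq> w' ==> w**w' = 0"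
  "\<And>x. ((%w. blinfun_apply w x) has_sum z0 x) F"
proof -
 obtain F where F: "F <= {w. zproj w & w ~= 0 & w**z0 = w & P w}" "orthogonal_family F"
  "!!w. w : {w. zproj w & w ~= 0 & w**z0 = w & P w} ==> ALL q:F. w**q = 0 & q**w = 0 ==> w : F"
  by (rule maximal_orthogonal_family, rule that)
 have Fz: "!!w. w : F ==> zproj w & w ~= 0 & w**z0 = w & P w"
  and Fo: "!!w w'. w : F ==> w' : F ==> w ~= w' ==> w**w' = 0"
  using F(1,2) by (auto simp: orthogonal_family_def)
 obtain L where zL: "zproj L" and L: "!!x. ((%w. blinfun_apply w x) has_sum blinfun_apply L x) F"
  and wL: "!!w. w : F ==> w**L = w" and ext: "!!T. ALL w:F. T**w = w ==> T**L = L"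
  by (rule central_family_sum[of F]) (use Fz Fo in blast)+
 have Lw: "L**w = w" if "w : F" for w using wL[OF that] zproj_comm[OF zL, of w] Fz[OF that] by simp
 have zw: "z0**w = w" if "w : F" for w using Fz[OF that] zproj_comm[of w z0] z0 by simp
 have z0L: "z0**L = L" by (rule ext) (simp add: zw)
 then have Lz0: "L**z0 = L" using zproj_comm[OF zL, of z0] z0 by simp
 have "z0 - L = 0"
 proof (rule ccontr)
  assume ne: "z0 - L ~= 0"
  have zd: "zproj (z0 - L)" by (rule zproj_diff[OF z0 zL Lz0])
  have "(z0 - L)**z0 = z0 - L" using z0 Lz0 by (simp add: op_simps)
  from loc[OF zd ne this] obtain w' where w': "zproj w'" "w' ~= 0" "w'**(z0 - L) = w'" "P w'" by blast
  have o: "w'**w = 0" if "w : F" for w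
  proof -
   have "w'**w = w'**((z0 - L)**w)" using w'(3) by (simp add: opm_assoc[symmetric])
   then show ?thesis using zw[OF that] Lw[OF that] by (simp add: op_simps)
  qed
  then have o': "w**w' = 0" if "w : F" for w using zproj_comm[of w w'] Fz[OF that] w'(1) that by simp
  have "w'**z0 = w'" using w'(3) `(z0 - L)**z0 = z0 - L` by (metis opm_assoc)
  then have "w' : F" using F(3)[of w'] w' o o' by simp
  then show False using o[of w'] w' by simp
 qed
 then show ?thesis using that[of F] Fz Fo L by auto
qed

text \<open>Two operators agree below a partitioned central projection if they agree on the members of the
 partition.\<close>

lemma has_sum_op_eqI:
 fixes S T z0 :: "'a \<Rightarrow>\<^sub>L 'a"
 assumes "\<And>x. ((%w. blinfun_apply w x) has_sum blinfun_apply z0 x) F" "\<And>w. w \<in> F ==> S**w = T**w"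
 shows "S**z0 = T**z0"
proof (rule blinfun_eqI)
 fix x
 have 1: "((%w'. S (blinfun_apply w' x)) has_sum S (z0 x)) F"
  "((%w'. T (blinfun_apply w' x)) has_sum T (z0 x)) F"
  by (rule has_sum_bounded_linear[OF blinfun.bounded_linear_right assms(1)])+
 have "S (w x) = T (w x)" if "w : F" for w using assms(2)[OF that] by (metis op_apply_assoc)
 then have "((%w'. S (blinfun_apply w' x)) has_sum T (z0 x)) F" using 1(2) has_sum_cong by force
 from has_sum_unique[OF 1(1) this] show "(S**z0) x = (T**z0) x" by simp
qed

text \<open>Operators on the members of a partition are independent, so a uniformly bounded family of them is
 the family of restrictions of one operator.\<close>

lemma central_gluing:
 assumes F: "\<And>w. w \<in> F ==> zproj w" "\<And>w w'. w \<in> F ==> w' \<in> F ==> w \<noteq> w' ==> w**w' = 0"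
  and T: "\<And>w. w \<in> F ==> T w \<in> M \<and> T w**w = T w \<and> norm (T w) \<le> C" "0 \<le> C"
  and z0: "\<And>x. ((%w. blinfun_apply w x) has_sum blinfun_apply z0 x) F"
 obtains L where "L \<in> M" "\<And>w. w \<in> F ==> L**w = T w" "L**z0 = L" "norm L \<le> C"
proof -
 have wT: "w**T w = T w" if "w : F" for w
  using T(1)[OF that] zproj_comm[OF F(1)[OF that], of "T w"] by simp
 have "EX L :: 'a \<Rightarrow>\<^sub>L 'a. (ALL x. ((%w. T w x) has_sum blinfun_apply L x) F) & norm L <= C"
  by (rule orthogonal_sum_op[of F "%w. w" "%w. w" T C]) (use F T wT in auto)
 then obtain L :: "'a \<Rightarrow>\<^sub>L 'a" where L: "!!x. ((%w. T w x) has_sum L x) F" "norm L <= C" by blast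
 have LM: "L : M" by (rule vna_has_sum[OF vna_M _ L(1)]) (use T in auto)
 have Lw: "L**w = T w" if "w : F" for w
 proof (rule blinfun_eqI)
  fix x
  have "((%w'. T w' (w x)) has_sum T w x) F"
  proof (rule has_sum_finite_neutralI[of "{w}"])
   show "T w' (w x) = 0" if w': "w' : F - {w}" for w'
   proof -
    have "T w'**w = T w'**w'**w" using T(1)[of w'] w' by simp
    also have "... = 0" using F(2)[of w' w] w' that `w : F` by (simp add: opm_assoc op_simps)
    finally show ?thesis by (metis op_apply_assoc blinfun.zero_left)
   qed
   show "T w x = (\<Sum>w'\<in>{w}. T w' (w x))"
    using T(1)[OF that] by (simp add: op_apply_assoc[symmetric] del: blinfun_apply_blinfun_compose)
  qed (use that in auto)
  from has_sum_unique[OF L(1)[of "w x"] this] show "(L**w) x = T w x" by simp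
 qed
 have wz0: "w**z0 = w" if w: "w : F" for w
 proof -
  obtain L0 where L0: "!!x. ((%w. blinfun_apply w x) has_sum blinfun_apply L0 x) F" "!!w. w : F ==> w**L0 = w"
   by (rule central_family_sum[of F]) (use F in blast)+
  have "L0 = z0" by (rule blinfun_eqI, rule has_sum_unique[OF L0(1) z0])
  then show ?thesis using L0(2)[OF w] by simp
 qed
 have "L**z0 = L"
 proof (rule blinfun_eqI)
  fix x
  have "T w (z0 x) = T w x" if "w : F" for w
  proof -
   have "w (z0 x) = w x" using wz0[OF that] by (metis op_apply_assoc)
   then show ?thesis using T(1)[OF that] by (metis op_apply_assoc)
  qed
  then have "((%w. T w (z0 x)) has_sum L x) F" using L(1)[of x] has_sum_cong by force
  from has_sum_unique[OF L(1)[of "z0 x"] this] show "(L**z0) x = L x" by simp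
 qed
 then show ?thesis using that[OF LM Lw _ L(2)] by blast
qed

text \<open>The central cover of \<open>T\<close> is the projection onto the closed span of \<open>M T H\<close>.\<close>

lemma central_cover:
 assumes T: "T \<in> M"
 obtains c where "zproj c" "c**T = T" "\<And>S. S \<in> M ==> \<forall>R\<in>M. S**(R**T) = 0 ==> S**c = 0"
proof -
 define G where "G = {blinfun_apply R (T x) | R x. R : M}"
 define K where "K = closure (span G)"
 have K: "subspace K" "closed K" unfolding K_def by (auto intro: subspace_closure_of_subspace)
 have GK: "G <= K" unfolding K_def using closure_subset span_superset by blast
 have inv: "blinfun_apply R k : K" if R: "R : M \<union> commutant M \<union> range cmul" and k: "k : K" for R k
 proof -
  have "R g : G" if g: "g : G" for g
  proof -
   obtain S x where S: "S : M" "g = S (T x)" using g unfolding G_def by blast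
   show ?thesis
   proof (cases "R : M")
    case True
    then have "R**S : M" "R g = (R**S) (T x)" using S by auto
    then show ?thesis unfolding G_def by blast
   next
    case False
    then have "R**S = S**R" "R**T = T**R"
     using R S(1) T M_clinear by (auto simp: commutant_def clinear_ops_iff)
    then have "R g = S (T (R x))" unfolding S(2) by (metis op_apply_assoc)
    then show ?thesis unfolding G_def using S(1) by blast
   qed
  qed
  then show ?thesis using closure_span_invariant[of G R k] k unfolding K_def by blast
 qed
 define c where "c = proj_on K"
 have "c : Z" unfolding center_eq_comm c_def
 proof (rule commI)
  fix R assume R: "R : M \<union> commutant M \<union> range cmul"
  then have "dag R : M \<union> commutant M \<union> range cmul"
   by (auto simp: dag_cmul vna_dag[OF vna_commutant])
  with R show "proj_on K**R = R**proj_on K"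
   by (intro proj_on_commute[symmetric] K inv)
 qed
 then have "zproj c" by (rule zprojI) (simp add: c_def is_proj_proj_on K)
 moreover have "c**T = T"
 proof (rule blinfun_eqI)
  fix x
  have "\<one> (T x) : G" unfolding G_def using vna_one[OF vna_M] by blast
  then show "(c**T) x = T x" using proj_on_fix[OF K] GK by (auto simp: c_def)
 qed
 moreover have "S**c = 0" if "S : M" "ALL R:M. S**(R**T) = 0" for S
 proof -
  have G0: "S g = 0" if g: "g : G" for g
  proof -
   obtain R x where R: "R : M" "g = R (T x)" using g unfolding G_def by blast
   have "(S**(R**T)) x = 0" using `ALL R:M. S**(R**T) = 0` R(1) by simp
   then show ?thesis by (simp add: R(2))
  qed
  have "subspace {k. S k = 0}" by (simp add: subspace_def blinfun.add_right blinfun.scaleR_right)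
  then have "span G <= {k. S k = 0}" using G0 by (intro span_minimal) auto
  moreover have "closed {k. S k = 0}" by (intro closed_Collect_eq continuous_intros)
  ultimately have "K <= {k. S k = 0}" unfolding K_def by (rule closure_minimal)
  then show ?thesis using proj_on_in[OF K] by (intro blinfun_eqI) (auto simp: c_def)
 qed
 ultimately show ?thesis using that by blast
qed

text \<open>The smallest central projection that fixes a vector \<open>\<eta>\<close> is the projection onto the closed span of \<open>Z' \<eta>\<close>.\<close>

lemma central_support_of_vector:
 obtains q where "zproj q" "q y = y" "\<And>c. c \<in> Z ==> c y = 0 ==> c**q = 0"
proof -
 define G where "G = {blinfun_apply R y | R. R : comm Z}"
 define K where "K = closure (span G)"
 have K: "subspace K" "closed K" unfolding K_def by (auto intro: subspace_closure_of_subspace)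
 have "\<one> y : G" unfolding G_def comm_def by (intro CollectI exI[of _ \<one>]) simp
 then have "y : K" unfolding K_def using closure_subset span_superset by fastforce
 have inv: "R k : K" if R: "R : comm Z" and k: "k : K" for R k
  unfolding K_def
 proof (rule closure_span_invariant)
  fix g assume "g : G"
  then obtain S where S: "S : comm Z" "g = S y" by (auto simp: G_def)
  have "R**S : comm Z" using R S(1) unfolding comm_def by (simp add: opm_assoc) (metis opm_assoc)
  then show "R g : G" unfolding G_def S(2) using blinfun_apply_blinfun_compose by (intro CollectI exI[of _ "R**S"]) simp
 qed (use k K_def in simp)
 have zq: "zproj (proj_on K)"
  by (intro zprojI is_proj_proj_on K vna_proj_on[OF vna_Z K] inv)
 have "c**proj_on K = 0" if c: "c : Z" "c y = 0" for c
 proof -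
  have "span G <= {k. c k = 0}"
  proof (rule span_minimal)
   have "c (R y) = 0" if "R : comm Z" for R
    using commD[OF that c(1)] c(2) by (metis op_apply_assoc blinfun.zero_right)
   then show "G <= {k. c k = 0}" by (auto simp: G_def)
   show "subspace {k. c k = 0}" by (simp add: subspace_def blinfun.add_right blinfun.scaleR_right)
  qed
  moreover have "closed {k. c k = 0}" by (intro closed_Collect_eq continuous_intros)
  ultimately have "K <= {k. c k = 0}" unfolding K_def by (rule closure_minimal)
  then show ?thesis using proj_on_in[OF K] by (intro blinfun_eqI) auto
 qed
 then show ?thesis by (rule that[OF zq proj_on_fix[OF K `y : K`]])
qed

lemma central_cover':
 assumes T: "T \<in> M"
 obtains c where "zproj c" "c**T = T" "\<And>S. S \<in> M ==> \<forall>R\<in>M. S**(R**T) = 0 ==> S**c = 0"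
  "\<And>w. w \<in> Z ==> w**T = 0 ==> w**c = 0"
proof -
 obtain c where c: "zproj c" "c**T = T" "!!S. S : M ==> ALL R:M. S**(R**T) = 0 ==> S**c = 0"
  by (rule central_cover[OF T], rule that)
 have "w**c = 0" if "w : Z" "w**T = 0" for w
 proof (rule c(3), safe)
  fix R assume "R : M"
  then have "w**(R**T) = R**(w**T)" using Z_comm[OF that(1), of R] by (simp add: opm_assoc[symmetric])
  then show "w**(R**T) = 0" using that(2) by (simp add: op_simps)
 qed (use that in simp)
 with c show ?thesis by (rule that)
qed

end

section \<open>Abelian projections\<close>

lemma symmetry_norm:
 assumes "is_proj p" "is_proj q" "p**q = q"
 shows "norm (q - (p - q)) \<le> 1"
proof (rule norm_blinfun_bound)
 fix x
 have "q**p = q" using assms by (metis dag_comp is_projD(2))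
 then have "(q - (p - q))**(q - (p - q)) = p"
  using assms by (simp add: op_simps is_projD)
 moreover have "dag (q - (p - q)) = q - (p - q)" using assms by (simp add: dag_simps is_projD)
 ultimately have "(norm ((q - (p - q)) x))\<^sup>2 = rin (p x) x" by (simp only: norm_op_sq)
 also have "... = (norm (p x))\<^sup>2" using is_proj_norm_apply[OF assms(1)] by simp
 also have "... <= (norm x)\<^sup>2" by (intro power_mono is_proj_contr assms) simp
 finally show "norm ((q - (p - q)) x) <= 1 * norm x" by (simp add: power2_le_iff_abs_le)
qed simp

lemma form_sum_le:
 fixes b :: "'a::complex_hilbert \<Rightarrow>\<^sub>L 'a"
 assumes "pos b"
 shows "rin (b (\<Sum>i<n. x i)) (\<Sum>i<n. x i) \<le> real n * (\<Sum>i<n. rin (b (x i)) (x i))"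
proof -
 obtain S where S: "pos S" "S**S = b" "!!R. R**b = b**R ==> R**S = S**R"
  by (rule sqrt_exists[OF assms], rule that)
 have form: "rin (b y) y = (norm (S y))\<^sup>2" for y
  using norm_op_sq[of S y] S(2) pos_dag[OF S(1)] by simp
 have "norm (S (\<Sum>i<n. x i)) <= (\<Sum>i<n. norm (S (x i)))"
  unfolding blinfun.sum_right by (rule norm_sum)
 then have "(norm (S (\<Sum>i<n. x i)))\<^sup>2 <= (\<Sum>i<n. norm (S (x i)))\<^sup>2" by (intro power_mono) auto
 also have "... <= (\<Sum>i<n. (norm (S (x i)))\<^sup>2) * card {..<n}"
  by (rule sum_squared_le_sum_of_squares)
 finally show ?thesis by (simp add: form mult.commute)
qed

primrec opow :: "('a::complex_hilbert \<Rightarrow>\<^sub>L 'a) => nat => ('a \<Rightarrow>\<^sub>L 'a)" where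
 "opow X 0 = \<one>"
| "opow X (Suc n) = X**opow X n"

lemma opow_commute: "opow X n**X = X**opow X n"
 by (induction n) (simp_all add: opm_assoc)

lemma norm_opow: "norm (opow X n) \<le> norm X ^ n"
proof (induction n)
 case 0
 then show ?case by (simp add: norm_blinfun_id_le)
next
 case (Suc n)
 have "norm (opow X (Suc n)) <= norm X * norm (opow X n)" by (simp add: norm_comp_le)
 also have "... <= norm X * norm X ^ n" using Suc by (intro mult_left_mono) auto
 finally show ?case by simp
qed

text \<open>A self-adjoint operator that is bounded below by a positive number has an inverse square root;
 the inverse is given by the Neumann series.\<close>

lemma inverse_sqrt:
 assumes N: "vna N" and A: "A \<in> N" "dag A = A" and e: "0 < e" "e *\<^sub>R \<one> \<preceq> A"
 obtains h where "h \<in> N" "dag h = h" "h**h**A = \<one>"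
proof -
 define K where "K = norm A + e"
 have K: "K > 0" "e <= K" using e by (auto simp: K_def add_nonneg_pos)
 define X where "X = \<one> - (1/K) *\<^sub>R A"
 have "A \<preceq> K *\<^sub>R \<one>" using A(2) e by (intro op_le_norm) (auto simp: K_def)
 then have "pos ((1/K) *\<^sub>R (K *\<^sub>R \<one> - A))" using K by (intro pos_scaleR) auto
 then have posX: "pos X" using K by (simp add: X_def scaleR_diff_right)
 have "pos ((1/K) *\<^sub>R (A - e *\<^sub>R \<one>))" using K e by (intro pos_scaleR) auto
 then have 1: "X \<preceq> (1 - e/K) *\<^sub>R \<one>" using K by (simp add: X_def scaleR_diff_right scaleR_diff_left)
 have "norm X <= 1 - e/K"
 proof (rule norm_op_le[OF pos_dag[OF posX] 1])
  have "pos (X + (1 - e/K) *\<^sub>R \<one>)" using K posX by (intro pos_add pos_scaleR) auto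
  then show "- ((1 - e/K) *\<^sub>R \<one>) \<preceq> X" by simp
 qed (use K in simp)
 then have X1: "norm X < 1" using K e by (smt (verit) divide_pos_pos)
 have sm: "summable (opow X)"
  by (rule summable_comparison_test'[of "%n. norm X ^ n" 0])
   (use X1 norm_opow in "auto intro: summable_geometric")
 define Y where "Y = (\<Sum>n. opow X n)"
 have XN: "X : N" unfolding X_def by (intro vna_diff[OF N] vna_one[OF N] vna_scaleR[OF N] A)
 have powN: "opow X n : N" for n
  by (induction n) (auto intro: vna_one[OF N] vna_comp[OF N] XN)
 have lim: "(%n. \<Sum>i<n. opow X i) \<longlonglongrightarrow> Y"
  unfolding Y_def using sm by (rule summable_LIMSEQ)
 have YN: "Y : N"
 proof (rule vna_limit[OF N, of sequentially "%n. \<Sum>i<n. opow X i"])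
  show "eventually (%n. (\<Sum>i<n. opow X i) : N) sequentially"
   by (intro always_eventually allI vna_sum[OF N] powN)
  show "(%n. (\<Sum>i<n. opow X i) x) \<longlonglongrightarrow> Y x" for x
   by (intro blinfun.tendsto lim tendsto_const)
 qed simp
 have "X**Y = (\<Sum>n. X**opow X n)"
  unfolding Y_def by (rule bounded_linear.suminf[OF opm.bounded_linear_right sm])
 also have "... = Y - \<one>" using suminf_split_head[OF sm] by (simp add: Y_def)
 finally have "(1/K) *\<^sub>R (A**Y) = \<one>" by (simp add: X_def op_simps algebra_simps)
 then have "K *\<^sub>R ((1/K) *\<^sub>R (A**Y)) = K *\<^sub>R \<one>" by simp
 then have AY: "A**Y = K *\<^sub>R \<one>" using K by simp
 then have "dag (A**Y) = K *\<^sub>R \<one>" by (simp add: dag_simps)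
 then have dYA: "dag Y**A = K *\<^sub>R \<one>" by (simp add: dag_comp A)
 have "dag Y**(A**Y) = (dag Y**A)**Y" by (simp add: opm_assoc)
 then have "K *\<^sub>R dag Y = K *\<^sub>R Y" unfolding AY dYA by (simp add: op_simps)
 then have dY: "dag Y = Y" using K by simp
 have "pos (dag Y**A**Y)"
 proof (rule pos_conj)
  have "pos (e *\<^sub>R \<one> + (A - e *\<^sub>R \<one>))" using e by (intro pos_add pos_scaleR) auto
  then show "pos A" by simp
 qed
 then have "pos (K *\<^sub>R Y)" by (simp add: dYA op_simps)
 from pos_scaleR[OF this, of "1/K"] K have "pos Y" by simp
 from vna_sqrt[OF N YN this] obtain S where S: "S : N" "pos S" "S**S = Y" by blast
 show ?thesis
 proof (rule that)
  show "(1 / sqrt K) *\<^sub>R S : N" by (rule vna_scaleR[OF N S(1)])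
  show "dag ((1 / sqrt K) *\<^sub>R S) = (1 / sqrt K) *\<^sub>R S" using S(2) by (simp add: dag_simps pos_dag)
  show "((1 / sqrt K) *\<^sub>R S)**((1 / sqrt K) *\<^sub>R S)**A = \<one>"
   using S(3) dYA K by (simp add: op_simps(10,11) dY)
 qed
qed

context vn_algebra
begin

text \<open>The central cover, with a choice operator instead of an infimum; the two minimality properties say
 what it has to annihilate.\<close>

definition cov :: "('a \<Rightarrow>\<^sub>L 'a) => ('a \<Rightarrow>\<^sub>L 'a)" where
 "cov T = (SOME c. zproj c \<and> c**T = T \<and> (\<forall>S\<in>M. (\<forall>R\<in>M. S**(R**T) = 0) --> S**c = 0) \<and>
  (\<forall>w\<in>Z. w**T = 0 --> w**c = 0))"

lemma cov:
 assumes "T \<in> M"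
 shows cov_zproj: "zproj (cov T)" and cov_absorb: "cov T**T = T"
  and cov_zero: "\<And>S. S \<in> M ==> \<forall>R\<in>M. S**(R**T) = 0 ==> S**cov T = 0"
  and cov_central_zero: "\<And>w. w \<in> Z ==> w**T = 0 ==> w**cov T = 0"
proof -
 obtain c where "zproj c" "c**T = T" "!!S. S : M ==> ALL R:M. S**(R**T) = 0 ==> S**c = 0"
  "!!w. w : Z ==> w**T = 0 ==> w**c = 0"
  by (rule central_cover'[OF assms], rule that)
 then have "EX c. zproj c & c**T = T & (ALL S:M. (ALL R:M. S**(R**T) = 0) --> S**c = 0) &
  (ALL w:Z. w**T = 0 --> w**c = 0)" by blast
 from someI_ex[OF this, folded cov_def]
 show "zproj (cov T)" "cov T**T = T" "!!S. S : M ==> ALL R:M. S**(R**T) = 0 ==> S**cov T = 0"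
  "!!w. w : Z ==> w**T = 0 ==> w**cov T = 0" by blast+
qed

lemma cov_le:
 assumes "T \<in> M" "zproj w" "w**T = T"
 shows "cov T**w = cov T"
proof -
 have "(\<one> - w)**cov T = 0"
  by (rule cov_central_zero[OF assms(1)]) (use assms in "simp_all add: op_simps")
 then have "w**cov T = cov T" by (simp add: op_simps)
 then show ?thesis using zproj_comm[OF assms(2), of "cov T"] cov_zproj[OF assms(1)] by simp
qed

lemma cov_nonzero: "T \<in> M ==> T \<noteq> 0 ==> cov T \<noteq> 0"
 using cov_absorb[of T] by (auto simp: op_simps)

text \<open>Every self-adjoint \<open>S = p S p\<close> with \<open>\<parallel>S\<parallel> \<le> r\<close> is the product of \<open>r/2 + S'\<close>, where
 \<open>\<parallel>S'\<parallel> \<le> r/2\<close>, and a symmetry of the corner at \<open>p\<close>. Iterating this reduces statements about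
 operators to statements about projections without the spectral theorem.\<close>

lemma halving_step:
 assumes p: "p \<in> M" "is_proj p" and S: "S \<in> M" "dag S = S" "p**S = S" "norm S \<le> r"
 obtains q S' where "q \<in> M" "is_proj q" "p**q = q" "S' \<in> M" "dag S' = S'" "p**S' = S'"
  "norm S' \<le> r / 2" "S = ((r/2) *\<^sub>R p + S')**(q - (p - q))" "(r/2) *\<^sub>R p + S' = S**(q - (p - q))"
proof -
 obtain q0 where q0: "q0 : M" "is_proj q0" "!!R. R**S = S**R ==> R**q0 = q0**R"
  "pos (q0**S)" "pos (- ((\<one> - q0)**S))"
  "S = oabs S**(q0 - (\<one> - q0))" "oabs S = S**(q0 - (\<one> - q0))"
  by (rule vna_spectral_projection[OF vna_M S(1,2)], rule that)
 have Sp: "S**p = S" using S(2,3) p by (metis dag_comp is_projD(2))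
 have pq0: "p**q0 = q0**p" by (rule q0(3)) (simp add: S(3) Sp)
 define q where "q = p**q0"
 define A where "A = oabs S"
 have pw: "(q0 - (\<one> - q0))**p = p**(q0 - (\<one> - q0))" using pq0 by (simp add: op_simps)
 have w: "p**(q0 - (\<one> - q0)) = q - (p - q)" by (simp add: q_def op_simps)
 have Ap: "A**p = A"
  unfolding A_def q0(7) opm_assoc pw by (simp add: opm_assoc[symmetric] Sp)
 have pA: "p**A = A" using Ap p(2) pos_dag[OF oabs_pos[of S]] unfolding A_def by (metis dag_comp is_projD(2))
 have 1: "S = A**(q - (p - q))"
  unfolding w[symmetric] opm_assoc[symmetric] Ap using q0(6) by (simp add: A_def)
 have 2: "A = S**(q - (p - q))"
  unfolding w[symmetric] opm_assoc[symmetric] Sp using q0(7) by (simp add: A_def)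
 have "norm A <= r" using S(4) by (simp add: A_def norm_oabs)
 then have "A \<preceq> r *\<^sub>R \<one>" by (intro op_le_norm) (simp_all add: A_def pos_dag oabs_pos)
 from pos_conj[OF this, of p] have rp: "pos (r *\<^sub>R p - A)"
  using p pA Ap by (simp add: op_simps is_projD)
 have r: "0 <= r" using S(4) norm_ge_zero order_trans by blast
 define S' where "S' = A - (r/2) *\<^sub>R p"
 have half: "r *\<^sub>R p = (r/2) *\<^sub>R p + (r/2) *\<^sub>R p" by (simp add: scaleR_add_left[symmetric])
 show ?thesis
 proof (rule that[of q S'])
  show "q : M" using p q0 by (simp add: q_def)
  show "is_proj q" unfolding q_def by (rule is_proj_mult[OF p(2) q0(2) pq0])
  show "p**q = q" using p(2) by (simp add: q_def is_proj_absorb)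
  show "S' : M" using p S by (simp add: S'_def A_def)
  show dS': "dag S' = S'" using p by (simp add: S'_def A_def dag_simps is_projD pos_dag oabs_pos)
  show "p**S' = S'" using p pA by (simp add: S'_def op_simps is_projD)
  show "norm S' <= r / 2"
  proof (rule norm_op_le[OF dS'])
   have "pos ((r *\<^sub>R p - A) + (r/2) *\<^sub>R (\<one> - p))"
    using r p by (intro pos_add rp pos_scaleR is_proj_pos is_proj_compl) auto
   then show "S' \<preceq> (r/2) *\<^sub>R \<one>" unfolding half by (simp add: S'_def scaleR_diff_right algebra_simps)
   have "pos ((r/2) *\<^sub>R (\<one> - p))"
    using r p by (intro pos_scaleR is_proj_pos is_proj_compl) auto
   then have "pos (A + (r/2) *\<^sub>R (\<one> - p))"
    by (intro pos_add) (simp_all add: A_def oabs_pos)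
   then show "- ((r/2) *\<^sub>R \<one>) \<preceq> S'" by (simp add: S'_def scaleR_diff_right algebra_simps)
  qed (use r in simp)
  show "S = ((r/2) *\<^sub>R p + S')**(q - (p - q))" "(r/2) *\<^sub>R p + S' = S**(q - (p - q))"
   using 1 2 by (simp_all add: S'_def)
 qed
qed

lemma commute_of_commute_projections:
 assumes p: "p \<in> M" "is_proj p" and T: "T \<in> M" "p**T = T" "T**p = T"
  and comm: "\<And>q. q \<in> M ==> is_proj q ==> p**q = q ==> q**T = T**q"
  and S: "S \<in> M" "dag S = S" "p**S = S"
 shows "S**T = T**S"
proof -
 have bound: "norm (S**T - T**S) <= r * (2 * norm T) / 2 ^ n"
  if "S : M" "dag S = S" "p**S = S" "norm S <= r" for S r n
  using that
 proof (induction n arbitrary: S r)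
  case 0
  have "norm (S**T - T**S) <= norm (S**T) + norm (T**S)" by (rule norm_triangle_ineq4)
  also have "... <= norm S * norm T + norm T * norm S" by (intro add_mono norm_comp_le)
  also have "... <= r * (2 * norm T)" using mult_right_mono[OF 0(4), of "norm T"] by (simp add: algebra_simps)
  finally show ?case by simp
 next
  case (Suc n)
  obtain q S' where q: "q : M" "is_proj q" "p**q = q" and S': "S' : M" "dag S' = S'" "p**S' = S'"
   "norm S' <= r / 2" and eq: "S = ((r/2) *\<^sub>R p + S')**(q - (p - q))" "(r/2) *\<^sub>R p + S' = S**(q - (p - q))"
   by (rule halving_step[OF p Suc.prems], rule that)
  define w where "w = q - (p - q)"
  define A where "A = (r/2) *\<^sub>R p + S'"
  have Tw: "w**T = T**w" unfolding w_def using comm[OF q] T by (simp add: op_simps)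
  have "S**T - T**S = A**w**T - T**(A**w)" using eq(1) by (simp add: A_def w_def)
  also have "... = (A**T - T**A)**w" using Tw by (simp add: op_simps)
  also have "A**T - T**A = S'**T - T**S'" using T by (simp add: A_def op_simps)
  finally have "norm (S**T - T**S) <= norm (S'**T - T**S') * norm w" by (simp add: norm_comp_le)
  also have "... <= norm (S'**T - T**S') * 1"
   unfolding w_def by (intro mult_left_mono symmetry_norm p q) simp
  also have "... <= (r/2) * (2 * norm T) / 2 ^ n" using Suc.IH[OF S'] by simp
  finally show ?case by simp
 qed
 have "(%n. norm S * (2 * norm T) / 2 ^ n) \<longlonglongrightarrow> 0" by (rule LIMSEQ_divide_realpow_zero) simp
 then have "norm (S**T - T**S) <= 0"
  by (rule LIMSEQ_le_const) (use bound[OF S order_refl] in blast)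
 then show ?thesis by simp
qed

text \<open>If every subprojection of \<open>p\<close> is central in the corner \<open>p M p\<close>, then the corner is abelian.\<close>

lemma noncentral_subprojection:
 assumes p: "p \<in> M" "is_proj p" "\<not> abelian_projection M p"
 obtains r R where "r \<in> M" "is_proj r" "p**r = r" "R \<in> M" "(p - r)**(R**r) \<noteq> 0"
proof (rule ccontr)
 note goal = that
 assume no: "~ thesis"
 have c: "(p - r)**(R**r) = 0" if "r : M" "is_proj r" "p**r = r" "R : M" for r R
  using goal[OF that] no by blast
 have comm: "r**T = T**r" if "T : M" "p**T = T" "T**p = T" "r : M" "is_proj r" "p**r = r" for r T
 proof -
  have 1: "p**(R**r) = r**(R**r)" if "R : M" for R using c[of r R] that `r : M` `is_proj r` `p**r = r` by (simp add: op_simps)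
  have "T**r = r**(T**r)" using 1[OF that(1)] that(2) by (metis opm_assoc)
  moreover have "dag T**r = r**(dag T**r)"
  proof -
   have "p**dag T = dag T" using that(3) p(2) by (metis dag_comp is_projD(2))
   then show ?thesis using 1[of "dag T"] vna_dag[OF vna_M that(1)] by (metis opm_assoc)
  qed
  then have "dag (dag T**r) = dag (r**(dag T**r))" by simp
  then have "r**T = r**T**r" using that(5) by (simp add: dag_simps is_projD)
  ultimately show ?thesis by (simp add: opm_assoc)
 qed
 have sa: "S**T = T**S" if "T : M" "p**T = T" "T**p = T" "S : M" "dag S = S" "p**S = S" for S T
  by (rule commute_of_commute_projections[OF p(1,2) that(1-3) comm[OF that(1-3)] that(4-6)])
 have all: "S**T = T**S" if T: "T : M" "p**T = T" "T**p = T" and S: "S : M" "p**S = S" "S**p = S" for S T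
 proof -
  have pd: "p**dag S = dag S" using S(3) p(2) by (metis dag_comp is_projD(2))
  have 1: "(S + dag S)**T = T**(S + dag S)"
   using S pd by (intro sa T) (simp_all add: dag_simps op_simps add.commute)
  \<comment> \<open>\<open>i (S - S\<^sup>*)\<close> is self-adjoint as well.\<close>
  define A where "A = cmul \<i>**(S - dag S)"
  have SM: "R**cmul c = cmul c**R" if "R : M" for R c using M_clinear[OF that] by (simp add: clinear_ops_iff)
  have "A**T = T**A"
  proof (intro sa T)
   show "A : M" using S cmul_M by (simp add: A_def)
   have "dag A = (dag S - S)**cmul (- \<i>)" by (simp add: A_def dag_simps dag_cmul)
   also have "... = cmul (- \<i>)**(dag S - S)" using S by (simp add: SM)
   also have "cmul (- \<i>) = - cmul \<i>" by (rule blinfun_eqI) (simp add: blinfun.minus_left, metis add.right_inverse diff_eq_eq minus_unique scaleC_add_left scaleC_of_real of_real_0 scaleR_zero_left)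
   also have "- cmul \<i>**(dag S - S) = A" by (simp add: A_def op_simps)
   finally show "dag A = A" .
   show "p**A = A" unfolding A_def opm_assoc[symmetric] SM[OF p(1)]
    using S pd by (simp add: op_simps)
  qed
  then have "cmul (- \<i>)**(A**T) = cmul (- \<i>)**(T**A)" by simp
  then have "(cmul (- \<i>)**A)**T = T**(cmul (- \<i>)**A)"
   by (simp add: opm_assoc[symmetric] SM[OF T(1)])
  moreover have "cmul (- \<i>)**A = S - dag S"
   by (simp add: A_def opm_assoc[symmetric] cmul_cmul cmul_one)
  ultimately have 2: "(S - dag S)**T = T**(S - dag S)" by simp
  have "2 *\<^sub>R (S**T) = (S + dag S)**T + (S - dag S)**T" by (simp add: op_simps scaleR_2)
  also have "... = 2 *\<^sub>R (T**S)" unfolding 1 2 by (simp add: op_simps scaleR_2)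
  finally show ?thesis by simp
 qed
 have "abelian_projection M p" unfolding abelian_projection_def projections_M
  using p by (intro conjI ballI all) (simp_all add: opm_assoc is_projD is_proj_absorb)
 then show False using p(3) by simp
qed

lemma abelian_projectionD:
 assumes "abelian_projection M e"
 shows "e \<in> M" "is_proj e" "S \<in> M ==> T \<in> M ==> e**S = S ==> S**e = S ==> e**T = T ==> T**e = T ==> S**T = T**S"
proof -
 show "e : M" "is_proj e" using assms by (auto simp: abelian_projection_def projections_M)
 assume "S : M" "T : M" "e**S = S" "S**e = S" "e**T = T" "T**e = T"
 moreover from this have "(e**S**e)**(e**T**e) = (e**T**e)**(e**S**e)"
  using assms unfolding abelian_projection_def by blast
 ultimately show "S**T = T**S" by simp
qed

lemma abelian_subprojection:
 assumes e: "abelian_projection M e" and p: "p \<in> M" "is_proj p" "e**p = p"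
 obtains z where "zproj z" "p = z**e"
proof -
 note eD = abelian_projectionD[OF e]
 have pe: "p**e = p" using p eD(2) by (metis dag_comp is_projD(2))
 have "(e - p)**(R**p) = 0" if R: "R : M" for R
 proof -
  have "(e**R**e)**p = p**(e**R**e)"
   using R eD(1,2) p pe by (intro eD(3)) (simp_all add: opm_assoc is_projD is_proj_absorb)
  then have "e**R**p = p**R**e" using p(3) pe by (simp add: opm_assoc) (metis opm_assoc)
  then have "p**(e**R**p) = p**(p**R**e)" by simp
  then have "p**R**p = p**R**e" using p(2) pe by (simp add: opm_assoc[symmetric] is_projD)
  then show ?thesis using `e**R**p = p**R**e` by (simp add: op_simps)
 qed
 then have "(e - p)**cov p = 0" by (intro cov_zero[OF p(1)]) (use eD p in auto)
 then have "e**cov p = p**cov p" by (simp add: op_simps)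
 also have "... = p" using cov_absorb[OF p(1)] zproj_comm[OF cov_zproj[OF p(1)] p(1)] by simp
 also have "e**cov p = cov p**e" by (rule zproj_comm[OF cov_zproj[OF p(1)] eD(1)])
 finally show ?thesis using that[OF cov_zproj[OF p(1)]] by simp
qed

text \<open>The corner at an abelian projection \<open>e\<close> consists of central multiples of \<open>e\<close>.\<close>

lemma abelian_selfadj:
 assumes e: "abelian_projection M e" and T: "T \<in> M" "dag T = T" "e**T = T"
 obtains c where "c \<in> Z" "dag c = c" "T = c**e"
proof -
 note eD = abelian_projectionD[OF e]
 define r where "r = norm T"
 define Q where "Q = (%n (c, u, S). c : Z & u : Z & norm u <= 1 & S : M & dag S = S & e**S = S &
  norm S <= r / 2 ^ n & T = c**e + u**S)"
 have "EX f. ALL n. Q n (f n) & norm (fst (f (Suc n)) - fst (f n)) <= r / 2 ^ Suc n"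
 proof (rule dependent_nat_choice)
  show "EX x. Q 0 x"
   by (rule exI[of _ "(0, \<one>, T)"]) (use T in "simp add: Q_def r_def op_simps norm_blinfun_id_le")
  fix x n assume "Q n x"
  moreover obtain c u S where x: "x = (c, u, S)" by (cases x) auto
  ultimately have cu: "c : Z" "u : Z" "norm u <= 1" "T = c**e + u**S"
   and S: "S : M" "dag S = S" "e**S = S" "norm S <= r / 2 ^ n" by (auto simp: Q_def)
  define t where "t = r / 2 ^ n / 2"
  obtain q S' where q: "q : M" "is_proj q" "e**q = q" and S': "S' : M" "dag S' = S'" "e**S' = S'"
   "norm S' <= t" and eq: "S = (t *\<^sub>R e + S')**(q - (e - q))" "t *\<^sub>R e + S' = S**(q - (e - q))"
   by (rule halving_step[OF eD(1,2) S, folded t_def], rule that)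
  obtain z where z: "zproj z" "q = z**e" by (rule abelian_subprojection[OF e q], rule that)
  define w where "w = z - (\<one> - z)"
  have wZ: "w : Z" using z by (simp add: w_def)
  have w1: "norm w <= 1" unfolding w_def by (rule symmetry_norm) (use z in "simp_all add: is_proj_def")
  have qw: "q - (e - q) = w**e" by (simp add: z(2) w_def op_simps)
  have S'e: "S'**e = S'" using S'(2,3) eD(2) by (metis dag_comp is_projD(2))
  have "S = w**(t *\<^sub>R e + S')"
  proof -
   have "S = (t *\<^sub>R e + S')**(e**w)" using eq(1) Z_comm[OF wZ eD(1)] by (simp add: qw)
   also have "... = (t *\<^sub>R e + S')**w" using S'e eD(2) by (simp add: opm_assoc[symmetric] opm.add_left op_simps(10) is_projD)
   also have "... = w**(t *\<^sub>R e + S')" using S'(1) eD(1) by (intro Z_comm wZ) simp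
   finally show ?thesis .
  qed
  then have "T = c**e + u**(w**(t *\<^sub>R e + S'))" using cu(4) by simp
  also have "... = (c + t *\<^sub>R (u**w))**e + (u**w)**S'" by (simp add: op_simps)
  finally have Teq: "T = (c + t *\<^sub>R (u**w))**e + (u**w)**S'" .
  have uw: "norm (u**w) <= 1"
   using norm_comp_le[of u w] mult_mono[OF cu(3) w1] by simp
  have t0: "0 <= t" by (simp add: t_def r_def)
  show "EX y. Q (Suc n) y & norm (fst y - fst x) <= r / 2 ^ Suc n"
  proof (intro exI conjI)
   show "Q (Suc n) (c + t *\<^sub>R (u**w), u**w, S')"
    unfolding Q_def using cu wZ uw S' Teq by (simp add: t_def)
   show "norm (fst (c + t *\<^sub>R (u**w), u**w, S') - fst x) <= r / 2 ^ Suc n"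
   proof -
    have "norm (t *\<^sub>R (u**w)) <= t" using mult_left_mono[OF uw t0] t0 by simp
    moreover have "r / 2 ^ Suc n = t" by (simp add: t_def)
    ultimately show ?thesis by (simp only: x fst_conv add_diff_cancel_left')
   qed
  qed
 qed
 then obtain f where f: "!!n. Q n (f n)" "!!n. norm (fst (f (Suc n)) - fst (f n)) <= r / 2 ^ Suc n" by blast
 define c where "c = (%n. fst (f n))"
 have "summable (%n. r * (1/2) ^ Suc n)" by (intro summable_mult summable_ignore_initial_segment[of _ 1, simplified] summable_geometric) simp
 then have "summable (%n. c (Suc n) - c n)"
  by (rule summable_comparison_test'[of _ 0]) (use f(2) in "simp add: c_def power_divide")
 then have "(%n. \<Sum>k<n. c (Suc k) - c k) \<longlonglongrightarrow> (\<Sum>k. c (Suc k) - c k)" by (rule summable_LIMSEQ)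
 then have "(%n. c n - c 0 + c 0) \<longlonglongrightarrow> (\<Sum>k. c (Suc k) - c k) + c 0"
  unfolding sum_lessThan_telescope by (intro tendsto_add tendsto_const)
 then obtain C where C: "c \<longlonglongrightarrow> C" by auto
 have cZ: "c n : Z" for n using f(1)[of n] by (auto simp: Q_def c_def split: prod.splits)
 have CZ: "C : Z"
  by (rule vna_limit[OF vna_Z, of sequentially c]) (use cZ C in "auto intro: blinfun.tendsto tendsto_const")
 have nle: "norm (T - c n**e) <= r / 2 ^ n" for n
 proof -
  obtain c' u S where x: "f n = (c', u, S)" by (cases "f n") auto
  have "norm (u**S) <= 1 * (r / 2 ^ n)"
   using f(1)[of n] unfolding x Q_def by (intro order_trans[OF norm_comp_le] mult_mono) auto
  then show ?thesis using f(1)[of n] unfolding x Q_def c_def by simp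
 qed
 have lim0: "(%n. r / 2 ^ n) \<longlonglongrightarrow> 0" by (rule LIMSEQ_divide_realpow_zero) simp
 have "(%n. T - c n**e) \<longlonglongrightarrow> 0"
  by (rule Lim_null_comparison[OF _ lim0]) (simp add: nle)
 moreover have "(%n. T - c n**e) \<longlonglongrightarrow> T - C**e" by (intro tendsto_diff tendsto_const opm.tendsto C)
 ultimately have "0 = T - C**e" by (rule LIMSEQ_unique)
 then have TC: "T = C**e" by simp
 have "T = dag C**e"
  using arg_cong[OF TC, of dag] T(2) eD Z_comm[of "dag C" e] CZ by (simp add: dag_simps is_projD)
 then have "T = ((1/2) *\<^sub>R (C + dag C))**e" using TC by (simp add: op_simps scaleR_2[symmetric])
 then show ?thesis
  by (intro that[of "(1/2) *\<^sub>R (C + dag C)"]) (use CZ in "simp_all add: dag_simps add.commute")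
qed

lemma abelian_central_pos:
 assumes e: "e \<in> M" "is_proj e" and c: "c \<in> Z" "dag c = c" "cov e**c = c" "pos (c**e)"
 shows "pos c"
proof -
 obtain q where q: "q : Z" "is_proj q" "!!R. R**c = c**R ==> R**q = q**R"
  "pos (q**c)" "pos (- ((\<one> - q)**c))"
  "c = oabs c**(q - (\<one> - q))" "oabs c = c**(q - (\<one> - q))"
  by (rule vna_spectral_projection[OF vna_Z c(1,2)], rule that)
 have zq: "zproj (\<one> - q)" using q by (intro zprojI is_proj_compl) simp_all
 have "pos ((\<one> - q)**(c**e))" using e c by (intro pos_zmult[OF zq]) simp_all
 moreover have "pos (dag e**- ((\<one> - q)**c)**e)" by (rule pos_conj[OF q(5)])
 moreover have "dag e**- ((\<one> - q)**c)**e = - ((\<one> - q)**(c**e))"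
 proof -
  have "(\<one> - q)**c : Z" using q c by simp
  then have "e**((\<one> - q)**c) = (\<one> - q)**c**e" by (rule Z_comm[OF _ e(1)])
  then have "e**((\<one> - q)**c)**e = (\<one> - q)**c**(e**e)" by (simp add: opm_assoc)
  then show ?thesis using e(2) by (simp add: is_projD opm.minus_left opm.minus_right opm_assoc)
 qed
 ultimately have "(\<one> - q)**(c**e) = 0" by (intro pos_antisym) auto
 then have "((\<one> - q)**c)**cov e = 0"
  by (intro cov_central_zero[OF e(1)]) (use q c in "simp_all add: opm_assoc")
 moreover have "c**cov e = c" using zproj_comm[OF cov_zproj[OF e(1)], of c] c by simp
 ultimately have "(\<one> - q)**c = 0" by (simp add: opm_assoc)
 then have "c = q**c" by (simp add: op_simps)
 then show ?thesis using q(4) by simp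
qed

text \<open>The central coefficient of \<open>e T e\<close>, normalized by the central cover of \<open>e\<close>.\<close>

lemma abelian_coeff:
 assumes e: "abelian_projection M e" and T: "T \<in> M" "dag T = T"
 obtains c where "c \<in> Z" "dag c = c" "e**T**e = c**e" "cov e**c = c"
proof -
 note eD = abelian_projectionD[OF e]
 have 1: "e**T**e : M" using eD T by simp
 have 2: "dag (e**T**e) = e**T**e" using eD T by (simp add: dag_simps is_projD opm_assoc)
 have 3: "e**(e**T**e) = e**T**e" using eD by (simp add: opm_assoc is_proj_absorb)
 obtain c where c: "c : Z" "dag c = c" "e**T**e = c**e"
  by (rule abelian_selfadj[OF e 1 2 3], rule that)
 have zc: "zproj (cov e)" by (rule cov_zproj[OF eD(1)])
 have comm: "cov e**c = c**cov e" using zproj_comm[OF zc, of c] c by simp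
 show ?thesis
 proof (rule that[of "cov e**c"])
  show "cov e**c : Z" using zc c by simp
  show "dag (cov e**c) = cov e**c" using zc c comm by (simp add: dag_simps)
  show "e**T**e = cov e**c**e" unfolding c(3) comm by (simp add: opm_assoc cov_absorb[OF eD(1)])
  show "cov e**(cov e**c) = cov e**c" using zc by (simp add: opm_assoc[symmetric])
 qed
qed

end

section \<open>Finite algebras of type I\<close>

context vn_algebra
begin

lemma abelian_projectionI:
 assumes "e \<in> M" "is_proj e"
  "\<And>S T. S \<in> M ==> T \<in> M ==> e**S = S ==> S**e = S ==> e**T = T ==> T**e = T ==> S**T = T**S"
 shows "abelian_projection M e"
 unfolding abelian_projection_def projections_M
proof (intro conjI ballI assms(1,2))
 fix S T assume "S : M" "T : M"
 then show "e**S**e**(e**T**e) = e**T**e**(e**S**e)"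
  using assms(1,2) by (intro assms(3)) (simp_all add: opm_assoc is_projD is_proj_absorb)
qed

lemma abelian_projection_zmult:
 assumes e: "abelian_projection M e" and w: "zproj w"
 shows "abelian_projection M (w**e)"
proof (rule abelian_projectionI)
 note eD = abelian_projectionD[OF e]
 show "w**e : M" using w eD by simp
 show "is_proj (w**e)" by (rule is_proj_zmult[OF w eD(1,2)])
 have we: "w**e = e**w" using zproj_comm[OF w eD(1)] by simp
 fix S T
 assume S: "S : M" "w**e**S = S" "S**(w**e) = S" and T: "T : M" "w**e**T = T" "T**(w**e) = T"
 have "e**S = S" "S**e = S" "e**T = T" "T**e = T"
  using S(2,3) T(2,3) eD(2) by (metis is_projD(1) opm_assoc we)+
 then show "S**T = T**S" using S(1) T(1) by (intro eD(3))
qed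

lemma partial_isometry_absorb:
 assumes "dag v **v = e" "is_proj e"
 shows "v **e = v"
proof -
 have "dag (v **(\<one> - e))**(v **(\<one> - e)) = (\<one> - e)**(dag v **v)**(\<one> - e)"
  using assms(2) by (simp add: dag_simps is_projD opm_assoc)
 also have "... = 0" unfolding assms(1) using assms(2) by (simp add: op_simps is_projD)
 finally have "v **(\<one> - e) = 0" by (rule dag_mult_zero)
 then show ?thesis by (simp add: op_simps)
qed

lemma partial_isometry_final:
 assumes "dag v **v = e" "is_proj e"
 shows "is_proj (v **dag v)"
 unfolding is_proj_def
proof
 have "v **dag v **(v **dag v) = v **(dag v **v)**dag v" by (simp add: opm_assoc)
 then show "v **dag v **(v **dag v) = v **dag v"
  unfolding assms(1) using partial_isometry_absorb[OF assms] by simp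
qed (simp add: dag_comp)

lemma partial_isometry_norm:
 assumes "dag v **v = e" "is_proj e"
 shows "norm v \<le> 1"
proof (rule norm_blinfun_bound)
 fix x
 have "(norm (v x))\<^sup>2 = (norm (e x))\<^sup>2"
  using norm_op_sq[of v x] assms is_proj_norm_apply[of e x] by simp
 also have "... <= (norm x)\<^sup>2" by (intro power_mono is_proj_contr assms) simp
 finally show "norm (v x) <= 1 * norm x" by (simp add: power2_le_iff_abs_le)
qed simp

lemma abelian_projection_equiv:
 assumes e: "abelian_projection M e" and v: "v \<in> M" "dag v **v = e"
 shows "abelian_projection M (v **dag v)"
proof (rule abelian_projectionI)
 note eD = abelian_projectionD[OF e]
 show "v **dag v : M" using v by simp
 show "is_proj (v **dag v)" by (rule partial_isometry_final[OF v(2) eD(2)])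
 fix S T
 assume S: "S : M" "v **dag v **S = S" "S**(v **dag v) = S"
  and T: "T : M" "v **dag v **T = T" "T**(v **dag v) = T"
 have ve: "v **e = v" by (rule partial_isometry_absorb[OF v(2) eD(2)])
 have ev: "e**dag v = dag v" using ve eD(2) by (metis dag_comp is_projD(2))
 have c: "(dag v **S**v)**(dag v **T**v) = (dag v **T**v)**(dag v **S**v)"
 proof (rule eD(3))
  show "dag v **S**v **e = dag v **S**v" "dag v **T**v **e = dag v **T**v"
   by (simp_all add: opm_assoc ve)
  show "e**(dag v **S**v) = dag v **S**v" "e**(dag v **T**v) = dag v **T**v"
   by (simp_all add: opm_assoc[symmetric] ev)
 qed (use S T v in simp_all)
 have expand: "v **((dag v **X**v)**(dag v **Y**v))**dag v = X**Y"
  if "v **dag v **X = X" "X**(v **dag v) = X" "Y**(v **dag v) = Y" for X Y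
 proof -
  have "v **((dag v **X**v)**(dag v **Y**v))**dag v = (v **dag v **X)**(v **dag v)**(Y**(v **dag v))"
   by (simp add: opm_assoc)
  then show ?thesis using that by simp
 qed
 show "S**T = T**S" using expand[OF S(2,3) T(3)] expand[OF T(2,3) S(3)] c by simp
qed

definition abel_sum :: "nat => ('a \<Rightarrow>\<^sub>L 'a) => bool" where
 "abel_sum n p \<longleftrightarrow> (\<exists>e. (\<forall>i<n. abelian_projection M (e i)) \<and> p = (\<Sum>i<n. e i))"

lemma abel_sum_zmult:
 assumes "abel_sum n p" "zproj w"
 shows "abel_sum n (w**p)"
proof -
 obtain e where "ALL i<n. abelian_projection M (e i)" "p = (\<Sum>i<n. e i)"
  using assms(1) by (auto simp: abel_sum_def)
 then show ?thesis unfolding abel_sum_def using assms(2)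
  by (intro exI[of _ "%i. w**e i"]) (simp add: abelian_projection_zmult opm.sum_right)
qed

lemma abel_sum_Suc:
 assumes "abel_sum n p" "abelian_projection M e"
 shows "abel_sum (Suc n) (p + e)"
proof -
 obtain f where "ALL i<n. abelian_projection M (f i)" "p = (\<Sum>i<n. f i)"
  using assms(1) by (auto simp: abel_sum_def)
 then show ?thesis unfolding abel_sum_def using assms(2)
  by (intro exI[of _ "f(n := e)"]) (auto simp: less_Suc_eq)
qed

text \<open>A central operator that is positive at some vector is bounded below on a central projection: cut at
 half of the value of its quadratic form.\<close>

lemma central_lower_bound:
 assumes c: "c \<in> Z" "dag c = c" and y: "0 < rin (c y) y"
 obtains q t where "zproj q" "0 < t" "pos (q**(c - t *\<^sub>R \<one>))" "(q**c) y \<noteq> 0"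
proof -
 define t where "t = rin (c y) y / (2 * (norm y)\<^sup>2)"
 have n0: "norm y ~= 0" using y by auto
 then have t: "0 < t" "t * (norm y)\<^sup>2 < rin (c y) y" using y by (simp_all add: t_def)
 have ct: "c - t *\<^sub>R \<one> : Z" "dag (c - t *\<^sub>R \<one>) = c - t *\<^sub>R \<one>" using c by (simp_all add: dag_simps)
 obtain q where q: "q : Z" "is_proj q" "!!R. R**(c - t *\<^sub>R \<one>) = (c - t *\<^sub>R \<one>)**R ==> R**q = q**R"
  "pos (q**(c - t *\<^sub>R \<one>))" "pos (- ((\<one> - q)**(c - t *\<^sub>R \<one>)))"
  "c - t *\<^sub>R \<one> = oabs (c - t *\<^sub>R \<one>)**(q - (\<one> - q))" "oabs (c - t *\<^sub>R \<one>) = (c - t *\<^sub>R \<one>)**(q - (\<one> - q))"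
  by (rule vna_spectral_projection[OF vna_Z ct], rule that)
 have "(q**c) y ~= 0"
 proof
  assume "(q**c) y = 0"
  then have "(- ((\<one> - q)**(c - t *\<^sub>R \<one>))) y = t *\<^sub>R (\<one> - q) y - c y"
   by (simp add: blinfun.diff_left blinfun.diff_right blinfun.minus_left blinfun.scaleR_left blinfun.scaleR_right algebra_simps)
  then have "rin (c y) y <= t * rin ((\<one> - q) y) y" using pos_ge[OF q(5), of y] by (simp add: rin_simps)
  also have "... <= t * rin (\<one> y) y"
   using op_leD[OF is_proj_le_one[OF is_proj_compl[OF q(2)]]] t(1) by (intro mult_left_mono) auto
  finally show False using t(2) by (simp add: rin_self)
 qed
 then show ?thesis by (rule that[OF zprojI[OF q(1,2)] t(1) q(4)])
qed

lemma abel_sum_finite: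
 assumes "finite F" "\<And>p. p \<in> F ==> abelian_projection M p"
 shows "abel_sum (card F) (\<Sum>p\<in>F. p)"
 using assms
proof (induction F rule: finite_induct)
 case empty
 then show ?case by (simp add: abel_sum_def)
next
 case (insert p F)
 then show ?case using abel_sum_Suc[of "card F" "\<Sum>p\<in>F. p" p] by (simp add: add.commute)
qed

text \<open>Polar decomposition of \<open>T = f S w e\<close>, carried out in the center: \<open>T\<^sup>* T = c e\<close>, and where \<open>c\<close> is
 bounded below, \<open>T c\<^sup>-\<^sup>1\<^sup>/\<^sup>2\<close> is a partial isometry.\<close>

lemma abelian_comparison_local:
 assumes e: "abelian_projection M e" and f: "f \<in> M" "is_proj f" and w: "zproj w"
  and S: "S \<in> M" "f**S**(w**e) \<noteq> 0"
 obtains w' v where "zproj w'" "w'**w = w'" "w'**e \<noteq> 0" "v \<in> M" "dag v **v = w'**e" "f**v = v"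
proof -
 note eD = abelian_projectionD[OF e]
 define T where "T = f**S**(w**e)"
 have TM: "T : M" using f S w eD by (simp add: T_def)
 have we: "w**e = e**w" using zproj_comm[OF w eD(1)] by simp
 have Te: "T**e = T" using eD(2) by (simp add: T_def opm_assoc is_projD)
 have Tw: "T**w = T" using w we by (simp add: T_def opm_assoc)
 have fT: "f**T = T" using f by (simp add: T_def opm_assoc is_proj_absorb)
 define D where "D = dag T**T"
 have D: "D : M" "dag D = D" "D ~= 0" "pos D"
 proof -
  have "T ~= 0" using S(2) by (simp only: T_def not_False_eq_True)
  then show "D : M" "dag D = D" "D ~= 0" "pos D"
   using TM dag_mult_zero[of T] pos_dag_mult[of T] by (auto simp: D_def dag_comp)
 qed
 have De: "D**e = D" using Te by (simp add: D_def opm_assoc)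
 then have eDD: "e**D = D" using D(2) eD(2) by (metis dag_comp is_projD(2))
 obtain c where c: "c : Z" "dag c = c" "D = c**e"
  by (rule abelian_selfadj[OF e D(1,2) eDD], rule that)
 obtain x where "rin (D x) x ~= 0" using selfadj_zero[OF D(2)] D(3) by blast
 then have "0 < rin (D x) x" using pos_ge[OF D(4), of x] by simp
 also have "rin (D x) x = rin (c (e x)) (e x)"
 proof -
  have "rin (D x) x = rin ((e**D) x) x" using eDD by simp
  also have "... = rin (D x) (e x)" using eD(2) by (simp add: rin_dag is_projD)
  also have "... = rin (c (e x)) (e x)" unfolding c(3) by simp
  finally show ?thesis .
 qed
 finally obtain q t where q: "zproj q" "0 < t" "pos (q**(c - t *\<^sub>R \<one>))" "(q**c) (e x) ~= 0"
  by (rule central_lower_bound[OF c(1,2)])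
 have qD: "q**D ~= 0"
 proof
  assume "q**D = 0"
  then have "((q**c)**e) x = 0" unfolding c(3) by (simp only: opm_assoc) simp
  then show False using q(4) by simp
 qed
 define A where "A = q**c + t *\<^sub>R (\<one> - q)"
 have qc: "q**c = c**q" using zproj_comm[OF q(1), of c] c by simp
 have A: "A : Z" "dag A = A" using q c qc by (simp_all add: A_def dag_simps)
 have "A - t *\<^sub>R \<one> = q**(c - t *\<^sub>R \<one>)" by (simp add: A_def op_simps algebra_simps)
 then have "t *\<^sub>R \<one> \<preceq> A" using q(3) by simp
 then obtain h where h: "h : Z" "dag h = h" "h**h**A = \<one>"
  using inverse_sqrt[OF vna_Z A, of t] q(2) by auto
 define v where "v = T**(h**q)"
 have qA: "A**q = c**q" using q(1) qc by (simp add: A_def op_simps)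
 have hhcq: "h**h**(c**q) = q" using h(3) qA by (metis opm_assoc opm_one(1))
 have hq: "h**q : Z" using h q by simp
 have qh: "q**h = h**q" using zproj_comm[OF q(1), of h] h by simp
 have "dag v **v = (q**h)**D**(h**q)"
  using h q by (simp add: v_def dag_simps D_def opm_assoc)
 also have "... = D**(h**q)**(h**q)" unfolding qh using Z_comm[OF hq D(1)] by (simp only: opm_assoc)
 also have "... = c**(e**(h**q))**(h**q)" unfolding c(3) by (simp only: opm_assoc)
 also have "... = c**((h**q)**(h**q))**e"
  using Z_comm[OF hq eD(1)] by (simp only: opm_assoc)
 also have "c**((h**q)**(h**q)) = q"
 proof -
  have "(h**q)**(h**q) = h**h**q" using qh q(1) by (metis opm_assoc zprojD(3))
  then have "c**((h**q)**(h**q)) = (h**h)**c**q"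
   using Z_comm[of "h**h" c] h c by (simp add: opm_assoc[symmetric])
  then show ?thesis using hhcq by (simp add: opm_assoc)
 qed
 finally have vv: "dag v **v = q**e" .
 have vw: "v **w = v" using Tw Z_comm[OF hq, of w] w unfolding v_def by (metis Z_M opm_assoc zprojD(1))
 have qew: "q**e = q**w**e" using vv vw we by (metis opm_assoc)
 have "q**e ~= 0"
 proof
  assume "q**e = 0"
  have "q**D = c**(q**e)" unfolding c(3) opm_assoc[symmetric] qc ..
  then show False using `q**e = 0` qD by (simp add: op_simps)
 qed
 then show ?thesis
  using that[of "q**w" v] zproj_mult[OF q(1) w] w qew vv fT TM hq
  by (simp add: opm_assoc v_def) (metis opm_assoc)
qed

lemma abelian_comparison:
 assumes e: "abelian_projection M e" and f: "f \<in> M" "is_proj f"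
  and cen: "\<And>w. zproj w ==> w \<noteq> 0 ==> w**cov e = w ==> w**f \<noteq> 0"
 obtains v where "v \<in> M" "dag v **v = e" "f**v = v"
proof -
 note eD = abelian_projectionD[OF e]
 have zc: "zproj (cov e)" by (rule cov_zproj[OF eD(1)])
 define P where "P = (%w. EX v:M. dag v **v = w**e & f**v = v)"
 have loc: "EX w'. zproj w' & w' ~= 0 & w'**w = w' & P w'" if w: "zproj w" "w ~= 0" "w**cov e = w" for w
 proof -
  have weM: "w**e : M" using w eD by simp
  have we0: "w**e ~= 0" using cov_central_zero[OF eD(1), of w] w by auto
  have "EX S:M. f**(S**(w**e)) ~= 0"
  proof (rule ccontr)
   assume "~ ?thesis"
   then have 0: "f**cov (w**e) = 0" by (intro cov_zero[OF weM f(1)]) auto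
   have zw: "zproj (cov (w**e))" by (rule cov_zproj[OF weM])
   have "cov (w**e)**cov e = cov (w**e)"
   proof (rule cov_le[OF weM zc])
    have "cov e**(w**e) = w**(cov e**e)" using zproj_comm[OF zc, of w] w(1) by (simp add: opm_assoc[symmetric])
    then show "cov e**(w**e) = w**e" using cov_absorb[OF eD(1)] by simp
   qed
   then have "cov (w**e)**f ~= 0" by (intro cen zw cov_nonzero weM we0)
   then show False using 0 zproj_comm[OF zw f(1)] by simp
  qed
  then obtain S where S: "S : M" "f**S**(w**e) ~= 0" by (auto simp: opm_assoc)
  obtain w' v where "zproj w'" "w'**w = w'" "w'**e ~= 0" "v : M" "dag v **v = w'**e" "f**v = v"
   by (rule abelian_comparison_local[OF e f w(1) S], rule that)
  then show ?thesis unfolding P_def by (intro exI[of _ w']) auto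
 qed
 obtain F where F: "!!w. w : F ==> zproj w & w ~= 0 & w**cov e = w & P w"
  "!!w w'. w : F ==> w' : F ==> w ~= w' ==> w**w' = 0"
  "!!x. ((%w. blinfun_apply w x) has_sum cov e x) F"
  by (rule central_exhaustion[of "cov e" P, OF zc loc], assumption+, rule that)
 define v where "v = (%w. SOME v. v : M & dag v **v = w**e & f**v = v)"
 have v: "v w : M" "dag (v w)**v w = w**e" "f**v w = v w" if "w : F" for w
 proof -
  have "EX v. v : M & dag v **v = w**e & f**v = v" using F(1)[OF that] unfolding P_def by blast
  from someI_ex[OF this] show "v w : M" "dag (v w)**v w = w**e" "f**v w = v w" unfolding v_def by blast+
 qed
 have prj: "is_proj (w**e)" if "w : F" for w using F(1)[OF that] eD by (intro is_proj_zmult) auto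
 have vw: "v w**w = v w" if w: "w : F" for w
 proof -
  have "v w**(w**e) = v w" by (rule partial_isometry_absorb[OF v(2)[OF w] prj[OF w]])
  then show ?thesis using zproj_comm[of w e] F(1)[OF w] eD(1) by (metis opm_assoc zprojD(3))
 qed
 obtain L where L: "L : M" "!!w. w : F ==> L**w = v w" "L**cov e = L" "norm L <= 1"
 proof (rule central_gluing[of F v 1 "cov e"])
  show "v w : M & v w**w = v w & norm (v w) <= 1" if "w : F" for w
   using v[OF that] vw[OF that] partial_isometry_norm[OF v(2)[OF that] prj[OF that]] by simp
 qed (use F zc in "auto")
 show ?thesis
 proof (rule that[OF L(1)])
  have "dag L**L**cov e = e**cov e"
  proof (rule has_sum_op_eqI[OF F(3)])
   fix w assume w: "w : F"
   have zw: "zproj w" using F(1)[OF w] by simp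
   have "dag L**L**w = dag L**L**w**w" using zw by (simp add: opm_assoc)
   also have "... = w**(dag L**L)**w"
    unfolding zproj_comm[OF zw vna_comp[OF vna_M vna_dag[OF vna_M L(1)] L(1)]] ..
   also have "w**(dag L**L)**w = dag (L**w)**(L**w)" using zw by (simp add: dag_comp opm_assoc)
   also have "... = e**w" using L(2)[OF w] v(2)[OF w] zproj_comm[OF zw eD(1)] by simp
   finally show "dag L**L**w = e**w" .
  qed
  then show "dag L**L = e"
   using L(3) cov_absorb[OF eD(1)] zproj_comm[OF zc eD(1)] by (simp add: opm_assoc)
  have "f**L**cov e = L**cov e"
   by (rule has_sum_op_eqI[OF F(3)]) (simp add: opm_assoc L(2) v(3))
  then show "f**L = L" using L(3) by (simp add: opm_assoc)
 qed
qed

lemma finite_isometry: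
 assumes fin: "finite_projection M \<one>" and v: "v \<in> M" "dag v **v = \<one>"
 shows "v **dag v = \<one>"
proof -
 have "is_proj (v **dag v)"
  by (rule partial_isometry_final[OF v(2)]) (simp add: is_proj_def)
 then have "v **dag v : projections M" using v by (simp add: projections_M)
 moreover have "proj_equiv M \<one> (v **dag v)"
 proof -
  have "is_adjoint v (dag v)" by (simp only: is_adjoint_M[OF v(1)])
  then show ?thesis
   unfolding proj_equiv_def using v by (intro bexI[of _ v] bexI[of _ "dag v"] conjI) (simp_all only: vna_dag[OF vna_M])
 qed
 ultimately show ?thesis using fin by (simp add: finite_projection_def proj_le_def)
qed

text \<open>An infinite sequence of mutually orthogonal projections \<open>v\<^sub>n v\<^sub>n\<^sup>*\<close> that are equivalent to one
 nonzero projection yields the shift, a nonunitary isometry.\<close>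

lemma no_orthogonal_copies:
 assumes fin: "finite_projection M \<one>" and e: "is_proj e" "e \<noteq> 0"
  and v: "\<And>n::nat. v n \<in> M" "\<And>n. dag (v n)**v n = e" "\<And>m n. m \<noteq> n ==> dag (v m)**v n = 0"
 shows False
proof -
 define p where "p = (%n. v n**dag (v n))"
 have p: "is_proj (p n)" for n unfolding p_def by (rule partial_isometry_final[OF v(2) e(1)])
 have po: "p m**p n = 0" if "m ~= n" for m n
 proof -
  have "p m**p n = v m**(dag (v m)**v n)**dag (v n)" by (simp add: p_def opm_assoc)
  then show ?thesis using v(3)[OF that] by (simp add: op_simps)
 qed
 have ve: "v n**e = v n" for n by (rule partial_isometry_absorb[OF v(2) e(1)])
 have ev: "e**dag (v n) = dag (v n)" for n using ve[of n] e(1) by (metis dag_comp is_projD(2))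
 have pv: "p m**v n = (if m = n then v n else 0)" for m n
  using v(3)[of m n] v(2)[of n] ve[of n] by (simp add: p_def opm_assoc op_simps)
 have vn: "norm (v n) <= 1" for n by (rule partial_isometry_norm[OF v(2) e(1)])
 have "EX E :: 'a \<Rightarrow>\<^sub>L 'a. (ALL x. ((%n. p n x) has_sum blinfun_apply E x) UNIV) & norm E <= 1"
  by (rule orthogonal_sum_op[of UNIV p p]) (auto simp: p po is_projD is_proj_norm)
 then obtain E :: "'a \<Rightarrow>\<^sub>L 'a" where E: "!!x. ((%n. p n x) has_sum blinfun_apply E x) UNIV" by blast
 define T where "T = (%n. v (Suc n)**dag (v n))"
 have "EX A :: 'a \<Rightarrow>\<^sub>L 'a. (ALL x. ((%n. T n x) has_sum blinfun_apply A x) UNIV) & norm A <= 1"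
 proof (rule orthogonal_sum_op[of UNIV p "%n. p (Suc n)"])
  show "T n**p n = T n" for n
   using v(2)[of n] ev[of n] by (simp add: T_def p_def) (metis opm_assoc)
  show "p (Suc n)**T n = T n" for n
   using pv[of "Suc n" "Suc n"] by (simp add: T_def opm_assoc[symmetric])
  show "norm (T n) <= 1" for n
  proof -
   have "norm (dag (v n)) <= 1"
   proof -
    have "dag (dag (v n))**dag (v n) = p n" by (simp add: p_def)
    then show ?thesis by (rule partial_isometry_norm[OF _ p])
   qed
   then have "norm (v (Suc n)) * norm (dag (v n)) <= 1 * 1" by (intro mult_mono vn) auto
   then show ?thesis unfolding T_def using norm_comp_le order_trans by fastforce
  qed
 qed (auto simp: p po)
 then obtain A :: "'a \<Rightarrow>\<^sub>L 'a" where A: "!!x. ((%n. T n x) has_sum blinfun_apply A x) UNIV" by blast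
 have EM: "E : M" by (rule vna_has_sum[OF vna_M _ E]) (use v in "simp add: p_def")
 have AM: "A : M" by (rule vna_has_sum[OF vna_M _ A]) (use v in "simp add: T_def")
 have sumL: "S (B x) = C x" if "((%n. blinfun_apply (X n) x) has_sum B x) UNIV"
  "((%n. blinfun_apply (Y n) x) has_sum C x) UNIV" "!!n. S**X n = Y n"
  for S B C :: "'a \<Rightarrow>\<^sub>L 'a" and X Y :: "nat => 'a \<Rightarrow>\<^sub>L 'a" and x
 proof -
  have "((%n. S (blinfun_apply (X n) x)) has_sum S (B x)) UNIV"
   by (rule has_sum_bounded_linear[OF blinfun.bounded_linear_right that(1)])
  then have "((%n. blinfun_apply (Y n) x) has_sum S (B x)) UNIV"
   by (simp add: that(3)[symmetric])
  then show ?thesis using that(2) by (rule has_sum_unique)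
 qed
 have dE: "dag E = E"
 proof (rule dag_unique)
  fix x y
  have "((%n. rin (p n x) y) has_sum rin (E x) y) UNIV"
   by (rule has_sum_bounded_linear[OF bounded_bilinear.bounded_linear_left[OF bounded_bilinear_rin] E])
  moreover have "((%n. rin x (p n y)) has_sum rin x (E y)) UNIV"
   by (rule has_sum_bounded_linear[OF bounded_bilinear.bounded_linear_right[OF bounded_bilinear_rin] E])
  moreover have "rin x (p n y) = rin (p n x) y" for n using is_projD(2)[OF p[of n]] by (metis rin_dag)
  ultimately show "rin (E x) y = rin x (E y)" by (simp add: has_sum_unique)
 qed
 have Ev: "E**v n = v n" for n
 proof (rule blinfun_eqI)
  fix x
  have "((%m. p m (v n x)) has_sum v n x) UNIV"
  proof (rule has_sum_finite_neutralI[of "{n}"])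
   show "p m (v n x) = 0" if "m : UNIV - {n}" for m
    using pv[of m n] that by (metis Diff_iff blinfun.zero_left insertI1 op_apply_assoc)
   show "v n x = (\<Sum>m\<in>{n}. p m (v n x))" using pv[of n n] by (simp add: op_apply_assoc[symmetric] del: blinfun_apply_blinfun_compose)
  qed auto
  from has_sum_unique[OF E[of "v n x"] this] show "(E**v n) x = v n x" by simp
 qed
 have EE: "E**E = E"
  by (rule blinfun_eqI, simp, rule sumL[OF E E]) (use Ev in "simp add: p_def opm_assoc[symmetric]")
 have EA: "E**A = A"
  by (rule blinfun_eqI, simp, rule sumL[OF A A]) (use Ev in "simp add: T_def opm_assoc[symmetric]")
 have dAv: "dag A**v n = (if n = 0 then 0 else v (n - 1))" for n
 proof (rule op_eqI_rin)
  fix y x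
  have TT: "rin (T k x) (v n y) = (if n = Suc k then rin x (v k y) else 0)" for k
  proof -
   have "rin (T k x) (v n y) = rin x ((dag (T k)**v n) y)" by (simp add: rin_dag)
   also have "dag (T k)**v n = v k**(dag (v (Suc k))**v n)" by (simp add: T_def dag_simps opm_assoc)
   also have "... = (if n = Suc k then v k else 0)" using v(3)[of "Suc k" n] v(2)[of n] ve[of k] by (auto simp: op_simps)
   finally show ?thesis by auto
  qed
  have 1: "((%k. rin (T k x) (v n y)) has_sum rin (A x) (v n y)) UNIV"
   by (rule has_sum_bounded_linear[OF bounded_bilinear.bounded_linear_left[OF bounded_bilinear_rin] A])
  have 2: "((%k. rin (T k x) (v n y)) has_sum (if n = 0 then 0 else rin x (v (n - 1) y))) UNIV"
   by (rule has_sum_finite_neutralI[of "if n = 0 then {} else {n - 1}"]) (auto simp: TT)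
  have "rin (A x) (v n y) = (if n = 0 then 0 else rin x (v (n - 1) y))" by (rule has_sum_unique[OF 1 2])
  moreover have "rin ((dag A**v n) y) x = rin (A x) (v n y)"
   unfolding rin_dag[of A] rin_commute[of _ x] by simp
  ultimately show "rin ((dag A**v n) y) x = rin ((if n = 0 then 0 else v (n - 1)) y) x"
   by (cases "n = 0") (simp_all add: rin_commute[of x])
 qed
 have AA: "dag A**A = E"
  by (rule blinfun_eqI, simp, rule sumL[OF A E]) (simp add: T_def p_def opm_assoc[symmetric] dAv)
 define V where "V = A + (\<one> - E)"
 have dAE: "dag A**E = dag A" using arg_cong[OF EA, of dag] by (simp add: dag_comp dE)
 have "dag V**V = \<one>"
  unfolding V_def using AA EA dAE EE dE by (simp add: dag_simps op_simps)
 moreover have "V : M" using AM EM by (simp add: V_def)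
 ultimately have "V**dag V = \<one>" by (intro finite_isometry fin)
 moreover have "dag V**v 0 = 0" unfolding V_def using dAv[of 0] Ev[of 0] dE by (simp add: dag_simps op_simps)
 ultimately have "v 0 = V**0" by (metis opm_assoc opm_one(1))
 then show False using v(2)[of 0] e(2) by (simp add: op_simps)
qed

end

context vn_algebra
begin

text \<open>Take a maximal orthogonal family of copies of an abelian projection \<open>e\<close>. It is finite, since \<open>M\<close> is
 finite. If its sum had a remainder \<open>f\<close> that vanishes on no central projection below the central cover of
 \<open>e\<close>, the comparison with \<open>e\<close> would give one more copy below \<open>f\<close>.\<close>

lemma type_I_fin_local:
 assumes I: "type_I_fin M" and z: "zproj z" "z \<noteq> 0"
 obtains w n where "zproj w" "w \<noteq> 0" "w**z = w" "abel_sum n w"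
proof -
 have fin: "finite_projection M \<one>" and tI: "type_I M" using I by (auto simp: type_I_fin_def)
 have "EX e. abelian_projection M e & e ~= 0 & proj_le e z"
  using tI z by (simp add: type_I_def projections_Z)
 then obtain e where e: "abelian_projection M e" "e ~= 0" "z**e = e" unfolding proj_le_def by blast
 note eD = abelian_projectionD[OF e(1)]
 define c where "c = cov e"
 have c: "zproj c" "c**e = e" unfolding c_def using cov_zproj cov_absorb eD by auto
 have cz: "c**z = c" unfolding c_def by (rule cov_le[OF eD(1) z(1) e(3)])
 define S where "S = {p. EX v:M. dag v **v = e & v **dag v = p & c**v = v}"
 have S: "p : M" "is_proj p" "abelian_projection M p" "c**p = p" "p ~= 0" if "p : S" for p
 proof -
  obtain v where v: "v : M" "dag v **v = e" "v **dag v = p" "c**v = v" using `p : S` unfolding S_def by blast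
  show "p : M" "is_proj p" "abelian_projection M p"
   using v partial_isometry_final[OF v(2) eD(2)] abelian_projection_equiv[OF e(1) v(1,2)] by auto
  show "c**p = p" using v(3,4) by (metis opm_assoc)
  have "e = dag v **p**v" using v(2) eD(2) unfolding v(3)[symmetric] by (metis opm_assoc is_projD(1))
  then show "p ~= 0" using e(2) by (auto simp: opm.zero_left opm.zero_right)
 qed
 obtain F where F: "F <= S" "orthogonal_family F" "!!p. p : S ==> ALL q:F. p**q = 0 & q**p = 0 ==> p : F"
  by (rule maximal_orthogonal_family, rule that)
 have Fo: "p**q = 0" if "p : F" "q : F" "p ~= q" for p q using F(2) that by (simp add: orthogonal_family_def)
 have fF: "finite F"
 proof (rule ccontr)
  assume "infinite F"
  then obtain f :: "nat => 'a \<Rightarrow>\<^sub>L 'a" where f: "inj f" "range f <= F" using infinite_countable_subset by blast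
  have "ALL n. EX v. v : M & dag v **v = e & v **dag v = f n" using f(2) F(1) unfolding S_def by blast
  from choice[OF this] obtain v where v: "!!n. v n : M" "!!n. dag (v n)**v n = e" "!!n. v n**dag (v n) = f n" by blast
  have "dag (v m)**v n = 0" if "m ~= n" for m n
  proof -
   have "f m**f n = 0" using f that by (intro Fo) (auto simp: inj_eq)
   moreover have "dag (v m)**(f m**f n)**v n = (dag (v m)**v m)**dag (v m)**(v n**(dag (v n)**v n))"
    unfolding v(3)[symmetric] by (simp only: opm_assoc)
   moreover have ve: "v n**e = v n" for n by (rule partial_isometry_absorb[OF v(2) eD(2)])
   moreover have "e**dag (v m) = dag (v m)" using arg_cong[OF ve[of m], of dag] eD(2) by (simp add: dag_comp is_projD)
   ultimately show ?thesis unfolding v(2) by (simp add: opm.zero_left opm.zero_right)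
  qed
  then show False by (rule no_orthogonal_copies[OF fin eD(2) e(2) v(1,2)])
 qed
 define s where "s = (\<Sum>p\<in>F. p)"
 have s: "s : M" "is_proj s" "c**s = s" "abel_sum (card F) s"
 proof -
  show "s : M" unfolding s_def using F(1) S(1) by (intro vna_sum[OF vna_M]) blast
  show "is_proj s" unfolding s_def using F(1) S(2) Fo by (intro is_proj_sum fF) blast+
  show "c**s = s" unfolding s_def opm.sum_right using F(1) S(4) by (intro sum.cong) auto
  show "abel_sum (card F) s" unfolding s_def using F(1) S(3) by (intro abel_sum_finite fF) blast
 qed
 have sc: "s**c = s" using zproj_comm[OF c(1) s(1)] s(3) by simp
 define f where "f = c - s"
 have f: "f : M" "is_proj f" using c s sc by (simp_all add: f_def is_proj_def dag_simps op_simps)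
 have sf: "s**f = 0" and cf: "c**f = f" using s sc c by (simp_all add: f_def op_simps is_projD)
 show ?thesis
 proof (cases "EX w. zproj w & w ~= 0 & w**c = w & w**f = 0")
  case True
  then obtain w where w: "zproj w" "w ~= 0" "w**c = w" "w**f = 0" by blast
  have "w = w**s" using w(3,4) by (simp add: f_def op_simps)
  then have "abel_sum (card F) w" using abel_sum_zmult[OF s(4) w(1)] by simp
  moreover have "w**z = w" using w(3) cz by (metis opm_assoc)
  ultimately show ?thesis using that w by blast
 next
  case False
  have "EX v. v : M & dag v **v = e & f**v = v"
   by (rule abelian_comparison[OF e(1) f]) (use False c_def in blast)+
  then obtain v where v: "v : M" "dag v **v = e" "f**v = v" by blast
  define p where "p = v **dag v"
  have "c**v = v" using v(3) cf by (metis opm_assoc)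
  then have pS: "p : S" unfolding S_def p_def using v by blast
  have fp: "f**p = p" using v(3) by (simp add: p_def opm_assoc[symmetric])
  have "p**q = 0 & q**p = 0" if q: "q : F" for q
  proof -
   have "q**s = q**q" unfolding s_def opm.sum_right using q fF Fo[OF q]
    by (subst sum.remove[OF fF q]) (auto intro!: sum.neutral)
   then have "q**s = q" using S(2) q F(1) by (auto simp: is_projD)
   then have 0: "q**p = 0" using fp sf by (metis opm_assoc opm.zero_left opm.zero_right)
   have "is_proj q" using S(2) q F(1) by blast
   then have "p**q = dag (q**p)" using S(2)[OF pS] by (simp add: dag_comp is_projD)
   then show ?thesis using 0 by simp
  qed
  then have "p : F" "p**p = 0" using F(3)[OF pS] by blast+
  then show ?thesis using S(2,5)[OF pS] by (simp add: is_projD)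
 qed
qed

text \<open>A projection without nonzero abelian subprojections splits into two parts with the same central
 cover.\<close>

lemma halving_projection:
 assumes p: "p \<in> M" "is_proj p" and na: "\<And>e. abelian_projection M e ==> p**e = e ==> e = 0"
 obtains p' where "p' \<in> M" "is_proj p'" "p**p' = p'"
  "\<And>w. zproj w ==> w**p \<noteq> 0 ==> w**p' \<noteq> 0 \<and> w**(p - p') \<noteq> 0"
proof -
 define Q where "Q = (%w r. r : M & is_proj r & p**r = r & r**w = r &
  (ALL w'. zproj w' & w' ~= 0 & w'**w = w' --> w'**r ~= 0 & w'**(p - r) ~= 0))"
 have zc: "zproj (cov p)" by (rule cov_zproj[OF p(1)])
 have loc: "EX w'. zproj w' & w' ~= 0 & w'**w = w' & (EX r. Q w' r)"
  if w: "zproj w" "w ~= 0" "w**cov p = w" for w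
 proof -
  have wp: "w**p : M" "is_proj (w**p)" using w p by (auto intro: is_proj_zmult)
  have wp0: "w**p ~= 0" using cov_central_zero[OF p(1), of w] w by auto
  have wpc: "p**(w**p) = w**p" using zproj_comm[OF w(1) p(1)] p(2) by (metis is_projD(1) opm_assoc)
  have nab: "~ abelian_projection M (w**p)" using na[OF _ wpc] wp0 by blast
  obtain r R where r: "r : M" "is_proj r" "w**p**r = r" "R : M" "(w**p - r)**(R**r) ~= 0"
   by (rule noncentral_subprojection[OF wp nab], rule that)
  define c where "c = cov r"
  have c: "zproj c" "c**r = r" unfolding c_def using cov_zproj cov_absorb r by auto
  have cw: "c**w = c" unfolding c_def
   by (rule cov_le[OF r(1) w(1)]) (metis opm_assoc r(3) w(1) zprojD(3))
  define d where "d = (w**p - r)**c"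
  have dM: "d : M" using wp r c by (simp add: d_def)
  have d0: "d ~= 0"
  proof
   assume "d = 0"
   have "(w**p - r)**(R**r) = (w**p - r)**(R**c)**r" using c(2) by (simp only: opm_assoc)
   also have "... = d**(R**r)" unfolding zproj_comm[OF c(1) r(4)] d_def by (simp only: opm_assoc)
   finally show False using r(5) `d = 0` by (simp add: opm.zero_left)
  qed
  define w2 where "w2 = cov d"
  have w2: "zproj w2" "w2 ~= 0" unfolding w2_def using cov_zproj dM cov_nonzero d0 by auto
  have "c**d = d" using zproj_comm[OF c(1) dM] c(1) by (simp add: d_def opm_assoc)
  then have w2c: "w2**c = w2" unfolding w2_def by (intro cov_le dM c)
  have rw2: "r**w2 = w2**r" by (rule zproj_comm[OF w2(1) r(1)])
  have pr: "p**r = r" using r(3) wpc by (metis opm_assoc)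
  have "Q w2 (w2**r)" unfolding Q_def
  proof (intro conjI allI impI)
   show "w2**r : M" using w2 r by simp
   show "is_proj (w2**r)" by (rule is_proj_zmult[OF w2(1) r(1,2)])
   show "p**(w2**r) = w2**r" using pr rw2 by (metis opm_assoc)
   show "w2**r**w2 = w2**r" using rw2 w2(1) by (metis opm_assoc zprojD(3))
   fix w' assume w': "zproj w' & w' ~= 0 & w'**w2 = w'"
   have w'c: "w'**c = w'" using w' w2c by (metis opm_assoc)
   show "w'**(w2**r) ~= 0"
   proof
    assume "w'**(w2**r) = 0"
    then have "w'**r = 0" using w' by (metis opm_assoc)
    then have "w'**c = 0" unfolding c_def using w' by (intro cov_central_zero r) auto
    then show False using w'c w' by simp
   qed
   show "w'**(p - w2**r) ~= 0"
   proof
    assume 0: "w'**(p - w2**r) = 0"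
    have w'w: "w'**w = w'" using w'c cw by (metis opm_assoc)
    have "w'**(w**p - r) = w'**(p - w2**r)"
     using w' w'w by (simp add: opm.diff_right opm_assoc[symmetric])
    then have "w'**d = 0" using 0 unfolding d_def by (simp add: opm_assoc[symmetric] opm.zero_left)
    then have "w'**w2 = 0" unfolding w2_def using w' by (intro cov_central_zero dM) auto
    then show False using w' by simp
   qed
  qed
  moreover have "w2**w = w2" using w2c cw by (metis opm_assoc)
  ultimately show ?thesis using w2 by blast
 qed
 obtain F where F: "!!w. w : F ==> zproj w & w ~= 0 & w**cov p = w & (EX r. Q w r)"
  "!!w w'. w : F ==> w' : F ==> w ~= w' ==> w**w' = 0"
  "!!x. ((%w. blinfun_apply w x) has_sum cov p x) F"
  by (rule central_exhaustion[of "cov p" "%w. EX r. Q w r", OF zc loc], assumption+, rule that)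
 define r where "r = (%w. SOME r. Q w r)"
 have r: "Q w (r w)" if "w : F" for w
  unfolding r_def by (rule someI_ex) (use F(1)[OF that] in blast)
 obtain L where L: "L : M" "!!w. w : F ==> L**w = r w" "L**cov p = L" "norm L <= 1"
 proof (rule central_gluing[of F r 1 "cov p"])
  show "r w : M & r w**w = r w & norm (r w) <= 1" if "w : F" for w
   using r[OF that] is_proj_norm by (auto simp: Q_def)
 qed (use F zc in auto)
 have wL: "w**L = r w" if "w : F" for w
  using L(2)[OF that] zproj_comm[of w L] F(1)[OF that] L(1) by simp
 have eqI: "S = T" if "!!w. w : F ==> S**w = T**w" "S**cov p = S" "T**cov p = T"
  for S T :: "'a \<Rightarrow>\<^sub>L 'a"
  using has_sum_op_eqI[OF F(3), of S T] that by simp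
 have cL: "cov p**L = L" using zproj_comm[OF zc L(1)] L(3) by simp
 have LL: "L**L = L"
 proof (rule eqI)
  fix w assume w: "w : F"
  have "L**L**w = L**(w**r w)" using L(2)[OF w] r[OF w] zproj_comm[of w "r w"] F(1)[OF w] by (auto simp: Q_def opm_assoc)
  also have "... = r w**r w" using L(2)[OF w] by (simp add: opm_assoc[symmetric])
  also have "... = L**w" using L(2)[OF w] r[OF w] by (auto simp: Q_def is_projD)
  finally show "L**L**w = L**w" .
 qed (simp_all add: opm_assoc L(3))
 have dL: "dag L = L"
 proof (rule eqI)
  show "dag L**w = L**w" if w: "w : F" for w
  proof -
   have "dag L**w = dag (w**L)" using F(1)[OF w] by (simp add: dag_comp)
   also have "... = L**w" using wL[OF w] L(2)[OF w] r[OF w] by (auto simp: Q_def is_projD)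
   finally show ?thesis .
  qed
  have "dag (cov p**L) = dag L" using cL by simp
  then show "dag L**cov p = dag L" using zc by (simp add: dag_comp)
 qed (rule L(3))
 have pL: "p**L = L"
 proof (rule eqI)
  show "p**L**w = L**w" if "w : F" for w
   using L(2)[OF that] r[OF that] by (auto simp: Q_def opm_assoc)
 qed (simp_all add: opm_assoc L(3))
 show ?thesis
 proof (rule that[of L])
  show "is_proj L" using LL dL by (simp add: is_proj_def)
  fix v assume v: "zproj v" "v **p ~= 0"
  have "EX w:F. v **w ~= 0"
  proof (rule ccontr)
   assume "~ ?thesis"
   then have "v **cov p = 0**cov p" by (intro has_sum_op_eqI[OF F(3)]) (simp add: opm.zero_left)
   then have "v **p = 0" using cov_absorb[OF p(1)] by (metis opm_assoc opm.zero_left)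
   then show False using v by simp
  qed
  then obtain w where w: "w : F" "v **w ~= 0" by blast
  have zw: "zproj w" using F(1)[OF w(1)] by simp
  have vw: "zproj (v **w)" "v **w**w = v **w" using zproj_mult[OF v(1) zw] zw by (simp_all add: opm_assoc)
  then have 1: "v **w**r w ~= 0" "v **w**(p - r w) ~= 0" using r[OF w(1)] w(2) unfolding Q_def by blast+
  have 2: "v **w**r w = w**(v **L)"
  proof -
   have "w**(v **L) = v **w**L" using zproj_comm[OF zw, of v] v by (simp add: opm_assoc[symmetric])
   also have "... = v **(w**(w**L))" using zw by (simp add: is_proj_absorb opm_assoc)
   finally show ?thesis using wL[OF w(1)] by (simp add: opm_assoc)
  qed
  have 3: "v **w**(p - r w) = w**(v **(p - L))"
  proof -
   have "w**(v **p) = v **w**p" using zproj_comm[OF zw, of v] v by (simp add: opm_assoc[symmetric])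
   then show ?thesis using 2 by (simp add: opm.diff_right)
  qed
  show "v **L ~= 0 & v **(p - L) ~= 0" using 1 unfolding 2 3 by (auto simp: opm.zero_right)
 qed (use L pL in simp_all)
qed

text \<open>If \<open>M\<close> is not finite of type I, there is a decreasing sequence of projections all of whose
 increments have central support above a fixed nonzero central projection.\<close>

lemma not_type_I_fin_sequence:
 assumes "\<not> type_I_fin M"
 obtains q :: "nat => 'a \<Rightarrow>\<^sub>L 'a" and z where "\<And>n. q n \<in> M" "\<And>n. is_proj (q n)" "\<And>n. q n**q (Suc n) = q (Suc n)"
  "zproj z" "z \<noteq> 0" "\<And>w n. zproj w ==> w \<noteq> 0 ==> w**z = w ==> w**(q n - q (Suc n)) \<noteq> 0"
proof (cases "finite_projection M \<one>")
 case False
 have "\<one> : projections M" by (simp add: projections_M is_proj_def)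
 with False obtain q where q: "q : projections M" "proj_equiv M \<one> q" "q ~= \<one>"
  by (auto simp: finite_projection_def)
 then obtain v u where uv: "v : M" "is_adjoint v u" "u**v = \<one>" "v **u = q"
  unfolding proj_equiv_def by blast
 then have "u = dag v" by (simp only: is_adjoint_M)
 with uv have v: "v : M" "dag v **v = \<one>" "v **dag v = q" by simp_all
 define V where "V = opow v"
 have V: "V n : M" "dag (V n)**V n = \<one>" for n
 proof (induction n)
  case (Suc n)
  case 1 show ?case using v Suc by (simp add: V_def)
  case 2
  have "dag (V (Suc n))**V (Suc n) = dag (V n)**(dag v **v)**V n"
   by (simp add: V_def dag_comp opm_assoc)
  then show ?case using v(2) Suc by simp
 qed (simp_all add: V_def)
 have VS: "V (Suc n) = V n**v" for n by (simp add: V_def opow_commute)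
 have id: "is_proj (\<one> :: 'a \<Rightarrow>\<^sub>L 'a)" by (simp add: is_proj_def)
 define Q where "Q = (%n. V n**dag (V n))"
 have diff: "Q n - Q (Suc n) = V n**(\<one> - q)**dag (V n)" for n
  unfolding Q_def VS v(3)[symmetric] by (simp add: dag_comp op_simps)
 have qM: "\<one> - q : M" "\<one> - q ~= 0" using q by (simp_all add: projections_M)
 show ?thesis
 proof (rule that[of Q "cov (\<one> - q)"])
  show "Q n : M" for n using V by (simp add: Q_def)
  show "is_proj (Q n)" for n unfolding Q_def by (rule partial_isometry_final[OF V(2) id])
  show "Q n**Q (Suc n) = Q (Suc n)" for n
  proof -
   have "Q n**Q (Suc n) = V n**(dag (V n)**V n)**v **dag (V (Suc n))" by (simp add: Q_def VS opm_assoc)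
   then show ?thesis using V(2)[of n] by (simp add: Q_def VS)
  qed
  show "zproj (cov (\<one> - q))" "cov (\<one> - q) ~= 0" using qM cov_zproj cov_nonzero by auto
  fix w n assume w: "zproj w" "w ~= 0" "w**cov (\<one> - q) = w"
  show "w**(Q n - Q (Suc n)) ~= 0"
  proof
   assume 0: "w**(Q n - Q (Suc n)) = 0"
   have "w**(\<one> - q) = w**(dag (V n)**V n)**(\<one> - q)**(dag (V n)**V n)" using V(2) by simp
   also have "... = (w**dag (V n))**(V n**(\<one> - q)**dag (V n))**V n" by (simp only: opm_assoc)
   also have "w**dag (V n) = dag (V n)**w" using zproj_comm[OF w(1), of "dag (V n)"] V by simp
   also have "dag (V n)**w**(V n**(\<one> - q)**dag (V n))**V n = dag (V n)**(w**(Q n - Q (Suc n)))**V n"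
    unfolding diff by (simp only: opm_assoc)
   finally have "w**(\<one> - q) = 0" unfolding 0 by (simp add: opm.zero_left opm.zero_right)
   then have "w**cov (\<one> - q) = 0" using w by (intro cov_central_zero qM) auto
   then show False using w by simp
  qed
 qed
next
 case True
 with assms obtain z where z: "zproj z" "z ~= 0" "!!p. abelian_projection M p ==> z**p = p ==> p = 0"
 proof -
  have "~ (ALL z. zproj z --> z ~= 0 --> (EX p. abelian_projection M p & p ~= 0 & z**p = p))"
   using True assms by (simp add: type_I_fin_def type_I_def projections_Z proj_le_def Ball_def)
  then show thesis using that by blast
 qed
 define P where "P = (%q. q : M & is_proj q & z**q = q & (ALL w. zproj w & w ~= 0 & w**z = w --> w**q ~= 0))"
 have "EX f. ALL n::nat. P (f n) & (f n**f (Suc n) = f (Suc n) &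
  (ALL w. zproj w & w ~= 0 & w**z = w --> w**(f n - f (Suc n)) ~= 0))"
 proof (rule dependent_nat_choice)
  show "EX q. P q" by (rule exI[of _ z]) (use z in "auto simp: P_def")
  fix q and n :: nat assume "P q"
  then have q: "q : M" "is_proj q" "z**q = q" "!!w. zproj w ==> w ~= 0 ==> w**z = w ==> w**q ~= 0"
   by (auto simp: P_def)
  have na: "e = 0" if "abelian_projection M e" "q**e = e" for e
   by (rule z(3)[OF that(1)]) (metis opm_assoc q(3) that(2))
  obtain q' where q': "q' : M" "is_proj q'" "q**q' = q'"
   "!!w. zproj w ==> w**q ~= 0 ==> w**q' ~= 0 & w**(q - q') ~= 0"
   by (rule halving_projection[OF q(1,2) na], assumption+, rule that)
  have "z**q' = q'" by (metis opm_assoc q(3) q'(3))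
  then show "EX q'. P q' & (q**q' = q' & (ALL w. zproj w & w ~= 0 & w**z = w --> w**(q - q') ~= 0))"
   unfolding P_def using q q' by (intro exI[of _ q']) blast
 qed
 then obtain f where f: "!!n. P (f n)" "!!n. f n**f (Suc n) = f (Suc n)"
  "!!n w. zproj w ==> w ~= 0 ==> w**z = w ==> w**(f n - f (Suc n)) ~= 0" by blast
 show ?thesis using that[of f z] f z(1,2) by (simp add: P_def)
qed

subsection \<open>Countable decomposability\<close>

lemma countable_nonzero_at_vector:
 fixes x :: 'a
 assumes F: "\<And>p. p \<in> F ==> is_proj p" "\<And>p q. p \<in> F ==> q \<in> F ==> p \<noteq> q ==> p**q = 0"
 shows "countable {p \<in> F. p x \<noteq> 0}"
proof -
 have "(%p. (norm (blinfun_apply p x))\<^sup>2) summable_on F"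
 proof (rule nonneg_bdd_above_summable_on)
  have "(\<Sum>p\<in>J. (norm (blinfun_apply p x))\<^sup>2) <= (norm x)\<^sup>2" if "J : {J. J <= F & finite J}" for J
  proof -
   have J: "finite J" "!!p. p : J ==> p : F" using that by blast+
   show ?thesis by (rule orthogonal_projections_Bessel[OF J(1) F(1)[OF J(2)] F(2)[OF J(2) J(2)]])
  qed
  then show "bdd_above (sum (%p. (norm (blinfun_apply p x))\<^sup>2) ` {J. J <= F & finite J})"
   by (rule bdd_aboveI2)
 qed simp
 from summable_countable_real[OF this] show ?thesis by simp
qed

text \<open>For an abelian projection \<open>e\<close> and a vector \<open>\<eta> = e \<eta>\<close>, an operator \<open>T\<close> with \<open>T \<eta> = 0\<close> satisfies
 \<open>T e q = 0\<close> for the central support \<open>q\<close> of \<open>\<eta>\<close>: if \<open>e T\<^sup>* T e = c e\<close> with central \<open>c\<close>, then \<open>c \<eta> = 0\<close>.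
 So if the center is \<open>\<sigma>\<close>-finite, then \<open>T e\<close> is determined by the values of \<open>T\<close> at countably many
 vectors, and by Bessel's inequality only countably many orthogonal projections are nonzero at one of
 them.\<close>

lemma sigma_finite_of_center:
 assumes I: "type_I_fin M"
  and cen: "\<And>F. (\<forall>w\<in>F. zproj w \<and> w \<noteq> 0) ==> orthogonal_family F ==> countable F"
 shows "sigma_finite_algebra M"
 unfolding sigma_finite_algebra_def
proof (intro allI impI)
 fix F assume "F <= projections M - {0} & orthogonal_family F"
 then have F: "!!p. p : F ==> p : M & is_proj p & p ~= 0" "!!p q. p : F ==> q : F ==> p ~= q ==> p**q = 0"
  by (auto simp: projections_M orthogonal_family_def)
 have cnt: "countable {p : F. p**e ~= 0}" if e: "abelian_projection M e" for e
 proof -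
  note eD = abelian_projectionD[OF e]
  define P where "P = (%w :: 'a \<Rightarrow>\<^sub>L 'a. EX \<eta>. ALL T:M. blinfun_apply T \<eta> = 0 --> T**e**w = 0)"
  have "EX w'. zproj w' & w' ~= 0 & w'**w = w' & P w'"
   if w: "zproj w" "w ~= 0" for w
  proof (cases "w**e = 0")
   case True
   then have "T**e**w = 0" if "T : M" for T using zproj_comm[OF w(1) eD(1)] by (simp add: opm_assoc opm.zero_right)
   then show ?thesis using w unfolding P_def by (intro exI[of _ w]) auto
  next
   case False
   then obtain x where "(w**e) x ~= 0" by (metis blinfun_eqI blinfun.zero_left)
   define \<eta> where "\<eta> = (w**e) x"
   have \<eta>: "\<eta> ~= 0" "w \<eta> = \<eta>" "e \<eta> = \<eta>"
   proof -
    show "\<eta> ~= 0" using `(w**e) x ~= 0` by (simp add: \<eta>_def)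
    have "w**(w**e) = w**e" "e**(w**e) = w**e"
     using w eD zproj_comm[OF w(1) eD(1)] by (simp_all add: is_proj_absorb) (metis opm_assoc is_projD(1))
    then show "w \<eta> = \<eta>" "e \<eta> = \<eta>" unfolding \<eta>_def by (metis op_apply_assoc)+
   qed
   obtain q where q: "zproj q" "q \<eta> = \<eta>" "!!c. c : Z ==> c \<eta> = 0 ==> c**q = 0"
    by (rule central_support_of_vector[of \<eta>], rule that)
   have "(\<one> - w)**q = 0" using w \<eta> by (intro q(3)) (simp_all add: blinfun.diff_left)
   then have "q**w = q" using zproj_comm[OF q(1), of w] w by (simp add: op_simps)
   moreover have "T**e**q = 0" if T: "T : M" "T \<eta> = 0" for T
   proof -
    have D: "dag T**T : M" "dag (dag T**T) = dag T**T" using T by (simp_all add: dag_comp)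
    obtain c where c: "c : Z" "e**(dag T**T)**e = c**e"
     using abelian_coeff[OF e D] by blast
    have "c \<eta> = (e**(dag T**T)**e) \<eta>" unfolding c(2) using \<eta>(3) by simp
    then have "c \<eta> = 0" using \<eta>(3) T(2) by (simp add: blinfun.zero_right)
    then have cq: "c**q = 0" by (rule q(3)[OF c(1)])
    have "dag (T**e**q)**(T**e**q) = q**(e**(dag T**T)**e)**q"
     using q(1) eD(2) by (simp add: dag_comp is_projD opm_assoc)
    also have "... = q**(c**q)**e" unfolding c(2) using zproj_comm[OF q(1) eD(1)] by (simp add: opm_assoc)
    also have "... = 0" unfolding cq by (simp add: op_simps)
    finally show ?thesis by (rule dag_mult_zero)
   qed
   ultimately show ?thesis using q(1,2) \<eta>(1) unfolding P_def by (intro exI[of _ q] conjI exI[of _ \<eta>]) (auto simp: blinfun.zero_left)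
  qed
  then have loc: "EX w'. zproj w' & w' ~= 0 & w'**w = w' & P w'"
   if "zproj w" "w ~= 0" "w**\<one> = w" for w using that by blast
  obtain G where G: "!!w. w : G ==> zproj w & w ~= 0 & w**\<one> = w & P w"
   "!!w w'. w : G ==> w' : G ==> w ~= w' ==> w**w' = 0"
   "!!x. ((%w. blinfun_apply w x) has_sum \<one> x) G"
   by (rule central_exhaustion[of \<one> P, OF zproj_one loc], assumption+, rule that)
  have cG: "countable G" by (rule cen) (use G in "auto simp: orthogonal_family_def")
  have "ALL w:G. EX \<eta>. ALL T:M. blinfun_apply T \<eta> = 0 --> T**e**w = 0" using G(1) unfolding P_def by blast
  from bchoice[OF this] obtain \<eta> where \<eta>: "ALL w:G. ALL T:M. blinfun_apply T (\<eta> w) = 0 --> T**e**w = 0" ..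
  have "{p : F. p**e ~= 0} <= (\<Union>w\<in>G. {p : F. blinfun_apply p (\<eta> w) ~= 0})"
  proof
   fix p assume p: "p : {p : F. p**e ~= 0}"
   show "p : (\<Union>w\<in>G. {p : F. blinfun_apply p (\<eta> w) ~= 0})"
   proof (rule ccontr)
    assume "~ ?thesis"
    then have 0: "p (\<eta> w) = 0" if "w : G" for w using p that by blast
    have "p**e**w = 0**w" if "w : G" for w using \<eta> that F(1)[of p] p 0[OF that] by (simp add: opm.zero_left)
    from has_sum_op_eqI[OF G(3) this] show False using p by (simp add: opm.zero_left)
   qed
  qed
  then show ?thesis
   by (rule countable_subset) (intro countable_UN cG countable_nonzero_at_vector, use F in auto)
 qed
 have loc: "EX w'. zproj w' & w' ~= 0 & w'**w = w' & (EX n. abel_sum n w')" if w: "zproj w" "w ~= 0" "w**\<one> = w" for w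
  by (rule type_I_fin_local[OF I w(1,2)]) blast
 obtain G where G: "!!w. w : G ==> zproj w & w ~= 0 & w**\<one> = w & (EX n. abel_sum n w)"
  "!!w w'. w : G ==> w' : G ==> w ~= w' ==> w**w' = 0"
  "!!x. ((%w. blinfun_apply w x) has_sum \<one> x) G"
  by (rule central_exhaustion[of \<one> "%w. EX n. abel_sum n w", OF zproj_one loc], assumption+, rule that)
 have cG: "countable G" by (rule cen) (use G in "auto simp: orthogonal_family_def")
 have "EX (n::nat) e. (ALL i<n. abelian_projection M (e i)) & w = (\<Sum>i<n. e i)" if "w : G" for w
 proof -
  have "EX n. abel_sum n w" using G(1)[OF that] by blast
  then show ?thesis unfolding abel_sum_def .
 qed
 then have "ALL w:G. EX (n::nat) e. (ALL i<n. abelian_projection M (e i)) & w = (\<Sum>i<n. e i)" by blast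
 from bchoice[OF this] obtain n :: "('a \<Rightarrow>\<^sub>L 'a) => nat"
  where "ALL w:G. EX e. (ALL i<n w. abelian_projection M (e i)) & w = (\<Sum>i<n w. e i)" ..
 from bchoice[OF this] obtain e
  where "ALL w:G. (ALL i<n w. abelian_projection M (e w i)) & w = (\<Sum>i<n w. e w i)" ..
 then have ne: "!!w i. w : G ==> i < n w ==> abelian_projection M (e w i)" "!!w. w : G ==> w = (\<Sum>i<n w. e w i)"
  by blast+
 have "F <= (\<Union>w\<in>G. \<Union>i\<in>{..<n w}. {p : F. p**e w i ~= 0})"
 proof
  fix p assume p: "p : F"
  show "p : (\<Union>w\<in>G. \<Union>i\<in>{..<n w}. {p : F. p**e w i ~= 0})"
  proof (rule ccontr)
   assume "~ ?thesis"
   then have 0: "p**e w i = 0" if "w : G" "i < n w" for w i using p that by blast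
   have "p**\<one> = 0**\<one>"
   proof (rule has_sum_op_eqI[OF G(3)])
    fix w assume w: "w : G"
    have "p**w = (\<Sum>i<n w. p**e w i)" by (subst ne(2)[OF w]) (simp only: opm.sum_right)
    then show "p**w = 0**w" using 0[OF w] by (simp add: opm.zero_left)
   qed
   then show False using F(1)[OF p] by simp
  qed
 qed
 moreover have "countable (\<Union>w\<in>G. \<Union>i\<in>{..<n w}. {p : F. p**e w i ~= 0})"
  by (intro countable_UN cG cnt ne) auto
 ultimately show "countable F" by (rule countable_subset)
qed

end

section \<open>Unbounded positive square roots\<close>

instantiation prod :: (complex_hilbert, complex_hilbert) complex_hilbert
begin

definition scaleC_prod :: "complex => 'a \<times> 'b => 'a \<times> 'b" where
 "scaleC_prod c x = (c *\<^sub>C fst x, c *\<^sub>C snd x)"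

definition cinner_prod :: "'a \<times> 'b => 'a \<times> 'b => complex" where
 "cinner_prod x y = cinner (fst x) (fst y) + cinner (snd x) (snd y)"

instance
proof
 fix x y z :: "'a \<times> 'b" and c d :: complex and r :: real
 show "c *\<^sub>C (x + y) = c *\<^sub>C x + c *\<^sub>C y" by (simp add: scaleC_prod_def scaleC_add_right)
 show "(c + d) *\<^sub>C x = c *\<^sub>C x + d *\<^sub>C x" by (simp add: scaleC_prod_def scaleC_add_left)
 show "c *\<^sub>C d *\<^sub>C x = (c * d) *\<^sub>C x" by (simp add: scaleC_prod_def scaleC_scaleC)
 show "complex_of_real r *\<^sub>C x = r *\<^sub>R x" by (simp add: scaleC_prod_def scaleC_of_real prod_eq_iff)
 show "cinner x y = cnj (cinner y x)"
  unfolding cinner_prod_def by (simp add: cinner_commute[of "fst x"] cinner_commute[of "snd x"])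
 show "cinner (x + y) z = cinner x z + cinner y z" by (simp add: cinner_prod_def cinner_add_left)
 show "cinner (c *\<^sub>C x) y = c * cinner x y"
  by (simp add: cinner_prod_def scaleC_prod_def cinner_scaleC_left distrib_left)
 show "cinner x x = complex_of_real ((norm x)\<^sup>2)"
  by (simp add: cinner_prod_def cinner_self norm_prod_def)
qed

end

lemma rin_Pair: "rin (a, b) (c, d) = rin a c + rin b d"
 by (simp add: rin_def cinner_prod_def)

lemma linear_operatorD:
 assumes "linear_operator x"
 shows "(0, 0) \<in> x" "(h, y) \<in> x ==> (h', y') \<in> x ==> (h + h', y + y') \<in> x"
  "(h, y) \<in> x ==> (c *\<^sub>C h, c *\<^sub>C y) \<in> x" "(0, y) \<in> x ==> y = 0"
 using assms unfolding linear_operator_def by blast+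

lemma linear_operator_scaleR:
 "linear_operator x ==> (h, y) \<in> x ==> (r *\<^sub>R h, r *\<^sub>R y) \<in> x"
 using linear_operatorD(3)[of x h y "complex_of_real r"] by (simp add: scaleC_of_real)

lemma linear_operator_diff:
 assumes "linear_operator x" "(h, y) \<in> x" "(h', y') \<in> x"
 shows "(h - h', y - y') \<in> x"
 using linear_operatorD(2)[OF assms(1,2) linear_operator_scaleR[OF assms(1,3), of "-1"]] by simp

lemma linear_operator_single:
 "linear_operator x ==> (h, y) \<in> x ==> (h, y') \<in> x ==> y = y'"
 using linear_operator_diff[of x h y h y'] linear_operatorD(4)[of x "y - y'"] by simp

lemma linear_operator_sum:
 assumes "linear_operator x" "\<And>i. i \<in> J ==> (f i, g i) \<in> x"
 shows "(sum f J, sum g J) \<in> x"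
 using assms(2) by (induction J rule: infinite_finite_induct) (auto intro: linear_operatorD(1,2)[OF assms(1)])

lemma linear_operator_subspace: "linear_operator x ==> subspace x"
 unfolding subspace_def using linear_operatorD(1,2) linear_operator_scaleR
 by (auto simp: zero_prod_def split: prod.splits)

lemma adj_rin:
 assumes "linear_operator x"
 shows "adj x = {(y, k). \<forall>(h, s)\<in>x. rin s y = rin h k}"
proof -
 have "cinner s y = cinner h k" if "ALL (h, s):x. rin s y = rin h k" "(h, s) : x" for y k h s
 proof (rule complex_eqI)
  show "Re (cinner s y) = Re (cinner h k)" using that by (auto simp: rin_def)
  have "(- \<i> *\<^sub>C h, - \<i> *\<^sub>C s) : x" using linear_operatorD(3)[OF assms that(2)] .
  then have "rin (- \<i> *\<^sub>C s) y = rin (- \<i> *\<^sub>C h) k" using that(1) by blast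
  then show "Im (cinner s y) = Im (cinner h k)" by (simp add: Im_cinner rin_scaleC)
 qed
 note * = this
 have "(ALL (h, s):x. cinner s y = cinner h k) \<longleftrightarrow> (ALL (h, s):x. rin s y = rin h k)" for y k
 proof
  assume L: "ALL (h, s):x. cinner s y = cinner h k"
  show "ALL (h, s):x. rin s y = rin h k"
  proof clarify
   fix h s assume "(h, s) : x"
   with L have "cinner s y = cinner h k" by blast
   then show "rin s y = rin h k" by (simp add: rin_def)
  qed
 qed (use * in blast)
 then show ?thesis unfolding adj_def by simp
qed

lemma adj_closed:
 assumes "linear_operator x"
 shows "closed (adj x)"
proof -
 have "adj x = (\<Inter>p\<in>x. {q. rin (snd p) (fst q) = rin (fst p) (snd q)})"
  unfolding adj_rin[OF assms] case_prod_unfold by blast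
 moreover have "closed {q. rin (snd p) (fst q) = rin (fst p) (snd q)}" for p :: "'a \<times> 'a"
  by (intro closed_Collect_eq bounded_bilinear.continuous_on[OF bounded_bilinear_rin] continuous_intros)
 ultimately show ?thesis by auto
qed

text \<open>For a positive self-adjoint \<open>y\<close> put \<open>R = (1 + y\<^sup>2)\<^sup>-\<^sup>1\<close> and \<open>B = y R\<close>, which come from the
 projection of \<open>H \<times> 0\<close> onto the graph of \<open>y\<close>. Then \<open>R\<close> depends on \<open>y\<^sup>2\<close> only, \<open>B\<close> is the
 positive square root of \<open>R - R\<^sup>2\<close>, and the pairs \<open>(R \<xi>, B \<xi>)\<close> are dense in the graph.\<close>

lemma resolvent_of_positive:
 fixes y :: "'a::complex_hilbert opr"
 assumes y: "linear_operator y" "adj y = y" "positive_opr y"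
 obtains R B :: "'a \<Rightarrow>\<^sub>L 'a" where "\<And>x. (R x, B x) \<in> y" "\<And>x. (B x, x - R x) \<in> y" "pos B" "B**B = R - R**R"
  "y = closure (range (%x. (R x, B x)))" "\<And>\<rho> \<beta> x. (\<rho>, \<beta>) \<in> y ==> (\<beta>, x - \<rho>) \<in> y ==> \<rho> = R x"
proof -
 have cl: "closed y" using adj_closed[OF y(1)] y(2) by simp
 have sub: "subspace y" by (rule linear_operator_subspace[OF y(1)])
 have sym: "rin b c = rin a d" if "(a, b) : y" "(c, d) : y" for a b c d
 proof -
  have "(c, d) : adj y" using that y by simp
  then show ?thesis using that(1) unfolding adj_rin[OF y(1)] by auto
 qed
 have posy: "0 <= rin b a" if "(a, b) : y" for a b using y(3) that by (auto simp: positive_opr_def rin_def)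
 define R where "R = Blinfun (%x. fst (proj_on y (x, 0)))"
 define B where "B = Blinfun (%x. snd (proj_on y (x, 0)))"
 have bl: "bounded_linear (%x. proj_on y (x, 0))"
  by (intro bounded_linear_compose[OF blinfun.bounded_linear_right] bounded_linear_Pair bounded_linear_ident bounded_linear_zero)
 have R: "R x = fst (proj_on y (x, 0))" and B: "B x = snd (proj_on y (x, 0))" for x
  unfolding R_def B_def
  by (simp_all add: bounded_linear_Blinfun_apply bounded_linear_compose[OF bounded_linear_fst bl]
    bounded_linear_compose[OF bounded_linear_snd bl])
 have 1: "(R x, B x) : y" for x
  using proj_on_in[OF sub cl, of "(x, 0)"] unfolding R B by (simp only: prod.collapse)
 have 2: "(B x, x - R x) : y" for x
 proof -
  have "rin s (B x) = rin k (x - R x)" if "(k, s) : y" for k s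
  proof -
   have "(x, 0) - proj_on y (x, 0) = (x - R x, - B x)" by (simp add: R B prod_eq_iff)
   then have "rin (x - R x, - B x) (k, s) = 0"
    using proj_on_orth[OF sub cl that, of "(x, 0)"] by simp
   then show ?thesis by (simp add: rin_Pair rin_minus_left rin_commute[of k] rin_commute[of s])
  qed
  then have "(B x, x - R x) : adj y" unfolding adj_rin[OF y(1)] by auto
  then show ?thesis using y(2) by simp
 qed
 have uniq: "\<rho> = \<rho>' & \<beta> = \<beta>'" if "(\<rho>, \<beta>) : y" "(\<beta>, x - \<rho>) : y" "(\<rho>', \<beta>') : y" "(\<beta>', x - \<rho>') : y" for \<rho> \<beta> \<rho>' \<beta>' x
 proof -
  have "(\<rho> - \<rho>', \<beta> - \<beta>') : y" "(\<beta> - \<beta>', - (\<rho> - \<rho>')) : y"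
   using linear_operator_diff[OF y(1) that(1,3)] linear_operator_diff[OF y(1) that(2,4)] by simp_all
  then have "rin (\<beta> - \<beta>') (\<beta> - \<beta>') = rin (\<rho> - \<rho>') (- (\<rho> - \<rho>'))" by (rule sym)
  then have "(norm (\<beta> - \<beta>'))\<^sup>2 + (norm (\<rho> - \<rho>'))\<^sup>2 = 0" by (simp only: rin_minus_right rin_self)
  then show ?thesis by (simp add: sum_power2_eq_zero_iff)
 qed
 have dB: "rin (B x) k = rin x (B k)" for x k
  using sym[OF 1[of x] 1[of k]] sym[OF 2[of x] 2[of k]] by (simp add: rin_simps)
 have "0 <= rin (B x) x" for x
  using posy[OF 1[of x]] posy[OF 2[of x]] by (simp add: rin_simps rin_commute[of _ "B x"])
 then have pB: "pos B" using dag_unique[OF dB] by (simp add: pos_def)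
 have BB: "B**B = R - R**R"
 proof (rule blinfun_eqI)
  fix x
  have "(R x - R (R x), B x - B (R x)) : y" by (rule linear_operator_diff[OF y(1) 1 1])
  from uniq[OF 1[of "B x"] 2 2[of "R x"] this]
  show "(B**B) x = (R - R**R) x" by (simp add: blinfun.diff_left)
 qed
 let ?G = "range (%x. (R x, B x))"
 have subG: "subspace (closure ?G)"
  by (intro subspace_closure_of_subspace linear_subspace_image)
   (auto simp: linear_iff blinfun.add_right blinfun.scaleR_right)
 have Gy: "closure ?G <= y" using 1 by (intro closure_minimal cl) auto
 have "y <= closure ?G"
 proof
  fix p assume p: "p : y"
  define q where "q = proj_on (closure ?G) p"
  have qG: "q : closure ?G" unfolding q_def by (rule proj_on_in[OF subG closed_closure])
  obtain a b where ab: "p - q = (a, b)" by (cases "p - q")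
  have aby: "(a, b) : y" unfolding ab[symmetric] using p qG Gy sub by (intro subspace_diff) auto
  have "rin a x = 0" for x
  proof -
   have "(R x, B x) : closure ?G" by (rule subsetD[OF closure_subset]) (rule rangeI)
   then have "rin (a, b) (R x, B x) = 0"
    using proj_on_orth[OF subG closed_closure, of "(R x, B x)" p] ab by (simp add: q_def)
   then show ?thesis using sym[OF aby 2[of x]] by (simp add: rin_Pair rin_simps)
  qed
  then have "a = 0" by (rule rin_all_zero)
  then have "b = 0" using aby linear_operatorD(4)[OF y(1)] by simp
  then have "p = q" using ab `a = 0` by (simp add: zero_prod_def[symmetric])
  then show "p : closure ?G" using qG by simp
 qed
 then have "y = closure ?G" using Gy by blast
 moreover have "\<rho> = R x" if "(\<rho>, \<beta>) : y" "(\<beta>, x - \<rho>) : y" for \<rho> \<beta> x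
  using uniq[OF that 1[of x] 2[of x]] by simp
 ultimately show ?thesis by (intro that[OF 1 2 pB BB])
qed

theorem unbounded_sqrt_unique:
 fixes y y' :: "'a::complex_hilbert opr"
 assumes y: "linear_operator y" "adj y = y" "positive_opr y"
  and y': "linear_operator y'" "adj y' = y'" "positive_opr y'"
  and eq: "y O y = y' O y'"
 shows "y = y'"
proof -
 obtain R B :: "'a \<Rightarrow>\<^sub>L 'a" where 1: "!!x. (R x, B x) : y" "!!x. (B x, x - R x) : y" "pos B" "B**B = R - R**R"
  "y = closure (range (%x. (R x, B x)))" "!!\<rho> \<beta> x. (\<rho>, \<beta>) : y ==> (\<beta>, x - \<rho>) : y ==> \<rho> = R x"
  by (rule resolvent_of_positive[OF y], rule that)
 obtain R' B' :: "'a \<Rightarrow>\<^sub>L 'a" where 2: "!!x. (R' x, B' x) : y'" "!!x. (B' x, x - R' x) : y'" "pos B'" "B'**B' = R' - R'**R'"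
  "y' = closure (range (%x. (R' x, B' x)))" "!!\<rho> \<beta> x. (\<rho>, \<beta>) : y' ==> (\<beta>, x - \<rho>) : y' ==> \<rho> = R' x"
  by (rule resolvent_of_positive[OF y'], rule that)
 have "R' x = R x" for x
 proof -
  have "(R' x, x - R' x) : y' O y'" using 2(1,2)[of x] by (rule relcompI)
  then have "(R' x, x - R' x) : y O y" using eq by simp
  then obtain \<beta> where "(R' x, \<beta>) : y" "(\<beta>, x - R' x) : y" by blast
  then show ?thesis by (rule 1(6))
 qed
 then have "R' = R" by (rule blinfun_eqI)
 moreover have "B' = B" by (rule sqrt_unique) (use 1(3,4) 2(3,4) `R' = R` in simp_all)
 ultimately show ?thesis unfolding 1(5) 2(5) by simp
qed

section \<open>The central extension as locally bounded operators\<close>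

context vn_algebra
begin

text \<open>Elements of \<open>E(M)\<close> are described by their bounded pieces \<open>T = z x\<close> for central projections \<open>z\<close>. Two
 conditions replace this equation, which involves a closure: \<open>x\<close> is defined on the range of \<open>z\<close>, and \<open>T\<close> extends
 \<open>z x\<close>.\<close>

definition piece :: "'a opr => ('a \<Rightarrow>\<^sub>L 'a) => ('a \<Rightarrow>\<^sub>L 'a) => bool" where
 "piece x z T \<longleftrightarrow> zproj z \<and> T \<in> M \<and> z**T = T \<and> (\<forall>\<xi>. (z \<xi>, T \<xi>) \<in> x) \<and> (\<forall>\<xi> \<eta>. (\<xi>, \<eta>) \<in> x --> z \<eta> = T \<xi>)"

definition cseq :: "(nat => 'a \<Rightarrow>\<^sub>L 'a) => bool" where
 "cseq z \<longleftrightarrow> (\<forall>n. zproj (z n) \<and> z n**z (Suc n) = z n) \<and> (\<forall>\<xi>. (%n. z n \<xi>) \<longlonglongrightarrow> \<xi>)"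

definition glue :: "(nat => 'a \<Rightarrow>\<^sub>L 'a) => (nat => 'a \<Rightarrow>\<^sub>L 'a) => 'a opr" where
 "glue z T = {(\<xi>, \<eta>). \<forall>n. z n \<eta> = T n \<xi>}"

abbreviation EM where "EM \<equiv> central_extension M"

lemma cseqD:
 assumes "cseq z"
 shows "zproj (z n)" "(%n. z n x) \<longlonglongrightarrow> x" "m \<le> n ==> z m**z n = z m"
proof -
 show zz: "zproj (z n)" "(%n. z n x) \<longlonglongrightarrow> x" for n x using assms by (auto simp: cseq_def)
 assume "m <= n"
 then show "z m**z n = z m"
 proof (induction n rule: dec_induct)
  case base
  then show ?case using zz by simp
 next
  case (step n)
  have "z n**z (Suc n) = z n" using assms by (simp add: cseq_def)
  then show ?case using step by (metis opm_assoc)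
 qed
qed

lemma cseq_one: "cseq (%_. \<one>)"
 by (simp add: cseq_def)

lemma cseq_mult:
 assumes "cseq z" "cseq w"
 shows "cseq (%n. z n**w n)"
 unfolding cseq_def
proof (intro conjI allI)
 fix n
 show "zproj (z n**w n)" by (intro zproj_mult cseqD(1) assms)
 have "z n**w n**(z (Suc n)**w (Suc n)) = (z n**z (Suc n))**(w n**w (Suc n))"
  using zproj_comm[OF cseqD(1)[OF assms(1), of "Suc n"], of "w n"] cseqD(1)[OF assms(2), of n]
  by (simp add: opm_assoc) (metis opm_assoc)
 then show "z n**w n**(z (Suc n)**w (Suc n)) = z n**w n"
  using cseqD(3)[OF assms(1), of n "Suc n"] cseqD(3)[OF assms(2), of n "Suc n"] by simp
next
 fix x
 have "(%n. z n (w n x - x)) \<longlonglongrightarrow> 0"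
 proof (rule Lim_null_comparison)
  show "\<forall>\<^sub>F n in sequentially. norm (z n (w n x - x)) <= norm (w n x - x)"
   by (intro always_eventually allI is_proj_contr zprojD(2) cseqD(1) assms)
  show "(%n. norm (w n x - x)) \<longlonglongrightarrow> 0"
   using cseqD(2)[OF assms(2), of x] by (simp add: LIM_zero_iff tendsto_norm_zero_iff)
 qed
 from tendsto_add[OF this cseqD(2)[OF assms(1), of x]]
 show "(%n. (z n**w n) x) \<longlonglongrightarrow> x" by (simp add: blinfun.diff_right)
qed

lemma cseq_op_eqI:
 assumes "cseq z" "\<And>n. z n**S = z n**T"
 shows "S = T"
proof (rule blinfun_eqI)
 fix x
 have "z n (S x) = z n (T x)" for n using assms(2)[of n] by (metis op_apply_assoc)
 then have "(%n. z n (S x)) \<longlonglongrightarrow> T x" using cseqD(2)[OF assms(1), of "T x"] by simp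
 then show "S x = T x" by (rule LIMSEQ_unique[OF cseqD(2)[OF assms(1)]])
qed

lemma cseq_vec_eqI: "cseq z ==> (\<And>n. z n x = z n y) ==> x = y"
 by (rule LIMSEQ_unique[OF cseqD(2)[of z x]]) (simp_all add: cseqD(2))

lemma cseq_nonzero: "cseq z ==> w \<noteq> 0 ==> \<exists>n. z n**w \<noteq> 0"
 using cseq_op_eqI[of z w 0] by (auto simp: opm.zero_right)

lemma cseq_pos:
 assumes "cseq z" "T \<in> M" "\<And>n. pos (z n**T)"
 shows "pos T"
 by (rule pos_limit[of sequentially "%n. z n**T"]) (use assms cseqD(2) in auto)

lemma pieceD:
 assumes "piece x z T"
 shows "zproj z" "T \<in> M" "z**T = T" "T**z = T" "(z h, T h) \<in> x" "(h, y) \<in> x ==> z y = T h"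
 using assms zproj_comm[of z T] by (auto simp: piece_def)

lemma piece_restrict:
 assumes x: "linear_operator x" and p: "piece x z T" and w: "zproj w"
 shows "piece x (w**z) (w**T)"
 unfolding piece_def
proof (intro conjI allI impI)
 note pD = pieceD[OF p]
 show "zproj (w**z)" by (intro zproj_mult w pD)
 show "w**T : M" using w pD by simp
 have zw: "z**w = w**z" using zproj_comm[OF w, of z] pD(1) by simp
 have Tw: "T**w = w**T" by (rule zproj_comm[OF w pD(2)])
 show "w**z**(w**T) = w**T" using w pD zw by (metis opm_assoc zprojD(3))
 show "((w**z) h, (w**T) h) : x" for h
  using pD(5)[of "w h"] zw Tw by (metis op_apply_assoc)
 show "(w**z) y = (w**T) h" if "(h, y) : x" for h y
  using pD(6)[OF that] by simp
qed

lemma piece_unique: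
 assumes x: "linear_operator x" and p: "piece x z T" "piece x z S"
 shows "T = S"
 by (rule blinfun_eqI) (rule linear_operator_single[OF x pieceD(5)[OF p(1)] pieceD(5)[OF p(2)]])

lemma piece_overlap:
 assumes x: "linear_operator x" and p: "piece x z T" "piece x w S"
 shows "w**T = z**S"
proof -
 have "w**z = z**w" using zproj_comm[of w z] pieceD(1)[OF p(1)] pieceD(1)[OF p(2)] by simp
 then show ?thesis
  using piece_restrict[OF x p(1) pieceD(1)[OF p(2)]] piece_restrict[OF x p(2) pieceD(1)[OF p(1)]]
  by (intro piece_unique[OF x]) simp_all
qed

lemma glue_of_pieces:
 assumes x: "linear_operator x" "closed x" and z: "cseq z" and p: "\<And>n. piece x (z n) (T n)"
 shows "x = glue z T"
proof -
 have "(h, y) : x" if "!!n. z n y = T n h" for h y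
 proof (rule closed_sequentially[OF x(2)])
  show "(z n h, z n y) : x" for n using pieceD(5)[OF p[of n], of h] that[of n] by simp
  show "(%n. (z n h, z n y)) \<longlonglongrightarrow> (h, y)" by (intro tendsto_Pair cseqD z)
 qed
 then show ?thesis unfolding glue_def using pieceD(6)[OF p] by blast
qed

lemma glue_props:
 assumes z: "cseq z" and T: "\<And>n. T n \<in> M" "\<And>n. z n**T n = T n" "\<And>n. z n**T (Suc n) = T n"
 shows "linear_operator (glue z T)" "closed (glue z T)" "piece (glue z T) (z n) (T n)"
proof -
 have compat: "z m**T n = T m" if "m <= n" for m n
  using that
 proof (induction n rule: dec_induct)
  case (step n)
  have "z m**T (Suc n) = z m**(z n**T (Suc n))"
   using cseqD(3)[OF z, of m n] step by (simp add: opm_assoc[symmetric])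
  then show ?case using T(3) step by simp
 qed (rule T(2))
 have Tz: "T m**z n = (if m <= n then T m else T n)" for m n
 proof -
  have "T m**z n = z n**T m" by (rule zproj_comm[OF cseqD(1)[OF z] T(1)])
  moreover have "z n**T m = T m" if "m <= n"
  proof -
   have "z n**z m = z m" using cseqD(3)[OF z that] zproj_comm[OF cseqD(1)[OF z, of n], of "z m"] cseqD(1)[OF z, of m] by simp
   then show ?thesis using T(2)[of m] by (metis opm_assoc)
  qed
  ultimately show ?thesis using compat[of n m] by auto
 qed
 have clin: "blinfun_apply S (c *\<^sub>C x) = c *\<^sub>C S x" if "S : M" for S c x
  using M_clinear[OF that] by (simp add: clinear_ops_def)
 show "linear_operator (glue z T)" unfolding linear_operator_def glue_def
  using cseq_vec_eqI[OF z, of _ 0] cseqD(1)[OF z] T(1)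
  by (auto simp: blinfun.add_right clin)
 have "glue z T = (\<Inter>n. {p. z n (snd p) = T n (fst p)})" by (auto simp: glue_def)
 moreover have "closed {p. z n (snd p) = T n (fst p)}" for n
  by (intro closed_Collect_eq continuous_intros)
 ultimately show "closed (glue z T)" by auto
 show "piece (glue z T) (z n) (T n)"
  unfolding piece_def
 proof (intro conjI allI impI)
  fix x
  have "z m (T n x) = T m (z n x)" for m
  proof -
   have "z m**T n = T m**z n"
    using Tz[of m n] Tz[of n m] compat[of m n] zproj_comm[OF cseqD(1)[OF z, of m] T(1)[of n]] by (cases "m <= n") auto
   then show ?thesis by (metis op_apply_assoc)
  qed
  then show "(z n x, T n x) : glue z T" by (simp add: glue_def)
 qed (use T cseqD(1)[OF z] in "auto simp: glue_def")
qed

text \<open>A relation between the graphs of the truncations and the glued operator has the glued operator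
 as its closure; this computes strong sums and products.\<close>

lemma closure_eq_glue:
 assumes z: "cseq z" and T: "\<And>n. T n \<in> M" "\<And>n. z n**T n = T n" "\<And>n. z n**T (Suc n) = T n"
  and X: "X \<subseteq> glue z T" "\<And>n x. (z n x, T n x) \<in> X"
 shows "closure X = glue z T"
proof
 note g = glue_props[OF z T]
 show "closure X <= glue z T" by (rule closure_minimal[OF X(1) g(2)])
 show "glue z T <= closure X"
 proof clarify
  fix x y assume "(x, y) : glue z T"
  then have eq: "T n x = z n y" for n by (simp add: glue_def)
  have "(%n. (z n x, T n x)) \<longlonglongrightarrow> (x, y)" unfolding eq by (intro tendsto_Pair cseqD z)
  then show "(x, y) : closure X" unfolding closure_sequential
   by (intro exI[of _ "%n. (z n x, T n x)"]) (simp add: X(2))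
 qed
qed

lemma piece_of_cseq:
 assumes x: "linear_operator x" "closed x" and z: "cseq z" and p: "\<And>n. piece x (z n) (T n)"
  and w: "zproj w" "S \<in> M" "w**S = S" and eq: "\<And>n. z n**S = w**T n"
 shows "piece x w S"
 unfolding piece_def
proof (intro conjI allI impI w)
 fix h
 have "z n (S h) = T n (w h)" for n
  using eq[of n] zproj_comm[OF w(1) pieceD(2)[OF p[of n]]] by (metis op_apply_assoc)
 then show "(w h, S h) : x" using glue_of_pieces[OF x z p] by (auto simp: glue_def)
 fix y assume "(h, y) : x"
 then have "z n y = T n h" for n by (rule pieceD(6)[OF p])
 moreover have "z n**w = w**z n" for n using zproj_comm[OF w(1), of "z n"] cseqD(1)[OF z, of n] by simp
 ultimately have "z n (w y) = z n (S h)" for n using eq[of n] by (metis op_apply_assoc)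
 then show "w y = S h" by (rule cseq_vec_eqI[OF z])
qed

lemma piece_strong_prod:
 assumes x: "linear_operator x" and z: "cseq z" and p: "\<And>n. piece x (z n) (T n)" and w: "piece x w S"
 shows "strong_prod (bounded_opr w) x = bounded_opr S"
 unfolding strong_prod_def
proof
 have "x O bounded_opr w <= bounded_opr S"
  using pieceD(6)[OF w] by (auto simp: bounded_opr_def)
 moreover have "closed (bounded_opr S)"
 proof -
  have "bounded_opr S = {p. snd p = S (fst p)}" by (auto simp: bounded_opr_def)
  then show ?thesis by (simp add: closed_Collect_eq continuous_intros)
 qed
 ultimately show "closure (x O bounded_opr w) <= bounded_opr S" by (rule closure_minimal)
 show "bounded_opr S <= closure (x O bounded_opr w)"
 proof
  fix q assume "q : bounded_opr S"
  then obtain h where q: "q = (h, S h)" by (auto simp: bounded_opr_def)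
  have "(z n h, S (z n h)) : x O bounded_opr w" for n
  proof (rule relcompI)
   show "(z n h, T n h) : x" by (rule pieceD(5)[OF p])
   from pieceD(6)[OF w this] show "(T n h, S (z n h)) : bounded_opr w" by (auto simp: bounded_opr_def)
  qed
  moreover have "(%n. (z n h, S (z n h))) \<longlonglongrightarrow> (h, S h)" by (intro tendsto_intros cseqD z)
  ultimately show "q : closure (x O bounded_opr w)" unfolding closure_sequential q
   by (intro exI[of _ "%n. (z n h, S (z n h))"]) simp
 qed
qed

lemma bounded_opr_inj: "bounded_opr S = bounded_opr T ==> S = T"
proof (rule blinfun_eqI)
 fix x assume "bounded_opr S = bounded_opr T"
 then have "(x, S x) : bounded_opr T" by (auto simp: bounded_opr_def)
 then show "S x = T x" by (auto simp: bounded_opr_def)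
qed

end

context vn_algebra
begin

lemma cseq_increases:
 assumes "cseq z" "N = M \<or> N = Z"
 shows "increases_to_one N z"
 unfolding increases_to_one_def is_proj_sup_def proj_le_def
proof (intro conjI allI ballI impI)
 fix n
 show "z (Suc n)**z n = z n"
  using zproj_comm[OF cseqD(1)[OF assms(1), of n], of "z (Suc n)"] cseqD(1)[OF assms(1), of "Suc n"]
   cseqD(3)[OF assms(1), of n "Suc n"] by simp
next
 show "\<one> : projections N" using assms(2) by (auto simp: projections_M projections_Z is_proj_def)
 fix r assume r: "ALL q:range z. r**q = q"
 have "r = \<one>"
 proof (rule blinfun_eqI)
  fix x
  have "(%n. r (z n x)) \<longlonglongrightarrow> r x" by (intro blinfun.tendsto tendsto_const cseqD assms)
  moreover have "r (z n x) = z n x" for n using r by (metis op_apply_assoc rangeI)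
  ultimately show "r x = \<one> x" using LIMSEQ_unique[OF _ cseqD(2)[OF assms(1), of x]] by simp
 qed
 then show "r**\<one> = \<one>" by simp
qed auto

lemma affiliatedI:
 assumes "cseq z" "\<And>n. T n \<in> N" "N \<subseteq> M" "\<And>n. T n \<in> N \<and> z n \<in> N"
 shows "affiliated N (glue z T)"
 unfolding affiliated_def
proof clarify
 fix u h y assume u: "u : unitaries (commutant N)" and x: "(h, y) : glue z T"
 have c: "u**S = S**u" if "S : N" for S
  using u that by (simp add: unitaries_def commutant_def)
 have "z n (u y) = T n (u h)" for n
  using c[of "z n"] c[of "T n"] assms(4)[of n] x by (simp add: glue_def) (metis op_apply_assoc)
 then show "(u h, u y) : glue z T" by (simp add: glue_def)
qed

lemma bounded_opr_eq_glue: "bounded_opr T = glue (%_. \<one>) (%_. T)"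
 by (auto simp: bounded_opr_def glue_def)

lemma bounded_opr_props:
 assumes "T \<in> M"
 shows "linear_operator (bounded_opr T)" "closed (bounded_opr T)" "zproj z ==> piece (bounded_opr T) z (z**T)"
proof -
 note g = glue_props[OF cseq_one, of "%_. T"]
 show 1: "linear_operator (bounded_opr T)" "closed (bounded_opr T)"
  unfolding bounded_opr_eq_glue using assms by (auto intro: g)
 have "piece (bounded_opr T) \<one> T"
  unfolding bounded_opr_eq_glue using assms by (auto intro: g)
 then show "piece (bounded_opr T) z (z**T)" if "zproj z"
  using piece_restrict[OF 1(1) _ that] by fastforce
qed

lemma bounded_opr_measurable:
 assumes "N = M \<or> N = Z" "T \<in> N"
 shows "bounded_opr T \<in> measurable_oprs N"
proof -
 have NM: "N <= M" "\<one> : N" "T : M" using assms by auto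
 have "affiliated N (bounded_opr T)"
  unfolding bounded_opr_eq_glue by (rule affiliatedI) (use assms NM cseq_one in auto)
 moreover have p: "\<one> : projections N" "0 : projections N"
  using assms(1) by (auto simp: projections_M projections_Z is_proj_def)
 then have "finite_projection N (\<one> - \<one>)"
  by (auto simp: finite_projection_def proj_le_def opm.zero_left)
 moreover have "range (blinfun_apply \<one>) <= Domain (bounded_opr T)" by (auto simp: bounded_opr_def)
 ultimately show ?thesis unfolding measurable_oprs_def
  using bounded_opr_props[OF NM(3)] cseq_increases[OF cseq_one assms(1)] p by blast
qed

text \<open>A partition each of whose members lies below some \<open>z\<^sub>n\<close> witnesses membership in the central
 extension.\<close>

lemma EM_I:
 assumes x: "linear_operator x" "closed x" and z: "cseq z" and p: "\<And>n. piece x (z n) (T n)"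
 shows "x \<in> EM"
proof -
 note pD = pieceD[OF p]
 have g: "x = glue z T" by (rule glue_of_pieces[OF x z p])
 have aff: "affiliated M x" unfolding g by (rule affiliatedI) (use z pD cseqD(1)[OF z] in auto)
 have lm: "x : locally_measurable_oprs M"
  unfolding locally_measurable_oprs_def
 proof (intro CollectI conjI exI[of _ z] allI)
  show "linear_operator x" "closed x" "affiliated M x" by (rule x aff)+
  show "increases_to_one M z" by (rule cseq_increases[OF z]) simp
  fix n
  show "z n : projections Z" using cseqD(1)[OF z] by (simp add: projections_Z)
  show "strong_prod (bounded_opr (z n)) x : measurable_oprs M"
   unfolding piece_strong_prod[OF x(1) z p p[of n]] by (rule bounded_opr_measurable) (use pD in simp_all)
 qed
 have loc: "EX w'. zproj w' & w' ~= 0 & w'**w = w' & (EX n. w'**z n = w')" if w: "zproj w" "w ~= 0" "w**\<one> = w" for w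
 proof -
  obtain n where "z n**w ~= 0" using cseq_nonzero[OF z w(2)] by blast
  moreover have "w**z n = z n**w" using zproj_comm[OF w(1)] cseqD(1)[OF z, of n] by simp
  moreover from this have "z n**w**z n = z n**w" using cseqD(1)[OF z, of n] by (simp add: opm_assoc is_proj_absorb)
  ultimately show ?thesis using zproj_mult[OF cseqD(1)[OF z, of n] w(1)] w(1)
   by (intro exI[of _ "z n**w"] conjI exI[of _ n]) (simp_all add: opm_assoc)
 qed
 obtain F where F: "!!w. w : F ==> zproj w & w ~= 0 & w**\<one> = w & (EX n. w**z n = w)"
  "!!w w'. w : F ==> w' : F ==> w ~= w' ==> w**w' = 0"
  "!!h. ((%w. blinfun_apply w h) has_sum \<one> h) F"
  by (rule central_exhaustion[of \<one> "%w. EX n. w**z n = w", OF zproj_one loc], assumption+, rule that)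
 have "r**\<one> = \<one>" if "ALL w:F. r**w = w" for r
  using has_sum_op_eqI[OF F(3), of r \<one>] that by simp
 then have "is_proj_sup M F \<one>" unfolding is_proj_sup_def proj_le_def by (auto simp: projections_M is_proj_def)
 moreover have "strong_prod (bounded_opr w) x : bounded_opr ` M" if w: "w : F" for w
 proof -
  obtain n where "w**z n = w" using F(1)[OF w] by blast
  then have "piece x w (w**T n)" using piece_restrict[OF x(1) p[of n], of w] F(1)[OF w] by simp
  then show ?thesis using piece_strong_prod[OF x(1) z p] pieceD(2) by fastforce
 qed
 ultimately show ?thesis using lm F(1,2) unfolding central_extension_def
  by (intro CollectI conjI exI[of _ F]) (auto simp: projections_Z orthogonal_family_def)
qed

lemma affiliated_central:
 assumes x: "linear_operator x" "affiliated N x" and N: "N = M \<or> N = Z" and z: "zproj z" "(h, y) \<in> x"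
 shows "(z h, z y) \<in> x"
proof -
 define u where "u = z - (\<one> - z)"
 have zN: "T : commutant N" if "T : Z" for T
 proof -
  have "T**S = S**T" if "S : N" for S using N that Z_comm[OF `T : Z`, of S] by auto
  then show ?thesis using M_clinear[of T] that by (auto simp: commutant_def)
 qed
 have uZ: "u : Z" using z by (simp add: u_def)
 have uu: "u**u = \<one>" "dag u = u" using z by (simp_all add: u_def op_simps dag_simps)
 have "u : unitaries (commutant N)"
  unfolding unitaries_def using zN[OF uZ] uu is_adjoint_M[of u u] uZ by auto
 then have "(u h, u y) : x" using x(2) z(2) unfolding affiliated_def by blast
 from linear_operator_scaleR[OF x(1) linear_operatorD(2)[OF x(1) z(2) this], of "1/2"]
 have "((1/2) *\<^sub>R (h + u h), (1/2) *\<^sub>R (y + u y)) : x" .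
 moreover have "(1/2) *\<^sub>R (k + u k) = z k" for k
  by (simp add: u_def blinfun.diff_left blinfun.scaleR_left scaleR_2[symmetric] algebra_simps)
 ultimately show ?thesis by simp
qed

lemma piece_of_strong_prod:
 assumes x: "linear_operator x" "closed x" "affiliated N x" and N: "N = M \<or> N = Z"
  and w: "zproj w" and T': "T \<in> M" "strong_prod (bounded_opr w) x = bounded_opr T"
 shows "piece x w T"
proof -
 have T: "T : M" "closure (x O bounded_opr w) = bounded_opr T" using T' by (simp_all add: strong_prod_def)
 have 1: "w y = T h" if "(h, y) : x" for h y
 proof -
  have "(h, w y) : closure (x O bounded_opr w)"
   by (rule subsetD[OF closure_subset]) (use that in "auto simp: bounded_opr_def")
  then show ?thesis unfolding T(2) by (auto simp: bounded_opr_def)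
 qed
 have 2: "(w h, T h) : x & w (T h) = T h" for h
 proof -
  have "(h, T h) : closure (x O bounded_opr w)" unfolding T(2) by (auto simp: bounded_opr_def)
  then obtain p where p: "!!n. p n : x O bounded_opr w" "p \<longlonglongrightarrow> (h, T h)"
   unfolding closure_sequential by blast
  have q: "(w (fst (p n)), snd (p n)) : x & w (snd (p n)) = snd (p n)" for n
  proof -
   obtain \<alpha> \<beta> where ab: "(\<alpha>, \<beta>) : x" "p n = (\<alpha>, w \<beta>)" using p(1)[of n] by (auto simp: bounded_opr_def)
   have "w (w \<beta>) = w \<beta>" using w by (metis op_apply_assoc zprojD(3))
   then show ?thesis using affiliated_central[OF x(1,3) N w ab(1)] by (simp add: ab(2))
  qed
  have l1: "(%n. fst (p n)) \<longlonglongrightarrow> h" using tendsto_fst[OF p(2)] by simp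
  have l2: "(%n. snd (p n)) \<longlonglongrightarrow> T h" using tendsto_snd[OF p(2)] by simp
  have "(%n. (w (fst (p n)), snd (p n))) \<longlonglongrightarrow> (w h, T h)" by (intro tendsto_intros l1 l2)
  then have "(w h, T h) : x" by (rule closed_sequentially[OF x(2), rotated]) (use q in blast)
  moreover have "(%n. w (snd (p n))) \<longlonglongrightarrow> w (T h)" by (intro tendsto_intros l2)
  then have "(%n. snd (p n)) \<longlonglongrightarrow> w (T h)" using q by simp
  then have "w (T h) = T h" by (rule LIMSEQ_unique[OF _ l2])
  ultimately show ?thesis by simp
 qed
 have "w**T = T" by (rule blinfun_eqI) (use 2 in simp)
 then show ?thesis unfolding piece_def using w T(1) 1 2 by blast
qed

text \<open>The members \<open>w\<close> of a partition with \<open>\<parallel>w x\<parallel> \<le> n\<close> add up to the \<open>n\<close>-th projection of an exhausting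
 sequence with bounded pieces.\<close>

lemma EM_E:
 assumes "x \<in> EM"
 obtains z T where "linear_operator x" "closed x" "cseq z" "\<And>n. piece x (z n) (T n)"
proof -
 have x: "linear_operator x" "closed x" "affiliated M x"
  using assms by (auto simp: central_extension_def locally_measurable_oprs_def)
 obtain F where F: "F <= projections Z" "orthogonal_family F" "is_proj_sup M F \<one>"
  "ALL z:F. strong_prod (bounded_opr z) x : bounded_opr ` M"
  using assms by (auto simp: central_extension_def)
 have Fz: "zproj w" if "w : F" for w using F(1) that projections_Z by auto
 have Fo: "w**w' = 0" if "w : F" "w' : F" "w ~= w'" for w w'
  using F(2) that by (simp add: orthogonal_family_def)
 from F(4) have "ALL w:F. EX T. T : M & strong_prod (bounded_opr w) x = bounded_opr T" by blast
 from bchoice[OF this] obtain T where T: "!!w. w : F ==> T w : M"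
  "!!w. w : F ==> closure (x O bounded_opr w) = bounded_opr (T w)" unfolding strong_prod_def by blast
 have pw: "piece x w (T w)" if w: "w : F" for w
  by (rule piece_of_strong_prod[OF x(1,2,3) _ Fz[OF w] T(1)[OF w]]) (simp_all add: strong_prod_def T(2)[OF w])
 define Fn where "Fn = (%n::nat. {w : F. norm (T w) <= real n})"
 define P where "P = (%n (L :: 'a \<Rightarrow>\<^sub>L 'a) S. zproj L & (ALL x. ((%w. blinfun_apply w x) has_sum L x) (Fn n)) &
  (ALL w:Fn n. w**L = w) & (ALL R. (ALL w:Fn n. R**w = w) --> R**L = L) & S : M & (ALL w:Fn n. S**w = T w) & S**L = S)"
 have "EX L S. P n L S" for n
 proof -
  obtain L where L: "zproj L" "!!h. ((%w. blinfun_apply w h) has_sum blinfun_apply L h) (Fn n)"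
   "!!w. w : Fn n ==> w**L = w" "!!R. ALL w:Fn n. R**w = w ==> R**L = L"
   by (rule central_family_sum[of "Fn n"]) (use Fz Fo in "auto simp: Fn_def")
  obtain S where "S : M" "!!w. w : Fn n ==> S**w = T w" "S**L = S" "norm S <= real n"
   by (rule central_gluing[of "Fn n" T "real n" L]) (use Fz Fo T(1) pieceD(4)[OF pw] L(2) in "auto simp: Fn_def")
  with L show ?thesis unfolding P_def by blast
 qed
 then have "ALL n. EX L S. P n L S" by blast
 from choice[OF this] obtain z where "ALL n. EX S. P n (z n) S" by (rule exE)
 from choice[OF this] obtain S where "ALL n. P n (z n) (S n)" by (rule exE)
 then have f: "zproj (z n)" "((%w. blinfun_apply w x) has_sum z n x) (Fn n)" "w : Fn n ==> w**z n = w"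
  "ALL w:Fn n. R**w = w ==> R**z n = z n" "S n : M" "w : Fn n ==> S n**w = T w" "S n**z n = S n" for n x w R
  unfolding P_def by blast+
 have zc: "z n**w = w" if "w : Fn n" for n w
  using f(3)[OF that] zproj_comm[OF f(1)[of n], of w] Fz that by (simp add: Fn_def)
 obtain L where L: "zproj L" "!!h. ((%w. blinfun_apply w h) has_sum blinfun_apply L h) F"
  "!!w. w : F ==> w**L = w" "!!R. ALL w:F. R**w = w ==> R**L = L"
  by (rule central_family_sum[of F]) (use Fz Fo in auto)
 have "L : projections M" using L(1) by (simp add: projections_M)
 moreover have "L**w = w" if "w : F" for w
  using L(3)[OF that] zproj_comm[OF L(1), of w] Fz[OF that] by simp
 ultimately have "L = \<one>" using F(3) by (auto simp: is_proj_sup_def proj_le_def)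
 then have sum1: "((%w. blinfun_apply w h) has_sum h) F" for h using L(2)[of h] by simp
 have cs: "cseq z"
  unfolding cseq_def
 proof (intro conjI allI)
  fix n
  show zn: "zproj (z n)" by (rule f)
  have "z (Suc n)**z n = z n"
   by (rule f(4)) (use zc[of _ "Suc n"] in "auto simp: Fn_def")
  then show "z n**z (Suc n) = z n" using zproj_comm[OF zn, of "z (Suc n)"] f(1)[of "Suc n"] by simp
 next
  fix h
  show "(%n. z n h) \<longlonglongrightarrow> h"
  proof (rule LIMSEQ_I)
   fix e :: real assume "e > 0"
   obtain J where J: "finite J" "J <= F" "dist (\<Sum>w\<in>J. blinfun_apply w h) h <= e / 2"
    using has_sum_finite_approximation[OF sum1[of h], of "e / 2"] `e > 0` by auto
   obtain N :: nat where N: "!!w. w : J ==> norm (T w) <= real N"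
   proof -
    obtain N :: nat where N: "(\<Sum>w\<in>J. norm (T w)) <= real N" using real_arch_simple by blast
    have "norm (T w) <= real N" if "w : J" for w
     using member_le_sum[of w J "%w. norm (T w)"] J(1) that N by simp
    then show thesis by (rule that)
   qed
   have "norm (z n h - h) < e" if n: "n >= N" for n
   proof -
    let ?s = "\<Sum>w\<in>J. blinfun_apply w h"
    have "z n (w h) = w h" if "w : J" for w
    proof -
     have "norm (T w) <= real n" using N[OF that] n by (simp add: order_trans)
     then have "w : Fn n" using J(2) that by (auto simp: Fn_def)
     from zc[OF this] show ?thesis by (metis op_apply_assoc)
    qed
    then have "z n ?s = ?s" by (simp add: blinfun.sum_right)
    then have "z n h - h = - ((\<one> - z n) (h - ?s))" by (simp add: blinfun.diff_right blinfun.diff_left)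
    then have "norm (z n h - h) = norm ((\<one> - z n) (h - ?s))" by simp
    also have "... <= norm (h - ?s)"
     by (intro is_proj_contr is_proj_compl zprojD) (rule f)
    finally show ?thesis using J(3) `e > 0` by (simp add: dist_norm norm_minus_commute)
   qed
   then show "EX N. ALL n>=N. norm (z n h - h) < e" by blast
  qed
 qed
 have "piece x (z n) (S n)" for n
  unfolding piece_def
 proof (intro conjI allI impI)
  show zn: "zproj (z n)" and SM: "S n : M" by (rule f)+
  have Sz: "S n**z n = S n" by (rule f)
  then show "z n**S n = S n" using zproj_comm[OF zn SM] by simp
  have sS: "((%w. T w h) has_sum S n h) (Fn n)" for h
  proof -
   have "((%w. S n (blinfun_apply w h)) has_sum S n (z n h)) (Fn n)"
    by (rule has_sum_bounded_linear[OF blinfun.bounded_linear_right f(2)])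
   moreover have "S n (z n h) = S n h" using Sz by (metis op_apply_assoc)
   moreover have "S n (blinfun_apply w h) = T w h" if "w : Fn n" for w
    using f(6)[OF that] by (metis op_apply_assoc)
   ultimately show ?thesis using has_sum_cong[of "Fn n" "%w. S n (blinfun_apply w h)" "%w. T w h"] by simp
  qed
  show "(z n h, S n h) : x" for h
  proof (rule Lim_in_closed_set[OF x(2)])
   show "((%J. (\<Sum>w\<in>J. blinfun_apply w h, \<Sum>w\<in>J. T w h)) \<longlongrightarrow> (z n h, S n h)) (finite_subsets_at_top (Fn n))"
    using f(2)[of h n] sS[of h] unfolding has_sum_def by (intro tendsto_Pair)
   show "\<forall>\<^sub>F J in finite_subsets_at_top (Fn n). (\<Sum>w\<in>J. blinfun_apply w h, \<Sum>w\<in>J. T w h) : x"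
    by (rule eventually_finite_subsets_at_top_weakI, rule linear_operator_sum[OF x(1)])
     (use pieceD(5)[OF pw] in "auto simp: Fn_def")
  qed simp
  fix h y assume xe: "(h, y) : x"
  have "blinfun_apply w y = T w h" if "w : Fn n" for w
   using pieceD(6)[OF pw xe] that by (simp add: Fn_def)
  then have "((%w. T w h) has_sum z n y) (Fn n)"
   using f(2)[of y n] has_sum_cong[of "Fn n" "%w. blinfun_apply w y" "%w. T w h"] by simp
  then show "z n y = S n h" using sS by (rule has_sum_unique)
 qed
 then show ?thesis by (rule that[OF x(1,2) cs])
qed

subsection \<open>Bounded truncations and the algebraic operations\<close>

text \<open>For \<open>x\<close> in \<open>E(M)\<close> the piece over \<open>z\<close> is unique if it exists. An exhausting sequence of bounded
 pieces turns statements about \<open>x\<close> into statements about bounded operators.\<close>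

definition bd :: "'a opr => ('a \<Rightarrow>\<^sub>L 'a) => bool" where
 "bd x z \<longleftrightarrow> (\<exists>T. piece x z T)"

definition pc :: "'a opr => ('a \<Rightarrow>\<^sub>L 'a) => ('a \<Rightarrow>\<^sub>L 'a)" where
 "pc x z = (SOME T. piece x z T)"

definition bseq :: "'a opr => (nat => 'a \<Rightarrow>\<^sub>L 'a) => bool" where
 "bseq x z \<longleftrightarrow> cseq z \<and> (\<forall>n. bd x (z n))"

lemma bseqD: "bseq x z ==> cseq z" "bseq x z ==> bd x (z n)"
 by (auto simp: bseq_def)

lemma EM_linear: "x \<in> EM ==> linear_operator x" and EM_closed: "x \<in> EM ==> closed x"
 by (auto simp: central_extension_def locally_measurable_oprs_def)

lemma EM_bseq: "x \<in> EM ==> \<exists>z. bseq x z"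
 by (rule EM_E[of x]) (auto simp: bseq_def bd_def)

lemma pc: "bd x z ==> piece x z (pc x z)"
 unfolding bd_def pc_def by (rule someI_ex)

lemma bdI: "piece x z T ==> bd x z"
 by (auto simp: bd_def)

lemma pc_eq: "x \<in> EM ==> piece x z T ==> pc x z = T"
 by (rule piece_unique[OF EM_linear pc[OF bdI]])

lemmas pcD = pieceD[OF pc]

lemma bd_zproj: "bd x z ==> zproj z"
 by (rule pcD(1))

lemma bd_restrict:
 assumes "x \<in> EM" "bd x z" "zproj w"
 shows "bd x (w**z)" "pc x (w**z) = w**pc x z"
proof -
 have "piece x (w**z) (w**pc x z)" by (rule piece_restrict[OF EM_linear[OF assms(1)] pc[OF assms(2)] assms(3)])
 then show "bd x (w**z)" "pc x (w**z) = w**pc x z" using pc_eq[OF assms(1)] by (auto intro: bdI)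
qed

lemma bd_restrict_le:
 assumes "x \<in> EM" "bd x z" "zproj w" "w**z = w"
 shows "bd x w" "pc x w = w**pc x z"
 using bd_restrict[OF assms(1-3)] assms(4) by simp_all

lemma bseq_mult:
 assumes "x \<in> EM" "bseq x z" "cseq w"
 shows "bseq x (%n. z n**w n)" "bseq x (%n. w n**z n)"
proof -
 have "z n**w n = w n**z n" for n
  using zproj_comm[OF cseqD(1)[OF assms(3)], of "z n" n] cseqD(1)[OF bseqD(1)[OF assms(2)], of n] by simp
 then show "bseq x (%n. z n**w n)" "bseq x (%n. w n**z n)"
  using bd_restrict(1)[OF assms(1) bseqD(2)[OF assms(2)] cseqD(1)[OF assms(3)]]
   cseq_mult[OF assms(3) bseqD(1)[OF assms(2)]] by (simp_all add: bseq_def)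
qed

lemma EM_bseq2:
 assumes "x \<in> EM" "y \<in> EM"
 obtains z where "bseq x z" "bseq y z"
proof -
 obtain z w where "bseq x z" "bseq y w" using assms EM_bseq by blast
 then show ?thesis using that[of "%n. z n**w n"] bseq_mult assms bseqD(1) by blast
qed

lemma bseq_compat:
 assumes "x \<in> EM" "bseq x z"
 shows "z n**pc x (z n) = pc x (z n)" "z n**pc x (z (Suc n)) = pc x (z n)" "pc x (z n) \<in> M"
proof -
 note bs = bseqD[OF assms(2)]
 show "z n**pc x (z n) = pc x (z n)" "pc x (z n) : M" by (rule pcD[OF bs(2)])+
 show "z n**pc x (z (Suc n)) = pc x (z n)"
  using bd_restrict(2)[OF assms(1) bs(2)[of "Suc n"] cseqD(1)[OF bs(1), of n]] cseqD(3)[OF bs(1), of n "Suc n"] by simp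
qed

lemma bd_overlap:
 assumes "x \<in> EM" "bd x z" "bd x w"
 shows "w**pc x z = z**pc x w"
 by (rule piece_overlap[OF EM_linear[OF assms(1)] pc[OF assms(2)] pc[OF assms(3)]])

lemma EM_glue:
 assumes z: "bseq x z" and x: "x \<in> EM"
 shows "x = glue z (%n. pc x (z n))"
 by (rule glue_of_pieces[OF EM_linear[OF x] EM_closed[OF x] bseqD(1)[OF z] pc[OF bseqD(2)[OF z]]])

lemma EM_eqI:
 assumes "x \<in> EM" "y \<in> EM" "bseq x z" "bseq y z" "\<And>n. pc x (z n) = pc y (z n)"
 shows "x = y"
 using EM_glue[OF assms(3,1)] EM_glue[OF assms(4,2)] assms(5) by simp

lemma glue_EM:
 assumes z: "cseq z" and T: "\<And>n. T n \<in> M" "\<And>n. z n**T n = T n" "\<And>n. z n**T (Suc n) = T n"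
 shows "glue z T \<in> EM" "bseq (glue z T) z" "pc (glue z T) (z n) = T n"
  "zproj w ==> S \<in> M ==> w**S = S ==> (\<And>n. z n**S = w**T n) ==> bd (glue z T) w \<and> pc (glue z T) w = S"
proof -
 note g = glue_props[OF z T]
 show E: "glue z T : EM" by (rule EM_I[OF g(1,2) z g(3)])
 show "bseq (glue z T) z" using z g(3) by (auto simp: bseq_def bd_def)
 show "pc (glue z T) (z n) = T n" by (rule pc_eq[OF E g(3)])
 assume "zproj w" "S : M" "w**S = S" "!!n. z n**S = w**T n"
 then have "piece (glue z T) w S" by (rule piece_of_cseq[OF g(1,2) z g(3)])
 then show "bd (glue z T) w & pc (glue z T) w = S" using pc_eq[OF E] bdI by blast
qed

lemma bounded_opr_EM:
 assumes "T \<in> M"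
 shows "bounded_opr T \<in> EM" "zproj z ==> bd (bounded_opr T) z" "zproj z ==> pc (bounded_opr T) z = z**T"
proof -
 note b = bounded_opr_props[OF assms]
 show E: "bounded_opr T : EM" by (rule EM_I[OF b(1,2) cseq_one b(3)]) simp
 show "zproj z ==> bd (bounded_opr T) z" "zproj z ==> pc (bounded_opr T) z = z**T"
  using b(3) pc_eq[OF E] bdI by blast+
qed

lemma strong_sum_EM:
 assumes x: "x \<in> EM" and y: "y \<in> EM"
 shows "strong_sum x y \<in> EM"
  and "bd x w ==> bd y w ==> bd (strong_sum x y) w \<and> pc (strong_sum x y) w = pc x w + pc y w"
proof -
 obtain z where z: "bseq x z" "bseq y z" by (rule EM_bseq2[OF x y])
 let ?T = "%n. pc x (z n) + pc y (z n)"
 note cx = bseq_compat[OF x z(1)] and cy = bseq_compat[OF y z(2)] and cz = bseqD(1)[OF z(1)]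
 have T: "?T n : M" "z n**?T n = ?T n" "z n**?T (Suc n) = ?T n" for n
  using cx cy by (simp_all add: opm.add_right)
 have "strong_sum x y = glue z ?T"
  unfolding strong_sum_def
 proof (rule closure_eq_glue[OF cz T])
  show "{(h, k + l) |h k l. (h, k) : x & (h, l) : y} <= glue z ?T"
   using pcD(6)[OF bseqD(2)[OF z(1)]] pcD(6)[OF bseqD(2)[OF z(2)]]
   by (auto simp: glue_def blinfun.add_right blinfun.add_left)
  show "(z n h, ?T n h) : {(h, k + l) |h k l. (h, k) : x & (h, l) : y}" for n h
   using pcD(5)[OF bseqD(2)[OF z(1)], of n h] pcD(5)[OF bseqD(2)[OF z(2)], of n h]
   by (auto simp: blinfun.add_left)
 qed
 note g = this glue_EM[OF cz T]
 show "strong_sum x y : EM" using g(1,2) by simp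
 assume w: "bd x w" "bd y w"
 show "bd (strong_sum x y) w & pc (strong_sum x y) w = pc x w + pc y w"
  unfolding g(1)
 proof (rule g(5))
  show "z n**(pc x w + pc y w) = w**(pc x (z n) + pc y (z n))" for n
   using bd_overlap[OF x w(1) bseqD(2)[OF z(1)], of n] bd_overlap[OF y w(2) bseqD(2)[OF z(2)], of n]
   by (simp add: opm.add_right)
 qed (use pcD[OF w(1)] pcD[OF w(2)] in "simp_all add: opm.add_right")
qed

lemma strong_scale_EM:
 assumes x: "x \<in> EM"
 shows "strong_scale c x \<in> EM"
  and "bd x w ==> bd (strong_scale c x) w \<and> pc (strong_scale c x) w = cmul c**pc x w"
proof -
 obtain z where z: "bseq x z" using EM_bseq[OF x] by blast
 let ?T = "%n. cmul c**pc x (z n)"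
 note cx = bseq_compat[OF x z] and cz = bseqD(1)[OF z]
 have cc: "w**(cmul c**S) = cmul c**(w**S)" if "zproj w" for w S
  using zproj_comm[OF that cmul_M] by (metis opm_assoc)
 have T: "?T n : M" "z n**?T n = ?T n" "z n**?T (Suc n) = ?T n" for n
  using cx cmul_M unfolding cc[OF cseqD(1)[OF cz]] by simp_all
 have "strong_scale c x = glue z ?T"
  unfolding strong_scale_def
 proof (rule closure_eq_glue[OF cz T])
  have "z n (c *\<^sub>C y) = c *\<^sub>C z n y" for n y
   using M_clinear[of "z n"] cseqD(1)[OF cz, of n] by (simp add: clinear_ops_def)
  then show "{(h, c *\<^sub>C y) |h y. (h, y) : x} <= glue z ?T"
   using pcD(6)[OF bseqD(2)[OF z]] by (auto simp: glue_def)
  show "(z n h, ?T n h) : {(h, c *\<^sub>C y) |h y. (h, y) : x}" for n h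
   using pcD(5)[OF bseqD(2)[OF z], of n h] by auto
 qed
 note g = this glue_EM[OF cz T]
 show "strong_scale c x : EM" using g(1,2) by simp
 assume w: "bd x w"
 show "bd (strong_scale c x) w & pc (strong_scale c x) w = cmul c**pc x w"
  unfolding g(1)
 proof (rule g(5))
  show "z n**(cmul c**pc x w) = w**(cmul c**pc x (z n))" for n
   using bd_overlap[OF x w bseqD(2)[OF z], of n] unfolding cc[OF cseqD(1)[OF cz]] cc[OF bd_zproj[OF w]] by simp
  show "w**(cmul c**pc x w) = cmul c**pc x w"
   unfolding cc[OF bd_zproj[OF w]] pcD(3)[OF w] by simp
 qed (use pcD[OF w] cmul_M in simp_all)
qed

lemma strong_diff_EM:
 assumes x: "x \<in> EM" and y: "y \<in> EM"
 shows "strong_diff x y \<in> EM"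
  and "bd x w ==> bd y w ==> bd (strong_diff x y) w \<and> pc (strong_diff x y) w = pc x w - pc y w"
proof -
 have m: "(cmul (- 1) :: 'a \<Rightarrow>\<^sub>L 'a) = - \<one>"
 proof (rule blinfun_eqI)
  fix h :: 'a
  show "cmul (- 1) h = (- \<one>) h" using scaleC_of_real[of "-1" h] by (simp add: blinfun.minus_left)
 qed
 show "strong_diff x y : EM" unfolding strong_diff_def by (intro strong_sum_EM strong_scale_EM x y)
 assume "bd x w" "bd y w"
 then show "bd (strong_diff x y) w & pc (strong_diff x y) w = pc x w - pc y w"
  using strong_sum_EM(2)[OF x strong_scale_EM(1)[OF y], of w "-1"] strong_scale_EM(2)[OF y, of w "-1"]
  by (simp add: strong_diff_def m opm.minus_left)
qed

lemma adj_EM: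
 assumes x: "x \<in> EM"
 shows "adj x \<in> EM"
  and "bd x w ==> bd (adj x) w \<and> pc (adj x) w = dag (pc x w)"
proof -
 obtain z where z: "bseq x z" using EM_bseq[OF x] by blast
 let ?T = "%n. dag (pc x (z n))"
 note cx = bseq_compat[OF x z] and cz = bseqD(1)[OF z]
 have dz: "v **dag S = dag (v **S)" if "zproj v" "S : M" for v S
  using zproj_comm[OF that] that(1) by (metis dag_comp zprojD(4))
 have T: "?T n : M" "z n**?T n = ?T n" "z n**?T (Suc n) = ?T n" for n
  using cx dz[OF cseqD(1)[OF cz]] by simp_all
 have "adj x = glue z ?T"
 proof -
  have "(ALL (h, s):x. rin s y = rin h k) \<longleftrightarrow> (ALL n. z n k = ?T n y)" for y k
  proof
   assume *: "ALL (h, s):x. rin s y = rin h k"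
   show "ALL n. z n k = ?T n y"
   proof
    fix n
    have "rin (?T n y - z n k) h = 0" for h
    proof -
     have "rin (pc x (z n) h) y = rin (z n h) k" using * pcD(5)[OF bseqD(2)[OF z], of n h] by blast
     then show ?thesis using cseqD(1)[OF cz, of n]
      by (simp add: rin_simps rin_dag rin_commute[of _ h])
    qed
    then show "z n k = ?T n y" using rin_all_zero[of "?T n y - z n k"] by simp
   qed
  next
   assume *: "ALL n. z n k = ?T n y"
   show "ALL (h, s):x. rin s y = rin h k"
   proof clarify
    fix h s assume xo: "(h, s) : x"
    have "rin (z n s) y = rin h (z n k)" for n
     using pcD(6)[OF bseqD(2)[OF z] xo, of n] *[THEN spec, of n] by (simp add: rin_dag)
    moreover have "(%n. rin (z n s) y) \<longlonglongrightarrow> rin s y" "(%n. rin h (z n k)) \<longlonglongrightarrow> rin h k"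
     by (intro tendsto_intros cseqD cz)+
    ultimately show "rin s y = rin h k" using LIMSEQ_unique by auto
   qed
  qed
  then show ?thesis unfolding adj_rin[OF EM_linear[OF x]] glue_def by simp
 qed
 note g = this glue_EM[OF cz T]
 show "adj x : EM" using g(1,2) by simp
 assume w: "bd x w"
 show "bd (adj x) w & pc (adj x) w = dag (pc x w)"
  unfolding g(1)
 proof (rule g(5))
  show "z n**dag (pc x w) = w**?T n" for n
   using bd_overlap[OF x w bseqD(2)[OF z], of n] dz[OF cseqD(1)[OF cz]] dz[OF bd_zproj[OF w]] pcD(2)[OF w] cx(3) by simp
 qed (use pcD[OF w] dz in simp_all)
qed

end

section \<open>Order and modulus on the central extension\<close>

lemma cmul_of_real: "cmul (complex_of_real r) = r *\<^sub>R (\<one> :: 'a::complex_hilbert \<Rightarrow>\<^sub>L 'a)"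
 by (rule blinfun_eqI) (simp add: blinfun.scaleR_left scaleC_of_real)

lemma norm_proj_comp: "is_proj p ==> norm (p**T) \<le> norm T"
 using norm_comp_le[of p T] mult_right_mono[OF is_proj_norm[of p] norm_ge_zero[of T]] by simp

lemma norm_le_of_pos: "pos T ==> T \<preceq> c *\<^sub>R \<one> ==> 0 \<le> c ==> norm T \<le> c"
 using pos_add[of T "c *\<^sub>R \<one>"] by (intro norm_op_le pos_dag) (auto simp: pos_scaleR)

context vn_algebra
begin

lemma EH_EM: "x \<in> E_h M ==> x \<in> EM" and EH_adj: "x \<in> E_h M ==> adj x = x"
 by (auto simp: self_adjoint_part_def)

lemma EH_pc: "x \<in> E_h M ==> bd x z ==> dag (pc x z) = pc x z"
 using adj_EM(2)[of x z] by (simp add: EH_adj EH_EM)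

lemma EHI:
 assumes "x \<in> EM" "bseq x z" "\<And>n. dag (pc x (z n)) = pc x (z n)"
 shows "x \<in> E_h M"
proof -
 note a = adj_EM[OF assms(1)]
 have "bseq (adj x) z" using a(2) assms(2) by (auto simp: bseq_def)
 then have "adj x = x"
  by (rule EM_eqI[OF a(1) assms(1) _ assms(2)]) (simp add: a(2) bseqD(2)[OF assms(2)] assms(3))
 then show ?thesis using assms(1) by (simp add: self_adjoint_part_def)
qed

lemma common_bseq:
 assumes "finite X" "X \<subseteq> EM"
 shows "\<exists>z. cseq z \<and> (\<forall>x\<in>X. bseq x z)"
 using assms
proof (induction X rule: finite_induct)
 case empty
 then show ?case using cseq_one by blast
next
 case (insert x X)
 then obtain z where z: "cseq z" "ALL y:X. bseq y z" by auto
 obtain w where w: "bseq x w" using EM_bseq[of x] insert.prems by auto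
 have "bseq x (%n. w n**z n)" by (rule bseq_mult(1)[OF _ w z(1)]) (use insert in auto)
 moreover have "bseq y (%n. w n**z n)" if "y : X" for y
  by (rule bseq_mult(2)) (use insert that z w bseqD(1) in auto)
 ultimately show ?case using cseq_mult[OF bseqD(1)[OF w] z(1)] by blast
qed

lemma bounded_opr_EH: "T \<in> M ==> dag T = T ==> bounded_opr T \<in> E_h M"
 by (rule EHI[where z = "%_. \<one>"]) (auto simp: bounded_opr_EM bseq_def cseq_one)

lemma strong_sum_EH: "x \<in> E_h M ==> y \<in> E_h M ==> strong_sum x y \<in> E_h M"
proof -
 assume x: "x : E_h M" and y: "y : E_h M"
 note E = EH_EM[OF x] EH_EM[OF y]
 obtain z where z: "bseq x z" "bseq y z" by (rule EM_bseq2[OF E])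
 note s = strong_sum_EM(2)[OF E bseqD(2)[OF z(1)] bseqD(2)[OF z(2)]]
 show ?thesis
 proof (rule EHI[OF strong_sum_EM(1)[OF E], where z = z])
  show "bseq (strong_sum x y) z" unfolding bseq_def using s bseqD(1)[OF z(1)] by blast
  show "dag (pc (strong_sum x y) (z n)) = pc (strong_sum x y) (z n)" for n
   unfolding s[THEN conjunct2] dag_add EH_pc[OF x bseqD(2)[OF z(1)]] EH_pc[OF y bseqD(2)[OF z(2)]] ..
 qed
qed

lemma strong_scale_pc:
 assumes "x \<in> EM" "bd x w"
 shows "bd (strong_scale (complex_of_real r) x) w" "pc (strong_scale (complex_of_real r) x) w = r *\<^sub>R pc x w"
 using strong_scale_EM(2)[OF assms, of "complex_of_real r"] by (simp_all add: cmul_of_real opm.scaleR_left)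

lemma strong_scale_EH:
 assumes "x \<in> E_h M"
 shows "strong_scale (complex_of_real r) x \<in> E_h M"
proof -
 obtain z where z: "bseq x z" using EM_bseq[OF EH_EM[OF assms]] by blast
 note s = strong_scale_pc[OF EH_EM[OF assms] bseqD(2)[OF z]]
 show ?thesis
 proof (rule EHI[OF strong_scale_EM(1)[OF EH_EM[OF assms]], where z = z])
  show "bseq (strong_scale (complex_of_real r) x) z" unfolding bseq_def using s(1) bseqD(1)[OF z] by blast
  show "dag (pc (strong_scale (complex_of_real r) x) (z n)) = pc (strong_scale (complex_of_real r) x) (z n)" for n
   unfolding s(2) dag_scaleR EH_pc[OF assms bseqD(2)[OF z]] ..
 qed
qed

lemma strong_diff_EH: "x \<in> E_h M ==> y \<in> E_h M ==> strong_diff x y \<in> E_h M"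
 unfolding strong_diff_def using strong_sum_EH strong_scale_EH[of y "-1"] by simp

lemma positive_opr_pc:
 assumes "x \<in> E_h M" "positive_opr x" "bd x z"
 shows "pos (pc x z)"
 unfolding pos_def
proof (intro conjI allI)
 show "dag (pc x z) = pc x z" by (rule EH_pc[OF assms(1,3)])
 fix h
 have "0 <= rin (pc x z h) (z h)"
  using pcD(5)[OF assms(3), of h] assms(2) by (auto simp: positive_opr_def rin_def)
 also have "rin (pc x z h) (z h) = rin (pc x z h) h"
  using rin_dag[of z "pc x z h" h] pcD(1,3)[OF assms(3)] by (metis op_apply_assoc zprojD(4))
 finally show "0 <= rin (pc x z h) h" .
qed

lemma positive_oprI:
 assumes "bseq x z" "\<And>n. pos (pc x (z n))"
 shows "positive_opr x"
 unfolding positive_opr_def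
proof clarify
 fix h y assume xe: "(h, y) : x"
 note b = bseqD[OF assms(1)]
 have e: "pc x (z n) h = z n y" for n using pcD(6)[OF b(2) xe, of n] by simp
 have l: "(%n. pc x (z n) h) \<longlonglongrightarrow> y" unfolding e by (rule cseqD(2)[OF b(1)])
 have c: "cinner (pc x (z n) h) h = cinner h (pc x (z n) h)" for n
  using is_adjoint_M[OF pcD(2)[OF b(2)]] pos_dag[OF assms(2)] by (metis is_adjoint_def)
 have "rin (pc x (z n) h) (\<i> *\<^sub>C h) = 0" for n
  using c[of n] cinner_commute[of "pc x (z n) h" h] unfolding Im_cinner[symmetric]
  by (metis cnj.simps(2) neg_equal_zero)
 moreover have "(%n. rin (pc x (z n) h) (\<i> *\<^sub>C h)) \<longlonglongrightarrow> rin y (\<i> *\<^sub>C h)" by (intro tendsto_intros l)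
 ultimately have 1: "rin y (\<i> *\<^sub>C h) = 0" by (simp add: LIMSEQ_const_iff)
 have "(%n. rin (pc x (z n) h) h) \<longlonglongrightarrow> rin y h" by (intro tendsto_intros l)
 then have "0 <= rin y h" by (rule LIMSEQ_le_const) (use pos_ge[OF assms(2)] in blast)
 with 1 show "Im (cinner y h) = 0 & 0 <= Re (cinner y h)" by (simp add: Im_cinner rin_def)
qed

lemma opr_leD:
 assumes "opr_le x y" "x \<in> E_h M" "y \<in> E_h M" "bd x z" "bd y z"
 shows "pc x z \<preceq> pc y z"
 using positive_opr_pc[OF strong_diff_EH[OF assms(3,2)], of z] assms(1)
  strong_diff_EM(2)[OF EH_EM[OF assms(3)] EH_EM[OF assms(2)] assms(5,4)] by (simp add: opr_le_def)

lemma opr_leI: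
 assumes "x \<in> EM" "y \<in> EM" "bseq x z" "bseq y z" "\<And>n. pc x (z n) \<preceq> pc y (z n)"
 shows "opr_le x y"
proof -
 note d = strong_diff_EM(2)[OF assms(2,1) bseqD(2)[OF assms(4)] bseqD(2)[OF assms(3)]]
 show ?thesis unfolding opr_le_def
 proof (rule positive_oprI[of _ z])
  show "bseq (strong_diff y x) z" unfolding bseq_def using d bseqD(1)[OF assms(3)] by blast
  show "pos (pc (strong_diff y x) (z n))" for n unfolding d[THEN conjunct2] by (rule assms(5))
 qed
qed

lemma opr_le_refl: "x \<in> EM ==> opr_le x x"
proof -
 assume x: "x : EM"
 then obtain z where "bseq x z" using EM_bseq by blast
 then show ?thesis by (intro opr_leI[OF x x, of z]) simp_all
qed

lemma opr_le_trans:
 assumes "opr_le x y" "opr_le y w" "x \<in> E_h M" "y \<in> E_h M" "w \<in> E_h M"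
 shows "opr_le x w"
proof -
 obtain z where z: "bseq x z" "bseq y z" "bseq w z"
  using common_bseq[of "{x, y, w}"] assms EH_EM by auto
 show ?thesis
  by (rule opr_leI[OF EH_EM[OF assms(3)] EH_EM[OF assms(5)] z(1,3)])
   (rule op_le_trans[OF opr_leD[OF assms(1,3,4) bseqD(2)[OF z(1)] bseqD(2)[OF z(2)]]
    opr_leD[OF assms(2,4,5) bseqD(2)[OF z(2)] bseqD(2)[OF z(3)]]])
qed

text \<open>A family of compatible pieces of \<open>x\<close> bounded by \<open>K\<close> has a strong limit, so a norm bound
 along any exhausting sequence bounds \<open>x\<close> itself on the whole central projection.\<close>

lemma bd_of_norm_le:
 assumes x: "x \<in> EM" "bseq x z" and w: "zproj w" and K: "\<And>n. norm (w**pc x (z n)) \<le> K"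
 shows "bd x w" "norm (pc x w) \<le> K"
proof -
 let ?T = "%n. w**pc x (z n)"
 note b = bseqD[OF x(2)]
 have K0: "0 <= K" using K[of 0] norm_ge_zero order_trans by blast
 have TM: "?T n : M" for n using pcD(2)[OF b(2)] w by simp
 have step: "?T m = z m**?T n" "?T m = ?T n**z m" if "m <= n" for m n
 proof -
  have "pc x (z m) = z m**pc x (z n)"
   using bd_restrict_le(2)[OF x(1) b(2)[of n] cseqD(1)[OF b(1), of m] cseqD(3)[OF b(1) that]] .
  then show 1: "?T m = z m**?T n" using zproj_comm[OF w, of "z m"] cseqD(1)[OF b(1), of m] by (metis opm_assoc zprojD(1) Z_M)
  then show "?T m = ?T n**z m" using zproj_comm[OF cseqD(1)[OF b(1)] TM] by simp
 qed
 have "Cauchy (%n. ?T n h)" for h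
 proof (rule CauchyI)
  fix e :: real assume "e > 0"
  define d where "d = e / (K + 1)"
  have d: "d > 0" using `e > 0` K0 by (simp add: d_def)
  have "Cauchy (%n. z n h)" using cseqD(2)[OF b(1)] LIMSEQ_imp_Cauchy by blast
  from CauchyD[OF this d] obtain N where N: "!!m n. m >= N ==> n >= N ==> norm (z m h - z n h) < d" by blast
  have main: "norm (?T m h - ?T n h) < e" if "m >= N" "n >= N" for m n
  proof -
   define k where "k = max m n"
   have "?T m h - ?T n h = ?T k (z m h - z n h)"
    unfolding step(2)[of m k, unfolded k_def, OF max.cobounded1] step(2)[of n k, unfolded k_def, OF max.cobounded2]
    by (simp add: k_def blinfun.diff_right)
   then have "norm (?T m h - ?T n h) <= norm (?T k) * norm (z m h - z n h)" by (simp only: norm_blinfun)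
   also have "... <= K * d" using N[OF that] by (intro mult_mono K K0) auto
   also have "... < e" using `e > 0` K0 by (simp add: d_def field_simps)
   finally show ?thesis .
  qed
  show "EX M. ALL m>=M. ALL n>=M. norm (?T m h - ?T n h) < e" by (intro exI[of _ N] allI impI main)
 qed
 then have "convergent (%n. ?T n h)" for h by (simp add: Cauchy_convergent_iff)
 then have lim: "(%n. ?T n h) \<longlonglongrightarrow> lim (%n. ?T n h)" for h by (simp add: convergent_LIMSEQ_iff)
 obtain S where S: "!!h. blinfun_apply S h = lim (%n. ?T n h)" "norm S <= K"
  by (rule pointwise_limit_op[OF sequentially_bot lim always_eventually[OF allI[OF K]]], rule that)
 have SM: "S : M"
  by (rule vna_limit[OF vna_M sequentially_bot always_eventually[OF allI[OF TM]]]) (simp only: S, rule lim)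
 have zS: "z n**S = ?T n" for n
 proof (rule blinfun_eqI)
  fix h
  have "(%k. z n (?T k h)) \<longlonglongrightarrow> z n (S h)" unfolding S by (intro tendsto_intros lim)
  moreover have "\<forall>\<^sub>F k in sequentially. z n (?T k h) = ?T n h"
   using step(1)[of n] unfolding eventually_sequentially by (metis op_apply_assoc)
  ultimately have "(%k. ?T n h) \<longlonglongrightarrow> z n (S h)" by (rule Lim_transform_eventually)
  then show "(z n**S) h = ?T n h" by (simp add: LIMSEQ_const_iff)
 qed
 have wS: "w**S = S"
 proof (rule cseq_op_eqI[OF b(1)])
  fix n
  have "z n**(w**S) = w**(z n**S)" using zproj_comm[OF w, of "z n"] cseqD(1)[OF b(1), of n] by (metis opm_assoc zprojD(1) Z_M)
  then show "z n**(w**S) = z n**S" unfolding zS using w by (simp add: is_proj_absorb)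
 qed
 have "piece x w S"
  by (rule piece_of_cseq[OF EM_linear[OF x(1)] EM_closed[OF x(1)] b(1) pc[OF b(2)] w SM wS]) (rule zS)
 then show "bd x w" "norm (pc x w) <= K" using pc_eq[OF x(1)] S(2) by (auto intro: bdI)
qed

lemma bd_of_opr_le:
 assumes v: "v \<in> E_h M" "c \<in> E_h M" "opr_le v c" "opr_le (strong_scale (- 1) c) v"
  and c: "bd c w" "norm (pc c w) \<le> K"
 shows "bd v w" "norm (pc v w) \<le> K"
proof -
 note E = EH_EM[OF v(1)] EH_EM[OF v(2)]
 obtain z where z: "bseq v z" "bseq c z" by (rule EM_bseq2[OF E])
 have m: "strong_scale (- 1) c : E_h M" using strong_scale_EH[OF v(2), of "-1"] by simp
 have K: "norm (w**pc v (z n)) <= K" for n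
 proof -
  note zn = cseqD(1)[OF bseqD(1)[OF z(1)], of n] and w = bd_zproj[OF c(1)]
  have v1: "bd v (w**z n)" "pc v (w**z n) = w**pc v (z n)" by (rule bd_restrict[OF E(1) bseqD(2)[OF z(1)] w])+
  have c1: "bd c (w**z n)" by (rule bd_restrict(1)[OF E(2) bseqD(2)[OF z(2)] w])
  have wz: "w**z n = z n**w" using zproj_comm[OF zn, of w] w by simp
  have "pc c (w**z n) = z n**pc c w" unfolding wz by (rule bd_restrict(2)[OF E(2) c(1) zn])
  then have "norm (pc c (w**z n)) <= norm (pc c w)"
   using norm_proj_comp[OF zprojD(2)[OF zn]] by simp
  then have nc: "norm (pc c (w**z n)) <= K" using c(2) by simp
  note cc = op_le_norm[OF EH_pc[OF v(2) c1] nc]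
  have "pc v (w**z n) \<preceq> K *\<^sub>R \<one>" by (rule op_le_trans[OF opr_leD[OF v(3,1,2) v1(1) c1] cc(1)])
  moreover have "- (K *\<^sub>R \<one>) \<preceq> pc v (w**z n)"
  proof (rule op_le_trans)
   have s: "bd (strong_scale (- 1) c) (w**z n)" "pc (strong_scale (- 1) c) (w**z n) = - pc c (w**z n)"
    using strong_scale_pc[OF E(2) c1, of "-1"] by simp_all
   show "- pc c (w**z n) \<preceq> pc v (w**z n)" using opr_leD[OF v(4) m v(1) s(1) v1(1)] s(2) by simp
   show "- (K *\<^sub>R \<one>) \<preceq> - pc c (w**z n)" using cc(1) by (simp add: algebra_simps)
  qed
  moreover have "0 <= K" using nc norm_ge_zero order_trans by blast
  ultimately have "norm (pc v (w**z n)) <= K" by (intro norm_op_le EH_pc[OF v(1) v1(1)])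
  then show ?thesis by (simp add: v1(2))
 qed
 show "bd v w" "norm (pc v w) <= K" by (rule bd_of_norm_le[OF E(1) z(1) bd_zproj[OF c(1)] K])+
qed

subsection \<open>The modulus\<close>

text \<open>The domain of a glued operator consists of the vectors at which the pieces converge, which depends
 on the norms of the pieces only. Therefore \<open>x\<close> and \<open>|x|\<close> have the same domain.\<close>

lemma glue_same_domain:
 assumes z: "cseq z"
  and T: "\<And>m n. m \<le> n ==> T m = T n**z m"
  and S: "\<And>m n. m \<le> n ==> S m = S n**z m" "\<And>m n. m \<le> n ==> S m = z m**S n"
  and eq: "\<And>n h. norm (S n h) = norm (T n h)"
  and x: "(h, s) \<in> glue z T"
 shows "\<exists>y. (h, y) \<in> glue z S"
proof -
 have xT: "z n s = T n h" for n using x by (simp add: glue_def)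
 have d: "norm (S m h - S n h) = norm (z m s - z n s)" for m n
 proof -
  define k where "k = max m n"
  have k: "m <= k" "n <= k" by (auto simp: k_def)
  have "S m h - S n h = S k (z m h - z n h)"
   unfolding S(1)[OF k(1)] S(1)[OF k(2)] by (simp add: blinfun.diff_right)
  moreover have "T m h - T n h = T k (z m h - z n h)"
   unfolding T[OF k(1)] T[OF k(2)] by (simp add: blinfun.diff_right)
  ultimately show ?thesis using eq xT by simp
 qed
 have "Cauchy (%n. z n s)" using cseqD(2)[OF z] LIMSEQ_imp_Cauchy by blast
 then have "Cauchy (%n. S n h)" unfolding Cauchy_def dist_norm d .
 then obtain y where l: "(%n. S n h) \<longlonglongrightarrow> y" using Cauchy_convergent_iff convergent_def by blast
 have "z m y = S m h" for m
 proof -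
  have "(%n. z m (S n h)) \<longlonglongrightarrow> z m y" by (intro tendsto_intros l)
  moreover have "\<forall>\<^sub>F n in sequentially. z m (S n h) = S m h"
   using S(2)[of m] unfolding eventually_sequentially by (metis op_apply_assoc)
  ultimately have "(%n. S m h) \<longlonglongrightarrow> z m y" by (rule Lim_transform_eventually)
  then show ?thesis by (simp add: LIMSEQ_const_iff)
 qed
 then show ?thesis by (auto simp: glue_def)
qed

lemma oabs_zmult:
 assumes "zproj z" "T \<in> M"
 shows "oabs (z**T) = z**oabs T"
proof (rule oabs_eqI)
 have aM: "oabs T : M" by (rule vna_oabs[OF vna_M assms(2)])
 show "pos (z**oabs T)" by (rule pos_zmult[OF assms(1) aM oabs_pos])
 have "z**oabs T**(z**oabs T) = z**(oabs T**oabs T)"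
  using zproj_comm[OF assms(1) aM] assms(1) by (metis opm_assoc zprojD(3))
 also have "... = z**dag T**T" by (simp add: oabs_square opm_assoc)
 also have "... = dag (z**T)**(z**T)"
  using zproj_comm[OF assms(1), of "dag T"] assms by (simp add: dag_comp) (metis opm_assoc zprojD(3))
 finally show "z**oabs T**(z**oabs T) = dag (z**T)**(z**T)" .
qed

text \<open>The operator glued from the moduli of the pieces is positive and self-adjoint, and its square is
 \<open>x\<^sup>* x\<close> with the same domain; uniqueness of positive square roots identifies it with \<open>|x|\<close>.\<close>

lemma modulus_EM:
 assumes x: "x \<in> EM"
 shows "modulus x \<in> E_h M" "bd x w ==> bd (modulus x) w \<and> pc (modulus x) w = oabs (pc x w)"
proof -
 obtain z where z: "bseq x z" using EM_bseq[OF x] by blast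
 note b = bseqD[OF z] and cx = bseq_compat[OF x z]
 note zn = cseqD(1)[OF b(1)]
 define T S where "T = (%n. pc x (z n))" and "S = (%n. oabs (T n))"
 have TM: "T n : M" for n using cx by (simp add: T_def)
 have SM: "S n : M" for n unfolding S_def by (rule vna_oabs[OF vna_M TM])
 have T1: "T m = z m**T n" "T m = T n**z m" if "m <= n" for m n
 proof -
  show 1: "T m = z m**T n" unfolding T_def
   by (rule bd_restrict_le(2)[OF x b(2) zn cseqD(3)[OF b(1) that]])
  then show "T m = T n**z m" using zproj_comm[OF zn TM] by simp
 qed
 have S1: "S m = z m**S n" "S m = S n**z m" if "m <= n" for m n
 proof -
  show 1: "S m = z m**S n" unfolding S_def T1(1)[OF that] by (rule oabs_zmult[OF zn TM])
  then show "S m = S n**z m" using zproj_comm[OF zn SM] by simp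
 qed
 have ST: "norm (S n h) = norm (T n h)" for n h by (simp add: S_def norm_oabs_apply)
 have SS: "S n**S n = dag (T n)**T n" "dag (S n) = S n" "pos (S n)" for n
  unfolding S_def using oabs_square oabs_pos pos_dag by auto
 define y where "y = glue z S"
 note g = glue_EM[OF b(1), of S, OF SM S1(1)[OF order_refl, symmetric] S1(1)[OF le_SucI[OF order_refl], symmetric], folded y_def]
 have yh: "y : E_h M" by (rule EHI[OF g(1,2)]) (simp add: g(3) SS)
 have yp: "positive_opr y" by (rule positive_oprI[OF g(2)]) (simp add: g(3) SS)
 have xT: "x = glue z T" unfolding T_def by (rule EM_glue[OF z x])
 have ax: "(s, l) : adj x \<longleftrightarrow> (ALL n. z n l = dag (T n) s)" for s l
 proof -
  have "bseq (adj x) z" using adj_EM(2)[OF x] z by (auto simp: bseq_def)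
  from EM_glue[OF this adj_EM(1)[OF x]] adj_EM(2)[OF x b(2)]
  have "adj x = glue z (%n. dag (T n))" by (simp add: T_def)
  then show ?thesis by (simp add: glue_def)
 qed
 have Tz: "dag (T n) s = dag (T n) (z n s)" for n s
 proof -
  have "dag (z n**T n) = dag (T n)**z n" using zn[of n] by (simp add: dag_comp)
  then show ?thesis using T1(1)[of n n] by (metis op_apply_assoc order_refl)
 qed
 have Sz: "S n s = S n (z n s)" for n s using S1(2)[of n n] by (metis op_apply_assoc order_refl)
 have SSa: "S n (S n h) = dag (T n) (T n h)" for n h using SS(1)[of n] by (metis op_apply_assoc)
 have eq: "y O y = x O adj x"
 proof (intro equalityI subrelI)
  fix h l assume "(h, l) : y O y"
  then obtain k where e: "!!n. z n k = S n h" "!!n. z n l = S n k" by (auto simp: y_def glue_def)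
  then have "(h, k) : glue z S" by (simp add: glue_def)
  from glue_same_domain[OF b(1) S1(2) T1(2) T1(1) ST[symmetric] this]
  obtain s where o: "(h, s) : glue z T" by blast
  then have o': "z n s = T n h" for n by (simp add: glue_def)
  have "z n l = dag (T n) s" for n
   unfolding Tz[of n s] o' SSa[symmetric] e(1)[symmetric] Sz[symmetric] by (rule e(2))
  then show "(h, l) : x O adj x" using o xT ax by blast
 next
  fix h l assume "(h, l) : x O adj x"
  then obtain s where o: "(h, s) : glue z T" "!!n. z n l = dag (T n) s" using xT ax by blast
  from glue_same_domain[OF b(1) T1(2) S1(2) S1(1) ST o(1)]
  obtain k where e: "(h, k) : y" by (auto simp: y_def)
  then have e': "z n k = S n h" for n by (simp add: y_def glue_def)
  have o': "z n s = T n h" for n using o(1) by (simp add: glue_def)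
  have "z n l = S n k" for n
   unfolding Sz[of n k] e' SSa o'[symmetric] Tz[symmetric] by (rule o(2))
  then have "(k, l) : y" by (simp add: y_def glue_def)
  with e show "(h, l) : y O y" by blast
 qed
 have "modulus x = y"
  unfolding modulus_def
 proof (rule the_equality)
  show "linear_operator y & adj y = y & positive_opr y & y O y = x O adj x"
   using yh yp eq EH_adj EM_linear[OF EH_EM] by blast
  fix y' assume "linear_operator y' & adj y' = y' & positive_opr y' & y' O y' = x O adj x"
  then show "y' = y"
   using unbounded_sqrt_unique[of y' y] EM_linear[OF EH_EM[OF yh]] EH_adj[OF yh] yp eq by simp
 qed
 then show "modulus x : E_h M" using yh by simp
 assume w: "bd x w"
 have "bd y w & pc y w = oabs (pc x w)"
  unfolding y_def
 proof (rule glue_EM(4)[OF b(1), of S, OF SM S1(1)[OF order_refl, symmetric] S1(1)[OF le_SucI[OF order_refl], symmetric]])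
  show "zproj w" "oabs (pc x w) : M" by (rule bd_zproj[OF w], rule vna_oabs[OF vna_M pcD(2)[OF w]])
  show "w**oabs (pc x w) = oabs (pc x w)"
   using oabs_zmult[OF bd_zproj[OF w] pcD(2)[OF w]] pcD(3)[OF w] by simp
  show "z n**oabs (pc x w) = w**S n" for n
   unfolding S_def oabs_zmult[OF zn pcD(2)[OF w], symmetric] oabs_zmult[OF bd_zproj[OF w] TM, symmetric]
   using bd_overlap[OF x w b(2), of n] by (simp add: T_def)
 qed
 then show "bd (modulus x) w & pc (modulus x) w = oabs (pc x w)" using `modulus x = y` by simp
qed

end

section \<open>Measurable operators over the center\<close>

lemma finite_esssup_iff:
 assumes "f \<in> borel_measurable \<mu>"
 shows "Linf_norm \<mu> f \<le> ereal c \<longleftrightarrow> (AE s in \<mu>. cmod (f s) \<le> c)"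
proof -
 have m: "(%s. ereal (cmod (f s))) : borel_measurable \<mu>" using assms by measurable
 show ?thesis
 proof
  assume "Linf_norm \<mu> f <= ereal c"
  moreover have "AE s in \<mu>. ereal (cmod (f s)) <= Linf_norm \<mu> f" unfolding Linf_norm_def by (rule esssup_AE)
  ultimately have "AE s in \<mu>. ereal (cmod (f s)) <= ereal c" by (metis (mono_tags, lifting) eventually_mono order_trans)
  then show "AE s in \<mu>. cmod (f s) <= c" by simp
 next
  assume "AE s in \<mu>. cmod (f s) <= c"
  then show "Linf_norm \<mu> f <= ereal c" unfolding Linf_norm_def by (intro esssup_I m) auto
 qed
qed

lemma Linf_iff: "f \<in> Linf \<mu> \<longleftrightarrow> f \<in> borel_measurable \<mu> \<and> (\<exists>c. AE s in \<mu>. cmod (f s) \<le> c)"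
proof (cases "f : borel_measurable \<mu>")
 case True
 have "Linf_norm \<mu> f < \<infinity> \<longleftrightarrow> (EX c. Linf_norm \<mu> f <= ereal c)"
  by (cases "Linf_norm \<mu> f") auto
 then show ?thesis using True finite_esssup_iff[OF True] by (simp add: Linf_def)
qed (simp add: Linf_def)

context vn_algebra
begin

lemma cseqI:
 assumes p: "\<And>n. zproj (p n)" "\<And>n. p n**p (Suc n) = p n"
  and sup: "\<And>r. zproj r ==> (\<And>n. r**p n = p n) ==> r = \<one>"
 shows "cseq p"
proof -
 have pm: "p m**p n = p m" if "m <= n" for m n
  using that
 proof (induction n rule: dec_induct)
  case base
  then show ?case using p by simp
 next
  case (step n)
  then show ?case using p(2)[of n] by (metis opm_assoc)
 qed
 have pc: "p n**p m = p m**p n" for m n using zproj_comm[OF p(1), of "p n" m] p(1) by simp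
 have decr: "\<one> - p n \<preceq> \<one> - p m" if "m <= n" for m n
 proof -
  have "zproj (p n - p m)" by (rule zproj_diff[OF p(1) p(1) pm[OF that]])
  then show ?thesis by (simp add: is_proj_pos)
 qed
 obtain L :: "'a \<Rightarrow>\<^sub>L 'a" where L: "!!x. ((%n. (\<one> - p n) x) \<longlongrightarrow> L x) (net_filter (UNIV :: nat set) (<=))"
 proof (rule decreasing_net_converges[OF directed_nat, of "%n. \<one> - p n" 0])
  show "dag (\<one> - p n) = \<one> - p n" "0 \<preceq> \<one> - p n" for n
   using p(1)[of n] zproj_compl[OF p(1), of n] by (simp_all add: dag_simps is_proj_pos)
 qed (use decr that in auto)
 define P where "P = \<one> - L"
 have lim: "(%n. p n x) \<longlonglongrightarrow> P x" for x
 proof -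
  have "(%n. (\<one> - p n) x) \<longlonglongrightarrow> L x" using L[of x] unfolding net_filter_nat .
  from tendsto_diff[OF tendsto_const[of x] this] show ?thesis by (simp add: P_def blinfun.diff_left)
 qed
 have PZ: "P : Z" by (rule vna_limit[OF vna_Z sequentially_bot _ lim]) (use p in auto)
 have dP: "dag P = P" by (rule selfadj_limit[OF sequentially_bot lim]) (use p in auto)
 have Pp: "P**p n = p n" for n
 proof (rule blinfun_eqI)
  fix x
  have "p m (p n x) = p n x" if "m >= n" for m using pm[OF that] pc[of m n] by (metis op_apply_assoc)
  then have "\<forall>\<^sub>F m in sequentially. p m (p n x) = p n x" unfolding eventually_sequentially by blast
  then have "(%m. p n x) \<longlonglongrightarrow> P (p n x)" by (rule Lim_transform_eventually[OF lim])
  then show "(P**p n) x = p n x" by (simp add: LIMSEQ_const_iff)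
 qed
 have "P**P = P"
 proof (rule blinfun_eqI)
  fix x
  have e: "P (p n x) = p n x" for n using Pp[of n] by (metis op_apply_assoc)
  have "(%n. P (p n x)) \<longlonglongrightarrow> P (P x)" by (intro tendsto_intros lim)
  then have "(%n. p n x) \<longlonglongrightarrow> P (P x)" unfolding e .
  from LIMSEQ_unique[OF this lim[of x]] show "(P**P) x = P x" by (simp only: blinfun_apply_blinfun_compose)
 qed
 then have "zproj P" using PZ dP by (intro zprojI) (simp_all add: is_proj_def)
 then have "P = \<one>" by (rule sup) (rule Pp)
 then show ?thesis using p lim by (simp add: cseq_def)
qed

lemma finite_projection_Z:
 assumes "zproj p"
 shows "finite_projection Z p"
 unfolding finite_projection_def proj_equiv_def
proof (intro conjI ballI impI)
 show "p : projections Z" using assms by (simp add: projections_Z)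
 fix q assume "proj_le q p & (EX v:Z. EX w:Z. is_adjoint v w & w**v = p & v **w = q)"
 then obtain v w where vw: "v : Z" "w : Z" "w**v = p" "v **w = q" by blast
 then show "q = p" using Z_comm[of v w] by simp
qed

abbreviation SZ where "SZ \<equiv> measurable_oprs Z"

lemma SZ_E:
 assumes "x \<in> SZ"
 shows "linear_operator x" "closed x" "affiliated Z x" "\<exists>p. cseq p \<and> (\<forall>n. range (blinfun_apply (p n)) \<subseteq> Domain x)"
proof -
 show "linear_operator x" "closed x" "affiliated Z x" using assms by (simp_all add: measurable_oprs_def)
 obtain p where p: "increases_to_one Z p" "!!n. p n : projections Z" "!!n. range (blinfun_apply (p n)) <= Domain x"
  using assms by (auto simp: measurable_oprs_def)
 have pz: "zproj (p n)" for n using p(2) by (simp add: projections_Z)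
 have "cseq p"
 proof (rule cseqI[OF pz])
  show "p n**p (Suc n) = p n" for n
   using p(1) zproj_comm[OF pz, of "p (Suc n)" n] pz by (simp add: increases_to_one_def proj_le_def)
  fix r assume r: "zproj r" "!!n. r**p n = p n"
  then have "r : projections Z" by (simp add: projections_Z)
  then have "r**\<one> = \<one>" using p(1) r(2) unfolding increases_to_one_def is_proj_sup_def proj_le_def by blast
  then show "r = \<one>" by simp
 qed
 then show "EX p. cseq p & (ALL n. range (blinfun_apply (p n)) <= Domain x)" using p(3) by blast
qed

lemma SZ_I:
 assumes "linear_operator x" "closed x" "affiliated Z x" "cseq p" "\<And>n. range (blinfun_apply (p n)) \<subseteq> Domain x"
 shows "x \<in> SZ"
 unfolding measurable_oprs_def
proof (intro CollectI conjI exI[of _ p] allI)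
 note z = cseqD(1)[OF assms(4)]
 show "increases_to_one Z p" by (rule cseq_increases[OF assms(4)]) simp
 show "p n : projections Z" "finite_projection Z (\<one> - p n)" for n
  using z finite_projection_Z[OF zproj_compl[OF z]] by (simp_all add: projections_Z)
qed (rule assms)+

text \<open>The strong product \<open>w x\<close> is the operator \<open>\<xi> \<mapsto> x (w \<xi>)\<close>: the domain of the latter contains
 \<open>w \<xi> + (1 - w) p\<^sub>n \<xi>\<close>, which approximates \<open>\<xi>\<close> in graph norm.\<close>

lemma strong_prod_SZ:
 assumes x: "x \<in> SZ" and w: "zproj w"
 shows "strong_prod (bounded_opr w) x \<in> SZ"
proof -
 note X = SZ_E[OF x]
 obtain p where p: "cseq p" "!!n. range (blinfun_apply (p n)) <= Domain x" using X(4) by blast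
 define y where "y = {(h, k). (w h, k) : x}"
 have ww: "w (w h) = w h" for h using w by (metis op_apply_assoc zprojD(3))
 have ac: "(w h, w k) : x" if "(h, k) : x" for h k
  by (rule affiliated_central[OF X(1,3) _ w that]) simp
 have yl: "linear_operator y"
  using X(1) M_clinear[of w] w unfolding linear_operator_def y_def
  by (auto simp: blinfun.add_right clinear_ops_def)
 have "continuous_on UNIV (%(h, k). (w h, k))"
  unfolding case_prod_beta by (intro continuous_intros)
 moreover have "y = (%(h, k). (w h, k)) -` x" by (auto simp: y_def)
 ultimately have yc: "closed y" using closed_vimage[OF X(2)] by simp
 have ya: "affiliated Z y"
  unfolding affiliated_def
 proof clarify
  fix u h k assume u: "u : unitaries (commutant Z)" and xe: "(h, k) : y"
  have "u**w = w**u" using u w by (simp add: unitaries_def commutant_def)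
  then have "u (w h) = w (u h)" by (metis op_apply_assoc)
  moreover have "(u (w h), u k) : x" using X(3) u xe unfolding affiliated_def y_def by blast
  ultimately show "(u h, u k) : y" by (simp add: y_def)
 qed
 have "strong_prod (bounded_opr w) x = y"
  unfolding strong_prod_def
 proof (rule antisym)
  have "x O bounded_opr w <= y" using ac by (auto simp: bounded_opr_def y_def)
  then show "closure (x O bounded_opr w) <= y" using yc by (rule closure_minimal)
  show "y <= closure (x O bounded_opr w)"
  proof clarify
   fix h k assume "(h, k) : y"
   then have xe: "(w h, k) : x" by (simp add: y_def)
   have we: "w k = k" by (rule linear_operator_single[OF X(1) _ xe]) (use ac[OF xe] ww in simp)
   define g where "g = (%n. p n (h - w h))"
   have "(w h + g n, k) : x O bounded_opr w" for n
   proof -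
    obtain \<theta> where t: "(g n, \<theta>) : x" using p(2)[of n] unfolding g_def by blast
    have "w (g n) = p n (w (h - w h))"
     unfolding g_def using zproj_comm[OF w, of "p n"] cseqD(1)[OF p(1), of n] by (metis op_apply_assoc zprojD(1) Z_M)
    then have "w (g n) = 0" by (simp add: blinfun.diff_right ww blinfun.zero_right)
    then have "w \<theta> = 0" using ac[OF t] linear_operator_single[OF X(1) _ linear_operatorD(1)[OF X(1)]] by simp
    moreover have "(w h + g n, k + \<theta>) : x" by (rule linear_operatorD(2)[OF X(1) xe t])
    ultimately show ?thesis using we unfolding bounded_opr_def
     by (intro relcompI[of _ "k + \<theta>"]) (auto simp: blinfun.add_right intro!: image_eqI[where x = "k + \<theta>"])
   qed
   moreover have "(%n. (w h + g n, k)) \<longlonglongrightarrow> (w h + (h - w h), k)"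
    unfolding g_def by (intro tendsto_intros cseqD(2)[OF p(1)])
   ultimately show "(h, k) : closure (x O bounded_opr w)"
    unfolding closure_sequential by (intro exI[of _ "%n. (w h + g n, k)"]) simp
  qed
 qed
 moreover have "y : SZ"
 proof (rule SZ_I[OF yl yc ya p(1)])
  fix n
  have "w (p n h) = p n (w h)" for h
   using zproj_comm[OF w, of "p n"] cseqD(1)[OF p(1), of n] by (metis op_apply_assoc zprojD(1) Z_M)
  then show "range (blinfun_apply (p n)) <= Domain y"
   using p(2)[of n] by (auto simp: y_def Domain_iff image_subset_iff)
 qed
 ultimately show ?thesis by simp
qed

lemma SZ_of_pieces:
 assumes x: "x \<in> EM" "bseq x z" and T: "\<And>n. pc x (z n) \<in> Z"
 shows "x \<in> SZ"
proof (rule SZ_I[OF EM_linear[OF x(1)] EM_closed[OF x(1)] _ bseqD(1)[OF x(2)]])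
 have "affiliated Z (glue z (%n. pc x (z n)))"
 proof (rule affiliatedI[OF bseqD(1)[OF x(2)] T])
  show "Z <= M" using Z_M by blast
  show "pc x (z n) : Z & z n : Z" for n using T zprojD(1)[OF cseqD(1)[OF bseqD(1)[OF x(2)]]] by blast
 qed
 then show "affiliated Z x" using EM_glue[OF x(2,1)] by simp
 show "range (blinfun_apply (z n)) <= Domain x" for n
  using pcD(5)[OF bseqD(2)[OF x(2)], of n] by auto
qed

lemma bounded_opr_eqI:
 assumes "x \<in> EM" "bd x \<one>" "pc x \<one> = T" "T \<in> M"
 shows "x = bounded_opr T"
 by (rule EM_eqI[OF assms(1) bounded_opr_EM(1)[OF assms(4)], where z = "%_. \<one>"])
  (use assms(2,3) bounded_opr_EM(2,3)[OF assms(4) zproj_one] in "simp_all add: bseq_def cseq_one")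

lemma relcomp_bounded_opr: "bounded_opr T O bounded_opr S = bounded_opr (S**T)"
 by (auto simp: bounded_opr_def)

lemma bounded_opr_algebra:
 assumes "S \<in> M" "T \<in> M"
 shows "strong_sum (bounded_opr S) (bounded_opr T) = bounded_opr (S + T)"
  "strong_prod (bounded_opr S) (bounded_opr T) = bounded_opr (S**T)"
  "strong_scale c (bounded_opr S) = bounded_opr (cmul c**S)"
  "adj (bounded_opr S) = bounded_opr (dag S)"
proof -
 note S = bounded_opr_EM[OF assms(1)] and T = bounded_opr_EM[OF assms(2)]
 note b = S(2)[OF zproj_one] T(2)[OF zproj_one] and p = S(3)[OF zproj_one] T(3)[OF zproj_one]
 show "strong_sum (bounded_opr S) (bounded_opr T) = bounded_opr (S + T)"
  by (rule bounded_opr_eqI[OF strong_sum_EM(1)[OF S(1) T(1)]])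
   (use strong_sum_EM(2)[OF S(1) T(1) b] assms p in simp_all)
 show "strong_prod (bounded_opr S) (bounded_opr T) = bounded_opr (S**T)"
  using bounded_opr_props(2)[of "S**T"] assms relcomp_bounded_opr[of T S] by (simp add: strong_prod_def)
 show "strong_scale c (bounded_opr S) = bounded_opr (cmul c**S)"
  by (rule bounded_opr_eqI[OF strong_scale_EM(1)[OF S(1)]])
   (use strong_scale_EM(2)[OF S(1) b(1)] assms p cmul_M in simp_all)
 show "adj (bounded_opr S) = bounded_opr (dag S)"
  by (rule bounded_opr_eqI[OF adj_EM(1)[OF S(1)]])
   (use adj_EM(2)[OF S(1) b(1)] assms p in simp_all)
qed

end

section \<open>The center as a function algebra\<close>

locale center_functions = vn_algebra M for M :: "('a::complex_hilbert \<Rightarrow>\<^sub>L 'a) set" +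
 fixes \<mu> :: "'w measure" and \<Phi> :: "'a opr => 'w => complex"
 assumes sf: "semifinite \<mu>" and cid: "center_identification M \<mu> \<Phi>"
begin

lemma Phi:
 shows Phi_measurable: "x \<in> SZ ==> \<Phi> x \<in> borel_measurable \<mu>"
  and Phi_surj: "f \<in> borel_measurable \<mu> ==> \<exists>x\<in>SZ. AE s in \<mu>. \<Phi> x s = f s"
  and Phi_inj: "x \<in> SZ ==> y \<in> SZ ==> AE s in \<mu>. \<Phi> x s = \<Phi> y s ==> x = y"
  and Phi_sum: "x \<in> SZ ==> y \<in> SZ ==> AE s in \<mu>. \<Phi> (strong_sum x y) s = \<Phi> x s + \<Phi> y s"
  and Phi_prod: "x \<in> SZ ==> y \<in> SZ ==> AE s in \<mu>. \<Phi> (strong_prod x y) s = \<Phi> x s * \<Phi> y s"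
  and Phi_scale: "x \<in> SZ ==> AE s in \<mu>. \<Phi> (strong_scale c x) s = c * \<Phi> x s"
  and Phi_adj: "x \<in> SZ ==> AE s in \<mu>. \<Phi> (adj x) s = cnj (\<Phi> x s)"
  and Phi_Linf: "x \<in> SZ ==> x \<in> bounded_opr ` Z \<longleftrightarrow> \<Phi> x \<in> Linf \<mu>"
proof -
 note c0 = cid[unfolded center_identification_def Let_def]
 note c1 = c0[THEN conjunct2]
 note c2 = c1[THEN conjunct2]
 note c3 = c2[THEN conjunct2]
 note c4 = c3[THEN conjunct2]
 note c5 = c4[THEN conjunct2]
 note c6 = c5[THEN conjunct2]
 note c7 = c6[THEN conjunct2]
 show "x : SZ ==> \<Phi> x : borel_measurable \<mu>"
  by (rule c0[THEN conjunct1, rule_format])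
 show "f : borel_measurable \<mu> ==> EX x:SZ. AE s in \<mu>. \<Phi> x s = f s"
  by (rule c1[THEN conjunct1, rule_format])
 show "x : SZ ==> y : SZ ==> AE s in \<mu>. \<Phi> x s = \<Phi> y s ==> x = y"
  by (rule c2[THEN conjunct1, rule_format])
 show "x : SZ ==> y : SZ ==> AE s in \<mu>. \<Phi> (strong_sum x y) s = \<Phi> x s + \<Phi> y s"
  by (rule c3[THEN conjunct1, rule_format])
 show "x : SZ ==> y : SZ ==> AE s in \<mu>. \<Phi> (strong_prod x y) s = \<Phi> x s * \<Phi> y s"
  by (rule c4[THEN conjunct1, rule_format])
 show "x : SZ ==> AE s in \<mu>. \<Phi> (strong_scale c x) s = c * \<Phi> x s"
  by (rule c5[THEN conjunct1, rule_format])
 show "x : SZ ==> AE s in \<mu>. \<Phi> (adj x) s = cnj (\<Phi> x s)"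
  by (rule c6[THEN conjunct1, rule_format])
 show "x : SZ ==> x : bounded_opr ` Z \<longleftrightarrow> \<Phi> x : Linf \<mu>"
  by (rule c7[rule_format])
qed

lemma Z_SZ: "T \<in> Z ==> bounded_opr T \<in> SZ"
 by (rule bounded_opr_measurable) simp_all

abbreviation \<phi> :: "('a \<Rightarrow>\<^sub>L 'a) => 'w => complex" where "\<phi> T \<equiv> \<Phi> (bounded_opr T)"

lemma phi_measurable [measurable]: "T \<in> Z ==> \<phi> T \<in> borel_measurable \<mu>"
 by (intro Phi_measurable Z_SZ)

lemma phi_eqI: "S \<in> Z ==> T \<in> Z ==> AE s in \<mu>. \<phi> S s = \<phi> T s ==> S = T"
 using Phi_inj[OF Z_SZ Z_SZ] bounded_opr_inj by blast

lemma phi_add: "S \<in> Z ==> T \<in> Z ==> AE s in \<mu>. \<phi> (S + T) s = \<phi> S s + \<phi> T s"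
 using Phi_sum[OF Z_SZ Z_SZ, of S T] bounded_opr_algebra(1)[of S T] by simp

lemma phi_mult: "S \<in> Z ==> T \<in> Z ==> AE s in \<mu>. \<phi> (S**T) s = \<phi> S s * \<phi> T s"
 using Phi_prod[OF Z_SZ Z_SZ, of S T] bounded_opr_algebra(2)[of S T] by simp

lemma phi_scaleR: "T \<in> Z ==> AE s in \<mu>. \<phi> (r *\<^sub>R T) s = r *\<^sub>R \<phi> T s"
 using Phi_scale[OF Z_SZ, of T "complex_of_real r"] bounded_opr_algebra(3)[of T T "complex_of_real r"]
 by (simp add: cmul_of_real opm.scaleR_left scaleR_conv_of_real)

lemma phi_dag: "T \<in> Z ==> AE s in \<mu>. \<phi> (dag T) s = cnj (\<phi> T s)"
 using Phi_adj[OF Z_SZ, of T] bounded_opr_algebra(4)[of T T] by simp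

lemma phi_diff: "S \<in> Z ==> T \<in> Z ==> AE s in \<mu>. \<phi> (S - T) s = \<phi> S s - \<phi> T s"
proof -
 assume S: "S : Z" and T: "T : Z"
 then have "- T : Z" by simp
 from phi_add[OF S this] phi_scaleR[OF T, of "-1"] show ?thesis by eventually_elim simp
qed

lemma phi_surj:
 assumes "f \<in> borel_measurable \<mu>" "AE s in \<mu>. cmod (f s) \<le> c"
 shows "\<exists>T\<in>Z. AE s in \<mu>. \<phi> T s = f s"
proof -
 obtain x where x: "x : SZ" "AE s in \<mu>. \<Phi> x s = f s" using Phi_surj[OF assms(1)] by blast
 have "AE s in \<mu>. cmod (\<Phi> x s) <= c" using x(2) assms(2) by eventually_elim simp
 then have "\<Phi> x : Linf \<mu>" unfolding Linf_iff using Phi_measurable[OF x(1)] by blast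
 then show ?thesis using Phi_Linf[OF x(1)] x(2) by blast
qed

lemma phi_bounded: "T \<in> Z ==> \<exists>c. AE s in \<mu>. cmod (\<phi> T s) \<le> c"
proof -
 assume T: "T : Z"
 then have "\<phi> T : Linf \<mu>" using Phi_Linf[OF Z_SZ[OF T]] by simp
 then show ?thesis by (simp add: Linf_iff)
qed

lemma phi_one: "AE s in \<mu>. \<phi> \<one> s = 1"
proof -
 obtain T where T: "T : Z" "AE s in \<mu>. \<phi> T s = 1" using phi_surj[of "%_. 1" 1] by auto
 have "AE s in \<mu>. \<phi> T s = \<phi> \<one> s * \<phi> T s" using phi_mult[of \<one> T] T(1) by (simp only: opm_one Z_simps)
 then show ?thesis using T(2) by eventually_elim simp
qed

lemma phi_pos:
 assumes "T \<in> Z"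
 shows "pos T \<longleftrightarrow> (AE s in \<mu>. Im (\<phi> T s) = 0 \<and> 0 \<le> Re (\<phi> T s))"
proof
 assume "pos T"
 then obtain S where S: "pos S" "S**S = T" "!!R. R**T = T**R ==> R**S = S**R"
  by (rule sqrt_exists) (rule that)
 have SZ: "S : Z" by (rule vna_bicommutant[OF vna_Z assms]) (rule S(3))
 show "AE s in \<mu>. Im (\<phi> T s) = 0 & 0 <= Re (\<phi> T s)"
  using phi_mult[OF SZ SZ] phi_dag[OF SZ] unfolding S(2) pos_dag[OF S(1)]
 proof eventually_elim
  case (elim s)
  then have "Im (\<phi> S s) = 0" by (metis cnj.simps(2) neg_equal_zero)
  then show ?case by (simp add: elim(1))
 qed
next
 assume ae: "AE s in \<mu>. Im (\<phi> T s) = 0 & 0 <= Re (\<phi> T s)"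
 define g where "g = (%s. complex_of_real (sqrt (Re (\<phi> T s))))"
 have [measurable]: "\<phi> T : borel_measurable \<mu>" using assms by measurable
 have gm: "g : borel_measurable \<mu>" unfolding g_def by measurable
 obtain c where c: "AE s in \<mu>. cmod (\<phi> T s) <= c" using phi_bounded[OF assms] by blast
 have "AE s in \<mu>. cmod (g s) <= sqrt c"
  using c ae
 proof eventually_elim
  case (elim s)
  then have "Re (\<phi> T s) <= c" using complex_Re_le_cmod order_trans by blast
  then show ?case using elim by (simp add: g_def)
 qed
 from phi_surj[OF gm this] obtain R where R: "R : Z" "AE s in \<mu>. \<phi> R s = g s" by blast
 have "AE s in \<mu>. \<phi> (dag R) s = \<phi> R s"
  using phi_dag[OF R(1)] R(2) by eventually_elim (simp add: g_def)
 then have "dag R = R" by (intro phi_eqI) (use R in auto)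
 moreover have "AE s in \<mu>. \<phi> (R**R) s = \<phi> T s"
  using phi_mult[OF R(1,1)] R(2) ae
 proof eventually_elim
  case (elim s)
  then show ?case by (simp add: g_def complex_eq_iff)
 qed
 then have "R**R = T" by (intro phi_eqI) (use R assms in auto)
 ultimately show "pos T" using pos_square by blast
qed

lemma phi_norm:
 assumes "T \<in> Z" "0 \<le> c"
 shows "norm T \<le> c \<longleftrightarrow> (AE s in \<mu>. cmod (\<phi> T s) \<le> c)"
proof -
 have 1: "c\<^sup>2 *\<^sub>R \<one> - dag T**T : Z" using assms by simp
 have "norm T <= c \<longleftrightarrow> dag T**T \<preceq> c\<^sup>2 *\<^sub>R \<one>"
 proof
  assume n: "norm T <= c"
  have "(norm (T x))\<^sup>2 <= (c * norm x)\<^sup>2" for x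
  proof (rule power_mono)
   show "norm (T x) <= c * norm x"
    by (rule order_trans[OF norm_blinfun mult_right_mono[OF n norm_ge_zero]])
  qed simp
  then show "dag T**T \<preceq> c\<^sup>2 *\<^sub>R \<one>"
   by (intro op_leI) (simp_all add: dag_simps norm_op_sq[symmetric] blinfun.scaleR_left rin_simps rin_self power_mult_distrib del: blinfun_apply_blinfun_compose)
 next
  assume l: "dag T**T \<preceq> c\<^sup>2 *\<^sub>R \<one>"
  show "norm T <= c"
  proof (rule norm_blinfun_bound[OF assms(2)])
   fix x
   have "(norm (T x))\<^sup>2 <= (c * norm x)\<^sup>2"
    using op_leD[OF l, of x] by (simp add: norm_op_sq blinfun.scaleR_left rin_simps rin_self power_mult_distrib)
   then show "norm (T x) <= c * norm x" by (rule power2_le_imp_le) (simp add: assms)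
  qed
 qed
 also have "... \<longleftrightarrow> (AE s in \<mu>. Im (\<phi> (c\<^sup>2 *\<^sub>R \<one> - dag T**T) s) = 0 & 0 <= Re (\<phi> (c\<^sup>2 *\<^sub>R \<one> - dag T**T) s))"
  by (rule phi_pos[OF 1])
 also have "... \<longleftrightarrow> (AE s in \<mu>. cmod (\<phi> T s) <= c)"
 proof -
  have "AE s in \<mu>. \<phi> (c\<^sup>2 *\<^sub>R \<one> - dag T**T) s = complex_of_real (c\<^sup>2 - (cmod (\<phi> T s))\<^sup>2)"
  proof -
   have Zs: "c\<^sup>2 *\<^sub>R \<one> : Z" "dag T : Z" "dag T**T : Z" "\<one> : Z" using assms by simp_all
   show ?thesis
    using phi_diff[OF Zs(1,3)] phi_scaleR[OF Zs(4), of "c\<^sup>2"] phi_one phi_mult[OF Zs(2) assms(1)] phi_dag[OF assms(1)]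
    by eventually_elim (simp add: scaleR_conv_of_real complex_norm_square[symmetric] mult.commute[of "cnj _"])
  qed
  then have "AE s in \<mu>. (Im (\<phi> (c\<^sup>2 *\<^sub>R \<one> - dag T**T) s) = 0 & 0 <= Re (\<phi> (c\<^sup>2 *\<^sub>R \<one> - dag T**T) s)) \<longleftrightarrow> cmod (\<phi> T s) <= c"
  proof eventually_elim
   case (elim s)
   have "(cmod (\<phi> T s))\<^sup>2 <= c\<^sup>2 \<longleftrightarrow> cmod (\<phi> T s) <= c" using assms(2) by (simp add: power2_le_iff_abs_le)
   then show ?case by (simp only: elim Im_complex_of_real Re_complex_of_real) simp
  qed
  then show ?thesis by (rule eventually_subst)
 qed
 finally show ?thesis .
qed

subsection \<open>Central projections as measurable sets\<close>

definition cproj :: "'w set => 'a \<Rightarrow>\<^sub>L 'a" where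
 "cproj B = (SOME T. T \<in> Z \<and> (AE \<omega> in \<mu>. \<phi> T \<omega> = indicator B \<omega>))"

lemma cproj_phi:
 assumes "B \<in> sets \<mu>"
 shows "cproj B \<in> Z" "AE s in \<mu>. \<phi> (cproj B) s = indicator B s"
proof -
 have "EX T:Z. AE s in \<mu>. \<phi> T s = indicator B s"
  by (rule phi_surj[of _ 1]) (use assms in "auto simp: indicator_def")
 then have "cproj B : Z & (AE s in \<mu>. \<phi> (cproj B) s = indicator B s)"
  unfolding cproj_def by (rule_tac someI_ex) blast
 then show "cproj B : Z" "AE s in \<mu>. \<phi> (cproj B) s = indicator B s" by auto
qed

lemma cproj_inter:
 assumes "B \<in> sets \<mu>" "C \<in> sets \<mu>"
 shows "cproj B**cproj C = cproj (B \<inter> C)"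
proof (rule phi_eqI)
 show "AE s in \<mu>. \<phi> (cproj B**cproj C) s = \<phi> (cproj (B \<inter> C)) s"
  using phi_mult[OF cproj_phi(1)[OF assms(1)] cproj_phi(1)[OF assms(2)]] cproj_phi(2)[OF assms(1)] cproj_phi(2)[OF assms(2)]
   cproj_phi(2)[OF sets.Int[OF assms]]
  by eventually_elim (auto simp: indicator_def)
qed (use cproj_phi(1) assms in auto)

lemma cproj_zproj:
 assumes "B \<in> sets \<mu>"
 shows "zproj (cproj B)"
proof -
 note c = cproj_phi[OF assms]
 have "dag (cproj B) = cproj B"
 proof (rule phi_eqI)
  show "AE s in \<mu>. \<phi> (dag (cproj B)) s = \<phi> (cproj B) s"
   using phi_dag[OF c(1)] c(2) by eventually_elim (auto simp: indicator_def)
 qed (use c in auto)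
 then show ?thesis using c(1) cproj_inter[OF assms assms] by (intro zprojI) (simp_all add: is_proj_def)
qed

lemma cproj_le:
 assumes "B \<in> sets \<mu>" "C \<in> sets \<mu>" "B \<subseteq> C"
 shows "cproj B**cproj C = cproj B"
 using cproj_inter[OF assms(1,2)] assms(3) by (simp add: Int_absorb2)

lemma cproj_eq_zero:
 assumes "B \<in> sets \<mu>"
 shows "cproj B = 0 \<longleftrightarrow> emeasure \<mu> B = 0"
proof -
 have z: "AE s in \<mu>. \<phi> 0 s = 0" using phi_scaleR[of \<one> 0] by simp
 note c = cproj_phi[OF assms]
 have "cproj B = 0 \<longleftrightarrow> (AE s in \<mu>. \<phi> (cproj B) s = \<phi> 0 s)"
  using phi_eqI[OF c(1), of 0] by auto
 also have "... \<longleftrightarrow> (AE s in \<mu>. s ~: B)"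
  by (rule eventually_subst) (use z c(2) in "eventually_elim, simp add: indicator_def")
 also have "... \<longleftrightarrow> emeasure \<mu> B = 0" using AE_iff_null_sets[OF assms] assms by (simp add: null_sets_def)
 finally show ?thesis .
qed

lemma cproj_diff:
 assumes "B \<in> sets \<mu>" "C \<in> sets \<mu>" "B \<subseteq> C"
 shows "cproj (C - B) = cproj C - cproj B"
proof (rule phi_eqI)
 show "AE s in \<mu>. \<phi> (cproj (C - B)) s = \<phi> (cproj C - cproj B) s"
  using phi_diff[OF cproj_phi(1)[OF assms(2)] cproj_phi(1)[OF assms(1)]] cproj_phi(2)[OF assms(1)] cproj_phi(2)[OF assms(2)]
   cproj_phi(2)[OF sets.Diff[OF assms(2,1)]]
  by eventually_elim (use assms(3) in "auto simp: indicator_def")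
qed (use cproj_phi(1) assms in auto)

lemma cproj_absorb_iff:
 assumes "B \<in> sets \<mu>" "C \<in> sets \<mu>"
 shows "cproj B**cproj C = cproj B \<longleftrightarrow> emeasure \<mu> (B - C) = 0"
 using cproj_diff[of "B \<inter> C" B] cproj_inter[OF assms] cproj_eq_zero[of "B - C"] assms by (auto simp: Diff_Int)

lemma zproj_cproj:
 assumes "zproj w"
 shows "\<exists>B\<in>sets \<mu>. w = cproj B"
proof -
 define B where "B = {s : space \<mu>. \<phi> w s = 1}"
 have [measurable]: "\<phi> w : borel_measurable \<mu>" using assms by (intro phi_measurable) simp
 have B: "B : sets \<mu>" unfolding B_def by measurable
 have "w = cproj B"
 proof (rule phi_eqI)
  have "AE s in \<mu>. \<phi> w s = \<phi> w s * \<phi> w s" using phi_mult[of w w] assms by simp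
  then show "AE s in \<mu>. \<phi> w s = \<phi> (cproj B) s"
   using cproj_phi(2)[OF B] AE_space by eventually_elim (auto simp: B_def indicator_def)
 qed (use cproj_phi(1) B assms in auto)
 then show ?thesis using B by blast
qed

lemma cproj_cseq:
 assumes "\<And>n. B n \<in> sets \<mu>" "\<And>n. B n \<subseteq> B (Suc n)" "AE s in \<mu>. \<exists>n. s \<in> B n"
 shows "cseq (%n. cproj (B n))"
proof (rule cseqI)
 show "zproj (cproj (B n))" "cproj (B n)**cproj (B (Suc n)) = cproj (B n)" for n
  using cproj_zproj cproj_le assms by auto
 fix r assume r: "zproj r" "!!n. r**cproj (B n) = cproj (B n)"
 have "AE s in \<mu>. s : B n --> \<phi> r s = 1" for n
  using phi_mult[OF zprojD(1)[OF r(1)] cproj_phi(1)[OF assms(1)[of n]]] cproj_phi(2)[OF assms(1)[of n]]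
  unfolding r(2) by eventually_elim (auto simp: indicator_def split: if_splits)
 then have "AE s in \<mu>. ALL n. s : B n --> \<phi> r s = 1" unfolding AE_all_countable by blast
 then have "AE s in \<mu>. \<phi> r s = \<phi> \<one> s" using assms(3) phi_one by eventually_elim auto
 then show "r = \<one>" using r(1) by (intro phi_eqI) simp_all
qed

lemma subset_finite_measure:
 assumes "zproj w" "w \<noteq> 0"
 obtains A where "A \<in> sets \<mu>" "0 < emeasure \<mu> A" "emeasure \<mu> A < \<infinity>" "cproj A**w = cproj A"
proof -
 obtain B where B: "B : sets \<mu>" "w = cproj B" using zproj_cproj[OF assms(1)] by blast
 have p: "0 < emeasure \<mu> B" using assms(2) cproj_eq_zero[OF B(1)] B(2) by (simp add: zero_less_iff_neq_zero)
 show ?thesis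
 proof (cases "emeasure \<mu> B = \<infinity>")
  case True
  then obtain A where "A : sets \<mu>" "A <= B" "0 < emeasure \<mu> A" "emeasure \<mu> A < \<infinity>"
   using sf B(1) unfolding semifinite_def by blast
  then show ?thesis using that cproj_le[of A B] B by blast
 next
  case False
  then show ?thesis using that[OF B(1) p] assms(1) by (simp add: B(2)[symmetric] less_top[symmetric])
 qed
qed

end

section \<open>The center-valued norm\<close>

context vn_algebra
begin

text \<open>The least central self-adjoint operator above \<open>T\<close>. Two central upper bounds have a common
 smaller one, obtained by cutting along the spectral projection of their difference, so the upper
 bounds form a decreasing net.\<close>

lemma central_majorant:
 assumes T: "T \<in> M" "pos T"
 obtains N where "N \<in> Z" "dag N = N" "T \<preceq> N" "\<And>f. f \<in> Z ==> dag f = f ==> T \<preceq> f ==> N \<preceq> f"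
proof -
 define I where "I = {f. f : Z & dag f = f & T \<preceq> f}"
 have dT: "dag T = T" by (rule pos_dag[OF T(2)])
 have min: "EX h:I. h \<preceq> f & h \<preceq> g" if f: "f : I" and g: "g : I" for f g
 proof -
  have fg: "f : Z" "g : Z" "dag f = f" "dag g = g" "T \<preceq> f" "T \<preceq> g" using f g by (auto simp: I_def)
  obtain q where q: "q : Z" "is_proj q" "pos (q**(f - g))" "pos (- ((\<one> - q)**(f - g)))"
   by (rule vna_spectral_projection[OF vna_Z, of "f - g"]) (use fg that in "auto simp: dag_simps")
  have zq: "zproj q" "zproj (\<one> - q)" using q zprojI zproj_compl by blast+
  define h where "h = q**g + (\<one> - q)**f"
  have qc: "g**q = q**g" "f**q = q**f" using zproj_comm[OF zq(1)] fg by auto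
  have hZ: "h : Z" "dag h = h"
   using fg q zq qc by (simp_all add: h_def dag_simps op_simps is_projD)
  have "f - h = q**(f - g)" "g - h = - ((\<one> - q)**(f - g))" by (simp_all add: h_def op_simps)
  then have 1: "h \<preceq> f" "h \<preceq> g" using q by simp_all
  have "h - T = q**(g - T) + (\<one> - q)**(f - T)" by (simp add: h_def op_simps)
  moreover have "pos (q**(g - T))" by (rule pos_zmult[OF zq(1) _ fg(6)]) (use fg T in simp)
  moreover have "pos ((\<one> - q)**(f - T))" by (rule pos_zmult[OF zq(2) _ fg(5)]) (use fg T in simp)
  ultimately have "T \<preceq> h" by (simp add: pos_add)
  then show ?thesis using hZ 1 by (auto simp: I_def)
 qed
 have "norm T *\<^sub>R \<one> : I" using op_le_norm(1)[OF dT order_refl] by (simp add: I_def dag_simps)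
 then have dir: "directed_index I (%f g. g \<preceq> f)"
  unfolding directed_index_def
 proof (intro conjI ballI impI)
  show "g \<preceq> f" if "h \<preceq> f & g \<preceq> h" for f g h using that op_le_trans by blast
  show "EX k:I. k \<preceq> f & k \<preceq> g" if "f : I" "g : I" for f g by (rule min[OF that])
 qed auto
 obtain N :: "'a \<Rightarrow>\<^sub>L 'a" where N: "!!x. ((%f. blinfun_apply f x) \<longlongrightarrow> N x) (net_filter I (%f g. g \<preceq> f))" "dag N = N"
  "!!f. f : I ==> N \<preceq> f" "!!C. (!!f. f : I ==> C \<preceq> f) ==> C \<preceq> N"
 proof -
  have "dag f = f" "T \<preceq> f" if "f : I" for f using that by (auto simp: I_def)
  note * = this
  have "g \<preceq> f" if "g \<preceq> f" for f g :: "'a \<Rightarrow>\<^sub>L 'a" using that .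
  from decreasing_net_converges[OF dir, of "%f. f", OF *(1) this *(2)]
  show thesis using that by blast
 qed
 have "N : Z"
 proof (rule vna_limit[OF vna_Z net_filter_nontrivial[OF dir] _ N(1)])
  show "\<forall>\<^sub>F f in net_filter I (%f g. g \<preceq> f). f : Z"
   unfolding eventually_net_filter[OF dir] using `norm T *\<^sub>R \<one> : I`
   by (intro bexI[of _ "norm T *\<^sub>R \<one>"] ballI impI) (simp_all add: I_def)
 qed
 moreover have "T \<preceq> N" by (rule N(4)) (simp add: I_def)
 ultimately show ?thesis using that N(2,3) by (simp add: I_def)
qed

definition cmaj :: "('a \<Rightarrow>\<^sub>L 'a) => 'a \<Rightarrow>\<^sub>L 'a" where
 "cmaj T = (SOME N. N \<in> Z \<and> dag N = N \<and> T \<preceq> N \<and> (\<forall>f. f \<in> Z --> dag f = f --> T \<preceq> f --> N \<preceq> f))"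

lemma cmaj:
 assumes "T \<in> M" "pos T"
 shows "cmaj T \<in> Z" "dag (cmaj T) = cmaj T" "T \<preceq> cmaj T" "f \<in> Z ==> dag f = f ==> T \<preceq> f ==> cmaj T \<preceq> f"
  "pos (cmaj T)"
proof -
 obtain N where N: "N : Z" "dag N = N" "T \<preceq> N" "!!f. f : Z ==> dag f = f ==> T \<preceq> f ==> N \<preceq> f"
  by (rule central_majorant[OF assms], rule that)
 have "EX N. N : Z & dag N = N & T \<preceq> N & (ALL f. f : Z --> dag f = f --> T \<preceq> f --> N \<preceq> f)"
  by (intro exI[of _ N] conjI allI impI N)
 from someI_ex[OF this, folded cmaj_def]
 have c: "cmaj T : Z" "dag (cmaj T) = cmaj T" "T \<preceq> cmaj T" "ALL f. f : Z --> dag f = f --> T \<preceq> f --> cmaj T \<preceq> f" by auto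
 show "cmaj T : Z" "dag (cmaj T) = cmaj T" "T \<preceq> cmaj T" by (rule c)+
 show "f : Z ==> dag f = f ==> T \<preceq> f ==> cmaj T \<preceq> f" using c(4) by blast
 show "pos (cmaj T)" using pos_add[OF c(3) assms(2)] by simp
qed

lemma cmaj_zmult:
 assumes T: "T \<in> M" "pos T" and w: "zproj w"
 shows "cmaj (w**T) = w**cmaj T"
proof (rule op_le_antisym)
 note c = cmaj[OF T]
 have wT: "w**T : M" "pos (w**T)" using T w pos_zmult[OF w T] by auto
 note cw = cmaj[OF wT]
 have ww: "w**(w**S) = w**S" for S using w by (simp add: is_proj_absorb)
 have dw: "dag (w**S) = w**S" if "S : Z" "dag S = S" for S
  using that w zproj_comm[OF w, of S] by (simp add: dag_comp)
 show "cmaj (w**T) \<preceq> w**cmaj T"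
 proof (rule cw(4))
  have "w**cmaj T - w**T = w**(cmaj T - T)" by (simp add: opm.diff_right)
  also have "pos ..." by (rule pos_zmult[OF w _ c(3)]) (use c T in simp)
  finally show "w**T \<preceq> w**cmaj T" .
 qed (use c w dw in auto)
 have "T \<preceq> w**cmaj (w**T) + (\<one> - w)**cmaj T"
 proof -
  have "w**cmaj (w**T) + (\<one> - w)**cmaj T - T = w**(cmaj (w**T) - w**T) + (\<one> - w)**(cmaj T - T)"
   by (simp add: op_simps ww)
  moreover have "pos (w**(cmaj (w**T) - w**T))" by (rule pos_zmult[OF w _ cw(3)]) (use cw wT in simp)
  moreover have "pos ((\<one> - w)**(cmaj T - T))" by (rule pos_zmult[OF zproj_compl[OF w] _ c(3)]) (use c T in simp)
  ultimately show ?thesis by (simp add: pos_add)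
 qed
 then have 1: "cmaj T \<preceq> w**cmaj (w**T) + (\<one> - w)**cmaj T"
  by (rule c(4)[rotated 2]) (use c cw w dw[OF cw(1,2)] dw[OF c(1,2)] in "simp_all add: dag_add opm.diff_left dag_diff")
 have "pos (w**(w**cmaj (w**T) + (\<one> - w)**cmaj T - cmaj T))" by (rule pos_zmult[OF w _ 1]) (use c cw w in simp)
 then have 2: "w**cmaj T \<preceq> w**cmaj (w**T)" by (simp add: op_simps ww)
 have "pos ((\<one> - w)**cmaj (w**T))" by (rule pos_zmult[OF zproj_compl[OF w] _ cw(5)]) (use cw in simp)
 then have "w**cmaj (w**T) \<preceq> cmaj (w**T)" by (simp add: opm.diff_left)
 with 2 show "w**cmaj T \<preceq> cmaj (w**T)" by (rule op_le_trans)
qed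

end

context center_functions
begin

text \<open>The sets on which the function of \<open>x\<close> is bounded by \<open>n\<close> exhaust the space.\<close>

lemma SZ_pieces:
 assumes "x \<in> SZ"
 shows "\<exists>z. cseq z \<and> (\<forall>n. \<exists>T. T \<in> Z \<and> piece x (z n) T)"
proof -
 note X = SZ_E[OF assms]
 define A where "A = (%n. {s : space \<mu>. cmod (\<Phi> x s) <= real n})"
 have [measurable]: "\<Phi> x : borel_measurable \<mu>" by (rule Phi_measurable[OF assms])
 have A: "A n : sets \<mu>" for n unfolding A_def by measurable
 have "cseq (%n. cproj (A n))"
 proof (rule cproj_cseq[OF A])
  show "A n <= A (Suc n)" for n by (auto simp: A_def)
  show "AE s in \<mu>. EX n. s : A n" using AE_space by eventually_elim (simp add: A_def real_arch_simple)
 qed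
 moreover have "EX T. T : Z & piece x (cproj (A n)) T" for n
 proof -
  let ?e = "cproj (A n)"
  note e = cproj_zproj[OF A[of n]]
  have eS: "strong_prod (bounded_opr ?e) x : SZ" by (rule strong_prod_SZ[OF assms e])
  have "AE s in \<mu>. cmod (\<Phi> (strong_prod (bounded_opr ?e) x) s) <= real n"
   using Phi_prod[OF Z_SZ[OF cproj_phi(1)[OF A[of n]]] assms] cproj_phi(2)[OF A[of n]]
   by eventually_elim (simp add: indicator_def A_def norm_mult)
  then have "\<Phi> (strong_prod (bounded_opr ?e) x) : Linf \<mu>" unfolding Linf_iff using Phi_measurable[OF eS] by blast
  then obtain T where T: "T : Z" "strong_prod (bounded_opr ?e) x = bounded_opr T" using Phi_Linf[OF eS] by blast
  have "piece x ?e T" by (rule piece_of_strong_prod[OF X(1,2,3) _ e _ T(2)]) (use T in simp_all)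
  then show ?thesis using T(1) by blast
 qed
 ultimately show ?thesis by blast
qed

lemma SZ_EM:
 assumes "x \<in> SZ"
 shows "x \<in> EM" "bd x w ==> pc x w \<in> Z"
proof -
 obtain z where z: "cseq z" "ALL n. EX T. T : Z & piece x (z n) T" using SZ_pieces[OF assms] by blast
 obtain T where T: "!!n. T n : Z" "!!n. piece x (z n) (T n)" using choice[OF z(2)] by blast
 show E: "x : EM" by (rule EM_I[OF SZ_E(1,2)[OF assms] z(1) T(2)])
 assume w: "bd x w"
 have P: "pc x (z n) : Z" "bd x (z n)" for n using pc_eq[OF E T(2)] T(1) bdI[OF T(2)] by simp_all
 have "pc x w**S = S**pc x w" if S: "S : M" for S
 proof (rule cseq_op_eqI[OF z(1)])
  fix n
  note zn = cseqD(1)[OF z(1), of n] and o = bd_overlap[OF E w P(2), of n]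
  have "w**pc x (z n) : Z" using P bd_zproj[OF w] by simp
  then have c: "(z n**pc x w)**S = S**(z n**pc x w)" unfolding o by (rule Z_comm[OF _ S, symmetric])
  have "z n**(S**pc x w) = S**(z n**pc x w)" using zproj_comm[OF zn S] by (metis opm_assoc)
  then show "z n**(pc x w**S) = z n**(S**pc x w)" using c by (simp add: opm_assoc)
 qed
 then have "pc x w : commutant M" using M_clinear[OF pcD(2)[OF w]] unfolding commutant_def by blast
 then show "pc x w : Z" using pcD(2)[OF w] by (simp add: center_def)
qed

text \<open>The center-valued norm is glued from the least central majorants of the bounded pieces of the
 modulus; it is a minimum, not merely an infimum.\<close>

lemma center_norm_pieces:
 assumes x: "x \<in> EM" and z: "bseq x z"
 shows "center_norm M x \<in> SZ" "bseq (center_norm M x) z"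
  "pc (center_norm M x) (z n) = cmaj (oabs (pc x (z n)))" "opr_le (modulus x) (center_norm M x)"
  "center_norm M x \<in> E_h M"
proof -
 note b = bseqD[OF z] and cx = bseq_compat[OF x z]
 note zn = cseqD(1)[OF b(1)]
 define T where "T = (%n. oabs (pc x (z n)))"
 have TM: "T n : M" "pos (T n)" for n unfolding T_def using vna_oabs[OF vna_M cx(3)] oabs_pos by auto
 have T1: "z n**T n = T n" "z n**T (Suc n) = T n" for n
  unfolding T_def using oabs_zmult[OF zn cx(3)] cx(1,2) by (metis)+
 define N where "N = (%n. cmaj (T n))"
 note cN = cmaj[OF TM]
 have N1: "N n : M" "z n**N n = N n" "z n**N (Suc n) = N n" for n
 proof -
  show "N n : M" unfolding N_def using cN(1) by simp
  show "z n**N n = N n" "z n**N (Suc n) = N n"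
   unfolding N_def cmaj_zmult[OF TM zn, symmetric] T1 by (rule refl)+
 qed
 define g where "g = glue z N"
 note G = glue_EM[OF b(1) N1, folded g_def]
 have gS: "g : SZ" by (rule SZ_of_pieces[OF G(1,2)]) (simp add: G(3) cN N_def)
 have gh: "g : E_h M" by (rule EHI[OF G(1,2)]) (simp add: G(3) cN N_def)
 have mz: "bseq (modulus x) z" "pc (modulus x) (z n) = T n" for n
  using modulus_EM(2)[OF x b(2)] b(1) by (auto simp: bseq_def T_def)
 have mh: "modulus x : E_h M" by (rule modulus_EM(1)[OF x])
 have mg: "opr_le (modulus x) g"
  by (rule opr_leI[OF EH_EM[OF mh] G(1) mz(1) G(2)]) (simp add: mz(2) G(3) cN N_def)
 have least: "opr_le g f" if f: "f : SZ" "adj f = f" "opr_le (modulus x) f" for f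
 proof -
  have fh: "f : E_h M" using SZ_EM(1)[OF f(1)] f(2) by (simp add: self_adjoint_part_def)
  obtain u where u: "bseq f u" using EM_bseq[OF EH_EM[OF fh]] by blast
  have fu: "bseq f (%n. u n**z n)" by (rule bseq_mult(1)[OF EH_EM[OF fh] u b(1)])
  have gu: "bseq g (%n. u n**z n)" by (rule bseq_mult(2)[OF G(1,2) bseqD(1)[OF u]])
  note un = cseqD(1)[OF bseqD(1)[OF u]]
  show ?thesis
  proof (rule opr_leI[OF G(1) EH_EM[OF fh] gu fu])
   fix n
   let ?p = "u n**z n"
   have mp: "bd (modulus x) ?p" "pc (modulus x) ?p = u n**T n"
    using bd_restrict[OF EH_EM[OF mh] bseqD(2)[OF mz(1)] un] mz(2) by simp_all
   have l: "u n**T n \<preceq> pc f ?p" using opr_leD[OF f(3) mh fh mp(1) bseqD(2)[OF fu]] mp(2) by simp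
   have "cmaj (u n**T n) \<preceq> pc f ?p"
    by (rule cmaj(4)[OF _ pos_zmult[OF un TM] SZ_EM(2)[OF f(1) bseqD(2)[OF fu]] EH_pc[OF fh bseqD(2)[OF fu]] l])
     (simp add: TM un)
   moreover have "cmaj (u n**T n) = pc g ?p"
    using cmaj_zmult[OF TM un] bd_restrict(2)[OF G(1) bseqD(2)[OF G(2)] un] by (simp add: G(3) N_def)
   ultimately show "pc g ?p \<preceq> pc f ?p" by simp
  qed
 qed
 let ?F = "{f : self_adjoint_part SZ. opr_le (modulus x) f}"
 have gF: "g : ?F" using gS gh mg by (simp add: self_adjoint_part_def)
 have "center_norm M x = g"
  unfolding center_norm_def
 proof (rule the_equality)
  show "is_inf_in (self_adjoint_part SZ) opr_le ?F g"
   unfolding is_inf_in_def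
  proof (intro conjI ballI impI)
   show "g : self_adjoint_part SZ" using gF by blast
   show "opr_le g f" if "f : ?F" for f using that least by (simp add: self_adjoint_part_def)
   show "opr_le y g" if "ALL a:?F. opr_le y a" for y using that gF by blast
  qed
  fix g' assume g': "is_inf_in (self_adjoint_part SZ) opr_le ?F g'"
  have g'S: "g' : SZ" "adj g' = g'" using g' by (simp_all add: is_inf_in_def self_adjoint_part_def)
  have g'h: "g' : E_h M" using SZ_EM(1)[OF g'S(1)] g'S(2) by (simp add: self_adjoint_part_def)
  have 1: "opr_le g' g" using g' gF unfolding is_inf_in_def by blast
  have "g : self_adjoint_part SZ" using gF by blast
  moreover have "ALL a:?F. opr_le g a" using least by (simp add: self_adjoint_part_def)
  ultimately have 2: "opr_le g g'" using g' unfolding is_inf_in_def by blast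
  obtain v where v: "bseq g' v" "bseq g v" by (rule EM_bseq2[OF EH_EM[OF g'h] G(1)])
  show "g' = g"
  proof (rule EM_eqI[OF EH_EM[OF g'h] G(1) v])
   fix n
   show "pc g' (v n) = pc g (v n)"
    by (rule op_le_antisym[OF opr_leD[OF 1 g'h gh bseqD(2)[OF v(1)] bseqD(2)[OF v(2)]]
     opr_leD[OF 2 gh g'h bseqD(2)[OF v(2)] bseqD(2)[OF v(1)]]])
  qed
 qed
 then show "center_norm M x : SZ" "bseq (center_norm M x) z"
  "pc (center_norm M x) (z n) = cmaj (oabs (pc x (z n)))" "opr_le (modulus x) (center_norm M x)"
  "center_norm M x : E_h M"
  using gS G(2,3) mg gh by (simp_all add: N_def T_def)
qed

text \<open>Membership of \<open>x\<close> in a basic neighborhood says that \<open>x\<close> is bounded by \<open>\<epsilon>\<close> on a large part of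
 \<open>A\<close>; this is the only way in which the center-valued norm enters below.\<close>

theorem O_nbhd_iff:
 assumes A: "A \<in> sets \<mu>" and \<epsilon>: "0 < \<epsilon>"
 shows "x \<in> O_nbhd M \<mu> \<Phi> A \<epsilon> \<delta> \<longleftrightarrow> x \<in> EM \<and> (\<exists>B\<in>sets \<mu>. B \<subseteq> A \<and> emeasure \<mu> (A - B) \<le> ennreal \<delta> \<and>
  bd x (cproj B) \<and> norm (pc x (cproj B)) \<le> \<epsilon>)"
proof (cases "x : EM")
 case True
 obtain z where z: "bseq x z" using EM_bseq[OF True] by blast
 note b = bseqD[OF z] and cx = bseq_compat[OF True z]
 note zn = cseqD(1)[OF b(1)]
 define g where "g = center_norm M x"
 note G = center_norm_pieces[OF True z, folded g_def]
 have gE: "g : EM" by (rule SZ_EM(1)[OF G(1)])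
 have TM: "oabs (pc x (z n)) : M" "pos (oabs (pc x (z n)))" for n using vna_oabs[OF vna_M cx(3)] oabs_pos by auto
 have [measurable]: "\<Phi> g : borel_measurable \<mu>" by (rule Phi_measurable[OF G(1)])
 have prod: "strong_prod (bounded_opr (cproj B)) g : SZ"
  "AE s in \<mu>. \<Phi> (strong_prod (bounded_opr (cproj B)) g) s = \<Phi> g s * indicator B s"
  "(%s. \<Phi> g s * indicator B s) : borel_measurable \<mu>" if B: "B : sets \<mu>" for B
 proof -
  show "strong_prod (bounded_opr (cproj B)) g : SZ" by (rule strong_prod_SZ[OF G(1) cproj_zproj[OF B]])
  show "AE s in \<mu>. \<Phi> (strong_prod (bounded_opr (cproj B)) g) s = \<Phi> g s * indicator B s"
   using Phi_prod[OF Z_SZ[OF cproj_phi(1)[OF B]] G(1)] cproj_phi(2)[OF B] by eventually_elim simp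
  show "(%s. \<Phi> g s * indicator B s) : borel_measurable \<mu>" using B by measurable
 qed
 have key: "(%s. \<Phi> g s * indicator B s) : Linf \<mu> & Linf_norm \<mu> (%s. \<Phi> g s * indicator B s) <= ereal \<epsilon> \<longleftrightarrow>
   bd x (cproj B) & norm (pc x (cproj B)) <= \<epsilon>" (is "?L \<longleftrightarrow> ?R") if B: "B : sets \<mu>" for B
 proof
  let ?e = "cproj B"
  note e = cproj_zproj[OF B] and P = prod[OF B]
  have ae: "(AE s in \<mu>. cmod (\<Phi> g s * indicator B s) <= c) \<longleftrightarrow> (AE s in \<mu>. cmod (\<Phi> (strong_prod (bounded_opr ?e) g) s) <= c)" for c
   by (rule eventually_subst) (use P(2) in "eventually_elim, simp")
  {
   assume ?L
   then have l: "AE s in \<mu>. cmod (\<Phi> (strong_prod (bounded_opr ?e) g) s) <= \<epsilon>"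
    using ae finite_esssup_iff[OF P(3)] by blast
   then have "\<Phi> (strong_prod (bounded_opr ?e) g) : Linf \<mu>" unfolding Linf_iff using Phi_measurable[OF P(1)] by blast
   then obtain T where T: "T : Z" "strong_prod (bounded_opr ?e) g = bounded_opr T" using Phi_Linf[OF P(1)] by blast
   have nT: "norm T <= \<epsilon>" using l phi_norm[OF T(1), of \<epsilon>] \<epsilon> by (simp add: T(2))
   have pT: "piece g ?e T"
    by (rule piece_of_strong_prod[OF EM_linear[OF gE] EM_closed[OF gE] SZ_E(3)[OF G(1)] _ e _ T(2)]) (use T in simp_all)
   have "norm (?e**pc x (z n)) <= \<epsilon>" for n
   proof -
    have "oabs (?e**pc x (z n)) = ?e**oabs (pc x (z n))" by (rule oabs_zmult[OF e cx(3)])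
    also have "pos (?e**(cmaj (oabs (pc x (z n))) - oabs (pc x (z n))))"
     by (rule pos_zmult[OF e _ cmaj(3)[OF TM]]) (use cmaj(1)[OF TM] TM in simp)
    then have "?e**oabs (pc x (z n)) \<preceq> ?e**pc g (z n)" by (simp add: G(3) opm.diff_right)
    also have "?e**pc g (z n) = z n**T"
     using bd_overlap[OF gE bdI[OF pT] bseqD(2)[OF G(2)], of n] pc_eq[OF gE pT] by simp
    finally have 1: "oabs (?e**pc x (z n)) \<preceq> z n**T" .
    have nz: "norm (z n**T) <= \<epsilon>" using order_trans[OF norm_proj_comp[OF zprojD(2)[OF zn]] nT] .
    have "pos (z n**T)" using pos_add[OF 1 oabs_pos[of "?e**pc x (z n)"]] by simp
    then have "dag (z n**T) = z n**T" by (rule pos_dag)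
    from op_le_trans[OF 1 op_le_norm(1)[OF this nz]]
    have "norm (oabs (?e**pc x (z n))) <= \<epsilon>" by (rule norm_le_of_pos[OF oabs_pos]) (use \<epsilon> in auto)
    then show ?thesis by (simp add: norm_oabs)
   qed
   then show ?R using bd_of_norm_le[OF True z e, of \<epsilon>] by blast
  next
   assume R: ?R
   then have R1: "bd x ?e" "norm (pc x ?e) <= \<epsilon>" by auto
   have n: "norm (?e**pc g (z n)) <= \<epsilon>" for n
   proof -
    have eT: "?e**oabs (pc x (z n)) = oabs (z n**pc x ?e)"
     unfolding oabs_zmult[OF e cx(3), symmetric] bd_overlap[OF True R1(1) b(2), of n] ..
    have eg: "?e**pc g (z n) = cmaj (oabs (z n**pc x ?e))"
     unfolding G(3) cmaj_zmult[OF TM e, symmetric] eT ..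
    have zM: "z n**pc x ?e : M" using pcD(2)[OF R1(1)] zn by simp
    note m = cmaj[OF vna_oabs[OF vna_M zM] oabs_pos]
    have "norm (oabs (z n**pc x ?e)) <= \<epsilon>"
     unfolding norm_oabs by (rule order_trans[OF norm_proj_comp[OF zprojD(2)[OF zn]] R1(2)])
    from op_le_norm(1)[OF pos_dag[OF oabs_pos] this]
    have "cmaj (oabs (z n**pc x ?e)) \<preceq> \<epsilon> *\<^sub>R \<one>" by (intro m(4)) (simp_all add: dag_simps)
    then show ?thesis unfolding eg by (intro norm_le_of_pos m(5)) (use \<epsilon> in auto)
   qed
   note gb = bd_of_norm_le[OF gE G(2) e n]
   have "strong_prod (bounded_opr ?e) g = bounded_opr (pc g ?e)"
    by (rule piece_strong_prod[OF EM_linear[OF gE] bseqD(1)[OF G(2)] pc[OF bseqD(2)[OF G(2)]] pc[OF gb(1)]])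
   moreover have "AE s in \<mu>. cmod (\<phi> (pc g ?e) s) <= \<epsilon>"
    using phi_norm[OF SZ_EM(2)[OF G(1) gb(1)], of \<epsilon>] gb(2) \<epsilon> by simp
   ultimately have "AE s in \<mu>. cmod (\<Phi> g s * indicator B s) <= \<epsilon>" using ae by simp
   then show ?L using finite_esssup_iff[OF P(3)] Linf_iff P(3) by blast
  }
 qed
 have "x : O_nbhd M \<mu> \<Phi> A \<epsilon> \<delta> \<longleftrightarrow> (EX B:sets \<mu>. B <= A & emeasure \<mu> (A - B) <= ennreal \<delta> &
   (%s. \<Phi> g s * indicator B s) : Linf \<mu> & Linf_norm \<mu> (%s. \<Phi> g s * indicator B s) <= ereal \<epsilon>)"
  using True Phi_measurable[OF G(1)] by (simp add: O_nbhd_def W_nbhd_def g_def)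
 also have "... \<longleftrightarrow> (EX B:sets \<mu>. B <= A & emeasure \<mu> (A - B) <= ennreal \<delta> &
   bd x (cproj B) & norm (pc x (cproj B)) <= \<epsilon>)"
  by (intro bex_cong refl conj_cong key)
 finally show ?thesis using True by simp
qed (simp add: O_nbhd_def)

end

section \<open>Decreasing nets in the central extension\<close>

context vn_algebra
begin

lemma zero_EH: "bounded_opr 0 \<in> E_h M"
 by (rule bounded_opr_EH) simp_all

lemma zero_pc: "zproj z ==> bd (bounded_opr 0) z" "zproj z ==> pc (bounded_opr 0) z = 0"
 using bounded_opr_EM(2,3)[of 0] by (simp_all add: opm.zero_right)

lemma bseq_ops:
 assumes "x \<in> EM" "y \<in> EM" "bseq x z" "bseq y z"
 shows "bseq (strong_sum x y) z" "pc (strong_sum x y) (z n) = pc x (z n) + pc y (z n)"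
  "bseq (strong_diff x y) z" "pc (strong_diff x y) (z n) = pc x (z n) - pc y (z n)"
 using strong_diff_EM(2)[OF assms(1,2) bseqD(2)[OF assms(3)] bseqD(2)[OF assms(4)]]
  strong_sum_EM(2)[OF assms(1,2) bseqD(2)[OF assms(3)] bseqD(2)[OF assms(4)]] bseqD(1)[OF assms(3)]
 by (simp_all add: bseq_def)

lemma opr_le_iff:
 assumes "x \<in> E_h M" "y \<in> E_h M" "bseq x z" "bseq y z"
 shows "opr_le x y \<longleftrightarrow> (\<forall>n. pc x (z n) \<preceq> pc y (z n))"
 using opr_leD[OF _ assms(1,2) bseqD(2)[OF assms(3)] bseqD(2)[OF assms(4)]]
  opr_leI[OF EH_EM[OF assms(1)] EH_EM[OF assms(2)] assms(3,4)] by blast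

lemma opr_le_moves:
 assumes "u \<in> E_h M" "v \<in> E_h M" "b \<in> E_h M"
 shows opr_le_diff_swap: "opr_le u (strong_diff b v) \<longleftrightarrow> opr_le v (strong_diff b u)"
  and opr_le_diff_sum: "opr_le u (strong_diff b v) \<longleftrightarrow> opr_le (strong_sum u v) b"
  and diff_le_swap: "opr_le (strong_diff v b) u \<longleftrightarrow> opr_le (strong_diff v u) b"
  and le_sum_diff: "opr_le u (strong_sum v b) \<longleftrightarrow> opr_le (strong_diff u v) b"
  and diff_le_zero: "opr_le (strong_diff u v) (bounded_opr 0) \<longleftrightarrow> opr_le u v"
  and diff_ge_zero: "opr_le (bounded_opr 0) b ==> opr_le (strong_diff u b) u"
  and sum_ge_zero: "opr_le (bounded_opr 0) b ==> opr_le u (strong_sum u b)"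
proof -
 note E = assms[THEN EH_EM]
 obtain z where "cseq z" "ALL x:{u, v, b}. bseq x z" using common_bseq[of "{u, v, b}"] E by auto
 then have z: "bseq u z" "bseq v z" "bseq b z" by auto
 note d = bseq_ops[where z = z]
 have o: "bseq (bounded_opr 0) z" "pc (bounded_opr 0) (z n) = 0" for n
  using zero_pc cseqD(1)[OF bseqD(1)[OF z(1)]] bseqD(1)[OF z(1)] by (simp_all add: bseq_def)
 note i = opr_le_iff[where z = z] and h = strong_diff_EH strong_sum_EH assms zero_EH
 show "opr_le u (strong_diff b v) \<longleftrightarrow> opr_le v (strong_diff b u)"
  by (subst (1 2) i) (simp_all add: h d E z diff_diff_eq add.commute)
 show "opr_le u (strong_diff b v) \<longleftrightarrow> opr_le (strong_sum u v) b"
  by (subst (1 2) i) (simp_all add: h d E z diff_diff_eq add.commute)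
 show "opr_le (strong_diff v b) u \<longleftrightarrow> opr_le (strong_diff v u) b"
  by (subst (1 2) i) (simp_all add: h d E z algebra_simps)
 show "opr_le u (strong_sum v b) \<longleftrightarrow> opr_le (strong_diff u v) b"
  by (subst (1 2) i) (simp_all add: h d E z algebra_simps)
 show "opr_le (strong_diff u v) (bounded_opr 0) \<longleftrightarrow> opr_le u v"
  by (subst (1 2) i) (simp_all add: h d E z o)
 show "opr_le (bounded_opr 0) b ==> opr_le (strong_diff u b) u"
  by (subst (asm) i, simp_all add: h z o, subst i) (simp_all add: h d E z)
 show "opr_le (bounded_opr 0) b ==> opr_le u (strong_sum u b)"
  by (subst (asm) i, simp_all add: h z o, subst i) (simp_all add: h d E z)
qed

lemma opr_le_diff_mono:
 assumes "p \<in> E_h M" "q \<in> E_h M" "s \<in> E_h M" "t \<in> E_h M" "opr_le p q" "opr_le s t"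
 shows "opr_le (strong_diff p t) (strong_diff q s)"
proof -
 note E = assms(1-4)[THEN EH_EM]
 obtain z where "cseq z" "ALL x:{p, q, s, t}. bseq x z" using common_bseq[of "{p, q, s, t}"] E by auto
 then have z: "bseq p z" "bseq q z" "bseq s z" "bseq t z" by auto
 note pt = bseq_ops[OF E(1,4) z(1,4)] and qs = bseq_ops[OF E(2,3) z(2,3)]
 show ?thesis
 proof (rule opr_leI[OF strong_diff_EM(1)[OF E(1,4)] strong_diff_EM(1)[OF E(2,3)] pt(3) qs(3)])
  fix n
  have "pos (pc q (z n) - pc p (z n) + (pc t (z n) - pc s (z n)))"
   by (intro pos_add opr_leD[OF assms(5,1,2)] opr_leD[OF assms(6,3,4)] bseqD(2) z)
  then show "pc (strong_diff p t) (z n) \<preceq> pc (strong_diff q s) (z n)"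
   unfolding pt(4) qs(4) by (simp add: algebra_simps)
 qed
qed

text \<open>For an abelian projection \<open>e\<close> and a net \<open>T\<^sub>i\<close> decreasing to \<open>0\<close>, the central coefficients
 of \<open>e T\<^sub>i e = c\<^sub>i e\<close> decrease to \<open>0\<close> as well: their limit is killed by \<open>e\<close>, hence by the central
 support of \<open>e\<close>.\<close>

lemma abelian_coeff_limit:
 assumes dir: "directed_index I r" and e: "e \<in> M" "is_proj e"
  and T: "\<And>i. i \<in> I ==> pos (T i)" "\<And>i j. i \<in> I ==> j \<in> I ==> r i j ==> T j \<preceq> T i"
  and T0: "\<And>x. ((%i. blinfun_apply (T i) x) \<longlongrightarrow> 0) (net_filter I r)"
  and c: "\<And>i. i \<in> I ==> c i \<in> Z" "\<And>i. i \<in> I ==> dag (c i) = c i" "\<And>i. i \<in> I ==> e**T i**e = c i**e"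
   "\<And>i. i \<in> I ==> cov e**c i = c i"
 shows "\<And>i. i \<in> I ==> pos (c i)" "((%i. blinfun_apply (c i) x) \<longlongrightarrow> 0) (net_filter I r)"
proof -
 show pc: "pos (c i)" if "i : I" for i
 proof (rule abelian_central_pos[OF e c(1)[OF that] c(2)[OF that] c(4)[OF that]])
  show "pos (c i**e)" using pos_conj[OF T(1)[OF that], of e] e c(3)[OF that] by (simp add: is_projD)
 qed
 have decr: "c j \<preceq> c i" if ij: "i : I" "j : I" "r i j" for i j
 proof (rule abelian_central_pos[OF e])
  have "pos (dag e**(T i - T j)**e)" by (rule pos_conj[OF T(2)[OF ij]])
  then show "pos ((c i - c j)**e)" using e c(3)[OF ij(1)] c(3)[OF ij(2)] by (simp add: is_projD op_simps)
 qed (use c ij in "simp_all add: dag_simps op_simps")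
 have ge: "0 \<preceq> c i" if "i : I" for i using pc[OF that] by simp
 obtain D :: "'a \<Rightarrow>\<^sub>L 'a" where D: "!!x. ((%i. c i x) \<longlongrightarrow> D x) (net_filter I r)"
  by (rule decreasing_net_converges[OF dir c(2) decr ge], assumption+, rule that)
 let ?F = "net_filter I r"
 note nt = net_filter_nontrivial[OF dir]
 have ev: "eventually (%i. i : I) ?F"
  using directed_indexD(1)[OF dir] eventually_net_filter[OF dir] by auto
 have "D : Z" by (rule vna_limit[OF vna_Z nt _ D]) (use ev c(1) in "auto elim: eventually_mono")
 moreover have "D**e = 0"
 proof (rule blinfun_eqI)
  fix x
  have "((%i. e (T i (e x))) \<longlongrightarrow> e 0) ?F" by (intro tendsto_intros T0)
  moreover have "eventually (%i. e (T i (e x)) = c i (e x)) ?F"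
   using ev by eventually_elim (use c(3) in "metis op_apply_assoc")
  ultimately have "((%i. c i (e x)) \<longlongrightarrow> e 0) ?F" by (rule Lim_transform_eventually)
  from tendsto_unique[OF nt D this] show "(D**e) x = blinfun_apply 0 x" by (simp add: blinfun.zero_right)
 qed
 ultimately have "D**cov e = 0" by (rule cov_central_zero[OF e(1)])
 then have z: "cov e**D = 0" using zproj_comm[OF cov_zproj[OF e(1)], of D] `D : Z` by simp
 have "D = 0"
 proof (rule blinfun_eqI)
  fix x
  have "((%i. cov e (c i x)) \<longlongrightarrow> cov e (D x)) ?F" by (intro tendsto_intros D)
  moreover have "cov e (D x) = 0" using z by (metis op_apply_assoc zero_blinfun.rep_eq)
  moreover have "eventually (%i. cov e (c i x) = c i x) ?F"
   using ev by eventually_elim (use c(4) in "metis op_apply_assoc")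
  ultimately have "((%i. c i x) \<longlongrightarrow> 0) ?F" using Lim_transform_eventually by fastforce
  from tendsto_unique[OF nt D this] show "D x = blinfun_apply 0 x" by simp
 qed
 then show "((%i. c i x) \<longlongrightarrow> 0) ?F" using D[of x] by simp
qed

text \<open>In type I\<open>\<^sub>f\<^sub>i\<^sub>n\<close> a bounded net decreasing to \<open>0\<close> is, below a sum of \<open>n\<close> abelian projections,
 dominated by the central net \<open>n (c\<^sub>1 + \<dots> + c\<^sub>n)\<close>.\<close>

lemma central_domination:
 assumes dir: "directed_index I r" and p: "abel_sum n p"
  and T: "\<And>i. i \<in> I ==> T i \<in> M" "\<And>i. i \<in> I ==> pos (T i)" "\<And>i j. i \<in> I ==> j \<in> I ==> r i j ==> T j \<preceq> T i"
   "\<And>i. i \<in> I ==> p**T i**p = T i"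
  and T0: "\<And>x. ((%i. blinfun_apply (T i) x) \<longlongrightarrow> 0) (net_filter I r)"
 obtains F where "\<And>i. i \<in> I ==> F i \<in> Z \<and> dag (F i) = F i \<and> T i \<preceq> F i"
  "\<And>x. ((%i. blinfun_apply (F i) x) \<longlongrightarrow> 0) (net_filter I r)"
proof -
 obtain e where e: "!!k. k < n ==> abelian_projection M (e k)" "p = (\<Sum>k<n. e k)" using p unfolding abel_sum_def by blast
 have ep: "e k : M" "is_proj (e k)" if "k < n" for k using abelian_projectionD[OF e(1)[OF that]] by auto
 have "EX c. c : Z & dag c = c & e k**T i**e k = c**e k & cov (e k)**c = c" if "k < n" "i : I" for k i
  by (rule abelian_coeff[OF e(1)[OF that(1)] T(1)[OF that(2)] pos_dag[OF T(2)[OF that(2)]]]) blast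
 note ex = someI_ex[OF this]
 define c where "c = (%k i. SOME c. c : Z & dag c = c & e k**T i**e k = c**e k & cov (e k)**c = c)"
 have c: "c k i : Z" "dag (c k i) = c k i" "e k**T i**e k = c k i**e k" "cov (e k)**c k i = c k i"
  if "k < n" "i : I" for k i
  using ex[OF that] unfolding c_def by blast+
 have lim: "!!i. i : I ==> pos (c k i)" "!!x. ((%i. blinfun_apply (c k i) x) \<longlongrightarrow> 0) (net_filter I r)" if k: "k < n" for k
  by (rule abelian_coeff_limit[OF dir ep[OF k] T(2,3) T0 c[OF k]]; assumption)+
 define F where "F = (%i. real n *\<^sub>R (\<Sum>k<n. c k i))"
 have FZ: "F i : Z" "dag (F i) = F i" if "i : I" for i
 proof -
  show "F i : Z" unfolding F_def by (intro vna_scaleR[OF vna_Z] vna_sum[OF vna_Z]) (simp add: c(1)[OF _ that])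
  have "dag (\<Sum>k<m. c k i) = (\<Sum>k<m. c k i)" if "m <= n" for m
   using that by (induction m) (simp_all add: dag_simps c(2)[OF _ `i : I`])
  then show "dag (F i) = F i" unfolding F_def by (simp add: dag_simps)
 qed
 have TF: "T i \<preceq> F i" if i: "i : I" for i
 proof (rule op_leI[OF pos_dag[OF T(2)[OF i]] FZ(2)[OF i]])
  fix x
  have pd: "dag p = p"
  proof -
   have "dag (\<Sum>k<m. e k) = (\<Sum>k<m. e k)" if "m <= n" for m
    using that by (induction m) (simp_all add: dag_simps is_projD ep)
   then show ?thesis using e(2) by simp
  qed
  have "rin (T i x) x = rin (p (T i (p x))) x" using T(4)[OF i] by (metis op_apply_assoc)
  also have "... = rin (T i (p x)) (p x)" by (simp add: rin_dag pd)
  also have "p x = (\<Sum>k<n. e k x)" unfolding e(2) by (simp add: blinfun.sum_left)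
  also have "rin (T i (\<Sum>k<n. e k x)) (\<Sum>k<n. e k x) <= real n * (\<Sum>k<n. rin (T i (e k x)) (e k x))"
   by (rule form_sum_le[OF T(2)[OF i]])
  also have "... <= real n * (\<Sum>k<n. rin (c k i x) x)"
  proof (intro mult_left_mono sum_mono)
   fix k assume "k : {..<n}"
   then have k: "k < n" by simp
   have "rin (T i (e k x)) (e k x) = rin (e k (T i (e k x))) x"
    using rin_dag[of "e k" "T i (e k x)" x] ep[OF k] by (simp add: is_projD)
   also have "... = rin ((c k i**e k) x) x" using c(3)[OF k i] by (metis op_apply_assoc)
   also have "... <= rin (c k i x) x"
   proof (rule op_leD)
    have "c k i - c k i**e k = c k i**(\<one> - e k)" by (simp add: opm.diff_right)
    also have "pos ..."
     by (rule pos_mult[OF lim(1)[OF k i] is_proj_pos[OF is_proj_compl[OF ep(2)[OF k]]] Z_comm[OF c(1)[OF k i], symmetric]])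
      (use ep k in simp)
    finally show "c k i**e k \<preceq> c k i" .
   qed
   finally show "rin (T i (e k x)) (e k x) <= rin (c k i x) x" .
  qed simp
  also have "... = rin (F i x) x"
   unfolding F_def by (simp add: blinfun.scaleR_left blinfun.sum_left rin_simps bounded_bilinear.sum_left[OF bounded_bilinear_rin])
  finally show "rin (T i x) x <= rin (F i x) x" .
 qed
 have "((%i. F i x) \<longlongrightarrow> 0) (net_filter I r)" for x
 proof -
  have "((%i. real n *\<^sub>R (\<Sum>k<n. c k i x)) \<longlongrightarrow> real n *\<^sub>R (\<Sum>k<n. 0)) (net_filter I r)"
   by (intro tendsto_intros lim(2)) simp_all
  then show ?thesis by (simp add: F_def blinfun.scaleR_left blinfun.sum_left)
 qed
 then show ?thesis using that[of F] FZ TF by blast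
qed

lemma opr_le_neg:
 assumes "c \<in> E_h M" "v \<in> E_h M" "positive_opr c" "positive_opr v"
 shows "opr_le (strong_scale (- 1) c) v"
proof -
 obtain z where z: "bseq c z" "bseq v z" by (rule EM_bseq2[OF assms(1,2)[THEN EH_EM]])
 note b = bseqD(2)[OF z(1)] bseqD(2)[OF z(2)]
 have s: "bd (strong_scale (- 1) c) (z n)" "pc (strong_scale (- 1) c) (z n) = - pc c (z n)" for n
  using strong_scale_pc[OF EH_EM[OF assms(1)] b(1), of "-1"] by simp_all
 show ?thesis
 proof (rule opr_leI[OF strong_scale_EM(1)[OF EH_EM[OF assms(1)]] EH_EM[OF assms(2)] _ z(2)])
  show "bseq (strong_scale (- 1) c) z" using s(1) bseqD(1)[OF z(1)] by (simp add: bseq_def)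
  show "pc (strong_scale (- 1) c) (z n) \<preceq> pc v (z n)" for n
   unfolding s(2) using pos_add[OF positive_opr_pc[OF assms(2,4) b(2)] positive_opr_pc[OF assms(1,3) b(1)]] by simp
 qed
qed

text \<open>On a central projection where one \<open>c\<^sub>i\<close> is bounded and the unit is a sum of abelian projections, the
 net is dominated by a central net that tends to \<open>0\<close>. At a fixed
 vector some member of the latter is below \<open>\<epsilon>\<close>, so the spectral projection of that member for the values at
 most \<open>\<epsilon>\<close> is nonzero, and there it bounds the piece of \<open>c\<^sub>i\<close>.\<close>

lemma decreasing_net_locally_small:
 assumes tI: "type_I_fin M" and dir: "directed_index I r"
  and c: "\<And>i. i \<in> I ==> c i \<in> E_h M" "\<And>i. i \<in> I ==> positive_opr (c i)"
   "\<And>i j. i \<in> I ==> j \<in> I ==> r i j ==> opr_le (c j) (c i)"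
  and inf: "\<And>L. L \<in> M ==> pos L ==> (\<And>i. i \<in> I ==> opr_le (bounded_opr L) (c i)) ==> L = 0"
  and w: "zproj w" "w \<noteq> 0" and e: "e > 0"
 shows "\<exists>i\<in>I. \<exists>v. zproj v \<and> v \<noteq> 0 \<and> v **w = v \<and> bd (c i) v \<and> norm (pc (c i) v) \<le> e"
proof -
 obtain w1 n where w1: "zproj w1" "w1 ~= 0" "w1**w = w1" "abel_sum n w1" by (rule type_I_fin_local[OF tI w], rule that)
 obtain i0 where i0: "i0 : I" using directed_indexD(1)[OF dir] by blast
 obtain z where z: "bseq (c i0) z" using EM_bseq[OF EH_EM[OF c(1)[OF i0]]] by blast
 obtain m where m: "z m**w1 ~= 0" using cseq_nonzero[OF bseqD(1)[OF z] w1(2)] by blast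
 define w2 where "w2 = w1**z m"
 have zm: "zproj (z m)" by (rule cseqD(1)[OF bseqD(1)[OF z]])
 have w12: "w1**z m = z m**w1" using zproj_comm[OF zm, of w1] w1 by simp
 have w2: "zproj w2" "w2 ~= 0" "w2**w = w2" "w2**w1 = w2" "w1**w2 = w2"
  using m w1 zm zproj_mult unfolding w2_def w12 by (simp_all add: opm_assoc is_proj_absorb) (metis opm_assoc w12 zprojD(3))
 have b0: "bd (c i0) w2" unfolding w2_def by (rule bd_restrict(1)[OF EH_EM[OF c(1)[OF i0]] bseqD(2)[OF z] w1(1)])
 define J where "J = {i : I. r i0 i}"
 have JI: "i : I" "r i0 i" if "i : J" for i using that by (auto simp: J_def)
 have tr: "r i k" if "r i j" "r j k" "i : I" "j : I" "k : I" for i j k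
  using directed_indexD(3)[OF dir that(1,2)] that by blast
 have cof: "EX k:J. r i k" if i: "i : I" for i
  using directed_indexD(4)[OF dir i i0] by (auto simp: J_def)
 have dirJ: "directed_index J r"
  unfolding directed_index_def
 proof (intro conjI ballI impI)
  show "J ~= {}" using cof[OF i0] by blast
  show "r i i" if "i : J" for i using directed_indexD(2)[OF dir] JI(1)[OF that] by blast
  show "r i k" if "i : J" "j : J" "k : J" "r i j & r j k" for i j k using tr[of i j k] that JI(1) by blast
  show "EX k:J. r i k & r j k" if ij: "i : J" "j : J" for i j
  proof -
   obtain k where k: "k : I" "r i k" "r j k" using directed_indexD(4)[OF dir JI(1)[OF ij(1)] JI(1)[OF ij(2)]] by blast
   then have "k : J" using tr[OF JI(2)[OF ij(1)] k(2) i0 JI(1)[OF ij(1)] k(1)] by (simp add: J_def)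
   then show ?thesis using k by blast
  qed
 qed
 have bi: "bd (c i) w2" if "i : J" for i
 proof (rule bd_of_opr_le(1)[OF c(1)[OF JI(1)[OF that]] c(1)[OF i0] _ _ b0 order_refl])
  show "opr_le (c i) (c i0)" by (rule c(3)[OF i0 JI[OF that]])
  show "opr_le (strong_scale (- 1) (c i0)) (c i)" by (rule opr_le_neg) (use c i0 JI[OF that] in blast)+
 qed
 define T where "T = (%i. pc (c i) w2)"
 have T: "T i : M" "pos (T i)" "w2**T i = T i" if "i : J" for i
  using pcD[OF bi[OF that]] positive_opr_pc[OF c(1,2)[OF JI(1)[OF that]] bi[OF that]] unfolding T_def by auto
 have Td: "T j \<preceq> T i" if ij: "i : J" "j : J" "r i j" for i j
  unfolding T_def by (rule opr_leD[OF c(3)[OF JI(1)[OF ij(1)] JI(1)[OF ij(2)] ij(3)] c(1)[OF JI(1)[OF ij(2)]] c(1)[OF JI(1)[OF ij(1)]] bi[OF ij(2)] bi[OF ij(1)]])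
 have Tp: "0 \<preceq> T i" "dag (T i) = T i" if "i : J" for i using T(2)[OF that] pos_dag by auto
 obtain L :: "'a \<Rightarrow>\<^sub>L 'a" where L: "!!x. ((%i. T i x) \<longlongrightarrow> L x) (net_filter J r)" "!!i. i : J ==> L \<preceq> T i"
  by (rule decreasing_net_converges[OF dirJ Tp(2) Td Tp(1)], assumption+, rule that)
 have ev: "eventually (%i. i : J) (net_filter J r)"
  using directed_indexD(1)[OF dirJ] eventually_net_filter[OF dirJ] by auto
 have LM: "L : M" by (rule vna_limit[OF vna_M net_filter_nontrivial[OF dirJ] _ L(1)]) (use ev T(1) in "auto elim: eventually_mono")
 have Lp: "pos L" by (rule pos_limit[OF net_filter_nontrivial[OF dirJ] L(1)]) (use ev T(2) in "auto elim: eventually_mono")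
 have wL: "w2**L = L"
 proof (rule blinfun_eqI)
  fix x
  have "((%i. w2 (T i x)) \<longlongrightarrow> w2 (L x)) (net_filter J r)" by (intro tendsto_intros L)
  moreover have "eventually (%i. w2 (T i x) = T i x) (net_filter J r)"
   using ev by eventually_elim (use T(3) in "metis op_apply_assoc")
  ultimately have "((%i. T i x) \<longlongrightarrow> w2 (L x)) (net_filter J r)" by (rule Lim_transform_eventually)
  from tendsto_unique[OF net_filter_nontrivial[OF dirJ] this L(1)] show "(w2**L) x = L x" by simp
 qed
 have Lh: "bounded_opr L : E_h M" by (rule bounded_opr_EH[OF LM pos_dag[OF Lp]])
 have "L = 0"
 proof (rule inf[OF LM Lp])
  fix i assume i: "i : I"
  obtain j where j: "j : J" "r i j" using cof[OF i] by blast
  note cj = c(1)[OF JI(1)[OF j(1)]]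
  obtain u where u: "bseq (c j) u" using EM_bseq[OF EH_EM[OF cj]] by blast
  have "opr_le (bounded_opr L) (c j)"
  proof (rule opr_leI[OF EH_EM[OF Lh] EH_EM[OF cj] _ u])
   note un = cseqD(1)[OF bseqD(1)[OF u]] and bu = bseqD(2)[OF u]
   show "bseq (bounded_opr L) u" using bounded_opr_EM(2)[OF LM un] bseqD(1)[OF u] by (simp add: bseq_def)
   fix n
   have "pc (c j) (u n) - u n**L = u n**(T j - L) + (\<one> - w2)**pc (c j) (u n)"
    using bd_overlap[OF EH_EM[OF cj] bu[of n] bi[OF j(1)]] by (simp add: op_simps T_def)
   moreover have "pos (u n**(T j - L))" by (rule pos_zmult[OF un _ L(2)[OF j(1)]]) (use LM T(1)[OF j(1)] in simp)
   moreover have "pos ((\<one> - w2)**pc (c j) (u n))"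
    by (rule pos_zmult[OF zproj_compl[OF w2(1)] pcD(2)[OF bu] positive_opr_pc[OF cj c(2)[OF JI(1)[OF j(1)]] bu]])
   ultimately show "pc (bounded_opr L) (u n) \<preceq> pc (c j) (u n)"
    unfolding bounded_opr_EM(3)[OF LM un] by (simp add: pos_add)
  qed
  then show "opr_le (bounded_opr L) (c i)"
   by (rule opr_le_trans[OF _ c(3)[OF i JI(1)[OF j(1)] j(2)] Lh cj c(1)[OF i]])
 qed
 then have T0: "((%i. T i x) \<longlongrightarrow> 0) (net_filter J r)" for x using L(1)[of x] by simp
 have wT: "w1**T i**w1 = T i" if "i : J" for i
  using T(3)[OF that] w2(5) zproj_comm[OF w1(1) T(1)[OF that]] by (metis opm_assoc)
 obtain F where F: "!!i. i : J ==> F i : Z & dag (F i) = F i & T i \<preceq> F i"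
  "!!x. ((%i. blinfun_apply (F i) x) \<longlongrightarrow> 0) (net_filter J r)"
  by (rule central_domination[OF dirJ w1(4) T(1,2) Td wT T0], assumption+, rule that)
 obtain y where y: "w2 y = y" "y ~= 0"
 proof -
  obtain x where "w2 x ~= 0" using w2(2) by (metis blinfun_eqI zero_blinfun.rep_eq)
  moreover have "w2 (w2 x) = w2 x" using w2(1) by (metis op_apply_assoc zprojD(3))
  ultimately show thesis by (rule that[rotated])
 qed
 have "eventually (%i. norm (F i y) < e * norm y) (net_filter J r)"
  using tendstoD[OF F(2)[of y], of "e * norm y"] e y(2) by (simp add: dist_norm)
 then obtain i where i: "i : J" "ALL j:J. r i j --> norm (F j y) < e * norm y"
  unfolding eventually_net_filter[OF dirJ] by (rule bexE)
 then have iF: "norm (F i y) < e * norm y" using directed_indexD(2)[OF dirJ i(1)] by blast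
 have Fi: "F i : Z" "dag (F i) = F i" "T i \<preceq> F i" using F(1)[OF i(1)] by auto
 obtain q where q: "q : Z" "is_proj q" "pos (q**(F i - e *\<^sub>R \<one>))" "pos (- ((\<one> - q)**(F i - e *\<^sub>R \<one>)))"
  by (rule vna_spectral_projection[OF vna_Z, of "F i - e *\<^sub>R \<one>"]) (use Fi that in "auto simp: dag_simps")
 have zq: "zproj (\<one> - q)" using q zprojI zproj_compl by blast
 define v where "v = (\<one> - q)**w2"
 have v: "zproj v" "v **w = v" using zproj_mult[OF zq w2(1)] w2(3) by (simp_all add: v_def opm_assoc)
 have "v ~= 0"
 proof
  assume "v = 0"
  then have "q**w2 = w2" by (simp add: v_def op_simps)
  then have qe: "q y = y" using y(1) by (metis op_apply_assoc)
  have "0 <= rin ((q**(F i - e *\<^sub>R \<one>)) y) y" by (rule pos_ge[OF q(3)])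
  also have "... = rin ((F i - e *\<^sub>R \<one>) y) y" using rin_dag[of q "(F i - e *\<^sub>R \<one>) y" y] q(2) qe by (simp add: is_projD)
  also have "... = rin (F i y) y - e * (norm y)\<^sup>2" by (simp add: blinfun.diff_left blinfun.scaleR_left rin_simps rin_self)
  finally have "e * (norm y)\<^sup>2 <= norm (F i y) * norm y" using rin_Cauchy_Schwarz[of "F i y" y] by simp
  then show False using iF y(2) by (simp add: power2_eq_square)
 qed
 moreover have "bd (c i) v" "pc (c i) v = (\<one> - q)**T i"
  unfolding v_def T_def by (rule bd_restrict[OF EH_EM[OF c(1)[OF JI(1)[OF i(1)]]] bi[OF i(1)] zq])+
 moreover have "norm ((\<one> - q)**T i) <= e"
 proof -
  have p: "pos ((\<one> - q)**T i)" by (rule pos_zmult[OF zq T(1,2)[OF i(1)]])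
  have "pos ((\<one> - q)**(F i - T i))" by (rule pos_zmult[OF zq _ Fi(3)]) (use Fi T(1)[OF i(1)] in simp)
  from pos_add[OF pos_add[OF this q(4)] pos_scaleR[OF is_proj_pos[OF q(2)], of e]] e
  have le: "(\<one> - q)**T i \<preceq> e *\<^sub>R \<one>" by (simp add: op_simps opm.scaleR_right algebra_simps)
  show ?thesis using norm_le_of_pos[OF p le] e by simp
 qed
 ultimately show ?thesis using v JI(1)[OF i(1)] by metis
qed

end

section \<open>Orthogonal families of central projections and measure\<close>

context center_functions
begin

text \<open>On a set of finite measure only countably many members of an orthogonal family are visible,
 and up to a set of small measure only finitely many.\<close>

lemma orthogonal_family_tail:
 assumes F: "\<And>w. w \<in> F ==> zproj w" "\<And>w w'. w \<in> F ==> w' \<in> F ==> w \<noteq> w' ==> w**w' = 0"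
  and A: "A \<in> sets \<mu>" "emeasure \<mu> A < \<infinity>" and d: "0 < d"
 shows "\<exists>J B. finite J \<and> J \<subseteq> F \<and> B \<in> sets \<mu> \<and> B \<subseteq> A \<and> emeasure \<mu> (A - B) \<le> ennreal d \<and> (\<forall>w\<in>F - J. cproj B**w = 0)"
proof -
 define S where "S = (%w. SOME B. B : sets \<mu> & w = cproj B)"
 have S: "S w : sets \<mu>" "cproj (S w) = w" if "w : F" for w
 proof -
  have "EX B. B : sets \<mu> & w = cproj B" using zproj_cproj[OF F(1)[OF that]] by blast
  from someI_ex[OF this] show "S w : sets \<mu>" "cproj (S w) = w" unfolding S_def by auto
 qed
 have null: "S v \<inter> S w : null_sets \<mu>" if "v : F" "w : F" "v ~= w" for v w
  using cproj_inter[OF S(1)[OF that(1)] S(1)[OF that(2)]] F(2)[OF that] S that cproj_eq_zero[OF sets.Int[OF S(1)[OF that(1)] S(1)[OF that(2)]]]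
  by (simp add: null_sets_def)
 define E where "E = (%J. A \<inter> (\<Union>w\<in>J. S w))"
 have Es: "E J : sets \<mu>" if "finite J" "J <= F" for J
  unfolding E_def using that S(1) A(1) by (intro sets.Int sets.finite_UN) auto
 have fA: "A : fmeasurable \<mu>" using A by (simp add: fmeasurable_def)
 have mE: "measure \<mu> (E J) <= measure \<mu> A" if "finite J" "J <= F" for J
  by (rule measure_mono_fmeasurable[OF _ Es[OF that] fA]) (simp add: E_def)
 define \<J> where "\<J> = {J. finite J & J <= F}"
 define s where "s = (SUP J\<in>\<J>. measure \<mu> (E J))"
 have bdd: "bdd_above ((%J. measure \<mu> (E J)) ` \<J>)" unfolding \<J>_def bdd_above_def using mE by blast
 have le_s: "measure \<mu> (E J) <= s" if "J : \<J>" for J unfolding s_def by (rule cSUP_upper[OF that bdd])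
 have "EX J:\<J>. s - 1 / real (Suc n) < measure \<mu> (E J)" for n
 proof -
  have "\<J> ~= {}" by (auto simp: \<J>_def)
  then show ?thesis using less_cSUP_iff[OF _ bdd, of "s - 1 / real (Suc n)"] by (simp add: s_def)
 qed
 then obtain K where K: "!!n. K n : \<J>" "!!n. s - 1 / real (Suc n) < measure \<mu> (E (K n))" by metis
 define J where "J = (%n. \<Union>k\<le>n. K k)"
 have J: "J n : \<J>" "K n <= J n" "m <= n ==> J m <= J n" for m n
  using K(1) unfolding J_def \<J>_def by (auto intro!: finite_UN_I) (meson atMost_iff order_trans)
 then have Jf: "finite (J n)" "J n <= F" for n by (auto simp: \<J>_def)
 have Jm: "s - 1 / real (Suc n) < measure \<mu> (E (J n))" for n
 proof -
  have "measure \<mu> (E (K n)) <= measure \<mu> (E (J n))"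
   using K(1)[of n] Es[of "K n"] Es[OF Jf, of n] A fA J(2)[of n] unfolding \<J>_def
   by (intro measure_mono_fmeasurable fmeasurableI2[OF fA]) (auto simp: E_def)
  then show ?thesis using K(2)[of n] by simp
 qed
 define U where "U = (\<Union>n. E (J n))"
 have Us: "U : sets \<mu>" "U <= A"
  unfolding U_def by (intro sets.countable_UN'' countableI_type Es Jf, auto simp: E_def)
 have fU: "U : fmeasurable \<mu>" by (rule fmeasurableI2[OF fA Us(2,1)])
 have fE: "E (J n) : fmeasurable \<mu>" for n by (rule fmeasurableI2[OF fA _ Es[OF Jf]]) (simp add: E_def)
 have mU: "measure \<mu> U <= s"
 proof -
  have "incseq (%n. E (J n))" using J(3) unfolding incseq_def E_def by blast
  then have "(%n. emeasure \<mu> (E (J n))) \<longlonglongrightarrow> emeasure \<mu> U"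
   unfolding U_def by (intro Lim_emeasure_incseq) (use Es[OF Jf] in auto)
  then have "(%n. measure \<mu> (E (J n))) \<longlonglongrightarrow> measure \<mu> U"
   using fE fU by (simp add: emeasure_eq_measure2 fmeasurableD2)
  then show ?thesis by (rule LIMSEQ_le_const2) (use le_s J(1) in blast)
 qed
 obtain n where n: "1 / real (Suc n) < d" using reals_Archimedean[OF d] by (auto simp: inverse_eq_divide)
 define B where "B = A - (U - E (J n))"
 have B: "B : sets \<mu>" "B <= A" "A - B = U - E (J n)" unfolding B_def using A Us Es[OF Jf] by auto
 have "measure \<mu> (A - B) = measure \<mu> U - measure \<mu> (E (J n))"
  unfolding B(3) by (rule measurable_measure_Diff[OF fU Es[OF Jf]]) (auto simp: U_def)
 then have "measure \<mu> (A - B) <= d" using mU Jm[of n] n by simp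
 moreover have "A - B : fmeasurable \<mu>" using fmeasurable_Diff[OF fA B(1)] .
 ultimately have mB: "emeasure \<mu> (A - B) <= ennreal d" by (simp add: emeasure_eq_measure2 fmeasurableD2 ennreal_leI)
 have En: "S w \<inter> E (J k) : null_sets \<mu>" if "w : F - J k" for w k
 proof -
  have "(\<Union>v\<in>J k. S v \<inter> S w) : null_sets \<mu>"
   by (rule null_sets_UN') (use Jf[of k] that null in "auto intro: countable_finite")
  then show ?thesis by (rule null_sets_subset) (use Es[OF Jf, of k] S(1) that in "auto simp: E_def")
 qed
 have "cproj B**w = 0" if w: "w : F - J n" for w
 proof -
  have "S w \<inter> B : null_sets \<mu>"
  proof (cases "EX k. w : J k")
   case True
   have "S w \<inter> B <= S w \<inter> E (J n)"
    using True unfolding B_def U_def E_def by auto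
   then show ?thesis by (intro null_sets_subset[OF En[OF w]]) (use S(1) B w in auto)
  next
   case False
   have x: "S w \<inter> A : fmeasurable \<mu>" using S(1) w A by (intro fmeasurableI2[OF fA]) auto
   have "measure \<mu> (S w \<inter> A) <= 1 / real (Suc k)" for k
   proof -
    have k: "w : F - J k" using w False by blast
    have i: "insert w (J k) : \<J>" using Jf[of k] w by (auto simp: \<J>_def)
    have "measure \<mu> (E (J k)) + measure \<mu> (S w \<inter> A - S w \<inter> E (J k)) = measure \<mu> (E (J k) \<union> (S w \<inter> A - S w \<inter> E (J k)))"
     using fE x En[OF k] by (intro measure_Union[symmetric]) (auto simp: fmeasurableD2 fmeasurable_Diff null_setsD2)
    also have "E (J k) \<union> (S w \<inter> A - S w \<inter> E (J k)) = E (insert w (J k))" by (auto simp: E_def)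
    also have "measure \<mu> (E (insert w (J k))) <= s" by (rule le_s[OF i])
    also have "measure \<mu> (S w \<inter> A - S w \<inter> E (J k)) = measure \<mu> (S w \<inter> A)"
     by (rule measure_Diff_null_set[OF _ En[OF k]]) (use x in auto)
    finally show ?thesis using Jm[of k] by simp
   qed
   then have "measure \<mu> (S w \<inter> A) <= 0"
    by (intro LIMSEQ_le_const[OF LIMSEQ_inverse_real_of_nat]) (auto simp: inverse_eq_divide)
   then have "S w \<inter> A : null_sets \<mu>" using x by (auto simp: null_sets_def emeasure_eq_measure2 fmeasurableD2 measure_le_0_iff)
   then show ?thesis by (rule null_sets_subset) (use S(1) B w in auto)
  qed
  then have "cproj (B \<inter> S w) = 0" using cproj_eq_zero[of "B \<inter> S w"] by (simp add: null_sets_def Int_commute)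
  then show ?thesis using cproj_inter[OF B(1) S(1)[of w]] S(2)[of w] w by simp
 qed
 then show ?thesis using Jf[of n] B mB by blast
qed

text \<open>By local smallness there is a partition on each member of which some \<open>c\<^sub>i\<close> is small. Finitely many members
 cover most of \<open>A\<close>, and one index works for all of them.\<close>

lemma decreasing_net_small:
 assumes tI: "type_I_fin M" and dir: "directed_index I r"
  and c: "\<And>i. i \<in> I ==> c i \<in> E_h M" "\<And>i. i \<in> I ==> positive_opr (c i)"
   "\<And>i j. i \<in> I ==> j \<in> I ==> r i j ==> opr_le (c j) (c i)"
  and inf: "\<And>L. L \<in> M ==> pos L ==> (\<And>i. i \<in> I ==> opr_le (bounded_opr L) (c i)) ==> L = 0"
  and A: "A \<in> sets \<mu>" "emeasure \<mu> A < \<infinity>" and d: "0 < d" "0 < a"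
 shows "\<exists>i\<in>I. \<exists>B\<in>sets \<mu>. B \<subseteq> A \<and> emeasure \<mu> (A - B) \<le> ennreal a \<and> bd (c i) (cproj B) \<and> norm (pc (c i) (cproj B)) \<le> d"
proof -
 define P where "P = (%v. EX i:I. bd (c i) v & norm (pc (c i) v) <= d)"
 have loc: "EX v. zproj v & v ~= 0 & v **w = v & P v" if "zproj w" "w ~= 0" "w**\<one> = w" for w
 proof -
  have "EX i:I. EX v. zproj v & v ~= 0 & v **w = v & bd (c i) v & norm (pc (c i) v) <= d"
   by (rule decreasing_net_locally_small[OF tI dir _ _ _ _ that(1,2) d(1)]) (fact c inf)+
  then show ?thesis unfolding P_def by blast
 qed
 obtain F where F: "!!w. w : F ==> zproj w & w ~= 0 & w**\<one> = w & P w"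
  "!!w w'. w : F ==> w' : F ==> w ~= w' ==> w**w' = 0"
  "!!x. ((%w. blinfun_apply w x) has_sum \<one> x) F"
  by (rule central_exhaustion[of \<one> P, OF zproj_one loc], assumption+, rule that)
 have Fz: "zproj w" if "w : F" for w using F(1)[OF that] by blast
 obtain J B where JB: "finite J" "J <= F" "B : sets \<mu>" "B <= A" "emeasure \<mu> (A - B) <= ennreal a"
  "ALL w:F - J. cproj B**w = 0"
 proof -
  have "EX J B. finite J & J <= F & B : sets \<mu> & B <= A & emeasure \<mu> (A - B) <= ennreal a & (ALL w:F - J. cproj B**w = 0)"
   by (rule orthogonal_family_tail[OF _ _ A d(2)]) (fact Fz F(2))+
  then show thesis by (elim exE conjE) (rule that)
 qed
 define e where "e = cproj B"
 have e: "zproj e" unfolding e_def by (rule cproj_zproj[OF JB(3)])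
 define Q where "Q = (\<Sum>w\<in>J. w)"
 have Jw: "zproj w" if "w : J" for w using JB(2) Fz that by blast
 have Qw: "Q**v = (if v : J then v else 0)" if "v : F" for v
 proof -
  have "Q**v = (\<Sum>w\<in>J. if w = v then v else 0)"
   unfolding Q_def opm.sum_left using that F(2) JB(2) Jw by (intro sum.cong) auto
  then show ?thesis using JB(1) by simp
 qed
 have QZ: "Q : Z" unfolding Q_def by (rule vna_sum[OF vna_Z]) (use Jw in auto)
 have "Q**Q = (\<Sum>w\<in>J. Q**w)" by (subst (2) Q_def) (simp add: opm.sum_right)
 also have "... = Q" unfolding Q_def[symmetric] using Qw JB(2) by (subst (2) Q_def) (intro sum.cong, auto)
 finally have QQ: "Q**Q = Q" .
 have "dag (\<Sum>w\<in>J'. w) = (\<Sum>w\<in>J'. w)" if "J' <= J" for J'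
  using finite_subset[OF that JB(1)] that by (induction J' rule: finite_induct) (auto simp: dag_simps Jw)
 then have Qp: "is_proj Q" using QQ by (simp add: is_proj_def Q_def)
 have eQ: "e = e**Q"
 proof (rule blinfun_eqI)
  fix x
  have "((%w. (e - e**Q) (blinfun_apply w x)) has_sum (e - e**Q) (\<one> x)) F"
   by (rule has_sum_bounded_linear[OF blinfun.bounded_linear_right F(3)])
  moreover have "(e - e**Q) (blinfun_apply w x) = 0" if w: "w : F" for w
  proof -
   have "(e - e**Q)**w = 0" using Qw[OF w] JB(6)[rule_format, of w] w by (auto simp: op_simps e_def opm.zero_right)
   then show ?thesis by (metis op_apply_assoc zero_blinfun.rep_eq)
  qed
  ultimately have "((%w. 0) has_sum (e - e**Q) x) F" using has_sum_cong[of F "%w. (e - e**Q) (blinfun_apply w x)" "%_. 0"] by simp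
  then have "(e - e**Q) x = 0" by (rule has_sum_unique) (rule has_sum_0, simp)
  then show "e x = (e**Q) x" by (simp add: blinfun.diff_left)
 qed
 have "ALL w:J. EX i. i : I & bd (c i) w & norm (pc (c i) w) <= d" using F(1) JB(2) unfolding P_def by blast
 from bchoice[OF this] obtain f where f: "ALL w:J. f w : I & bd (c (f w)) w & norm (pc (c (f w)) w) <= d" by (rule exE)
 then have "f ` J <= I" by blast
 from directed_finite_bound[OF dir finite_imageI[OF JB(1)] this] obtain i where i: "i : I" "ALL j:f ` J. r j i" by (rule bexE)
 have bi: "bd (c i) w" "norm (pc (c i) w) <= d" if "w : J" for w
 proof -
  have fw: "f w : I" "bd (c (f w)) w" "norm (pc (c (f w)) w) <= d" "r (f w) i" using f i that by auto
  show "bd (c i) w" "norm (pc (c i) w) <= d"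
   by (rule bd_of_opr_le[OF c(1)[OF i(1)] c(1)[OF fw(1)] c(3)[OF fw(1) i(1) fw(4)] opr_le_neg[OF c(1)[OF fw(1)] c(1)[OF i(1)] c(2)[OF fw(1)] c(2)[OF i(1)]] fw(2,3)])+
 qed
 note ci = c(1)[OF i(1)] and cE = EH_EM[OF c(1)[OF i(1)]]
 obtain z where z: "bseq (c i) z" using EM_bseq[OF cE] by blast
 have "norm (e**pc (c i) (z n)) <= d" for n
 proof -
  note zn = cseqD(1)[OF bseqD(1)[OF z], of n] and bz = bseqD(2)[OF z, of n]
  define T where "T = e**pc (c i) (z n)"
  have TM: "T : M" "pos T" unfolding T_def using e pcD(2)[OF bz] pos_zmult[OF e pcD(2)[OF bz] positive_opr_pc[OF ci c(2)[OF i(1)] bz]] by auto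
  have wT: "w**T \<preceq> d *\<^sub>R w" if w: "w : J" for w
  proof -
   note zw = Jw[OF w]
   have "w**T = e**(w**pc (c i) (z n))"
    unfolding T_def using zproj_comm[OF e, of w] zw by (metis opm_assoc zprojD(1) Z_M)
   also have "... = e**(z n**pc (c i) w)" using bd_overlap[OF cE bz bi(1)[OF w]] by simp
   finally have "norm (w**T) <= norm e * (norm (z n) * norm (pc (c i) w))"
    using order_trans[OF norm_comp_le mult_left_mono[OF norm_comp_le norm_ge_zero]] by simp
   also have "... <= 1 * (1 * d)" using e zn bi(2)[OF w] by (intro mult_mono is_proj_norm zprojD(2)) auto
   finally have "norm (w**T) <= d" by simp
   from op_le_norm(1)[OF pos_dag[OF pos_zmult[OF zw TM]] this]
   have 1: "w**T \<preceq> d *\<^sub>R \<one>" .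
   have "pos (w**(d *\<^sub>R \<one> - w**T))" by (rule pos_zmult[OF zw _ 1]) (use TM zw in simp)
   then show ?thesis using zw by (simp add: opm.diff_right opm.scaleR_right is_proj_absorb)
  qed
  have "pos (\<Sum>w\<in>J'. d *\<^sub>R w - w**T)" if "J' <= J" for J'
   using finite_subset[OF that JB(1)] that by (induction J' rule: finite_induct) (auto intro!: pos_add wT)
  then have "pos (d *\<^sub>R Q - Q**T)"
   by (simp add: Q_def sum_subtractf scaleR_sum_right opm.sum_left)
  moreover have "Q**T = T" unfolding T_def
  proof -
   have "Q**e = e" using eQ zproj_comm[OF e, of Q] QZ by simp
   then show "Q**(e**pc (c i) (z n)) = e**pc (c i) (z n)" by (metis opm_assoc)
  qed
  moreover have "pos (d *\<^sub>R (\<one> - Q))" by (rule pos_scaleR[OF is_proj_le_one[OF Qp]]) (use d in simp)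
  ultimately have le: "T \<preceq> d *\<^sub>R \<one>" using pos_add[of "d *\<^sub>R Q - T" "d *\<^sub>R (\<one> - Q)"] by (simp add: algebra_simps)
  then show ?thesis using norm_le_of_pos[OF TM(2)] d by (simp add: T_def)
 qed
 from bd_of_norm_le[OF cE z e this] show ?thesis using i(1) JB(3-5) unfolding e_def by blast
qed

end

section \<open>Comparison of the two topologies\<close>

lemma o_convergesI:
 assumes "x \<in> E" "\<And>i. i \<in> I ==> X i \<in> E"
  and "\<And>i. i \<in> I ==> a i \<in> E \<and> b i \<in> E \<and> le (a i) (X i) \<and> le (X i) (b i)"
  and "\<And>i j. i \<in> I ==> j \<in> I ==> r i j ==> le (a i) (a j) \<and> le (b j) (b i)"
  and "is_sup_in E le (a ` I) x" "is_inf_in E le (b ` I) x"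
 shows "o_converges E le I r X x"
 unfolding o_converges_def using assms by blast

context center_functions
begin

lemma t_ch_openI: "openin (center_norm_topology M \<mu> \<Phi>) U ==> openin (t_ch M \<mu> \<Phi>) (U \<inter> E_h M)"
 unfolding t_ch_def openin_subtopology by blast

lemma strong_sum_diff_cancel:
 assumes "x \<in> EM" "y \<in> EM"
 shows "strong_sum x (strong_diff y x) = y"
proof -
 obtain z where z: "bseq x z" "bseq y z" by (rule EM_bseq2[OF assms])
 note d = bseq_ops[OF assms(2,1) z(2,1)]
 note s = bseq_ops[OF assms(1) strong_diff_EM(1)[OF assms(2,1)] z(1) d(3)]
 show ?thesis
  by (rule EM_eqI[OF strong_sum_EM(1)[OF assms(1) strong_diff_EM(1)[OF assms(2,1)]] assms(2) s(1) z(2)])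
   (simp add: s(2) d(4))
qed

lemma strong_scale_neg_diff:
 assumes "x \<in> EM" "y \<in> EM"
 shows "strong_scale (- 1) (strong_diff x y) = strong_diff y x"
proof -
 obtain z where z: "bseq x z" "bseq y z" by (rule EM_bseq2[OF assms])
 note d = bseq_ops[OF assms z] and d' = bseq_ops[OF assms(2,1) z(2,1)]
 note E = strong_diff_EM(1)[OF assms]
 note s = strong_scale_pc[OF E bseqD(2)[OF d(3)], of "-1", simplified]
 show ?thesis
 proof (rule EM_eqI[OF strong_scale_EM(1)[OF E] strong_diff_EM(1)[OF assms(2,1)] _ d'(3)])
  show "bseq (strong_scale (- 1) (strong_diff x y)) z" using s(1) bseqD(1)[OF z(1)] by (simp add: bseq_def)
  show "pc (strong_scale (- 1) (strong_diff x y)) (z n) = pc (strong_diff y x) (z n)" for n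
   unfolding s(2) d(4) d'(4) by simp
 qed
qed

text \<open>If \<open>a\<^sub>i \<le> x\<^sub>i \<le> b\<^sub>i\<close> squeezes \<open>x\<^sub>i\<close> to \<open>x\<close>, then \<open>\<plusminus>(x\<^sub>i - x) \<le> b\<^sub>i - a\<^sub>i\<close>, and \<open>b\<^sub>i - a\<^sub>i\<close> decreases
 to \<open>0\<close>.\<close>

theorem t_ch_le_t_o:
 assumes tI: "type_I_fin M"
 shows "coarser (t_ch M \<mu> \<Phi>) (t_o M)"
 unfolding coarser_def
proof (intro allI impI)
 fix U assume "openin (t_ch M \<mu> \<Phi>) U"
 then obtain V where V: "openin (center_norm_topology M \<mu> \<Phi>) V" "U = V \<inter> E_h M"
  unfolding t_ch_def openin_subtopology by blast
 show "openin (t_o M) U"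
  unfolding t_o_def openin_order_topology
 proof (intro conjI allI impI)
  show "U <= E_h M" using V(2) by blast
  fix I :: "('a opr \<times> 'a opr \<times> 'a opr) set set" and r X x
  assume h: "directed_index I r & o_converges (E_h M) opr_le I r X x & x : U"
  then have dir: "directed_index I r" and xU: "x : U" by auto
  obtain a b where xE: "x : E_h M" and XE: "ALL i:I. X i : E_h M"
   and ab: "ALL i:I. a i : E_h M & b i : E_h M & opr_le (a i) (X i) & opr_le (X i) (b i)"
    "ALL i:I. ALL j:I. r i j --> opr_le (a i) (a j) & opr_le (b j) (b i)"
    "is_sup_in (E_h M) opr_le (a ` I) x" "is_inf_in (E_h M) opr_le (b ` I) x"
   using h unfolding o_converges_def by (elim conjE exE) (rule that)
  have ai: "a i : E_h M" "b i : E_h M" "opr_le (a i) (X i)" "opr_le (X i) (b i)" "X i : E_h M"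
    "opr_le (a i) x" "opr_le x (b i)" if "i : I" for i
   using ab XE that unfolding is_sup_in_def is_inf_in_def by auto
  obtain A e \<delta> where O: "A : sets \<mu>" "emeasure \<mu> A < \<infinity>" "0 < e" "0 < \<delta>" "strong_sum x ` O_nbhd M \<mu> \<Phi> A e \<delta> <= V"
   using V xU unfolding openin_center_norm_topology by blast
  define c where "c = (%i. strong_diff (b i) (a i))"
  have c1: "c i : E_h M" if "i : I" for i unfolding c_def by (rule strong_diff_EH[OF ai(2,1)[OF that]])
  have c2: "positive_opr (c i)" if "i : I" for i
   using opr_le_trans[OF ai(3,4)[OF that] ai(1,5,2)[OF that]] unfolding c_def opr_le_def .
  have c3: "opr_le (c j) (c i)" if ij: "i : I" "j : I" "r i j" for i j
   unfolding c_def using ab(2) ij by (intro opr_le_diff_mono ai) auto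
  have inf: "L = 0" if L: "L : M" "pos L" "!!i. i : I ==> opr_le (bounded_opr L) (c i)" for L
  proof -
   let ?y = "bounded_opr L"
   have y: "?y : E_h M" by (rule bounded_opr_EH[OF L(1) pos_dag[OF L(2)]])
   have 1: "opr_le ?y (strong_diff (b i) (a j))" if ij: "i : I" "j : I" for i j
   proof -
    obtain k where k: "k : I" "r i k" "r j k" using directed_indexD(4)[OF dir ij] by blast
    have "opr_le (c k) (strong_diff (b i) (a j))"
     unfolding c_def using ab(2) ij k by (intro opr_le_diff_mono ai) auto
    then show ?thesis
     by (rule opr_le_trans[OF L(3)[OF k(1)] _ y c1[OF k(1)] strong_diff_EH[OF ai(2)[OF ij(1)] ai(1)[OF ij(2)]]])
   qed
   have 2: "opr_le ?y (strong_diff (b i) x)" if i: "i : I" for i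
   proof -
    note bi = ai(2)[OF i]
    have "opr_le (a j) (strong_diff (b i) ?y)" if j: "j : I" for j
     using 1[OF i j] opr_le_diff_swap[OF y ai(1)[OF j] bi] by simp
    then have "opr_le x (strong_diff (b i) ?y)"
     using ab(3) strong_diff_EH[OF bi y] unfolding is_sup_in_def by blast
    then show ?thesis using opr_le_diff_swap[OF y xE bi] by simp
   qed
   have "opr_le (strong_sum ?y x) (b i)" if i: "i : I" for i
    using 2[OF i] opr_le_diff_sum[OF y xE ai(2)[OF i]] by simp
   then have "opr_le (strong_sum ?y x) x"
    using ab(4) strong_sum_EH[OF y xE] unfolding is_inf_in_def by blast
   then have le: "opr_le ?y (strong_diff x x)" using opr_le_diff_sum[OF y xE xE] by simp
   obtain z where z: "bseq x z" using EM_bseq[OF EH_EM[OF xE]] by blast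
   note d = bseq_ops[OF EH_EM[OF xE] EH_EM[OF xE] z z]
   have "pos (- L)"
   proof (rule cseq_pos[OF bseqD(1)[OF z]])
    fix n
    note zn = cseqD(1)[OF bseqD(1)[OF z], of n]
    show "pos (z n**- L)"
     using opr_leD[OF le y strong_diff_EH[OF xE xE] bounded_opr_EM(2)[OF L(1) zn] bseqD(2)[OF d(3)]]
     by (simp add: bounded_opr_EM(3)[OF L(1) zn] d(4) opm.minus_right)
   qed (use L in simp)
   then show "L = 0" by (rule pos_antisym[OF L(2)])
  qed
  have "EX i:I. EX B:sets \<mu>. B <= A & emeasure \<mu> (A - B) <= ennreal \<delta> & bd (c i) (cproj B) & norm (pc (c i) (cproj B)) <= e"
   by (rule decreasing_net_small[OF tI dir _ _ _ _ O(1-4)]) (fact c1 c2 c3 inf)+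
  then obtain i B where iB: "i : I" "B : sets \<mu>" "B <= A" "emeasure \<mu> (A - B) <= ennreal \<delta>"
   "bd (c i) (cproj B)" "norm (pc (c i) (cproj B)) <= e" by (elim bexE conjE) (rule that)
  have "X j : U" if j: "j : I" "r i j" for j
  proof -
   define v where "v = strong_diff (X j) x"
   have v: "v : E_h M" unfolding v_def by (rule strong_diff_EH[OF ai(5)[OF j(1)] xE])
   have "opr_le v (c j)" unfolding v_def c_def by (rule opr_le_diff_mono) (use ai[OF j(1)] xE in auto)
   then have 1: "opr_le v (c i)" by (rule opr_le_trans[OF _ c3[OF iB(1) j] v c1[OF j(1)] c1[OF iB(1)]])
   have "opr_le (strong_diff (a i) (b i)) v"
    unfolding v_def by (rule opr_le_diff_mono)
     (use ai[OF j(1)] ai[OF iB(1)] xE opr_le_trans[OF _ ai(3)[OF j(1)] ai(1)[OF iB(1)] ai(1,5)[OF j(1)]] ab(2) iB(1) j in auto)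
   then have 2: "opr_le (strong_scale (- 1) (c i)) v"
    unfolding c_def strong_scale_neg_diff[OF EH_EM[OF ai(2)[OF iB(1)]] EH_EM[OF ai(1)[OF iB(1)]]] .
   have "bd v (cproj B)" "norm (pc v (cproj B)) <= e"
    by (rule bd_of_opr_le[OF v c1[OF iB(1)] 1 2 iB(5,6)])+
   then have "v : O_nbhd M \<mu> \<Phi> A e \<delta>" using O_nbhd_iff[OF O(1,3)] EH_EM[OF v] iB(2-4) by blast
   then have "strong_sum x v : V" using O(5) by blast
   then show ?thesis unfolding V(2) v_def strong_sum_diff_cancel[OF EH_EM[OF xE] EH_EM[OF ai(5)[OF j(1)]]]
    using ai(5)[OF j(1)] by blast
  qed
  then show "\<forall>\<^sub>F i in net_filter I r. X i : U" unfolding eventually_net_filter[OF dir] using iB(1) by blast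
 qed
qed

text \<open>Without type I\<open>\<^sub>f\<^sub>i\<^sub>n\<close> there is a sequence of projections \<open>q\<^sub>n\<close> decreasing strictly below every nonzero
 central projection under some \<open>z\<close>. Then \<open>q\<^sub>n - inf q\<^sub>n\<close> decreases to \<open>0\<close> in order, while its
 center-valued norm stays \<open>1\<close> on \<open>z\<close>.\<close>

theorem type_I_fin_of_t_ch_le_t_o:
 assumes co: "coarser (t_ch M \<mu> \<Phi>) (t_o M)"
 shows "type_I_fin M"
proof (rule ccontr)
 assume nI: "~ type_I_fin M"
 obtain q z where q: "!!n. q n : M" "!!n. is_proj (q n)" "!!n. q n**q (Suc n) = q (Suc n)"
  and z: "zproj z" "z ~= 0" "!!w n. zproj w ==> w ~= 0 ==> w**z = w ==> w**(q n - q (Suc n)) ~= 0"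
  by (rule not_type_I_fin_sequence[OF nI], rule that)
 obtain A where A: "A : sets \<mu>" "0 < emeasure \<mu> A" "emeasure \<mu> A < \<infinity>" "cproj A**z = cproj A"
  by (rule subset_finite_measure[OF z(1,2)], rule that)
 have fA: "A : fmeasurable \<mu>" using A by (simp add: fmeasurable_def)
 define U where "U = {x : EM. EX B:sets \<mu>. B <= A & measure \<mu> (A - B) < measure \<mu> A &
  bd x (cproj B) & norm (pc x (cproj B)) < 1}"
 have "openin (center_norm_topology M \<mu> \<Phi>) U"
  unfolding openin_center_norm_topology
 proof (intro conjI ballI)
  show "U <= EM" by (auto simp: U_def)
  fix x assume "x : U"
  then obtain B where x: "x : EM" and B: "B : sets \<mu>" "B <= A" "measure \<mu> (A - B) < measure \<mu> A"
   "bd x (cproj B)" "norm (pc x (cproj B)) < 1" by (auto simp: U_def)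
  define r where "r = (1 - norm (pc x (cproj B))) / 2"
  define d where "d = (measure \<mu> A - measure \<mu> (A - B)) / 2"
  have ed: "r > 0" "d > 0" using B by (auto simp: r_def d_def)
  have "strong_sum x ` O_nbhd M \<mu> \<Phi> A r d <= U"
  proof clarify
   fix y assume "y : O_nbhd M \<mu> \<Phi> A r d"
   then obtain C where y: "y : EM" and C: "C : sets \<mu>" "C <= A" "emeasure \<mu> (A - C) <= ennreal d"
    "bd y (cproj C)" "norm (pc y (cproj C)) <= r" using O_nbhd_iff[OF A(1) ed(1)] by blast
   note BC = sets.Int[OF B(1) C(1)]
   let ?e = "cproj (B \<inter> C)"
   note e = cproj_zproj[OF BC]
   have eB: "?e**cproj B = ?e" "?e**cproj C = ?e" using cproj_le[OF BC B(1)] cproj_le[OF BC C(1)] by auto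
   note rx = bd_restrict_le[OF x B(4) e eB(1)] and ry = bd_restrict_le[OF y C(4) e eB(2)]
   note n1 = norm_proj_comp[OF zprojD(2)[OF e]]
   have "norm (pc x ?e + pc y ?e) <= norm (pc x (cproj B)) + r"
    using norm_triangle_ineq[of "pc x ?e" "pc y ?e"] n1[of "pc x (cproj B)"] n1[of "pc y (cproj C)"] C(5)
    unfolding rx(2) ry(2) by linarith
   also have "... < 1" using B(5) by (simp add: r_def field_simps)
   finally have n: "norm (pc x ?e + pc y ?e) < 1" .
   have AC: "measure \<mu> (A - C) <= d"
    using C(3) fmeasurable_Diff[OF fA C(1)] ed by (simp add: emeasure_eq_measure2 fmeasurableD2 ennreal_le_iff)
   have "measure \<mu> (A - B \<inter> C) <= measure \<mu> ((A - B) \<union> (A - C))"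
    by (rule measure_mono_fmeasurable) (use fA A(1) B(1) C(1) in "auto intro: fmeasurable_Diff fmeasurable.Un")
   also have "... <= measure \<mu> (A - B) + measure \<mu> (A - C)"
    by (rule measure_Un_le) (use A(1) B(1) C(1) in auto)
   also have "... < measure \<mu> A" using AC B(3) by (simp add: d_def field_simps)
   finally have m: "measure \<mu> (A - B \<inter> C) < measure \<mu> A" .
   note s = strong_sum_EM(2)[OF x y rx(1) ry(1)]
   show "strong_sum x y : U"
    unfolding U_def using strong_sum_EM(1)[OF x y] BC B(2) m n s by (auto intro!: bexI[of _ "B \<inter> C"])
  qed
  then show "EX A r d. A : sets \<mu> & emeasure \<mu> A < \<infinity> & 0 < r & 0 < d & strong_sum x ` O_nbhd M \<mu> \<Phi> A r d <= U"
   using A(1,3) ed by blast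
 qed
 from t_ch_openI[OF this] have Uo: "openin (t_o M) (U \<inter> E_h M)" using co by (simp add: coarser_def)
 have pp: "is_proj (q n - q (Suc n))" for n
 proof -
  have "q (Suc n)**q n = q (Suc n)" using arg_cong[OF q(3)[of n], of dag] q(2) by (simp add: dag_comp is_projD)
  then show ?thesis using q(2)[of n] q(2)[of "Suc n"] q(3)[of n] by (simp add: is_proj_def dag_simps op_simps)
 qed
 have qd: "q n \<preceq> q m" if "m <= n" for m n
  using that
 proof (induction n rule: dec_induct)
  case (step n)
  show ?case by (rule op_le_trans[OF is_proj_pos[OF pp] step(3)])
 qed simp
 have q0: "dag (q n) = q n" "0 \<preceq> q n" for n using q(2) is_proj_pos[OF q(2)] by (simp_all add: is_projD)
 obtain L :: "'a \<Rightarrow>\<^sub>L 'a" where L: "!!h. ((%n. q n h) \<longlongrightarrow> L h) (net_filter (UNIV :: nat set) (<=))" "dag L = L"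
  "!!n. n : UNIV ==> L \<preceq> q n"
  by (rule decreasing_net_converges[OF directed_nat q0(1) qd q0(2)], assumption+, rule that)
 have Ls: "(%n. q n h) \<longlonglongrightarrow> L h" for h using L(1)[of h] unfolding net_filter_nat .
 have LM: "L : M" by (rule vna_limit[OF vna_M sequentially_bot _ Ls]) (use q in auto)
 define b where "b = (%n. q n - L)"
 have b: "b n : M" "dag (b n) = b n" "pos (b n)" for n
  using q LM L(2,3) q0 by (simp_all add: b_def dag_simps)
 have bh: "bounded_opr (b n) : E_h M" for n by (rule bounded_opr_EH[OF b(1,2)])
 have bd_le: "opr_le (bounded_opr S) (bounded_opr T)" if "S : M" "T : M" "S \<preceq> T" for S T
  by (rule opr_leI[where z = "%_. \<one>"]) (use that bounded_opr_EM in "auto simp: bseq_def cseq_one")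
 let ?X = "%n. bounded_opr (b n)"
 have "o_converges (E_h M) opr_le (UNIV :: nat set) (<=) ?X (bounded_opr 0)"
 proof (rule o_convergesI[where a = "%_. bounded_opr 0" and b = ?X])
  have "opr_le (bounded_opr 0) (?X n)" for n by (rule bd_le) (use b in auto)
  then show "bounded_opr 0 : E_h M & ?X n : E_h M & opr_le (bounded_opr 0) (?X n) & opr_le (?X n) (?X n)" for n
   using bh zero_EH opr_le_refl[OF EH_EM[OF bh]] by blast
  have anti: "opr_le (?X n) (?X m)" if "m <= n" for m n by (rule bd_le[OF b(1,1)]) (use qd[OF that] in "simp add: b_def")
  show "opr_le (bounded_opr 0 :: 'a opr) (bounded_opr 0) & opr_le (?X n) (?X m)" if "m <= n" for m n
   by (rule conjI[OF opr_le_refl[OF EH_EM[OF zero_EH]] anti[OF that]])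
  show "is_sup_in (E_h M) opr_le ((%_. bounded_opr 0) ` UNIV) (bounded_opr 0)"
   unfolding is_sup_in_def using zero_EH opr_le_refl[OF EH_EM[OF zero_EH]] by auto
  show "is_inf_in (E_h M) opr_le (?X ` UNIV) (bounded_opr 0)"
   unfolding is_inf_in_def
  proof (intro conjI ballI impI)
   show "bounded_opr 0 : E_h M" by (rule zero_EH)
   show "opr_le (bounded_opr 0) x" if "x : ?X ` UNIV" for x using that bd_le[OF _ b(1)] b(3) by auto
   fix y assume y: "y : E_h M" "ALL a:?X ` UNIV. opr_le y a"
   obtain u where u: "bseq y u" using EM_bseq[OF EH_EM[OF y(1)]] by blast
   note un = cseqD(1)[OF bseqD(1)[OF u]]
   show "opr_le y (bounded_opr 0)"
   proof (rule opr_leI[OF EH_EM[OF y(1)] EH_EM[OF zero_EH] u])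
    show "bseq (bounded_opr 0) u" using zero_pc(1)[OF un] bseqD(1)[OF u] by (simp add: bseq_def)
    fix m
    have "pos (0 - pc y (u m))"
    proof (rule pos_limit[of sequentially "%n. u m**b n - pc y (u m)"])
     fix h
     have "(%n. u m (q n h - L h) - pc y (u m) h) \<longlonglongrightarrow> u m (L h - L h) - pc y (u m) h" by (intro tendsto_intros Ls)
     then show "(%n. (u m**b n - pc y (u m)) h) \<longlonglongrightarrow> (0 - pc y (u m)) h"
      by (simp add: b_def blinfun.diff_left blinfun.minus_left blinfun.zero_right)
    next
     have "pc y (u m) \<preceq> u m**b n" for n
      using opr_leD[OF _ y(1) bh bseqD(2)[OF u] bounded_opr_EM(2)[OF b(1) un]] y(2) by (simp add: bounded_opr_EM(3)[OF b(1) un])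
     then show "\<forall>\<^sub>F n in sequentially. pos (u m**b n - pc y (u m))" by simp
    qed simp
    then show "pc y (u m) \<preceq> pc (bounded_opr 0) (u m)" by (simp add: zero_pc(2)[OF un])
   qed
  qed
 qed (use zero_EH bh in auto)
 from o_converges_order_topology[OF directed_nat this]
 have lim: "limitin (t_o M) ?X (bounded_opr 0) sequentially" unfolding net_filter_nat t_o_def .
 have "bounded_opr 0 : U"
  unfolding U_def using zero_pc[OF cproj_zproj[OF A(1)]] EH_EM[OF zero_EH] A(1,2) emeasure_eq_measure2[OF fA]
  by (auto intro!: bexI[of _ A])
 then have "\<forall>\<^sub>F n in sequentially. ?X n : U \<inter> E_h M" using lim Uo zero_EH unfolding limitin_def by blast
 then obtain n where "?X n : U" unfolding eventually_sequentially by blast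
 then obtain B where B: "B : sets \<mu>" "B <= A" "measure \<mu> (A - B) < measure \<mu> A" "norm (pc (?X n) (cproj B)) < 1"
  by (auto simp: U_def)
 let ?e = "cproj B"
 note e = cproj_zproj[OF B(1)]
 have "?e ~= 0"
 proof
  assume "?e = 0"
  then have "B : null_sets \<mu>" using cproj_eq_zero[OF B(1)] B(1) by (simp add: null_sets_def)
  then show False using B(3) measure_Diff_null_set[OF A(1), of B] by simp
 qed
 moreover have "?e**z = ?e" using cproj_le[OF B(1) A(1) B(2)] A(4) by (metis opm_assoc)
 ultimately have ne: "?e**(q n - q (Suc n)) ~= 0" by (rule z(3)[OF e])
 define p where "p = ?e**(q n - q (Suc n))"
 have p: "is_proj p" unfolding p_def by (rule is_proj_zmult[OF e _ pp]) (use q in simp)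
 have "pos (?e**(q (Suc n) - L))" by (rule pos_zmult[OF e _ L(3)]) (use q LM in auto)
 then have pb: "p \<preceq> ?e**b n" by (simp add: p_def b_def op_simps)
 obtain h where "p h ~= 0" using ne unfolding p_def[symmetric] by (metis blinfun_eqI zero_blinfun.rep_eq)
 define v where "v = p h"
 have pe: "p v = v" unfolding v_def using is_projD(1)[OF p] by (metis op_apply_assoc)
 have nb: "norm (?e**b n) < 1" using B(4) by (simp add: bounded_opr_EM(3)[OF b(1) e])
 have "(norm v)\<^sup>2 = rin (p v) v" by (simp add: pe rin_self)
 also have "... <= rin ((?e**b n) v) v" by (rule op_leD[OF pb])
 also have "... <= norm ((?e**b n) v) * norm v" using rin_Cauchy_Schwarz[of "(?e**b n) v" v] by linarith
 also have "... <= norm (?e**b n) * norm v * norm v" by (rule mult_right_mono[OF norm_blinfun norm_ge_zero])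
 finally show False using nb `p h ~= 0` by (simp add: v_def power2_eq_square)
qed

end

section \<open>Equality of the topologies\<close>

context center_functions
begin

text \<open>The bound \<open>t w \<le> w x\<close> for elements \<open>x\<close> whose piece over \<open>w\<close> need not be bounded.\<close>

definition dominates :: "real => 'a opr => ('a \<Rightarrow>\<^sub>L 'a) => bool" where
 "dominates t x w \<longleftrightarrow> (\<forall>u. zproj u --> u**w = u --> bd x u --> t *\<^sub>R u \<preceq> pc x u)"

lemma dominatesD: "dominates t x w ==> zproj u ==> u**w = u ==> bd x u ==> t *\<^sub>R u \<preceq> pc x u"
 unfolding dominates_def by blast

lemma dominates_mono:
 assumes x: "x \<in> E_h M" and y: "y \<in> E_h M" and le: "opr_le x y" and d: "dominates t x w"
 shows "dominates t y w"
 unfolding dominates_def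
proof (intro allI impI)
 fix u assume u: "zproj u" "u**w = u" "bd y u"
 obtain z where z: "bseq x z" using EM_bseq[OF EH_EM[OF x]] by blast
 note zn = cseqD(1)[OF bseqD(1)[OF z]]
 show "t *\<^sub>R u \<preceq> pc y u"
 proof (rule cseq_pos[OF bseqD(1)[OF z]])
  fix n
  have zu: "u**z n = z n**u" using zproj_comm[OF zn, of u n] u(1) by simp
  have v: "zproj (u**z n)" by (rule zproj_mult[OF u(1) zn])
  have vw: "u**z n**w = u**z n" unfolding zu using u(2) by (simp add: opm_assoc)
  have bx: "bd x (u**z n)" by (rule bd_restrict(1)[OF EH_EM[OF x] bseqD(2)[OF z] u(1)])
  have by': "bd y (u**z n)" "pc y (u**z n) = z n**pc y u" unfolding zu by (rule bd_restrict[OF EH_EM[OF y] u(3) zn])+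
  have "t *\<^sub>R (u**z n) \<preceq> pc y (u**z n)"
   by (rule op_le_trans[OF dominatesD[OF d v vw bx] opr_leD[OF le x y bx by'(1)]])
  then show "pos (z n**(pc y u - t *\<^sub>R u))" unfolding by'(2) by (simp add: opm.diff_right opm.scaleR_right zu)
 qed (use pcD(2)[OF u(3)] u(1) in simp)
qed

text \<open>If all \<open>b\<^sub>i\<close> dominate \<open>t\<close> on \<open>w\<close>, then replacing a bounded piece of \<open>inf b\<^sub>i\<close> under \<open>w\<close> by \<open>t\<close>
 still gives a lower bound of the \<open>b\<^sub>i\<close>.\<close>

lemma dominates_inf:
 assumes x: "is_inf_in (E_h M) opr_le (b ` I) x" and b: "\<And>i. i \<in> I ==> b i \<in> E_h M"
  and d: "\<And>i. i \<in> I ==> dominates t (b i) w"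
 shows "dominates t x w"
 unfolding dominates_def
proof (intro allI impI)
 fix u assume u: "zproj u" "u**w = u" "bd x u"
 have xE: "x : E_h M" and xb: "!!i. i : I ==> opr_le x (b i)" using x by (auto simp: is_inf_in_def)
 note xM = EH_EM[OF xE]
 define S where "S = t *\<^sub>R u - pc x u"
 have S: "S : M" "dag S = S" "u**S = S"
  using pcD(2,3)[OF u(3)] EH_pc[OF xE u(3)] u(1) by (simp_all add: S_def dag_simps op_simps opm.scaleR_right)
 note SE = bounded_opr_EM[OF S(1)]
 have Sh: "bounded_opr S : E_h M" by (rule bounded_opr_EH[OF S(1,2)])
 define y where "y = strong_sum x (bounded_opr S)"
 have yE: "y : E_h M" unfolding y_def by (rule strong_sum_EH[OF xE Sh])
 have "opr_le y (b i)" if i: "i : I" for i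
 proof -
  note bi = b[OF i]
  obtain z where z: "bseq x z" "bseq (b i) z" by (rule EM_bseq2[OF xM EH_EM[OF bi]])
  note zn = cseqD(1)[OF bseqD(1)[OF z(1)]]
  have Sz: "bseq (bounded_opr S) z" using SE(2)[OF zn] bseqD(1)[OF z(1)] by (simp add: bseq_def)
  note s = bseq_ops[OF xM SE(1) z(1) Sz]
  show ?thesis
  proof (rule opr_leI[OF EH_EM[OF yE] EH_EM[OF bi] s(1)[folded y_def] z(2)])
   fix n
   let ?P = "pc x (z n)" and ?Q = "pc (b i) (z n)"
   note bz = bseqD(2)[OF z(1), of n] bseqD(2)[OF z(2), of n]
   have v: "zproj (u**z n)" by (rule zproj_mult[OF u(1) zn])
   have vw: "u**z n**w = u**z n"
    using u(2) zproj_comm[OF zn, of u n] u(1) by (simp add: opm_assoc)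
   have bv: "bd (b i) (u**z n)" "pc (b i) (u**z n) = u**?Q" by (rule bd_restrict[OF EH_EM[OF bi] bz(2) u(1)])+
   have 1: "pos (u**?Q - t *\<^sub>R (u**z n))" using dominatesD[OF d[OF i] v vw bv(1)] bv(2) by simp
   have "pos ((\<one> - u)**(?Q - ?P))"
    by (rule pos_zmult[OF zproj_compl[OF u(1)] _ opr_leD[OF xb[OF i] xE bi bz]]) (use pcD(2)[OF bz(1)] pcD(2)[OF bz(2)] in simp)
   from pos_add[OF this 1]
   have "pos (?Q - (?P + (t *\<^sub>R (u**z n) - u**?P)))" by (simp add: op_simps algebra_simps)
   also have "t *\<^sub>R (u**z n) - u**?P = z n**S"
    using bd_overlap[OF xM bz(1) u(3)] zproj_comm[OF zn, of u n] u(1) by (simp add: S_def opm.diff_right opm.scaleR_right)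
   also have "?P + z n**S = pc y (z n)" unfolding y_def s(2) SE(3)[OF zn] ..
   finally show "pc y (z n) \<preceq> ?Q" .
  qed
 qed
 then have "opr_le y x" using x yE unfolding is_inf_in_def by blast
 moreover have "bd y u" "pc y u = t *\<^sub>R u"
  using strong_sum_EM(2)[OF xM SE(1) u(3) SE(2)[OF u(1)]] SE(3)[OF u(1)] S(3) by (simp_all add: y_def S_def)
 ultimately show "t *\<^sub>R u \<preceq> pc x u" using opr_leD[OF _ yE xE _ u(3)] by metis
qed

text \<open>Let \<open>F\<close> be an uncountable orthogonal family of central projections. The operators that dominate
 some \<open>n \<ge> 1\<close> on all but \<open>n\<close> members of \<open>F\<close> form a closed set for the order topology: on infinitely
 many members of \<open>F\<close> an order convergent net is eventually bounded by one number, so only finitely many \<open>n\<close>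
 matter. The set does not contain \<open>0\<close>, but every neighborhood \<open>O(A, \<epsilon>, \<delta>)\<close> meets it, because \<open>A\<close> sees all
 but finitely many members of \<open>F\<close> only up to measure \<open>\<delta>\<close>.\<close>

theorem countable_of_topologies_eq:
 assumes eq: "t_ch M \<mu> \<Phi> = t_o M"
  and F: "\<forall>w\<in>F. zproj w \<and> w \<noteq> 0" "orthogonal_family F"
 shows "countable F"
proof (rule ccontr)
 assume unc: "~ countable F"
 have Fz: "zproj w" "w ~= 0" if "w : F" for w using F(1) that by auto
 have Fo: "w**w' = 0" if "w : F" "w' : F" "w ~= w'" for w w' using F(2) that by (simp add: orthogonal_family_def)
 have Finf: "infinite F" using unc countable_finite by blast
 define C where "C = (%n. {x : E_h M. EX J<=F. finite J & card J <= n & (ALL w:F - J. dominates (real n) x w)})"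
 define V where "V = {x : E_h M. ALL n>=1. x ~: C n}"
 have "openin (t_o M) V"
  unfolding t_o_def openin_order_topology
 proof (intro conjI allI impI)
  show "V <= E_h M" by (auto simp: V_def)
  fix I :: "('a opr \<times> 'a opr \<times> 'a opr) set set" and r X x
  assume h: "directed_index I r & o_converges (E_h M) opr_le I r X x & x : V"
  then have dir: "directed_index I r" and xV: "x : V" by auto
  obtain a b where xE: "x : E_h M" and XE: "ALL i:I. X i : E_h M"
   and ab: "ALL i:I. a i : E_h M & b i : E_h M & opr_le (a i) (X i) & opr_le (X i) (b i)"
    "ALL i:I. ALL j:I. r i j --> opr_le (a i) (a j) & opr_le (b j) (b i)"
    "is_sup_in (E_h M) opr_le (a ` I) x" "is_inf_in (E_h M) opr_le (b ` I) x"
   using h unfolding o_converges_def by (elim conjE exE) (rule that)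
  have bi: "b i : E_h M" "opr_le (X i) (b i)" "X i : E_h M" if "i : I" for i using ab(1) XE that by auto
  have bm: "opr_le (b j) (b i)" if "i : I" "j : I" "r i j" for i j using ab(2) that by blast
  obtain i0 where i0: "i0 : I" using directed_indexD(1)[OF dir] by blast
  define G where "G = (%m::nat. {w : F. EX u. zproj u & u ~= 0 & u**w = u & bd (b i0) u & norm (pc (b i0) u) <= real m})"
  obtain z where z: "bseq (b i0) z" using EM_bseq[OF EH_EM[OF bi(1)[OF i0]]] by blast
  have "F <= (\<Union>m. G m)"
  proof
   fix w assume w: "w : F"
   obtain n where n: "z n**w ~= 0" using cseq_nonzero[OF bseqD(1)[OF z] Fz(2)[OF w]] by blast
   note zn = cseqD(1)[OF bseqD(1)[OF z], of n]
   have wz: "w**z n = z n**w" using zproj_comm[OF zn, of w] Fz(1)[OF w] by simp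
   obtain m where "norm (pc (b i0) (w**z n)) <= real m" using real_arch_simple by blast
   moreover have "bd (b i0) (w**z n)" by (rule bd_restrict(1)[OF EH_EM[OF bi(1)[OF i0]] bseqD(2)[OF z] Fz(1)[OF w]])
   moreover have "w**z n**w = w**z n" unfolding wz using Fz(1)[OF w] by (simp add: opm_assoc)
   ultimately have "w : G m" unfolding G_def using w n zproj_mult[OF Fz(1)[OF w] zn] wz by auto
   then show "w : (\<Union>m. G m)" by blast
  qed
  then have cG: "countable (\<Union>m. G m) ==> False" using unc countable_subset by blast
  have "EX m. infinite (G m)"
  proof (rule ccontr)
   assume "~ ?thesis"
   then have "countable (\<Union>m. G m)" by (intro countable_UN countableI_type countable_finite) simp
   then show False by (rule cG)
  qed
  then obtain m where m: "infinite (G m)" by (rule exE)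
  have nm: "n <= m" if j: "j : I" "r i0 j" and XC: "X j : C n" for j n
  proof -
   obtain J where J: "finite J" "ALL w:F - J. dominates (real n) (X j) w" using XC by (auto simp: C_def)
   have "G m - J ~= {}" using Diff_infinite_finite[OF J(1) m] by force
   then obtain w where w: "w : G m - J" by blast
   then obtain u where u: "zproj u" "u ~= 0" "u**w = u" "bd (b i0) u" "norm (pc (b i0) u) <= real m" and wF: "w : F" by (auto simp: G_def)
   have "dominates (real n) (X j) w" using J(2) w wF by blast
   then have "dominates (real n) (b i0) w"
    by (rule dominates_mono[OF bi(3)[OF j(1)] bi(1)[OF i0] opr_le_trans[OF bi(2)[OF j(1)] bm[OF i0 j] bi(3,1)[OF j(1)] bi(1)[OF i0]]])
   from dominatesD[OF this u(1,3,4)] have 1: "real n *\<^sub>R u \<preceq> pc (b i0) u" .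
   have 2: "real n *\<^sub>R u \<preceq> real m *\<^sub>R \<one>" by (rule op_le_trans[OF 1 op_le_norm(1)[OF EH_pc[OF bi(1)[OF i0] u(4)] u(5)]])
   obtain v where "u v ~= 0" using u(2) by (metis blinfun_eqI zero_blinfun.rep_eq)
   moreover have "u (u v) = u v" using u(1) by (metis op_apply_assoc zprojD(3))
   ultimately have "real n * (norm (u v))\<^sup>2 <= real m * (norm (u v))\<^sup>2"
    using op_leD[OF 2, of "u v"] by (simp add: blinfun.scaleR_left rin_simps rin_self)
   then show "n <= m" using `u v ~= 0` by simp
  qed
  have "EX K. K <= F & finite K & card K = Suc n & (ALL w:K. ~ dominates (real n) x w)" if "n >= 1" for n
  proof -
   let ?D = "{w : F. ~ dominates (real n) x w}"
   have "~ (finite ?D & card ?D <= n)"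
   proof
    assume "finite ?D & card ?D <= n"
    then have "x : C n" unfolding C_def using xE by (auto intro!: exI[of _ ?D])
    then show False using xV that by (simp add: V_def)
   qed
   then have "infinite ?D \<or> Suc n <= card ?D" by auto
   then have "EX K. finite K & card K = Suc n & K <= ?D"
   proof
    assume "infinite ?D"
    then show ?thesis by (rule infinite_arbitrarily_large)
   next
    assume "Suc n <= card ?D"
    then show ?thesis by (rule obtain_subset_with_card_n) blast
   qed
   then show ?thesis by blast
  qed
  then have "ALL n. EX K. n >= 1 --> K <= F & finite K & card K = Suc n & (ALL w:K. ~ dominates (real n) x w)" by blast
  from choice[OF this] obtain K where K: "ALL n>=1. K n <= F & finite (K n) & card (K n) = Suc n & (ALL w:K n. ~ dominates (real n) x w)" by blast
  define Q where "Q = (SIGMA n:{1..m}. K n)"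
  have Qf: "finite Q" unfolding Q_def by (rule finite_SigmaI) (use K in auto)
  have "EX i:I. ~ dominates (real (fst p)) (b i) (snd p)" if p: "p : Q" for p
  proof (rule ccontr)
   assume "~ ?thesis"
   then have "dominates (real (fst p)) x (snd p)" by (intro dominates_inf[OF ab(4) bi(1)]) auto
   then show False using p K by (auto simp: Q_def)
  qed
  then have "ALL p:Q. EX i. i : I & ~ dominates (real (fst p)) (b i) (snd p)" by blast
  from bchoice[OF this] obtain f where f: "ALL p:Q. f p : I & ~ dominates (real (fst p)) (b (f p)) (snd p)" by (rule exE)
  then have "insert i0 (f ` Q) <= I" using i0 by blast
  from directed_finite_bound[OF dir _ this] Qf have "EX k:I. ALL i:insert i0 (f ` Q). r i k" by simp
  then obtain k where k: "k : I" "ALL i:insert i0 (f ` Q). r i k" by (rule bexE)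
  have "X j : V" if j: "j : I" "r k j" for j
  proof -
   have rj: "r i j" if "i : I" "r i k" for i by (rule directed_indexD(3)[OF dir that(2) j(2) that(1) k(1) j(1)])
   have "X j ~: C n" if n: "n >= 1" for n
   proof
    assume XC: "X j : C n"
    have "n <= m" using nm[OF j(1) rj[OF i0] XC] k(2) by blast
    obtain J where J: "finite J" "card J <= n" "ALL w:F - J. dominates (real n) (X j) w" using XC by (auto simp: C_def)
    have Kn: "K n <= F" "card (K n) = Suc n" using K n by auto
    have "~ K n <= J" using card_mono[OF J(1), of "K n"] J(2) Kn(2) by auto
    then obtain w where w: "w : K n" "w ~: J" by blast
    then have p: "(n, w) : Q" using n `n <= m` by (simp add: Q_def)
    define i where "i = f (n, w)"
    have i: "i : I" "~ dominates (real n) (b i) w" "r i k" using f p k(2) unfolding i_def by auto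
    have "dominates (real n) (X j) w" using J(3) w Kn by blast
    then have "dominates (real n) (b i) w"
     by (rule dominates_mono[OF bi(3)[OF j(1)] bi(1)[OF i(1)] opr_le_trans[OF bi(2)[OF j(1)] bm[OF i(1) j(1) rj[OF i(1,3)]] bi(3,1)[OF j(1)] bi(1)[OF i(1)]]])
    then show False using i(2) by blast
   qed
   then show ?thesis using bi(3)[OF j(1)] by (simp add: V_def)
  qed
  then show "\<forall>\<^sub>F i in net_filter I r. X i : V" unfolding eventually_net_filter[OF dir] using k(1) by blast
 qed
 then have "openin (t_ch M \<mu> \<Phi>) V" by (simp add: eq)
 then obtain U where U: "openin (center_norm_topology M \<mu> \<Phi>) U" "V = U \<inter> E_h M"
  unfolding t_ch_def openin_subtopology by blast
 have "bounded_opr 0 ~: C n" if "n >= 1" for n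
 proof
  assume "bounded_opr 0 : C n"
  then obtain J where J: "finite J" "ALL w:F - J. dominates (real n) (bounded_opr 0) w" by (auto simp: C_def)
  have "F - J ~= {}" using Diff_infinite_finite[OF J(1) Finf] by force
  then obtain w where w: "w : F - J" by blast
  have wz: "zproj w" "w ~= 0" using w Fz by auto
  have d: "dominates (real n) (bounded_opr 0) w" using J(2) w by blast
  have "real n *\<^sub>R w \<preceq> 0" using dominatesD[OF d wz(1) _ zero_pc(1)[OF wz(1)]] wz(1) by (simp add: zero_pc)
  moreover have "pos (real n *\<^sub>R w)" by (rule pos_scaleR[OF is_proj_pos]) (use wz in auto)
  ultimately have "real n *\<^sub>R w = 0" using pos_antisym[of "real n *\<^sub>R w"] by simp
  then show False using wz(2) that by simp
 qed
 then have "bounded_opr 0 : V" using zero_EH by (simp add: V_def)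
 then have "bounded_opr 0 : U" using U(2) by blast
 then obtain A c \<delta> where O: "A : sets \<mu>" "emeasure \<mu> A < \<infinity>" "0 < c" "0 < \<delta>"
  "strong_sum (bounded_opr 0) ` O_nbhd M \<mu> \<Phi> A c \<delta> <= U"
  using U(1) unfolding openin_center_norm_topology by blast
 have "EX J B. finite J & J <= F & B : sets \<mu> & B <= A & emeasure \<mu> (A - B) <= ennreal \<delta> & (ALL w:F - J. cproj B**w = 0)"
  by (rule orthogonal_family_tail[OF _ _ O(1,2,4)]) (fact Fz(1) Fo)+
 then obtain J B where J: "finite J" "J <= F" and B: "B : sets \<mu>" "B <= A" "emeasure \<mu> (A - B) <= ennreal \<delta>" "ALL w:F - J. cproj B**w = 0"
  by (elim exE conjE) (rule that)
 have FJ: "zproj w" if "w : F - J" for w using Fz that by blast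
 have FJo: "w**w' = 0" if "w : F - J" "w' : F - J" "w ~= w'" for w w' using Fo that by blast
 obtain L where L: "zproj L" "!!w. w : F - J ==> w**L = w" "!!R. ALL w:F - J. R**w = w ==> R**L = L"
  by (rule central_family_sum[OF FJ FJo], assumption+, rule that)
 define n where "n = Suc (card J)"
 define T where "T = real n *\<^sub>R L"
 have T: "T : M" "dag T = T" using L(1) by (simp_all add: T_def dag_simps)
 let ?x = "bounded_opr T"
 have xE: "?x : E_h M" by (rule bounded_opr_EH[OF T])
 have "dominates (real n) ?x w" if w: "w : F - J" for w
  unfolding dominates_def
 proof (intro allI impI)
  fix u assume u: "zproj u" "u**w = u" "bd ?x u"
  have "u**L = u" using L(2)[OF w] u(2) by (metis opm_assoc)
  then show "real n *\<^sub>R u \<preceq> pc ?x u" unfolding bounded_opr_EM(3)[OF T(1) u(1)] by (simp add: T_def opm.scaleR_right)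
 qed
 then have "?x : C n" unfolding C_def using xE J by (auto simp: n_def intro!: exI[of _ J])
 then have xV: "?x ~: V" by (auto simp: V_def n_def)
 note e = cproj_zproj[OF B(1)]
 have "(\<one> - cproj B)**L = L" by (rule L(3)) (use B(4) in "simp add: opm.diff_left")
 then have "cproj B**L = 0" by (simp add: opm.diff_left)
 then have "pc ?x (cproj B) = 0" unfolding bounded_opr_EM(3)[OF T(1) e] by (simp add: T_def opm.scaleR_right)
 then have "?x : O_nbhd M \<mu> \<Phi> A c \<delta>"
  using O_nbhd_iff[OF O(1,3)] EH_EM[OF xE] B(1-3) bounded_opr_EM(2)[OF T(1) e] O(3) by auto
 then have "strong_sum (bounded_opr 0) ?x : U" using O(5) by blast
 then have "?x : U" using bounded_opr_algebra(1)[of 0 T] T(1) by simp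
 then show False using xV U(2) xE by blast
qed

end

context center_functions
begin

lemma sigma_finite_exhaustion:
 assumes "sigma_finite_algebra M"
 shows "\<exists>A. (\<forall>n. A n \<in> sets \<mu> \<and> emeasure \<mu> (A n) < \<infinity> \<and> A n \<subseteq> A (Suc n)) \<and> cseq (%n. cproj (A n))"
proof -
 define P where "P = (%v. EX A. A : sets \<mu> & emeasure \<mu> A < \<infinity> & v = cproj A)"
 have loc: "EX v. zproj v & v ~= 0 & v **w = v & P v" if w: "zproj w" "w ~= 0" "w**\<one> = w" for w
 proof -
  obtain A where A: "A : sets \<mu>" "0 < emeasure \<mu> A" "emeasure \<mu> A < \<infinity>" "cproj A**w = cproj A"
   by (rule subset_finite_measure[OF w(1,2)], rule that)
  have "cproj A ~= 0" using A(2) cproj_eq_zero[OF A(1)] by simp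
  then show ?thesis using A cproj_zproj[OF A(1)] unfolding P_def by (intro exI[of _ "cproj A"]) blast
 qed
 obtain G where G: "!!w. w : G ==> zproj w & w ~= 0 & w**\<one> = w & P w"
  "!!w w'. w : G ==> w' : G ==> w ~= w' ==> w**w' = 0"
  "!!x. ((%w. blinfun_apply w x) has_sum \<one> x) G"
  by (rule central_exhaustion[of \<one> P, OF zproj_one loc], assumption+, rule that)
 have "G <= projections M - {0}" using G(1) by (auto simp: projections_M)
 moreover have "orthogonal_family G" unfolding orthogonal_family_def using G(2) by auto
 ultimately have cG: "countable G" using assms unfolding sigma_finite_algebra_def by blast
 have "ALL w:G. EX A. A : sets \<mu> & emeasure \<mu> A < \<infinity> & w = cproj A" using G(1) unfolding P_def by blast
 from bchoice[OF this] obtain S where S: "ALL w:G. S w : sets \<mu> & emeasure \<mu> (S w) < \<infinity> & w = cproj (S w)" by (rule exE)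
 define H where "H = (%n. {w : G. to_nat_on G w < n})"
 have Hf: "finite (H n)" for n
 proof (rule finite_imageD)
  show "finite (to_nat_on G ` H n)" by (rule finite_subset[of _ "{..<n}"]) (auto simp: H_def)
  show "inj_on (to_nat_on G) (H n)" by (rule inj_on_subset[OF inj_on_to_nat_on[OF cG]]) (auto simp: H_def)
 qed
 define A where "A = (%n. \<Union>w\<in>H n. S w)"
 have "A n : fmeasurable \<mu>" for n
  unfolding A_def using S by (intro fmeasurable.finite_UN Hf) (auto simp: H_def fmeasurable_def)
 then have A: "A n : sets \<mu>" "emeasure \<mu> (A n) < \<infinity>" "A n <= A (Suc n)" for n
  by (auto simp: fmeasurable_def A_def H_def)
 have "cseq (%n. cproj (A n))"
 proof (rule cseqI)
  show "zproj (cproj (A n))" "cproj (A n)**cproj (A (Suc n)) = cproj (A n)" for n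
   using cproj_zproj cproj_le A by auto
  fix r assume r: "zproj r" "!!n. r**cproj (A n) = cproj (A n)"
  have rw: "r**w = w" if w: "w : G" for w
  proof -
   define n where "n = Suc (to_nat_on G w)"
   have "S w <= A n" using w unfolding A_def H_def n_def by auto
   then have "w**cproj (A n) = w" using S w cproj_le[OF _ A(1)] by metis
   then have "cproj (A n)**w = w" using zproj_comm[OF cproj_zproj[OF A(1)], of w] G(1)[OF w] by simp
   then show ?thesis using r(2)[of n] by (metis opm_assoc)
  qed
  show "r = \<one>" using has_sum_op_eqI[OF G(3), of r \<one>] rw by simp
 qed
 then show ?thesis using A by blast
qed

text \<open>Continuity of the finite measure on \<open>A\<close>, transported to central projections.\<close>

lemma cseq_exhausts_measure:
 assumes u: "cseq u" and A: "A \<in> sets \<mu>" "emeasure \<mu> A < \<infinity>" and d: "0 < d"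
 shows "\<exists>m. \<exists>B\<in>sets \<mu>. B \<subseteq> A \<and> emeasure \<mu> (A - B) \<le> ennreal d \<and> cproj B**u m = cproj B"
proof -
 have "ALL m. EX B. B : sets \<mu> & u m = cproj B" using zproj_cproj[OF cseqD(1)[OF u]] by blast
 from choice[OF this] obtain S where S: "!!m. S m : sets \<mu>" "!!m. u m = cproj (S m)" by blast
 define R where "R = (%m. A \<inter> (\<Inter>k\<in>{m..}. S k))"
 have R: "R m : sets \<mu>" "R m <= R (Suc m)" "R m <= A" "R m <= S m" for m
  unfolding R_def using A(1) S(1) by (auto intro!: sets.Int sets.countable_INT'')
 define U where "U = (\<Union>m. R m)"
 have U: "U : sets \<mu>" "U <= A" unfolding U_def using R(1,3) by (auto intro: sets.countable_UN'')
 note AU = sets.Diff[OF A(1) U(1)]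
 have Sn: "S m - S k : null_sets \<mu>" if "m <= k" for m k
 proof -
  show ?thesis using cproj_absorb_iff[OF S(1) S(1), of m k] cseqD(3)[OF u that] S(1) by (simp add: S(2)[symmetric] null_sets_def)
 qed
 have "cproj (A - U) = 0"
 proof (rule cseq_op_eqI[OF u])
  fix m
  have 1: "(A - U) \<inter> S m <= (\<Union>k\<in>{m..}. S m - S k)" by (auto simp: U_def R_def)
  have 2: "(\<Union>k\<in>{m..}. S m - S k) : null_sets \<mu>" by (rule null_sets_UN') (use Sn in auto)
  have "(A - U) \<inter> S m : null_sets \<mu>" by (rule null_sets_subset[OF 2 sets.Int[OF AU S(1)] 1])
  then have "cproj (S m \<inter> (A - U)) = 0" using cproj_eq_zero[OF sets.Int[OF S(1) AU], of m] by (simp add: null_sets_def Int_commute)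
  then show "u m**cproj (A - U) = u m**0" unfolding S(2) cproj_inter[OF S(1) AU] by (simp add: opm.zero_right)
 qed
 then have "emeasure \<mu> (A - U) = 0" using cproj_eq_zero[OF AU] by simp
 have fA: "A : fmeasurable \<mu>" using A by (simp add: fmeasurable_def)
 have fR: "R m : fmeasurable \<mu>" for m by (rule fmeasurableI2[OF fA R(3,1)])
 have fU: "U : fmeasurable \<mu>" by (rule fmeasurableI2[OF fA U(2,1)])
 have mU: "measure \<mu> A = measure \<mu> U"
  using measurable_measure_Diff[OF fA U(1,2)] `emeasure \<mu> (A - U) = 0` by (simp add: measure_def)
 have "(%m. emeasure \<mu> (R m)) \<longlonglongrightarrow> emeasure \<mu> U"
  unfolding U_def using R by (intro Lim_emeasure_incseq incseq_SucI) auto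
 then have "(%m. measure \<mu> (R m)) \<longlonglongrightarrow> measure \<mu> U"
  using fR fU by (simp add: emeasure_eq_measure2 fmeasurableD2)
 from order_tendstoD(1)[OF this, of "measure \<mu> U - d"] d
 obtain m where m: "measure \<mu> U - d < measure \<mu> (R m)" by (auto simp: eventually_sequentially)
 have "measure \<mu> (A - R m) <= d" using measurable_measure_Diff[OF fA R(1,3)] m mU by simp
 then have "emeasure \<mu> (A - R m) <= ennreal d"
  using fmeasurable_Diff[OF fA R(1)[of m]] by (simp add: emeasure_eq_measure2 fmeasurableD2 ennreal_leI)
 moreover have "cproj (R m)**u m = cproj (R m)" unfolding S(2) by (rule cproj_le[OF R(1) S(1) R(4)])
 ultimately show ?thesis using R(1,3) by blast
qed

text \<open>A positive element that is the scalar \<open>s\<^sub>m\<^sub>k\<close> on the \<open>m\<close>-th step of an exhausting sequence, where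
 \<open>s\<^sub>m\<^sub>k\<close> is \<open>2\<^sup>-\<^sup>k\<close> for \<open>m \<le> k\<close>; such elements decrease to \<open>0\<close> in \<open>k\<close>.\<close>

lemma order_dominating_sequence:
 assumes g: "cseq g" and y: "\<And>j. y j \<in> E_h M" "\<And>j n. bd (y j) (g n)"
  and small: "\<And>j n. n \<le> j ==> norm (pc (y j) (g n)) \<le> 1 / 2 ^ j"
 obtains b where "\<And>k. b k \<in> E_h M" "\<And>k. bseq (b k) g" "\<And>k n. pos (pc (b k) (g n))"
  "\<And>k l n. k \<le> l ==> pc (b l) (g n) \<preceq> pc (b k) (g n)"
  "\<And>k n. pc (y k) (g n) \<preceq> pc (b k) (g n)" "\<And>k n. - pc (y k) (g n) \<preceq> pc (b k) (g n)"
  "\<And>k n. n \<le> k ==> pc (b k) (g n) = (1 / 2 ^ k) *\<^sub>R g n"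
proof -
 note gn = cseqD(1)[OF g]
 have gc: "g n**g m = g m" "g m**g n = g m" if "m <= n" for m n
  using cseqD(3)[OF g that] zproj_comm[OF gn, of "g n" m] gn[of n] by auto
 define D where "D = (%n. case n of 0 => g 0 | Suc k => g (Suc k) - g k)"
 have Dz: "zproj (D n)" for n
  unfolding D_def using gn gc by (cases n) (auto intro: zproj_diff)
 have Dg: "D m**g n = D m" "g n**D m = D m" if "m <= n" for m n
  using gc that by (cases m; simp add: D_def op_simps)+
 have gD: "g n**D (Suc n) = 0" for n using gc by (simp add: D_def op_simps)
 have Ds: "(\<Sum>m\<le>n. D m) = g n" for n by (induction n) (simp_all add: D_def)
 define t where "t = (%m. 1 + (\<Sum>j<m. norm (pc (y j) (g m))))"
 define s :: "nat => nat => real" where "s = (%m k. if m <= k then 1 / 2 ^ k else t m)"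
 have t1: "1 <= t m" for m unfolding t_def by (simp add: sum_nonneg)
 have p1: "1 / 2 ^ k <= (1::real)" for k :: nat by simp
 have s0: "0 <= s m k" for m k using t1[of m] by (simp add: s_def)
 have sd: "s m l <= s m k" if "k <= l" for k l m
  using that order_trans[OF p1[of l] t1[of m]] by (auto simp: s_def frac_le power_increasing)
 have sn: "norm (pc (y k) (g m)) <= s m k" for m k
 proof (cases "m <= k")
  case True
  then show ?thesis using small by (simp add: s_def)
 next
  case False
  then have "norm (pc (y k) (g m)) <= (\<Sum>j<m. norm (pc (y j) (g m)))" by (intro member_le_sum) auto
  then show ?thesis using False by (simp add: s_def t_def)
 qed
 define P where "P = (%k n. \<Sum>m\<le>n. s m k *\<^sub>R D m)"
 have psum: "pos (\<Sum>m\<le>n. f m)" if "!!m. m <= n ==> pos (f m)" for f :: "nat => 'a \<Rightarrow>\<^sub>L 'a" and n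
  using that by (induction n) (auto intro: pos_add)
 have pD: "pos (c *\<^sub>R D m)" if "0 <= c" for c m by (rule pos_scaleR[OF is_proj_pos that]) (use Dz in simp)
 have PM: "P k n : M" for k n unfolding P_def by (intro vna_sum[OF vna_M] vna_scaleR[OF vna_M]) (use Dz in simp)
 have Pg: "g n**P k n = P k n" for k n
  unfolding P_def opm.sum_right by (intro sum.cong) (auto simp: opm.scaleR_right Dg)
 have PS: "g n**P k (Suc n) = P k n" for k n
  using Pg[of n k] gD[of n] by (simp add: P_def opm.add_right opm.scaleR_right)
 have Pp: "pos (P k n)" for k n unfolding P_def by (intro psum pD s0)
 define b where "b = (%k. glue g (P k))"
 note B = glue_EM[OF g PM Pg PS, folded b_def]
 have Bp: "pc (b k) (g n) = P k n" for k n unfolding b_def by (rule glue_EM(3)[OF g PM Pg PS])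
 have bE: "b k : EM" "bseq (b k) g" for k unfolding b_def by (rule glue_EM[OF g PM Pg PS])+
 have bh: "b k : E_h M" for k by (rule EHI[OF bE]) (simp add: Bp pos_dag[OF Pp])
 have decr: "P l n \<preceq> P k n" if "k <= l" for k l n
 proof -
  have "P k n - P l n = (\<Sum>m\<le>n. (s m k - s m l) *\<^sub>R D m)" by (simp add: P_def sum_subtractf scaleR_diff_left)
  also have "pos ..." by (intro psum pD) (simp add: sd[OF that])
  finally show ?thesis .
 qed
 have dom: "c *\<^sub>R pc (y k) (g n) \<preceq> P k n" if c: "\<bar>c\<bar> = 1" for c k n
 proof -
  let ?T = "pc (y k) (g n)"
  have TM: "?T : M" "g n**?T = ?T" using pcD(2,3)[OF y(2)] by auto
  have "P k n - c *\<^sub>R ?T = (\<Sum>m\<le>n. s m k *\<^sub>R D m - c *\<^sub>R (D m**?T))"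
   using TM(2) Ds[of n] by (simp add: P_def sum_subtractf scaleR_sum_right[symmetric] opm.sum_left[symmetric])
  also have "pos ..."
  proof (rule psum)
   fix m assume m: "m <= n"
   have "pc (y k) (g m) = g m**?T" by (rule bd_restrict_le(2)[OF EH_EM[OF y(1)] y(2) gn gc(2)[OF m]])
   then have e: "D m**?T = D m**pc (y k) (g m)" using Dg(1)[of m m] by (metis opm_assoc order_refl)
   have "norm (D m**pc (y k) (g m)) <= norm (D m) * norm (pc (y k) (g m))" by (rule norm_comp_le)
   also have "... <= 1 * s m k" by (intro mult_mono sn is_proj_norm zprojD(2) Dz) simp_all
   finally have n1: "norm (c *\<^sub>R (D m**?T)) <= s m k" using c e by simp
   have "dag (D m**?T) = D m**?T"
    using zproj_comm[OF Dz TM(1), of m] Dz[of m] EH_pc[OF y(1,2)] by (simp add: dag_comp)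
   then have "c *\<^sub>R (D m**?T) \<preceq> s m k *\<^sub>R \<one>" by (intro op_le_norm(1) n1) (simp add: dag_scaleR)
   from pos_zmult[OF Dz[of m] _ this] show "pos (s m k *\<^sub>R D m - c *\<^sub>R (D m**?T))"
    using TM(1) Dz[of m] by (simp add: opm.diff_right opm.scaleR_right is_proj_absorb)
  qed
  finally show ?thesis .
 qed
 show ?thesis
 proof (rule that[of b])
  fix k n :: nat
  assume "n <= k"
  then have "P k n = (\<Sum>m\<le>n. (1 / 2 ^ k) *\<^sub>R D m)" unfolding P_def by (intro sum.cong) (auto simp: s_def)
  then have "P k n = (1 / 2 ^ k) *\<^sub>R (\<Sum>m\<le>n. D m)" by (simp only: scaleR_sum_right)
  then show "pc (b k) (g n) = (1 / 2 ^ k) *\<^sub>R g n" unfolding Ds Bp .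
 qed (use bh bE(2) Bp Pp decr dom[of 1] dom[of "-1"] in simp_all)
qed

text \<open>Convergence in measure along an exhausting sequence becomes order convergence when the errors are
 summable (Borel--Cantelli): outside sets of small measure all the later terms are small at once.\<close>

lemma order_open_contains_nbhd:
 assumes sf: "sigma_finite_algebra M" and V: "openin (t_o M) V" "v \<in> V"
 shows "\<exists>A c \<delta>. A \<in> sets \<mu> \<and> emeasure \<mu> A < \<infinity> \<and> 0 < c \<and> 0 < \<delta> \<and>
  (\<forall>y\<in>E_h M \<inter> O_nbhd M \<mu> \<Phi> A c \<delta>. strong_sum v y \<in> V)"
proof (rule ccontr)
 assume no: "~ ?thesis"
 have vE: "v : E_h M" using V unfolding t_o_def openin_order_topology by blast
 obtain A where A0: "ALL n. A n : sets \<mu> & emeasure \<mu> (A n) < \<infinity> & A n <= A (Suc n)" and Ac: "cseq (%n. cproj (A n))"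
  using sigma_finite_exhaustion[OF sf] by (elim exE conjE) (rule that)
 have A: "A n : sets \<mu>" "emeasure \<mu> (A n) < \<infinity>" "m <= n ==> A m <= A n" for m n
  using A0 lift_Suc_mono_le[of A m n] by auto
 have e0: "0 < (1 / 2 ^ n :: real)" for n :: nat by simp
 have "ALL n. EX y. y : E_h M & y : O_nbhd M \<mu> \<Phi> (A n) (1 / 2 ^ n) (1 / 2 ^ n) & strong_sum v y ~: V"
 proof
  fix n
  show "EX y. y : E_h M & y : O_nbhd M \<mu> \<Phi> (A n) (1 / 2 ^ n) (1 / 2 ^ n) & strong_sum v y ~: V"
   using no A(1)[of n] A(2)[of n] e0[of n] by blast
 qed
 from choice[OF this] obtain y where y: "!!n. y n : E_h M" "!!n. y n : O_nbhd M \<mu> \<Phi> (A n) (1 / 2 ^ n) (1 / 2 ^ n)"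
  "!!n. strong_sum v (y n) ~: V" by blast
 note yM = EH_EM[OF y(1)]
 have "ALL n. EX K. K : sets \<mu> & K <= A n & emeasure \<mu> (A n - K) <= ennreal (2 / 2 ^ n) & (ALL j<=n. bd (y j) (cproj K)) &
   norm (pc (y n) (cproj K)) <= 1 / 2 ^ n"
 proof
  fix n
  obtain B where B: "B : sets \<mu>" "B <= A n" "emeasure \<mu> (A n - B) <= ennreal (1 / 2 ^ n)" "bd (y n) (cproj B)"
   "norm (pc (y n) (cproj B)) <= 1 / 2 ^ n"
   using iffD1[OF O_nbhd_iff[OF A(1) e0] y(2)[of n]] by (elim conjE bexE) (rule that)
  have "y ` {..n} <= EM" using yM by blast
  from common_bseq[OF finite_imageI[OF finite_atMost] this]
  obtain u where u: "cseq u" "ALL x:y ` {..n}. bseq x u" by (elim exE conjE) (rule that)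
  obtain m H where H: "H : sets \<mu>" "H <= A n" "emeasure \<mu> (A n - H) <= ennreal (1 / 2 ^ n)" "cproj H**u m = cproj H"
   using cseq_exhausts_measure[OF u(1) A(1)[of n] A(2)[of n] e0[of n]] by (elim exE conjE bexE) (rule that)
  note BH = sets.Int[OF B(1) H(1)]
  note e = cproj_zproj[OF BH]
  have "emeasure \<mu> (A n - B \<inter> H) <= emeasure \<mu> ((A n - B) \<union> (A n - H))" using A(1) B(1) H(1) by (intro emeasure_mono) auto
  also have "... <= emeasure \<mu> (A n - B) + emeasure \<mu> (A n - H)" by (rule emeasure_subadditive) (use A(1) B(1) H(1) in auto)
  also have "... <= ennreal (1 / 2 ^ n) + ennreal (1 / 2 ^ n)" by (intro add_mono B H)
  also have "... = ennreal (2 / 2 ^ n)" by (simp add: ennreal_plus[symmetric] del: ennreal_plus)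
  finally have m2: "emeasure \<mu> (A n - B \<inter> H) <= ennreal (2 / 2 ^ n)" .
  have eB: "cproj (B \<inter> H)**cproj B = cproj (B \<inter> H)" and eH: "cproj (B \<inter> H)**cproj H = cproj (B \<inter> H)"
   using cproj_le[OF BH B(1)] cproj_le[OF BH H(1)] by auto
  have eu: "cproj (B \<inter> H)**u m = cproj (B \<inter> H)" using eH H(4) by (metis opm_assoc)
  have "bd (y j) (cproj (B \<inter> H))" if "j <= n" for j
  proof -
   have "bseq (y j) u" using u(2) that by simp
   from bd_restrict_le(1)[OF yM bseqD(2)[OF this] e eu] show ?thesis .
  qed
  moreover have "norm (pc (y n) (cproj (B \<inter> H))) <= 1 / 2 ^ n"
   unfolding bd_restrict_le(2)[OF yM B(4) e eB]
   by (rule order_trans[OF norm_proj_comp[OF zprojD(2)[OF e]] B(5)])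
  ultimately show "EX K. K : sets \<mu> & K <= A n & emeasure \<mu> (A n - K) <= ennreal (2 / 2 ^ n) & (ALL j<=n. bd (y j) (cproj K)) &
   norm (pc (y n) (cproj K)) <= 1 / 2 ^ n"
   using BH B(2) m2 by (intro exI[of _ "B \<inter> H"]) auto
 qed
 from choice[OF this] obtain K where K: "!!n. K n : sets \<mu>" "!!n. K n <= A n" "!!n. emeasure \<mu> (A n - K n) <= ennreal (2 / 2 ^ n)"
  "!!n j. j <= n ==> bd (y j) (cproj (K n))" "!!n. norm (pc (y n) (cproj (K n))) <= 1 / 2 ^ n" by blast
 define C where "C = (%n. \<Inter>k\<in>{n..}. K k)"
 have Cs: "C n : sets \<mu>" "C n <= C (Suc n)" for n
  unfolding C_def using K(1) by (auto intro!: sets.countable_INT'')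
 have CK: "C n <= K k" if "n <= k" for n k unfolding C_def using that by auto
 have AC: "emeasure \<mu> (A n - C n) <= ennreal (4 / 2 ^ n)" for n
 proof -
  have "A n - C n <= (\<Union>k. A (k + n) - K (k + n))"
  proof
   fix x assume x: "x : A n - C n"
   then obtain k where k: "n <= k" "x ~: K k" by (auto simp: C_def)
   then have "x : A (k - n + n) - K (k - n + n)" using A(3)[of n k] x by auto
   then show "x : (\<Union>k. A (k + n) - K (k + n))" by blast
  qed
  then have "emeasure \<mu> (A n - C n) <= emeasure \<mu> (\<Union>k. A (k + n) - K (k + n))"
   by (rule emeasure_mono) (use A(1) K(1) in auto)
  also have "... <= (\<Sum>k. emeasure \<mu> (A (k + n) - K (k + n)))"
   by (rule emeasure_subadditive_countably) (use A(1) K(1) in auto)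
  also have "... <= (\<Sum>k. ennreal (2 / 2 ^ (k + n)))" by (intro suminf_le K(3) summableI)
  also have "... = ennreal (4 / 2 ^ n)"
  proof (rule suminf_ennreal_eq)
   have "(%k. (2 / 2 ^ n) * (1 / 2) ^ k) sums ((2 / 2 ^ n) * (1 / (1 - 1 / 2 :: real)))" by (intro sums_mult geometric_sums) simp
   then show "(%k. 2 / 2 ^ (k + n)) sums (4 / 2 ^ n :: real)" by (simp add: power_add power_divide mult.commute)
  qed simp
  finally show ?thesis .
 qed
 define g where "g = (%n. cproj (C n))"
 have gz: "zproj (g n)" for n unfolding g_def by (rule cproj_zproj[OF Cs(1)])
 have gK: "g n**cproj (K k) = g n" if "n <= k" for n k unfolding g_def by (rule cproj_le[OF Cs(1) K(1) CK[OF that]])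
 have g: "cseq g"
 proof (rule cseqI[OF gz])
  show "g n**g (Suc n) = g n" for n unfolding g_def by (rule cproj_le[OF Cs(1) Cs(1) Cs(2)])
  fix r assume r: "zproj r" "!!n. r**g n = g n"
  obtain R where R: "R : sets \<mu>" "r = cproj R" using zproj_cproj[OF r(1)] by blast
  have CR: "emeasure \<mu> (C n - R) = 0" for n
  proof -
   have "cproj (C n)**cproj R = cproj (C n)" using r(2)[of n] zproj_comm[OF r(1), of "g n"] gz[of n] by (simp add: R(2) g_def)
   then show ?thesis using cproj_absorb_iff[OF Cs(1) R(1)] by simp
  qed
  show "r = \<one>"
  proof (rule cseq_op_eqI[OF Ac])
   fix m
   have "emeasure \<mu> (A m - R) <= ennreal (4 / 2 ^ n)" if "m <= n" for n
   proof -
    have "emeasure \<mu> (A m - R) <= emeasure \<mu> ((A n - C n) \<union> (C n - R))"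
     using A(3)[OF that] A(1) Cs(1) R(1) by (intro emeasure_mono) auto
    also have "... <= emeasure \<mu> (A n - C n) + emeasure \<mu> (C n - R)"
     by (rule emeasure_subadditive) (use A(1) Cs(1) R(1) in auto)
    also have "... <= ennreal (4 / 2 ^ n)" using AC[of n] CR by simp
    finally show ?thesis .
   qed
   moreover have "(%n. ennreal (4 / 2 ^ n)) \<longlonglongrightarrow> ennreal 0"
   proof (rule tendsto_ennrealI)
    have "(%n. 4 * (1 / 2 :: real) ^ n) \<longlonglongrightarrow> 4 * 0" by (intro tendsto_intros LIMSEQ_power_zero) simp
    then show "(%n. 4 / 2 ^ n :: real) \<longlonglongrightarrow> 0" by (simp add: power_divide)
   qed
   ultimately have "emeasure \<mu> (A m - R) <= ennreal 0" by (intro LIMSEQ_le_const) auto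
   then show "cproj (A m)**r = cproj (A m)**\<one>" using cproj_absorb_iff[OF A(1) R(1), of m] R(2) by simp
  qed
 qed
 have yb: "bd (y j) (g n)" for j n
 proof -
  have "bd (y j) (cproj (K (max j n)))" by (rule K(4)) simp
  from bd_restrict_le(1)[OF yM this gz gK] show ?thesis by simp
 qed
 have ys: "norm (pc (y j) (g n)) <= 1 / 2 ^ j" if "n <= j" for j n
  unfolding bd_restrict_le(2)[OF yM K(4)[OF order_refl] gz gK[OF that]]
  by (rule order_trans[OF norm_proj_comp[OF zprojD(2)[OF gz]] K(5)])
 obtain b where b: "!!k. b k : E_h M" "!!k. bseq (b k) g" "!!k n. pos (pc (b k) (g n))"
  "!!k l n. k <= l ==> pc (b l) (g n) \<preceq> pc (b k) (g n)"
  "!!k n. pc (y k) (g n) \<preceq> pc (b k) (g n)" "!!k n. - pc (y k) (g n) \<preceq> pc (b k) (g n)"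
  "!!k n. n <= k ==> pc (b k) (g n) = (1 / 2 ^ k) *\<^sub>R g n"
  by (rule order_dominating_sequence[OF g y(1) yb ys], assumption, rule that)
 note bM = EH_EM[OF b(1)]
 have yg: "bseq (y j) g" for j using g yb by (simp add: bseq_def)
 have inf: "opr_le u (bounded_opr 0)" if u: "u : E_h M" "!!k. opr_le u (b k)" for u
 proof -
  obtain z where z: "bseq u z" using EM_bseq[OF EH_EM[OF u(1)]] by blast
  note zn = cseqD(1)[OF bseqD(1)[OF z]]
  have uz: "bseq u (%n. z n**g n)" by (rule bseq_mult(1)[OF EH_EM[OF u(1)] z g])
  show ?thesis
  proof (rule opr_leI[OF EH_EM[OF u(1)] EH_EM[OF zero_EH] uz])
   note wz = zproj_mult[OF zn gz]
   show "bseq (bounded_opr 0) (%n. z n**g n)" using zero_pc(1)[OF wz] bseqD(1)[OF uz] by (simp add: bseq_def)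
   fix n
   have "pos (0 - pc u (z n**g n))"
   proof (rule pos_limit[of sequentially "%k. (1 / 2 ^ k) *\<^sub>R (z n**g n) - pc u (z n**g n)"])
    fix h
    have "(%k. (1 / 2 :: real) ^ k *\<^sub>R (z n**g n) h - pc u (z n**g n) h) \<longlonglongrightarrow> 0 *\<^sub>R (z n**g n) h - pc u (z n**g n) h"
     by (intro tendsto_intros LIMSEQ_power_zero) simp
    then show "(%k. ((1 / 2 ^ k) *\<^sub>R (z n**g n) - pc u (z n**g n)) h) \<longlonglongrightarrow> (0 - pc u (z n**g n)) h"
     by (simp add: blinfun.diff_left blinfun.scaleR_left blinfun.minus_left power_divide)
   next
    have "pc u (z n**g n) \<preceq> (1 / 2 ^ k) *\<^sub>R (z n**g n)" if "n <= k" for k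
    proof -
     note r = bd_restrict[OF bM[of k] bseqD(2)[OF b(2)[of k], of n] zn[of n]]
     show ?thesis using opr_leD[OF u(2)[of k] u(1) b(1) bseqD(2)[OF uz] r(1)] b(7)[OF that] by (simp add: r(2) opm.scaleR_right)
    qed
    then show "\<forall>\<^sub>F k in sequentially. pos ((1 / 2 ^ k) *\<^sub>R (z n**g n) - pc u (z n**g n))" unfolding eventually_sequentially by blast
   qed simp
   then show "pc u (z n**g n) \<preceq> pc (bounded_opr 0) (z n**g n)" by (simp add: zero_pc(2)[OF wz])
  qed
 qed
 have "bseq (bounded_opr 0) g" using zero_pc(1)[OF gz] g by (simp add: bseq_def)
 then have b0: "opr_le (bounded_opr 0) (b k)" for k
  by (rule opr_leI[OF EH_EM[OF zero_EH] bM _ b(2)]) (simp add: zero_pc(2)[OF gz] b(3))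
 have bb: "opr_le (b l) (b k)" if "k <= l" for k l by (rule opr_leI[OF bM bM b(2) b(2) b(4)[OF that]])
 have yb1: "opr_le (y k) (b k)" for k by (rule opr_leI[OF yM bM yg b(2) b(5)])
 note vM = EH_EM[OF vE]
 have neg: "opr_le (strong_diff v (b k)) (strong_sum v (y k))" for k
 proof -
  obtain z where z: "bseq v z" using EM_bseq[OF vM] by blast
  note zn = cseqD(1)[OF bseqD(1)[OF z]]
  let ?w = "%n. z n**g n"
  have w: "bseq v ?w" "bseq (y k) ?w" "bseq (b k) ?w"
   by (rule bseq_mult(1)[OF vM z g], rule bseq_mult(2)[OF yM yg bseqD(1)[OF z]], rule bseq_mult(2)[OF bM b(2) bseqD(1)[OF z]])
  note d = bseq_ops[OF vM bM w(1,3)] and s = bseq_ops[OF vM yM w(1,2)]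
  show ?thesis
  proof (rule opr_leI[OF strong_diff_EM(1)[OF vM bM] strong_sum_EM(1)[OF vM yM] d(3) s(1)])
   fix n
   note rb = bd_restrict(2)[OF bM bseqD(2)[OF b(2)] zn[of n], of k n] and ry = bd_restrict(2)[OF yM yb zn[of n], of k n]
   have "pos (z n**(pc (b k) (g n) - - pc (y k) (g n)))"
    by (rule pos_zmult[OF zn _ b(6)]) (use pcD(2)[OF yb] pcD(2)[OF bseqD(2)[OF b(2)]] in simp)
   then show "pc (strong_diff v (b k)) (?w n) \<preceq> pc (strong_sum v (y k)) (?w n)"
    unfolding d(4) s(2) rb ry by (simp add: opm.add_right add.commute)
  qed
 qed
 have sum_mono: "opr_le (strong_sum v p) (strong_sum v q)" if pq: "p : E_h M" "q : E_h M" "opr_le p q" for p q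
 proof -
  obtain z where "cseq z" "ALL x:{v, p, q}. bseq x z" using common_bseq[of "{v, p, q}"] vM EH_EM pq by auto
  then have z: "bseq v z" "bseq p z" "bseq q z" by auto
  note sp = bseq_ops[OF vM EH_EM[OF pq(1)] z(1,2)] and sq = bseq_ops[OF vM EH_EM[OF pq(2)] z(1,3)]
  show ?thesis
   by (rule opr_leI[OF strong_sum_EM(1)[OF vM EH_EM[OF pq(1)]] strong_sum_EM(1)[OF vM EH_EM[OF pq(2)]] sp(1) sq(1)])
    (use opr_leD[OF pq(3,1,2) bseqD(2)[OF z(2)] bseqD(2)[OF z(3)]] in "simp add: sp(2) sq(2)")
 qed
 note sE = strong_sum_EH[OF vE b(1)] and dE = strong_diff_EH[OF vE b(1)]
 let ?X = "%k. strong_sum v (y k)" and ?a = "%k. strong_diff v (b k)" and ?b = "%k. strong_sum v (b k)"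
 have "o_converges (E_h M) opr_le (UNIV :: nat set) (<=) ?X v"
 proof (rule o_convergesI[where a = ?a and b = ?b])
  show "v : E_h M" by (rule vE)
  show "?X k : E_h M" for k by (rule strong_sum_EH[OF vE y(1)])
  show "?a k : E_h M & ?b k : E_h M & opr_le (?a k) (?X k) & opr_le (?X k) (?b k)" for k
   by (intro conjI sE dE neg sum_mono y b yb1)
  show "opr_le (?a k) (?a l) & opr_le (?b l) (?b k)" if "k <= l" for k l
   by (intro conjI opr_le_diff_mono sum_mono vE b bb that opr_le_refl[OF vM])
  show "is_sup_in (E_h M) opr_le (?a ` UNIV) v"
   unfolding is_sup_in_def
  proof (intro conjI ballI impI vE)
   show "opr_le x v" if x: "x : ?a ` UNIV" for x using x diff_ge_zero[OF vE vE b(1) b0] by auto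
   fix u assume u: "u : E_h M" "ALL x:?a ` UNIV. opr_le x u"
   have "opr_le (strong_diff v u) (b k)" for k using u(2) diff_le_swap[OF u(1) vE b(1), of k] by blast
   then show "opr_le v u" using inf[OF strong_diff_EH[OF vE u(1)]] diff_le_zero[OF vE u(1) vE] by blast
  qed
  show "is_inf_in (E_h M) opr_le (?b ` UNIV) v"
   unfolding is_inf_in_def
  proof (intro conjI ballI impI vE)
   show "opr_le v x" if x: "x : ?b ` UNIV" for x using x sum_ge_zero[OF vE vE b(1) b0] by auto
   fix u assume u: "u : E_h M" "ALL x:?b ` UNIV. opr_le u x"
   have "opr_le (strong_diff u v) (b k)" for k using u(2) le_sum_diff[OF u(1) vE b(1), of k] by blast
   then show "opr_le u v" using inf[OF strong_diff_EH[OF u(1) vE]] diff_le_zero[OF u(1) vE vE] by blast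
  qed
 qed
 from o_converges_order_topology[OF directed_nat this]
 have "limitin (t_o M) ?X v sequentially" unfolding net_filter_nat t_o_def .
 then have "\<forall>\<^sub>F k in sequentially. ?X k : V" using V unfolding limitin_def by blast
 then show False using y(3) unfolding eventually_sequentially by blast
qed

definition re :: "'a opr => 'a opr" where
 "re x = strong_scale (complex_of_real (1 / 2)) (strong_sum x (adj x))"

lemma re_EM:
 assumes x: "x \<in> EM"
 shows "re x \<in> E_h M"
  and "bd x w ==> bd (re x) w \<and> pc (re x) w = (1 / 2) *\<^sub>R (pc x w + dag (pc x w))"
proof -
 note a = adj_EM[OF x]
 note s = strong_sum_EM[OF x a(1)]
 show 1: "bd (re x) w & pc (re x) w = (1 / 2) *\<^sub>R (pc x w + dag (pc x w))" if w: "bd x w" for w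
  using strong_scale_pc[OF s(1), of w "1 / 2"] s(2)[OF w] a(2)[OF w] w unfolding re_def by simp
 obtain z where z: "bseq x z" using EM_bseq[OF x] by blast
 show "re x : E_h M"
 proof (rule EHI[where z = z])
  show "re x : EM" unfolding re_def by (rule strong_scale_EM(1)[OF s(1)])
  show "bseq (re x) z" using 1[OF bseqD(2)[OF z]] bseqD(1)[OF z] by (simp add: bseq_def)
  show "dag (pc (re x) (z n)) = pc (re x) (z n)" for n
   using 1[OF bseqD(2)[OF z, of n]] by (simp add: dag_simps add.commute)
 qed
qed

lemma re_EH:
 assumes x: "x \<in> E_h M"
 shows "re x = x"
proof -
 obtain z where z: "bseq x z" using EM_bseq[OF EH_EM[OF x]] by blast
 note r = re_EM[OF EH_EM[OF x]]
 show ?thesis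
 proof (rule EM_eqI[OF EH_EM[OF r(1)] EH_EM[OF x] _ z])
  show "bseq (re x) z" using r(2)[OF bseqD(2)[OF z]] bseqD(1)[OF z] by (simp add: bseq_def)
  show "pc (re x) (z n) = pc x (z n)" for n
   using r(2)[OF bseqD(2)[OF z, of n]] EH_pc[OF x bseqD(2)[OF z, of n]] by (simp add: scaleR_2[symmetric])
 qed
qed

lemma re_sum:
 assumes x: "x \<in> EM" and y: "y \<in> EM"
 shows "re (strong_sum x y) = strong_sum (re x) (re y)"
proof -
 obtain z where z: "bseq x z" "bseq y z" by (rule EM_bseq2[OF x y])
 note s = bseq_ops[OF x y z] and sM = strong_sum_EM(1)[OF x y]
 note rx = re_EM[OF x] and ry = re_EM[OF y] and rs = re_EM[OF sM]
 have zz: "bseq (re x) z" "bseq (re y) z" "bseq (re (strong_sum x y)) z"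
  using rx(2)[OF bseqD(2)[OF z(1)]] ry(2)[OF bseqD(2)[OF z(2)]] rs(2)[OF bseqD(2)[OF s(1)]] bseqD(1)[OF z(1)] by (simp_all add: bseq_def)
 note t = bseq_ops[OF EH_EM[OF rx(1)] EH_EM[OF ry(1)] zz(1,2)]
 show ?thesis
 proof (rule EM_eqI[OF EH_EM[OF rs(1)] strong_sum_EM(1)[OF EH_EM[OF rx(1)] EH_EM[OF ry(1)]] zz(3) t(1)])
  show "pc (re (strong_sum x y)) (z n) = pc (strong_sum (re x) (re y)) (z n)" for n
   using rx(2)[OF bseqD(2)[OF z(1), of n]] ry(2)[OF bseqD(2)[OF z(2), of n]] rs(2)[OF bseqD(2)[OF s(1), of n]]
   by (simp add: t(2) s(2) dag_simps algebra_simps)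
 qed
qed

lemma re_O_nbhd:
 assumes A: "A \<in> sets \<mu>" "0 < e" and y: "y \<in> O_nbhd M \<mu> \<Phi> A e d"
 shows "re y \<in> O_nbhd M \<mu> \<Phi> A e d"
proof -
 obtain B where yM: "y : EM" and B: "B : sets \<mu>" "B <= A" "emeasure \<mu> (A - B) <= ennreal d" "bd y (cproj B)" "norm (pc y (cproj B)) <= e"
  using y O_nbhd_iff[OF A] by blast
 note r = re_EM[OF yM]
 let ?T = "pc y (cproj B)"
 have "norm (dag ?T) <= e"
 proof (rule norm_blinfun_bound[OF less_imp_le[OF A(2)]])
  fix x
  have "(norm (dag ?T x))\<^sup>2 = rin x (?T (dag ?T x))" by (simp add: rin_self[symmetric] rin_dag')
  also have "... <= norm x * norm (?T (dag ?T x))" using rin_Cauchy_Schwarz[of x "?T (dag ?T x)"] by linarith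
  also have "... <= norm x * (e * norm (dag ?T x))"
   by (intro mult_left_mono order_trans[OF norm_blinfun mult_right_mono[OF B(5)]]) simp_all
  finally have "norm (dag ?T x) * norm (dag ?T x) <= (e * norm x) * norm (dag ?T x)"
   by (simp add: power2_eq_square mult_ac)
  then show "norm (dag ?T x) <= e * norm x"
   by (cases "dag ?T x = 0") (use A(2) in simp_all)
 qed
 then have "norm (?T + dag ?T) <= 2 * e" using norm_triangle_ineq[of ?T "dag ?T"] B(5) by linarith
 then have "norm (pc (re y) (cproj B)) <= e" using r(2)[OF B(4)] by simp
 then show ?thesis using O_nbhd_iff[OF A] EH_EM[OF r(1)] r(2)[OF B(4)] B(1-3) by blast
qed

text \<open>The topology of the norm lives on \<open>E(M)\<close>, an order open set on its self-adjoint part only. Its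
 preimage under the real part, which does not increase the norm, is open in \<open>E(M)\<close>.\<close>

theorem t_o_le_t_ch:
 assumes "sigma_finite_algebra M"
 shows "coarser (t_o M) (t_ch M \<mu> \<Phi>)"
 unfolding coarser_def
proof (intro allI impI)
 fix V assume V: "openin (t_o M) V"
 have VE: "V <= E_h M" using V unfolding t_o_def openin_order_topology by blast
 define U where "U = {x : EM. re x : V}"
 have "openin (center_norm_topology M \<mu> \<Phi>) U"
  unfolding openin_center_norm_topology
 proof (intro conjI ballI)
  show "U <= EM" by (auto simp: U_def)
  fix x assume "x : U"
  then have x: "x : EM" "re x : V" by (auto simp: U_def)
  obtain A e d where O: "A : sets \<mu>" "emeasure \<mu> A < \<infinity>" "0 < e" "0 < d"
   "ALL y:E_h M \<inter> O_nbhd M \<mu> \<Phi> A e d. strong_sum (re x) y : V"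
   using order_open_contains_nbhd[OF assms V x(2)] by (elim exE conjE) (rule that)
  have "strong_sum x y : U" if y: "y : O_nbhd M \<mu> \<Phi> A e d" for y
  proof -
   have yM: "y : EM" using y by (simp add: O_nbhd_def)
   have "strong_sum (re x) (re y) : V" using O(5) re_O_nbhd[OF O(1,3) y] re_EM(1)[OF yM] by blast
   then show ?thesis using re_sum[OF x(1) yM] strong_sum_EM(1)[OF x(1) yM] by (simp add: U_def)
  qed
  then show "EX A e d. A : sets \<mu> & emeasure \<mu> A < \<infinity> & 0 < e & 0 < d & strong_sum x ` O_nbhd M \<mu> \<Phi> A e d <= U"
   using O(1-4) by blast
 qed
 moreover have "U \<inter> E_h M = V" unfolding U_def using re_EH EH_EM VE by auto
 ultimately show "openin (t_ch M \<mu> \<Phi>) V" using t_ch_openI by metis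
qed

theorem topologies:
 "(coarser (t_ch M \<mu> \<Phi>) (t_o M) \<longleftrightarrow> type_I_fin M) \<and>
  (t_ch M \<mu> \<Phi> = t_o M \<longleftrightarrow> sigma_finite_algebra M \<and> type_I_fin M)"
proof (intro conjI iffI)
 show "type_I_fin M" if "coarser (t_ch M \<mu> \<Phi>) (t_o M)" by (rule type_I_fin_of_t_ch_le_t_o[OF that])
 show "coarser (t_ch M \<mu> \<Phi>) (t_o M)" if "type_I_fin M" by (rule t_ch_le_t_o[OF that])
 show tI: "type_I_fin M" if "t_ch M \<mu> \<Phi> = t_o M"
  by (rule type_I_fin_of_t_ch_le_t_o) (simp add: that coarser_def)
 show "sigma_finite_algebra M" if eq: "t_ch M \<mu> \<Phi> = t_o M"
  by (rule sigma_finite_of_center[OF tI[OF eq] countable_of_topologies_eq[OF eq]])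
 assume "sigma_finite_algebra M & type_I_fin M"
 then show "t_ch M \<mu> \<Phi> = t_o M"
  using t_ch_le_t_o t_o_le_t_ch unfolding coarser_def topology_eq by blast
qed

end

theorem theorem3p10:
  fixes M :: "('a::complex_hilbert \<Rightarrow>\<^sub>L 'a) set"
    and \<mu> :: "'w measure"
    and \<Phi> :: "'a opr \<Rightarrow> 'w \<Rightarrow> complex"
  assumes "von_neumann_algebra M"
    and "direct_sum_property \<mu>"
    and "semifinite \<mu>"
    and "center_identification M \<mu> \<Phi>"
  shows "(coarser (t_ch M \<mu> \<Phi>) (t_o M) \<longleftrightarrow> type_I_fin M) \<and>
    (t_ch M \<mu> \<Phi> = t_o M \<longleftrightarrow> sigma_finite_algebra M \<and> type_I_fin M)"
proof -
  interpret center_functions M \<mu> \<Phi>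
    by unfold_locales (rule assms)+
  show ?thesis by (rule topologies)
qed

end
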